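(* Let $T$ be a Calderón--Zygmund operator on $\mathbb{R}^n$ and let $q>p>1$. There is a constant $c_{n,T,p,q}$, depending only on $n,T,p,q$, such that for every weight $w\in C_q$ and every $f\in C_c^\infty(\mathbb{R}^n)$, $$\|T^*f\|_{L^p(w)}\le c_{n,T,p,q}\,\big([w]_{C_q}+1\big)\log\big(e+[w]_{C_q}\big)\,\|Mf\|_{L^p(w)}.$$
   Context: A weight is a non-negative locally integrable function on $\mathbb{R}^n$. Cubes have sides parallel to the coordinate axes. $M$ is the Hardy--Littlewood maximal operator $Mf(x)=\sup_Q \frac{\chi_Q(x)}{|Q|}\int_Q|f|$ (supremum over cubes), $w(E)=\int_E w$, and $\|g\|_{L^p(w)}=\left(\int_{\mathbb{R}^n}|g|^pw\,dx\right)^{1/p}$. Class $C_q$ ($1<q<\infty$): $w\in C_q$ if there exist $C,\varepsilon>0$ such that for every cube $Q$ and every measurable $E\subset Q$, $w(E)\le C\left(\frac{|E|}{|Q|}\right)^{\varepsilon}\int_{\mathbb{R}^n}(M\chi_Q)^q w\,dx$. $C_q$ constant: for $w$ not a.e. zero (statements involving it refer to such weights), $[w]_{C_q}:=\sup_Q \frac{1}{\int_{\mathbb{R}^n}(M\chi_Q)^q w}\int_Q M(\chi_Q w)$, with the convention that the quotient is $0$ when the denominator is $+\infty$. It is known that $w\in C_q$ if and only if $0\le [w]_{C_q}<\infty$. Calderón--Zygmund operator: a kernel $K(x,y)$ defined for $x\ne y$ in $\mathbb{R}^n$ is required to satisfy, for some $A>0$ and some $\eta>0$: $|K(x,y)|\le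 A|x-y|^{-n}$ for $x\neq y$; $|K(x,y)-K(x',y)|\le A\frac{|x-x'|^{\eta}}{|x-y|^{n+\eta}}$ whenever $2|x-x'|\le|x-y|$; and $|K(x,y)-K(x,y')|\le A\frac{|y-y'|^{\eta}}{|x-y|^{n+\eta}}$ whenever $2|y-y'|\le|x-y|$. A Calderón--Zygmund operator associated to $K$ is a linear operator $T:\mathscr{S}(\mathbb{R}^n)\to\mathscr{S}'(\mathbb{R}^n)$, bounded on $L^2$, with $Tf(x)=\int_{\mathbb{R}^n}K(x,y)f(y)\,dy$ for $f\in C_c^\infty(\mathbb{R}^n)$ and $x\notin\operatorname{supp} f$. Its maximal truncation is $T^*f(x)=\sup_{t>0}\left|\int_{|x-y|>t}K(x,y)f(y)\,dy\right|$. *)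

theory Defs
  imports "HOL-Analysis.Analysis"
begin

section \<open>Powers and logarithms of extended nonnegative reals\<close>

text \<open>Only used with an exponent \<open>p > 0\<close>, so that infinity is mapped to infinity.\<close>

definition ennreal_powr :: "ennreal \<Rightarrow> real \<Rightarrow> ennreal" where
  "ennreal_powr x p = (if x = \<infinity> then \<infinity> else ennreal (enn2real x powr p))"

text \<open>Only used for arguments \<open>\<ge> e\<close>; below \<open>1\<close> the (negative) logarithm is truncated to \<open>0\<close>.\<close>

definition ennreal_ln :: "ennreal \<Rightarrow> ennreal" where
  "ennreal_ln x = (if x = \<infinity> then \<infinity> else ennreal (ln (enn2real x)))"


section \<open>Smooth functions, test functions, Schwartz functions, tempered distributions\<close>

text \<open>
  Mixed partial derivatives are indexed by lists of coordinate directions. For smooth functions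
  the order is irrelevant, and the lists of length \<open>k\<close> yield exactly the partial derivatives of
  order \<open>k\<close>.
\<close>

fun iter_partial :: "'n list \<Rightarrow> (real^'n \<Rightarrow> complex) \<Rightarrow> real^'n \<Rightarrow> complex" where
  "iter_partial [] f = f"
| "iter_partial (i # is) f = (\<lambda>x. frechet_derivative (iter_partial is f) (at x) (axis i 1))"

definition smooth :: "(real^'n \<Rightarrow> complex) \<Rightarrow> bool" where
  "smooth f \<longleftrightarrow> (\<forall>is x. iter_partial is f differentiable at x)"

definition supp :: "(real^'n \<Rightarrow> complex) \<Rightarrow> (real^'n) set" where
  "supp f = closure {x. f x \<noteq> 0}"

definition test_functions :: "(real^'n \<Rightarrow> complex) set" where
  "test_functions = {f. smooth f \<and> compact (supp f)}"

definition schwartz :: "(real^'n \<Rightarrow> complex) set" where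
  "schwartz = {f. smooth f \<and>
     (\<forall>is k. bounded (range (\<lambda>x. (1 + norm x) ^ k * norm (iter_partial is f x))))}"

definition schwartz_seminorm :: "nat \<Rightarrow> (real^'n \<Rightarrow> complex) \<Rightarrow> real" where
  "schwartz_seminorm k f =
     (\<Sum>is\<in>{is. length is \<le> k}. SUP x. (1 + norm x) ^ k * norm (iter_partial is f x))"

text \<open>
  Distributions act on functions of type \<^typ>\<open>real^'n \<Rightarrow> complex\<close>; only their values on
  \<^const>\<open>schwartz\<close> are meaningful.
\<close>

definition tempered_distribution :: "((real^'n \<Rightarrow> complex) \<Rightarrow> complex) \<Rightarrow> bool" where
  "tempered_distribution u \<longleftrightarrow>
     (\<forall>\<phi>\<in>schwartz. \<forall>\<psi>\<in>schwartz. \<forall>a b.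
        u (\<lambda>x. a * \<phi> x + b * \<psi> x) = a * u \<phi> + b * u \<psi>) \<and>
     (\<exists>C k. \<forall>\<phi>\<in>schwartz. norm (u \<phi>) \<le> C * schwartz_seminorm k \<phi>)"


section \<open>Calderon-Zygmund operators\<close>

definition CZ_kernel :: "(real^'n \<Rightarrow> real^'n \<Rightarrow> complex) \<Rightarrow> bool" where
  "CZ_kernel K \<longleftrightarrow> (\<exists>A>0. \<exists>\<eta>>0.
     (\<forall>x y. x \<noteq> y \<longrightarrow> norm (K x y) \<le> A / norm (x - y) ^ CARD('n)) \<and>
     (\<forall>x x' y. x \<noteq> y \<and> 2 * norm (x - x') \<le> norm (x - y) \<longrightarrow>
        norm (K x y - K x' y)
          \<le> A * norm (x - x') powr \<eta> / norm (x - y) powr (real CARD('n) + \<eta>)) \<and>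
     (\<forall>x y y'. x \<noteq> y \<and> 2 * norm (y - y') \<le> norm (x - y) \<longrightarrow>
        norm (K x y - K x y')
          \<le> A * norm (y - y') powr \<eta> / norm (x - y) powr (real CARD('n) + \<eta>)))"

text \<open>
  Boundedness on \<open>L\<^sup>2\<close>: the distribution \<open>T f\<close> is given by a function \<open>g\<close> whose
  \<open>L\<^sup>2\<close> norm is controlled by that of \<open>f\<close>.
\<close>

definition bounded_on_L2 ::
  "((real^'n \<Rightarrow> complex) \<Rightarrow> (real^'n \<Rightarrow> complex) \<Rightarrow> complex) \<Rightarrow> bool" where
  "bounded_on_L2 T \<longleftrightarrow> (\<exists>B. \<forall>f\<in>schwartz. \<exists>g.
     g \<in> borel_measurable lebesgue \<and>
     integrable lebesgue (\<lambda>x. (norm (g x))\<^sup>2) \<and>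
     (\<forall>\<phi>\<in>schwartz. T f \<phi> = (LINT x|lebesgue. g x * \<phi> x)) \<and>
     sqrt (LINT x|lebesgue. (norm (g x))\<^sup>2) \<le> B * sqrt (LINT x|lebesgue. (norm (f x))\<^sup>2))"

text \<open>
  The last clause is the identity \<open>T f(x) = \<integral> K(x,y) f(y) dy\<close> for \<open>x\<close> outside the support of
  \<open>f\<close>, read as an equality of distributions on that open set.
\<close>

definition CZ_operator ::
  "(real^'n \<Rightarrow> real^'n \<Rightarrow> complex) \<Rightarrow>
   ((real^'n \<Rightarrow> complex) \<Rightarrow> (real^'n \<Rightarrow> complex) \<Rightarrow> complex) \<Rightarrow> bool" where
  "CZ_operator K T \<longleftrightarrow>
     CZ_kernel K \<and>
     (\<forall>f\<in>schwartz. tempered_distribution (T f)) \<and>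
     (\<forall>f\<in>schwartz. \<forall>g\<in>schwartz. \<forall>a b. \<forall>\<phi>\<in>schwartz.
        T (\<lambda>x. a * f x + b * g x) \<phi> = a * T f \<phi> + b * T g \<phi>) \<and>
     bounded_on_L2 T \<and>
     (\<forall>f\<in>test_functions. \<forall>\<phi>\<in>test_functions. supp f \<inter> supp \<phi> = {} \<longrightarrow>
        T f \<phi> = (LINT x|lebesgue. (LINT y|lebesgue. K x y * f y) * \<phi> x))"

definition max_truncation ::
  "(real^'n \<Rightarrow> real^'n \<Rightarrow> complex) \<Rightarrow> (real^'n \<Rightarrow> complex) \<Rightarrow> real^'n \<Rightarrow> ennreal" where
  "max_truncation K f x =
     (SUP t\<in>{0<..}. ennreal (norm (LINT y:{y. norm (x - y) > t}|lebesgue. K x y * f y)))"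


section \<open>Maximal function, weights and the class \<open>C\<^sub>q\<close>\<close>

definition cubes :: "(real^'n) set set" where
  "cubes = {cbox a (\<chi> i. a $ i + s) | a s. s > 0}"

definition HL_max :: "(real^'n \<Rightarrow> 'b::real_normed_vector) \<Rightarrow> real^'n \<Rightarrow> ennreal" where
  "HL_max f x = (SUP Q\<in>cubes.
     indicator Q x / emeasure lebesgue Q * (\<integral>\<^sup>+y\<in>Q. ennreal (norm (f y)) \<partial>lebesgue))"

definition weight :: "(real^'n \<Rightarrow> real) \<Rightarrow> bool" where
  "weight w \<longleftrightarrow> (\<forall>x. 0 \<le> w x) \<and> (\<forall>S. compact S \<longrightarrow> set_integrable lebesgue S w)"

definition Lp_norm :: "real \<Rightarrow> (real^'n \<Rightarrow> real) \<Rightarrow> (real^'n \<Rightarrow> ennreal) \<Rightarrow> ennreal" where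
  "Lp_norm p w g =
     ennreal_powr (\<integral>\<^sup>+x. ennreal_powr (g x) p * ennreal (w x) \<partial>lebesgue) (1 / p)"

text \<open>The integral of \<open>(M \<chi>\<^sub>Q)\<^sup>q w\<close> over the whole space; it may be infinite.\<close>

definition Cq_tail :: "real \<Rightarrow> (real^'n \<Rightarrow> real) \<Rightarrow> (real^'n) set \<Rightarrow> ennreal" where
  "Cq_tail q w Q =
     (\<integral>\<^sup>+x. ennreal_powr (HL_max (indicator Q :: real^'n \<Rightarrow> real) x) q * ennreal (w x) \<partial>lebesgue)"

definition Cq_class :: "real \<Rightarrow> (real^'n \<Rightarrow> real) set" where
  "Cq_class q = {w. weight w \<and> (\<exists>C>0. \<exists>\<epsilon>>0. \<forall>Q\<in>cubes. \<forall>E\<in>sets lebesgue. E \<subseteq> Q \<longrightarrow>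
     (\<integral>\<^sup>+x\<in>E. ennreal (w x) \<partial>lebesgue)
       \<le> ennreal (C * (measure lebesgue E / measure lebesgue Q) powr \<epsilon>) * Cq_tail q w Q)}"

text \<open>
  For weights that are not almost everywhere zero the denominator is positive, because
  \<open>M \<chi>\<^sub>Q\<close> is positive everywhere.
\<close>

definition Cq_const :: "real \<Rightarrow> (real^'n \<Rightarrow> real) \<Rightarrow> ennreal" where
  "Cq_const q w = (SUP Q\<in>cubes.
     if Cq_tail q w Q = \<infinity> then 0
     else (\<integral>\<^sup>+x\<in>Q. HL_max (\<lambda>y. indicator Q y * w y) x \<partial>lebesgue) / Cq_tail q w Q)"

end

theory Submission
  imports Defs
begin

text \<open>
  The maximal truncation is dominated pointwise by a sum, over a sparse family of dyadic cubes
  \<open>Q\<close>, of the averages of \<open>\<bar>f\<bar>\<close> over \<open>3Q\<close>. This comes from its weak type \<open>(1,1)\<close>, which in turn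
  follows from Cotlar's inequality and a Calderon-Zygmund decomposition. The selected cubes are
  sorted by the largest \<open>k\<close> with \<open>5Q\<close> inside \<open>{M f > 2^k}\<close>, so that those of level \<open>k\<close> lie in the
  Whitney cubes \<open>P\<close> of that set, and more than \<open>m\<close> of them meet only in a subset of \<open>P\<close> of measure
  \<open>2^-m |P|\<close>. A quantitative self-improvement of the \<open>C_q\<close> condition bounds the weight of such a
  subset by \<open>C W exp(-c m / W)\<close> times the weighted tail of \<open>P\<close>, where \<open>W\<close> is comparable to
  \<open>[w] + 1\<close>. Hence each level contributes at most \<open>L = C W log(e W)\<close> cubes up to an error, and the
  error is absorbed by Sawyer's inequality: since \<open>q > p\<close>, the sum over \<open>k\<close> of \<open>2^(k p)\<close> times the
  tails of the Whitney cubes is at most \<open>C W^2\<close> times the \<open>p\<close>-th power of the norm of \<open>M f\<close>.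
\<close>

section \<open>Cubes and the maximal function\<close>

text \<open>A \<open>C_q\<close> weight need not be doubling and may live far from a given cube, so
  the weight of the cube is no reference quantity; the tail \<open>kint\<close>, taken against a
  polynomially decaying profile, replaces it throughout. Tails of disjoint cubes overlap and are
  summed by duality with the maximal operator, where the \<open>C_q\<close> condition costs a factor
  W. The strict inequality q > p is spent in Sawyer's inequality: descending N levels multiplies by
  2^(p N), while the distant parts of the tails shrink like 2^(-q N). The shape of the final bound
  comes from one balance: counting errors carry the factor W^(2p+4), partly from moments and partly
  from Sawyer's inequality, and decay only like exp(-c L / W). Hence L has the size W log W, and
  another power of W would only change the constant before the logarithm. Absorption needs finite
  quantities, which is why the support is placed in one root cube, levels start at a multiple of the
  average over it, and finitely many levels are summed. If a tail is infinite, so is the norm of M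
  f, and the bound is trivial.\<close>

type_synonym 'n cube = "nat \<times> ('n \<Rightarrow> int)"

abbreviation vol :: "(real^'n) set \<Rightarrow> ennreal" where "vol \<equiv> emeasure lebesgue"

abbreviation lmeas :: "(real^'n \<Rightarrow> 'b::topological_space) set" where "lmeas \<equiv> borel_measurable lebesgue"

abbreviation lebesgue_int :: "(real^'n \<Rightarrow> ennreal) \<Rightarrow> ennreal" (binder "\<integral>" 10) where
  "lebesgue_int f \<equiv> nn_integral lebesgue f"

abbreviation enorm :: "'a::real_normed_vector \<Rightarrow> ennreal" where "enorm x \<equiv> ennreal (norm x)"

syntax
  "_set_int" :: "pttrn \<Rightarrow> 'a set \<Rightarrow> ennreal \<Rightarrow> ennreal" ("(2\<integral>_\<in>_./ _)" [0, 51, 10] 10)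
  "_count_int" :: "pttrn \<Rightarrow> 'a set \<Rightarrow> ennreal \<Rightarrow> ennreal" ("(2\<Sum>\<^sup>+_\<in>_./ _)" [0, 51, 10] 10)
translations
  "\<integral>x\<in>S. f" \<rightharpoonup> "CONST nn_integral (CONST lebesgue) (\<lambda>x. f * CONST indicator S x)"
  "\<Sum>\<^sup>+x\<in>S. f" \<rightharpoonup> "CONST nn_integral (CONST count_space S) (\<lambda>x. f)"

declare emeasure_completion [simp del]
  power_mult_distrib [where a = "numeral w" for w, simp del]
  power_mult_distrib [where b = "numeral w" for w, simp del]

text \<open>Cubes are balls of the maximum norm with centre c and half side r, so inclusions follow
  from the triangle inequality; passing to Euclidean distances costs a factor
  \<open>sqrt n\<close>.\<close>

definition qb :: "real^'n \<Rightarrow> real \<Rightarrow> (real^'n) set" where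
  "qb c r = {y. infnorm (y - c) \<le> r}"

lemma infnorm_le_iff: "infnorm (x::real^'n) \<le> r \<longleftrightarrow> (\<forall>i. \<bar>x$i\<bar> \<le> r)"
proof
  assume "infnorm x \<le> r" thus "\<forall>i. \<bar>x$i\<bar> \<le> r" using component_le_infnorm_cart[of x] by (meson order_trans)
next
  assume "\<forall>i. \<bar>x$i\<bar> \<le> r" thus "infnorm x \<le> r" unfolding infnorm_cart by (intro cSup_least) auto
qed

lemma infnorm_triangle_sub: "infnorm (x - z) \<le> infnorm (x - y) + infnorm (y - z)" using infnorm_triangle[of "x - y" "y - z"] by simp

lemma norm_le_infnorm_cart: "norm (x::real^'n) \<le> sqrt CARD('n) * infnorm x" using norm_le_infnorm[of x] by simp

lemma mem_qb: "y \<in> qb c r \<longleftrightarrow> infnorm (y - c) \<le> r" by (simp add: qb_def)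

lemma qb_mono: "infnorm (c - c') + r \<le> r' \<Longrightarrow> qb c r \<subseteq> qb c' r'"
  unfolding qb_def using infnorm_triangle_sub by (smt (verit, best) Collect_mono_iff)

lemma qb_mono_radius: "r \<le> r' \<Longrightarrow> qb c r \<subseteq> qb c r'" by (auto simp: qb_def)

lemma qb_cbox: "qb (c::real^'n) r = cbox (\<chi> i. c$i - r) (\<chi> i. c$i + r)"
proof -
  have "(\<bar>x$i - c$i\<bar> \<le> r) = (c$i - r \<le> x$i \<and> x$i \<le> c$i + r)" for x :: "real^'n" and i by linarith
  thus ?thesis by (auto simp: qb_def infnorm_le_iff mem_box_cart)
qed

lemma qb_sets [measurable, simp]: "qb c r \<in> sets lebesgue" "qb c r \<in> sets borel" by (auto simp: qb_cbox)

lemma compact_qb: "compact (qb c r)" and closed_qb: "closed (qb c r)" and bounded_qb: "bounded (qb c r)" by (auto simp: qb_cbox)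

lemma emeasure_qb: "0 \<le> r \<Longrightarrow> vol (qb (c::real^'n) r) = ennreal ((2*r)^CARD('n))"
proof -
  assume r: "0 \<le> r"
  have "measure lebesgue (qb c r) = (2*r)^CARD('n)"
  proof -
    have ne: "cbox (\<chi> i. c$i - r) (\<chi> i. c$i + r) \<noteq> {}" using r by (simp add: interval_ne_empty_cart)
    show ?thesis unfolding qb_cbox using content_cbox_cart[OF ne] by (simp add: prod_constant)
  qed
  moreover have "vol (qb c r) = ennreal (measure lebesgue (qb c r))" by (rule emeasure_eq_ennreal_measure) (simp add: qb_cbox fmeasurableD2)
  ultimately show ?thesis by simp
qed

lemma cubes_qb: "(cubes::(real^'n) set set) = {qb c r | c r. 0 < r}"
proof -
  have 1: "\<exists>c r. Q = qb c r \<and> 0 < r" if QQ: "Q \<in> cubes" for Q :: "(real^'n) set"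
  proof -
    obtain a s where Q: "Q = cbox a (\<chi> i. a $ i + s)" "s > 0" using QQ by (auto simp: cubes_def)
    have "Q = qb (\<chi> i. a$i + s/2) (s/2)" unfolding qb_cbox Q(1) by (rule arg_cong2[where f=cbox]) (auto simp: vec_eq_iff)
    thus ?thesis using Q(2) by (intro exI[of _ "\<chi> i. a$i + s/2"] exI[of _ "s/2"]) auto
  qed
  have 2: "qb c r \<in> cubes" if "0 < r" for c :: "real^'n" and r
  using that by (auto simp: qb_cbox arg_cong2[where f=cbox] vec_eq_iff cubes_def CollectI exI[of _ "\<chi> i. c$i - r"] exI[of _ "2*r"] conjI)
  show ?thesis using 1 2 by auto
qed

text \<open>The uncentred maximal function for functions with extended values. It is applied below
  to indicators, squares, weights and sums of atoms, with no integrability to be checked.\<close>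

definition MM :: "(real^'n \<Rightarrow> ennreal) \<Rightarrow> real^'n \<Rightarrow> ennreal" where
  "MM g x = (SUP (c,r)\<in>{(c,r). 0 < r \<and> x \<in> qb c r}.
     (\<integral>y\<in>qb c r. g y) / ennreal ((2*r)^CARD('n)))"

lemma ennreal_div_le_iff:
  assumes "0 < v" shows "a / ennreal v \<le> b \<longleftrightarrow> a \<le> b * ennreal v"
proof
  have *: "a / ennreal v * ennreal v = a" using assms by (simp add: ennreal_divide_times mult_divide_eq_ennreal)
  show "a \<le> b * ennreal v" if "a / ennreal v \<le> b" using mult_right_mono[OF that, of "ennreal v"] * by simp
  show "a / ennreal v \<le> b" if "a \<le> b * ennreal v" using assms that by (intro divide_le_posI_ennreal) (auto simp: mult.commute)
qed

lemma MM_le_iff: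
  "MM g x \<le> l \<longleftrightarrow> (\<forall>c r. 0 < r \<longrightarrow> x \<in> qb c r \<longrightarrow>
     (\<integral>y\<in>qb (c::real^'n) r. g y) \<le> l * ennreal ((2*r)^CARD('n)))" unfolding MM_def SUP_le_iff by (auto simp: ennreal_div_le_iff)

lemma MM_upper:
  fixes c :: "real^'n"
  assumes "0 < r" "x \<in> qb c r"
  shows "(\<integral>y\<in>qb c r. g y) \<le> MM g x * ennreal ((2*r)^CARD('n))"
  using MM_le_iff[of g x "MM g x"] assms by auto

lemma less_MM_iff:
  "l < MM g x \<longleftrightarrow> (\<exists>c r. 0 < r \<and> x \<in> qb c r \<and>
     l * ennreal ((2*r)^CARD('n)) < (\<integral>y\<in>qb (c::real^'n) r. g y))" using MM_le_iff[of g x l] by (auto simp: not_le[symmetric])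

lemma HL_max_eq_MM:
  fixes f :: "real^'n \<Rightarrow> 'b::real_normed_vector"
  shows "HL_max f x = MM (\<lambda>y. enorm (f y)) x"
proof -
  have A: "indicator Q x / vol Q * (\<integral>y\<in>Q. enorm (f y))
    = (if x \<in> Q then (\<integral>y\<in>Q. enorm (f y)) / vol Q else 0)" for Q by (simp add: indicator_def divide_ennreal_def mult.commute)
  show ?thesis
  proof (rule antisym)
    show "HL_max f x \<le> MM (\<lambda>y. enorm (f y)) x" unfolding HL_max_def A cubes_qb
    proof (rule SUP_least, clarify)
      fix c :: "real^'n" and r :: real assume "0 < r"
      thus "(if x \<in> qb c r then (\<integral>y\<in>qb c r. enorm (f y)) / vol (qb c r) else 0)
        \<le> MM (\<lambda>y. enorm (f y)) x"
      proof (cases "x \<in> qb c r")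
        case True
        have v: "0 < (2*r)^CARD('n)" using \<open>0 < r\<close> by simp
        have "(\<integral>y\<in>qb c r. enorm (f y)) / ennreal ((2*r)^CARD('n)) \<le> MM (\<lambda>y. enorm (f y)) x"
          unfolding ennreal_div_le_iff[OF v] by (rule MM_upper[OF \<open>0 < r\<close> True])
        thus ?thesis using True \<open>0 < r\<close> by (simp only: emeasure_qb[OF less_imp_le] if_True)
      qed simp
    qed
    show "MM (\<lambda>y. enorm (f y)) x \<le> HL_max f x" unfolding MM_le_iff
    proof (intro allI impI)
      fix c :: "real^'n" and r :: real
      assume r: "0 < r" "x \<in> qb c r"
      have "(\<integral>y\<in>qb c r. enorm (f y)) / ennreal ((2*r)^CARD('n)) \<le> HL_max f x" unfolding HL_max_def A cubes_qb
        by (rule SUP_upper2[of "qb c r"]) (use r in \<open>auto simp: emeasure_qb\<close>)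
      thus "(\<integral>y\<in>qb c r. enorm (f y)) \<le> HL_max f x * ennreal ((2*r)^CARD('n))" using r by (simp add: ennreal_div_le_iff)
    qed
  qed
qed

lemma open_infnorm_ball: "open {y. infnorm (y - c) < r}" by (intro open_Collect_less)
     (auto intro!: continuous_at_imp_continuous_on simp: isCont_def intro!: tendsto_intros)

lemma nn_integral_mono_set:
  "A \<subseteq> B \<Longrightarrow> (\<integral>\<^sup>+y\<in>A. g y \<partial>M) \<le> (\<integral>\<^sup>+y\<in>B. (g y :: ennreal) \<partial>M)"
  by (intro nn_integral_mono) (auto simp: indicator_def)

text \<open>The volume depends continuously on the radius and the integral can only grow with it, so
  a strict inequality survives a slight enlargement, which moves x into the interior. Openness of
  superlevel sets and the covering by open cubes in the weak type bound both rest on this.\<close>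

lemma MM_enlarge:
  fixes g :: "real^'n \<Rightarrow> ennreal"
  assumes "l < MM g x"
  shows "\<exists>c r. 0 < r \<and> infnorm (x - c) < r \<and> l * ennreal ((2*r)^CARD('n)) < (\<integral>y\<in>qb c r. g y)"
proof -
  obtain c r where cr: "0 < r" "x \<in> qb c r" "l * ennreal ((2*r)^CARD('n)) < (\<integral>y\<in>qb c r. g y)" (is "_ < ?I") using assms unfolding less_MM_iff by blast
  have "((\<lambda>t. l * ennreal ((2*t)^CARD('n))) \<longlongrightarrow> l * ennreal ((2*r)^CARD('n))) (at_right r)"
  proof (cases "l = \<infinity>")
    case True
    have "eventually (\<lambda>t. t > r) (at_right r)" by (rule eventually_at_right_less)
    hence "eventually (\<lambda>t. l * ennreal ((2*r)^CARD('n)) = l * ennreal ((2*t)^CARD('n))) (at_right r)"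
      by eventually_elim (use cr(1) True in \<open>auto simp: ennreal_top_mult\<close>)
    thus ?thesis by (rule Lim_transform_eventually[OF tendsto_const])
  next
    case False
    have "((\<lambda>t. ennreal ((2*t)^CARD('n))) \<longlongrightarrow> ennreal ((2*r)^CARD('n))) (at_right r)" by (intro tendsto_intros)
    thus ?thesis using False by (intro tendsto_mult_ennreal) (auto simp: cr(1))
  qed
  hence "eventually (\<lambda>t. l * ennreal ((2*t)^CARD('n)) < ?I) (at_right r)" using cr(3) by (rule order_tendstoD)
  moreover have "eventually (\<lambda>t. t > r) (at_right r)" by (rule eventually_at_right_less)
  ultimately have "eventually (\<lambda>t. l * ennreal ((2*t)^CARD('n)) < ?I \<and> t > r) (at_right r)" by eventually_elim auto
  then obtain t where t: "l * ennreal ((2*t)^CARD('n)) < ?I" "t > r" using eventually_happens[of _ "at_right r"] trivial_limit_at_right_real by blast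
  have "?I \<le> (\<integral>y\<in>qb c t. g y)" using t(2) by (intro nn_integral_mono_set qb_mono_radius) auto
  with t cr show ?thesis by (intro exI[of _ c] exI[of _ t]) (auto simp: mem_qb)
qed

lemma open_MM: "open {x. l < MM (g :: real^'n \<Rightarrow> ennreal) x}"
proof (rule openI, clarify)
  fix x :: "real^'n" assume "l < MM g x"
  then obtain c r where cr: "0 < r" "infnorm (x - c) < r" "l * ennreal ((2*r)^CARD('n)) < (\<integral>y\<in>qb c r. g y)" using MM_enlarge by blast
  have "{y. infnorm (y - c) < r} \<subseteq> {x. l < MM g x}" using cr by (auto simp: less_MM_iff mem_qb intro!: exI[of _ c] exI[of _ r])
  thus "\<exists>e>0. ball x e \<subseteq> {x. l < MM g x}"
    using open_infnorm_ball[of c r] cr(2) openE[of "{y. infnorm (y - c) < r}" x] by (metis (no_types, lifting) mem_Collect_eq order_trans)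
qed

lemma MM_measurable [measurable]: "MM g \<in> borel_measurable borel" by (rule borel_measurableI_greater) (use open_MM[of _ g] in \<open>auto simp: open_MM\<close>)

lemma MM_measurable_lebesgue [measurable]: "MM g \<in> lmeas" by (rule measurable_completion) simp

section \<open>Vitali covering and the weak type (1,1) bound\<close>

lemma vitali_qb:
  fixes C :: "'i \<Rightarrow> real^'n"
  assumes "finite I" "\<And>i. i \<in> I \<Longrightarrow> 0 < R i"
  shows "\<exists>J\<subseteq>I. disjoint_family_on (\<lambda>i. qb (C i) (R i)) J \<and>
     (\<Union>i\<in>I. qb (C i) (R i)) \<subseteq> (\<Union>i\<in>J. qb (C i) (3 * R i))" using assms
proof (induction I rule: finite_psubset_induct)
  case (psubset I)
  show ?case
  proof (cases "I = {}")
    case False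
    \<comment> \<open>A cube of largest radius is kept: every cube that meets it lies in its triple,
      and the remaining ones form the smaller family to which the induction hypothesis
      applies.\<close>
    have "Max (R ` I) \<in> R ` I" using psubset.hyps False by (intro Max_in) auto
    then obtain i where i1: "i \<in> I" "R i = Max (R ` I)" by auto
    hence i: "i \<in> I" "\<And>j. j \<in> I \<Longrightarrow> R j \<le> R i" using psubset.hyps by auto
    define I' where "I' = {j\<in>I. qb (C j) (R j) \<inter> qb (C i) (R i) = {}}"
    have "C i \<in> qb (C i) (R i)" using psubset.prems[OF i(1)] by (simp add: mem_qb infnorm_0)
    hence "I' \<subset> I" using i(1) by (auto simp: I'_def)
    then obtain J where J: "J \<subseteq> I'" "disjoint_family_on (\<lambda>i. qb (C i) (R i)) J"
      "(\<Union>i\<in>I'. qb (C i) (R i)) \<subseteq> (\<Union>i\<in>J. qb (C i) (3 * R i))"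
      using psubset.IH[of I'] psubset.prems by (metis (no_types, lifting) psubset_imp_subset subsetD)
    have "disjoint_family_on (\<lambda>i. qb (C i) (R i)) (insert i J)" using J(1,2) by (fastforce simp: disjoint_family_on_def I'_def)
    moreover have "qb (C j) (R j) \<subseteq> (\<Union>i\<in>insert i J. qb (C i) (3 * R i))" if j: "j \<in> I" for j
    proof (cases "j \<in> I'")
      case True thus ?thesis using J(3) by auto
    next
      case False
      then obtain z where z: "z \<in> qb (C j) (R j)" "z \<in> qb (C i) (R i)" using j by (auto simp: I'_def)
      have "infnorm (C j - C i) + R j \<le> 3 * R i" using infnorm_triangle_sub[of "C j" "C i" z] z i(2)[OF j] unfolding mem_qb by (simp add: infnorm_sub)
      thus ?thesis using qb_mono by fastforce
    qed
    ultimately show ?thesis using J(1) i(1) by (intro exI[of _ "insert i J"]) (auto simp: I'_def)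
  qed (auto simp: disjoint_family_on_def)
qed

lemma MM_weak_type_finite:
  fixes C :: "'i \<Rightarrow> real^'n"
  assumes [measurable]: "g \<in> lmeas" and "finite I"
    and I: "\<And>i. i \<in> I \<Longrightarrow> 0 < R i \<and> l * ennreal ((2 * R i)^CARD('n)) \<le> (\<integral>y\<in>qb (C i) (R i). g y)"
  shows "l * vol (\<Union>i\<in>I. qb (C i) (R i)) \<le> 3^CARD('n) * (\<integral>y. g y)"
proof -
  obtain J where J: "J \<subseteq> I" "disjoint_family_on (\<lambda>i. qb (C i) (R i)) J"
    "(\<Union>i\<in>I. qb (C i) (R i)) \<subseteq> (\<Union>i\<in>J. qb (C i) (3 * R i))" using vitali_qb[OF assms(2), of R C] I by blast
  have fJ: "finite J" using J(1) assms(2) finite_subset by blast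
  have "l * vol (\<Union>i\<in>I. qb (C i) (R i)) \<le> l * vol (\<Union>i\<in>J. qb (C i) (3 * R i))" using J(3) fJ by (intro mult_left_mono emeasure_mono) auto
  also have "... \<le> l * (\<Sum>i\<in>J. vol (qb (C i) (3 * R i)))" using fJ by (intro mult_left_mono emeasure_subadditive_finite) auto
  also have "... = (\<Sum>i\<in>J. 3^CARD('n) * (l * ennreal ((2 * R i)^CARD('n))))" unfolding sum_distrib_left
  proof (rule sum.cong[OF refl])
    fix i assume "i \<in> J"
    hence "0 < R i" using I J(1) by auto
    hence "vol (qb (C i) (3 * R i)) = ennreal ((2 * (3 * R i))^CARD('n))" by (intro emeasure_qb) simp
    also have "(2 * (3 * R i))^CARD('n) = 3^CARD('n) * (2 * R i)^CARD('n)" by (metis mult.left_commute power_mult_distrib)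
    also have "... = 3^CARD('n) * ennreal ((2 * R i)^CARD('n))" using \<open>0 < R i\<close> by (simp add: ennreal_mult ennreal_power[symmetric])
    finally show "l * vol (qb (C i) (3 * R i)) = 3^CARD('n) * (l * ennreal ((2 * R i)^CARD('n)))" by (simp add: mult_ac)
  qed
  also have "... \<le> (\<Sum>i\<in>J. 3^CARD('n) * (\<integral>y\<in>qb (C i) (R i). g y))" using I J(1) by (intro sum_mono mult_left_mono) auto
  also have "... = 3^CARD('n) * (\<integral>y. (\<Sum>i\<in>J. g y * indicator (qb (C i) (R i)) y))" by (subst nn_integral_sum) (auto simp: sum_distrib_left)
  also have "... \<le> 3^CARD('n) * (\<integral>y. g y)"
  proof (intro mult_left_mono nn_integral_mono)
    fix y
    have "(\<Sum>i\<in>J. g y * indicator (qb (C i) (R i)) y) = g y * indicator (\<Union>i\<in>J. qb (C i) (R i)) y"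
      unfolding sum_distrib_left[symmetric] by (subst indicator_UN_disjoint[OF fJ J(2)]) simp
    thus "(\<Sum>i\<in>J. g y * indicator (qb (C i) (R i)) y) \<le> g y" by (simp add: indicator_def)
  qed auto
  finally show ?thesis .
qed

text \<open>The superlevel set is covered by open cubes of large average; Lindelof reduces these to
  a sequence, finite parts are handled by \<open>MM_weak_type_finite\<close>, and continuity from
  below finishes.\<close>

theorem MM_weak_type:
  fixes g :: "real^'n \<Rightarrow> ennreal"
  assumes [measurable]: "g \<in> lmeas"
  shows "l * vol {x. l < MM g x} \<le> 3^CARD('n) * (\<integral>y. g y)"
proof -
  define G where "G = {(c::real^'n,r::real). 0 < r \<and> l * ennreal ((2 * r)^CARD('n)) \<le> (\<integral>y\<in>qb c r. g y)}"
  define ob where "ob = (\<lambda>(c::real^'n,r). {y. infnorm (y - c) < r})"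
  have cover: "{x. l < MM g x} \<subseteq> (\<Union>i\<in>G. ob i)"
  proof clarify
    fix x assume "l < MM g x"
    from MM_enlarge[OF this] show "x \<in> (\<Union>i\<in>G. ob i)" unfolding G_def ob_def by (force intro: less_imp_le)
  qed
  have opens: "\<And>S. S \<in> ob ` G \<Longrightarrow> open S" by (auto simp: ob_def open_infnorm_ball)
  obtain F where F: "F \<subseteq> ob ` G" "countable F" "\<Union>F = \<Union>(ob ` G)" using Lindelof[OF opens] by blast
  obtain G' where G': "countable G'" "G' \<subseteq> G" "F = ob ` G'" using F(1,2) countable_subset_image by meson
  show ?thesis
  proof (cases "G' = {}")
    case True
    hence "{x. l < MM g x} = {}" using cover F(3) G'(3) by auto
    thus ?thesis by simp
  next
    case False
    define e where "e = from_nat_into G'"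
    have e: "range e = G'" unfolding e_def using False G'(1) by simp
    define U where "U m = (\<Union>i\<le>m. ob (e i))" for m :: nat
    have Um: "U m \<in> sets lebesgue" for m by (auto simp: U_def ob_def split_beta open_infnorm_ball intro!: sets.finite_UN)
    have "(\<Union>m. U m) = (\<Union>i. ob (e i))" by (auto simp: U_def)
    also have "... = \<Union>(ob ` G)" using F(3) G'(3) e by (metis image_image)
    finally have UU: "(\<Union>m. U m) = \<Union>(ob ` G)" .
    have UUm: "(\<Union>m. U m) \<in> sets lebesgue" using Um by blast
    have inc: "incseq U" unfolding U_def incseq_def by (force intro: order_trans)
    have b: "l * vol (U m) \<le> 3^CARD('n) * (\<integral>y. g y)" for m
    proof -
      have "U m \<subseteq> (\<Union>i\<le>m. qb (fst (e i)) (snd (e i)))" unfolding U_def ob_def by (force simp: mem_qb split_beta)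
      hence "l * vol (U m) \<le> l * vol (\<Union>i\<le>m. qb (fst (e i)) (snd (e i)))" by (intro mult_left_mono emeasure_mono) auto
      also have "... \<le> 3^CARD('n) * (\<integral>y. g y)"
      proof (rule MM_weak_type_finite)
        fix i have "e i \<in> G" using e G'(2) by auto
        thus "0 < snd (e i) \<and> l * ennreal ((2 * snd (e i)) ^ CARD('n)) \<le> (\<integral>y\<in>qb (fst (e i)) (snd (e i)). g y)" by (auto simp: G_def split_beta)
      qed auto
      finally show ?thesis .
    qed
    have "l * vol {x. l < MM g x} \<le> l * vol (\<Union>m. U m)" using cover UUm by (intro mult_left_mono emeasure_mono) (simp_all add: UU)
    also have "vol (\<Union>m. U m) = (SUP m. vol (U m))" using SUP_emeasure_incseq[of U lebesgue] Um inc by (simp add: image_subset_iff)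
    also have "l * ... = (SUP m. l * vol (U m))" by (rule SUP_mult_left_ennreal)
    also have "... \<le> 3^CARD('n) * (\<integral>y. g y)" by (rule SUP_least) (rule b)
    finally show ?thesis .
  qed
qed

lemma MM_mono: "(\<And>y. g y \<le> h y) \<Longrightarrow> MM g x \<le> MM h x" unfolding MM_le_iff
proof (intro allI impI)
  fix c :: "real^'a" and r :: real
  assume g: "\<And>y. g y \<le> h y" and r: "0 < r" "x \<in> qb c r"
  have "(\<integral>y\<in>qb c r. g y) \<le> (\<integral>y\<in>qb c r. h y)" using g by (intro nn_integral_mono mult_right_mono) auto
  also have "... \<le> MM h x * ennreal ((2*r)^CARD('a))" using r by (rule MM_upper)
  finally show "(\<integral>y\<in>qb c r. g y) \<le> MM h x * ennreal ((2*r)^CARD('a))" .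
qed

text \<open>For exponent \<open>n\<close> this is comparable to the maximal function of the indicator of \<open>qb c r\<close>, so
  exponent \<open>n * q\<close> gives the integrand of \<^const>\<open>Cq_tail\<close>.\<close>

definition kap :: "real \<Rightarrow> real^'n \<Rightarrow> real \<Rightarrow> real^'n \<Rightarrow> real" where
  "kap s c r y = (r / max r (infnorm (y - c))) powr s"

lemma infnorm_borel [measurable]: "(infnorm :: real^'n \<Rightarrow> real) \<in> borel_measurable borel"
  by (rule borel_measurable_continuous_onI) (auto intro!: continuous_at_imp_continuous_on simp: isCont_def intro!: tendsto_intros)

lemma kap_measurable [measurable]: "kap s c r \<in> borel_measurable borel" unfolding kap_def by measurable

lemma kap_measurable_lebesgue [measurable]: "kap s c r \<in> lmeas" by (rule measurable_completion) simp

lemma kap_nonneg [simp]: "0 \<le> kap s c r y" by (simp add: kap_def)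

lemma kap_le_1: "0 < r \<Longrightarrow> 0 \<le> s \<Longrightarrow> kap s c r y \<le> 1" unfolding kap_def by (intro powr_le1) auto

text \<open>On the j-th dyadic shell around the cube the profile is at most 2^(-j (n+e)), while the
  mass of the dilate is bounded by a multiple of 2^(j n); the product is a geometric series in
  2^(-e).\<close>

theorem nn_integral_kap_le:
  fixes h :: "real^'n \<Rightarrow> ennreal" and e :: real
  assumes r: "0 < r" and e: "0 < e" and [measurable]: "h \<in> lmeas"
    and m: "\<And>\<rho>. r \<le> \<rho> \<Longrightarrow> (\<integral>y\<in>qb c \<rho>. h y) \<le> m * ennreal ((2*\<rho>)^CARD('n))"
  shows "(\<integral>y. h y * ennreal (kap (CARD('n) + e) c r y))
    \<le> ennreal (4^CARD('n) / (1 - 2 powr - e) * r^CARD('n)) * m"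
proof -
  define s where "s = real CARD('n) + e"
  define q where "q j = (2::real) powr (- real j * s)" for j :: nat
  have s: "s > 0" using e by (simp add: s_def)
  have point: "h y * ennreal (kap s c r y) \<le> (\<Sum>j. h y * indicator (qb c (2^(j+1) * r)) y * ennreal (q j))" for y
  proof -
    define P where "P j \<longleftrightarrow> infnorm (y - c) \<le> 2^(j+1) * r" for j :: nat
    have "\<exists>j. P j"
    proof -
      obtain j :: nat where "infnorm (y - c) / r < 2^j" using real_arch_pow[of 2] by auto
      hence "infnorm (y - c) \<le> 2^j * r" using r by (simp add: field_simps)
      also have "... \<le> 2^(j+1) * r" using r by simp
      finally show ?thesis unfolding P_def by blast
    qed
    hence L: "P (LEAST j. P j)" by (rule LeastI_ex)
    \<comment> \<open>For j = 0 only \<open>kap_le_1\<close> is available; for j > 0 the failure of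
      \<open>P (j - 1)\<close> puts y outside the dilate by 2^j, which gives the decay.\<close>
    define j where "j = (LEAST j. P j)"
    have "kap s c r y \<le> q j"
    proof (cases "j = 0")
      case True thus ?thesis using kap_le_1[OF r, of s c y] s by (simp add: q_def)
    next
      case False
      have "\<not> P (j - 1)" using False not_less_Least[of "j-1" P] by (simp add: j_def)
      hence *: "infnorm (y - c) > 2^j * r" using False by (simp add: P_def)
      have "1 * r \<le> 2^j * r" using r by (intro mult_right_mono one_le_power) auto
      hence "max r (infnorm (y - c)) = infnorm (y - c)" using * by simp
      hence "r / max r (infnorm (y - c)) \<le> 1 / 2^j" using * r by (simp add: field_simps)
      hence "kap s c r y \<le> (1 / 2^j) powr s" unfolding kap_def using s r by (intro powr_mono2) auto
      also have "... = q j" unfolding q_def by (simp add: powr_minus powr_realpow[symmetric] powr_powr divide_inverse flip: powr_minus)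
      finally show ?thesis .
    qed
    moreover have "infnorm (y - c) \<le> 2^(j+1) * r" using L unfolding j_def[symmetric] by (simp only: P_def)
    ultimately have "h y * ennreal (kap s c r y) \<le> h y * indicator (qb c (2^(j+1) * r)) y * ennreal (q j)"
      by (simp add: mem_qb indicator_def mult_left_mono ennreal_leI)
    also have "... \<le> (\<Sum>j. h y * indicator (qb c (2^(j+1) * r)) y * ennreal (q j))"
      using sum_le_suminf[of "\<lambda>j. h y * indicator (qb c (2^(j+1) * r)) y * ennreal (q j)" "{j}"] by simp
    finally show ?thesis .
  qed
  have "(\<integral>y. h y * ennreal (kap s c r y))
     \<le> (\<integral>y. (\<Sum>j. h y * indicator (qb c (2^(j+1) * r)) y * ennreal (q j)))" by (intro nn_integral_mono point)
  also have "... = (\<Sum>j. (\<integral>y. h y * indicator (qb c (2^(j+1) * r)) y * ennreal (q j)))" by (rule nn_integral_suminf) measurable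
  also have "... \<le> (\<Sum>j. ennreal (4^CARD('n) * r^CARD('n) * (2 powr - e)^j) * m)"
  proof (intro suminf_le summableI)
    fix j :: nat
    have "(\<integral>y. h y * indicator (qb c (2^(j+1) * r)) y * ennreal (q j))
       = (\<integral>y\<in>qb c (2^(j+1) * r). h y) * ennreal (q j)" by (rule nn_integral_multc) measurable
    also have "... \<le> m * ennreal ((2*(2^(j+1) * r))^CARD('n)) * ennreal (q j)"
    proof (intro mult_right_mono m)
      have "(1::real) \<le> 2^(j+1)" by (rule one_le_power) simp
      thus "r \<le> 2^(j+1) * r" using r by simp
    qed auto
    also have "... = m * ennreal ((2*(2^(j+1) * r))^CARD('n) * q j)" using r by (simp add: q_def ennreal_mult mult.assoc)
    also have "(2*(2^(j+1) * r))^CARD('n) * q j = 4^CARD('n) * r^CARD('n) * (2 powr - e)^j"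
    proof -
      have "q j = 2 powr (- real (j * CARD('n)) + (- e) * real j)" unfolding q_def s_def by (simp add: algebra_simps)
      also have "... = inverse (2^(j * CARD('n))) * (2 powr - e) powr real j"
      proof -
        have "2 powr - real (j * CARD('n)) = inverse (2^(j * CARD('n)))" by (simp only: powr_minus powr_realpow zero_less_numeral)
        moreover have "2 powr (- e * real j) = (2 powr - e) powr real j" by (rule powr_powr[symmetric])
        ultimately show ?thesis by (simp only: powr_add)
      qed
      also have "(2 powr - e) powr real j = (2 powr - e)^j" by (rule powr_realpow) simp
      finally have A: "q j = inverse ((2^j)^CARD('n)) * (2 powr - e)^j" by (simp only: power_mult)
      have "2*(2^(j+1) * r) = 2^j * (4 * r)" by simp
      hence B: "(2*(2^(j+1) * r))^CARD('n) = (2^j)^CARD('n) * (4^CARD('n) * r^CARD('n))" by (simp only: power_mult_distrib)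
      show ?thesis unfolding A B by simp
    qed
    finally show "(\<integral>y. h y * indicator (qb c (2^(j+1) * r)) y * ennreal (q j))
      \<le> ennreal (4^CARD('n) * r^CARD('n) * (2 powr - e)^j) * m" by (simp add: mult.commute)
  qed
  also have "... = (\<Sum>j. ennreal (4^CARD('n) * r^CARD('n) * (2 powr - e)^j)) * m" by simp
  also have "(\<Sum>j. ennreal (4^CARD('n) * r^CARD('n) * (2 powr - e)^j)) = ennreal (4^CARD('n) / (1 - 2 powr - e) * r^CARD('n))"
  proof -
    have "2 powr - e < 1" using e powr_less_mono[of "- e" 0 2] by simp
    hence "(\<lambda>j. 4^CARD('n) * r^CARD('n) * (2 powr - e)^j) sums (4^CARD('n) * r^CARD('n) * (1 / (1 - 2 powr - e)))" by (intro sums_mult geometric_sums) auto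
    thus ?thesis using r by (subst suminf_ennreal2) (auto simp: sums_iff)
  qed
  finally show ?thesis by (simp add: s_def)
qed

section \<open>Dyadic grids\<close>

text \<open>The grid is given by the corner a and the side s of one cube and has no generations
  coarser than that. Hence increasing chains of cells are finite and every nonempty family of cells
  has maximal members.\<close>

locale grid =
  fixes a :: "real^'n" and s :: real
  assumes s_pos: "0 < s"
begin

definition gidx :: "nat \<Rightarrow> real^'n \<Rightarrow> ('n \<Rightarrow> int)" where
  "gidx k y = (\<lambda>i. \<lfloor>(y$i - a$i) / s * 2^k\<rfloor>)"

definition at_gen :: "nat \<Rightarrow> real^'n \<Rightarrow> 'n cube" where
  "at_gen k y = (k, gidx k y)"

definition cell :: "'n cube \<Rightarrow> (real^'n) set" where
  "cell Q = {y. at_gen (fst Q) y = Q}"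

definition ctr :: "'n cube \<Rightarrow> real^'n" where
  "ctr Q = (\<chi> i. a$i + s * (of_int (snd Q i) + 1/2) / 2^fst Q)"

definition rad :: "'n cube \<Rightarrow> real" where
  "rad Q = s / 2^fst Q / 2"

abbreviation cv :: "'n cube \<Rightarrow> real" where "cv Q \<equiv> (2 * rad Q)^CARD('n)"

abbreviation root :: "'n cube" where "root \<equiv> (0, \<lambda>_. 0)"

text \<open>Meaningful in positive generations. In generation 0 the truncated subtraction keeps the
  generation, and \<open>root\<close>, whose position is 0, is its own parent.\<close>

definition parent :: "'n cube \<Rightarrow> 'n cube" where
  "parent Q = (fst Q - 1, \<lambda>i. snd Q i div 2)"

lemma rad_pos [simp]: "0 < rad Q" using s_pos by (simp add: rad_def)

lemma rad_neq_0 [simp]: "rad Q \<noteq> 0" using rad_pos[of Q] by linarith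

lemma rad_nonneg [simp]: "0 \<le> rad Q" using rad_pos[of Q] by linarith

lemma fst_at_gen [simp]: "fst (at_gen k y) = k" by (simp add: at_gen_def)

lemma mem_at_gen [simp]: "y \<in> cell (at_gen k y)" by (simp add: cell_def)

lemma mem_cell_iff: "y \<in> cell Q \<longleftrightarrow> Q = at_gen (fst Q) y" by (auto simp: cell_def)

lemma cell_eq: "y \<in> cell Q \<Longrightarrow> y \<in> cell P \<Longrightarrow> fst P = fst Q \<Longrightarrow> P = Q" by (simp add: mem_cell_iff)

lemma mem_cell_coord: "y \<in> cell Q \<longleftrightarrow> (\<forall>i. ctr Q $ i - rad Q \<le> y $ i \<and> y $ i < ctr Q $ i + rad Q)"
proof -
  have "(\<lfloor>(y$i - a$i) / s * 2^fst Q\<rfloor> = snd Q i) \<longleftrightarrow> (ctr Q $ i - rad Q \<le> y $ i \<and> y $ i < ctr Q $ i + rad Q)" for i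
  proof -
    have *: "ctr Q $ i - rad Q = a$i + s * of_int (snd Q i) / 2^fst Q"
      "ctr Q $ i + rad Q = a$i + s * (of_int (snd Q i) + 1) / 2^fst Q" by (simp_all add: ctr_def rad_def add_divide_distrib distrib_left)
    show ?thesis unfolding * using s_pos by (simp add: floor_eq_iff field_simps)
  qed
  thus ?thesis unfolding cell_def at_gen_def gidx_def by (cases Q) (auto simp: fun_eq_iff)
qed

lemma cell_subset_qb: "cell Q \<subseteq> qb (ctr Q) (rad Q)"
proof
  fix y assume "y \<in> cell Q"
  hence "ctr Q $ i - rad Q \<le> y $ i \<and> y $ i < ctr Q $ i + rad Q" for i by (simp add: mem_cell_coord)
  hence "\<bar>(y - ctr Q)$i\<bar> \<le> rad Q" for i unfolding vector_minus_component abs_le_iff by (smt (verit, best))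
  thus "y \<in> qb (ctr Q) (rad Q)" by (simp add: mem_qb infnorm_le_iff)
qed

lemma box_subset_cell: "box (\<chi> i. ctr Q $ i - rad Q) (\<chi> i. ctr Q $ i + rad Q) \<subseteq> cell Q" by (auto simp: mem_cell_coord mem_box_cart less_imp_le)

lemma cell_borel [measurable, simp]: "cell Q \<in> sets borel"
proof -
  have "cell Q = {y. \<forall>i\<in>UNIV. ctr Q $ i - rad Q \<le> y $ i \<and> y $ i < ctr Q $ i + rad Q}" by (auto simp: mem_cell_coord)
  thus ?thesis by simp
qed

lemma cell_sets [measurable, simp]: "cell Q \<in> sets lebesgue" by simp

lemma emeasure_cell: "vol (cell Q) = ennreal (cv Q)"
proof (rule antisym)
  show "vol (cell Q) \<le> ennreal (cv Q)" using emeasure_mono[OF cell_subset_qb[of Q] qb_sets(1)] emeasure_qb[of "rad Q" "ctr Q"] by simp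
  let ?B = "box (\<chi> i. ctr Q $ i - rad Q) (\<chi> i. ctr Q $ i + rad Q)"
  have "vol ?B = vol (qb (ctr Q) (rad Q))" unfolding qb_cbox using rad_nonneg[of Q] by (simp add: emeasure_completion emeasure_lborel_cbox_eq emeasure_lborel_box_eq)
  thus "ennreal (cv Q) \<le> vol (cell Q)" using emeasure_mono[OF box_subset_cell[of Q] cell_sets] emeasure_qb[of "rad Q" "ctr Q"] by simp
qed

lemma cell_root: "cell root = {y. \<forall>i. a$i \<le> y$i \<and> y$i < a$i + s}" using mem_cell_coord[of _ root] by (auto simp: ctr_def rad_def algebra_simps)

text \<open>Coarsening the grid is integer division of the position, because the floor of a quotient
  by an integer can be taken after an inner floor; the nesting of cells is a consequence.\<close>

lemma gidx_div: assumes "j \<le> k" shows "gidx j y i = gidx k y i div 2^(k-j)"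
proof -
  have "gidx j y i = \<lfloor>((y$i - a$i) / s * 2^k) / real_of_int (2^(k-j))\<rfloor>"
  proof -
    have "(2::real)^k = 2^j * 2^(k-j)" using assms by (simp flip: power_add)
    thus ?thesis by (simp add: gidx_def)
  qed
  also have "... = gidx k y i div 2^(k-j)" unfolding gidx_def by (rule floor_divide_real_eq_div) simp
  finally show ?thesis .
qed

lemma at_gen_cong: "y \<in> cell (at_gen k x) \<Longrightarrow> j \<le> k \<Longrightarrow> at_gen j y = at_gen j x"
  by (auto simp: cell_def at_gen_def gidx_div fun_eq_iff)

lemma cell_at_gen_mono: "j \<le> k \<Longrightarrow> cell (at_gen k x) \<subseteq> cell (at_gen j x)"
proof
  fix y assume "j \<le> k" "y \<in> cell (at_gen k x)"
  hence "at_gen j y = at_gen j x" by (intro at_gen_cong)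
  thus "y \<in> cell (at_gen j x)" by (metis mem_at_gen)
qed

lemma cell_nested:
  assumes "x \<in> cell P" "x \<in> cell Q" "fst P \<le> fst Q" shows "cell Q \<subseteq> cell P"
  using cell_at_gen_mono[OF assms(3), of x] assms(1,2) by (metis mem_cell_iff)

lemma cell_disjoint_or_nested: "cell P \<inter> cell Q = {} \<or> cell P \<subseteq> cell Q \<or> cell Q \<subseteq> cell P"
  using cell_nested by (metis disjoint_iff linear)

lemma ctr_in_cell: "ctr Q \<in> cell Q" using rad_pos[of Q] by (simp add: mem_cell_coord)

text \<open>This metric form of inclusion is what the comparison of tails and dilates consumes. It
  is read off coordinatewise from the open box of Q inside the closed box of P.\<close>

lemma cell_subset_ctr_rad:
  assumes "cell Q \<subseteq> cell P"
  shows "infnorm (ctr Q - ctr P) + rad Q \<le> rad P"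
proof -
  have "box (\<chi> i. ctr Q $ i - rad Q) (\<chi> i. ctr Q $ i + rad Q) \<subseteq> cbox (\<chi> i. ctr P $ i - rad P) (\<chi> i. ctr P $ i + rad P)"
    using assms box_subset_cell[of Q] cell_subset_qb[of P] unfolding qb_cbox by blast
  hence "ctr P $ i - rad P \<le> ctr Q $ i - rad Q \<and> ctr Q $ i + rad Q \<le> ctr P $ i + rad P" for i using rad_pos[of Q] by (simp add: subset_interval_cart)
  hence "\<bar>(ctr Q - ctr P)$i\<bar> \<le> rad P - rad Q" for i unfolding vector_minus_component abs_le_iff by (smt (verit, best))
  thus ?thesis using infnorm_le_iff[of "ctr Q - ctr P" "rad P - rad Q"] by simp
qed

lemma cell_subset_fst: "cell Q \<subseteq> cell P \<Longrightarrow> fst P \<le> fst Q"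
proof -
  assume "cell Q \<subseteq> cell P"
  hence "rad Q \<le> rad P" using cell_subset_ctr_rad[of Q P] infnorm_pos_le[of "ctr Q - ctr P"] by linarith
  hence "(2::real)^fst P \<le> 2^fst Q" using s_pos by (simp add: rad_def field_simps)
  thus ?thesis by simp
qed

lemma cell_subset_antisym: "cell Q \<subseteq> cell P \<Longrightarrow> cell P \<subseteq> cell Q \<Longrightarrow> P = Q"
  using cell_eq ctr_in_cell cell_subset_fst by (meson le_antisym subsetD)

lemma qb_cell_mono:
  assumes "cell Q \<subseteq> cell P" "1 \<le> t" shows "qb (ctr Q) (t * rad Q) \<subseteq> qb (ctr P) (t * rad P)"
proof (rule qb_mono)
  have *: "infnorm (ctr Q - ctr P) + rad Q \<le> rad P" using cell_subset_ctr_rad[OF assms(1)] .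
  have "infnorm (ctr Q - ctr P) \<le> t * infnorm (ctr Q - ctr P)" using assms(2) infnorm_pos_le[of "ctr Q - ctr P"] by (simp add: mult_right_mono[of 1 t, simplified])
  thus "infnorm (ctr Q - ctr P) + t * rad Q \<le> t * rad P" using mult_left_mono[OF *, of t] assms(2) by (simp add: algebra_simps)
qed

lemma cell_subset_qb_point: "x \<in> cell Q \<Longrightarrow> cell Q \<subseteq> qb x (2 * rad Q)"
  using cell_subset_qb[of Q] infnorm_triangle_sub infnorm_sub unfolding mem_qb subset_iff by (smt (verit, best) mem_qb)

lemma parent_at_gen: "parent (at_gen (Suc k) x) = at_gen k x" using gidx_div[of k "Suc k" x] by (auto simp: parent_def at_gen_def)

lemma parent_cell: "0 < fst Q \<Longrightarrow> cell Q \<subseteq> cell (parent Q)"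
proof
  fix x assume f: "0 < fst Q" and x: "x \<in> cell Q"
  obtain k where k: "fst Q = Suc k" using f gr0_implies_Suc by blast
  have "parent Q = at_gen k x" using parent_at_gen[of k x] x k by (metis mem_cell_iff)
  thus "x \<in> cell (parent Q)" by simp
qed

lemma rad_parent: "0 < fst Q \<Longrightarrow> rad (parent Q) = 2 * rad Q" by (cases "fst Q") (auto simp: rad_def parent_def)

lemma fst_parent [simp]: "fst (parent Q) = fst Q - 1" by (simp add: parent_def)

lemma rad_at_gen: "rad (at_gen k x) = s / 2^k / 2" by (simp add: rad_def)

lemma small_cell:
  assumes "open U" "x \<in> U" shows "\<exists>k0. \<forall>k\<ge>k0. cell (at_gen k x) \<subseteq> U"
proof -
  obtain e where e: "0 < e" "ball x e \<subseteq> U" using assms openE by blast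
  define C where "C = sqrt CARD('n)"
  have C: "0 < C" by (simp add: C_def)
  obtain k0 where k0: "C * s / e < 2^k0" using real_arch_pow[of 2] by auto
  have "cell (at_gen k x) \<subseteq> U" if k: "k0 \<le> k" for k
  proof
    fix y assume "y \<in> cell (at_gen k x)"
    hence "infnorm (y - x) \<le> s / 2^k" using cell_subset_qb_point[of x "at_gen k x"] by (auto simp: mem_qb rad_at_gen)
    also have "... \<le> s / 2^k0" using s_pos k by (intro divide_left_mono power_increasing) auto
    finally have "C * infnorm (y - x) \<le> C * (s / 2^k0)" using C by (intro mult_left_mono) auto
    also have "... < e" using k0 e by (simp add: field_simps)
    finally have "norm (y - x) < e" using norm_le_infnorm_cart[of "y - x"] by (simp add: C_def)
    thus "y \<in> U" using e by (auto simp: dist_norm norm_minus_commute)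
  qed
  thus ?thesis by blast
qed

section \<open>Maximal cells of a family\<close>

definition maxc :: "'n cube set \<Rightarrow> 'n cube set" where
  "maxc F = {Q\<in>F. \<forall>R\<in>F. cell Q \<subseteq> cell R \<longrightarrow> R = Q}"

lemma maxc_subset: "maxc F \<subseteq> F" by (auto simp: maxc_def)

lemma maxc_disjoint: "disjoint_family_on cell (maxc F)" unfolding disjoint_family_on_def
proof (intro ballI impI)
  fix P Q assume "P \<in> maxc F" "Q \<in> maxc F" "P \<noteq> Q"
  thus "cell P \<inter> cell Q = {}" using cell_disjoint_or_nested[of P Q] unfolding maxc_def by blast
qed

text \<open>A strictly larger cell has a strictly smaller generation, so climbing inside F
  stops.\<close>

lemma maxc_cover: assumes "Q \<in> F" shows "\<exists>P\<in>maxc F. cell Q \<subseteq> cell P" using assms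
proof (induction "fst Q" arbitrary: Q rule: less_induct)
  case less
  show ?case
  proof (cases "Q \<in> maxc F")
    case False
    then obtain R where R: "R \<in> F" "cell Q \<subseteq> cell R" "R \<noteq> Q" using less.prems by (auto simp: maxc_def)
    hence "fst R < fst Q" using cell_subset_fst[OF R(2)] cell_eq ctr_in_cell by (metis le_neq_implies_less subsetD)
    then obtain P where "P \<in> maxc F" "cell R \<subseteq> cell P" using less.hyps R(1) by blast
    thus ?thesis using R(2) by blast
  qed auto
qed

lemma maxc_Union: "(\<Union>Q\<in>maxc F. cell Q) = (\<Union>Q\<in>F. cell Q)" using maxc_cover maxc_subset by blast

text \<open>Every stopping argument below uses it: the parent of a maximal cell violates the
  selection rule, which gives an estimate in the opposite direction for a cube of twice the
  size.\<close>

lemma maxc_parent: "Q \<in> maxc F \<Longrightarrow> 0 < fst Q \<Longrightarrow> parent Q \<notin> F"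
proof
  assume "Q \<in> maxc F" "0 < fst Q" "parent Q \<in> F"
  hence "parent Q = Q" using parent_cell[of Q] unfolding maxc_def by blast
  thus False using fst_parent[of Q] \<open>0 < fst Q\<close> by simp
qed

lemma countable_cells [simp]: "countable (F :: 'n cube set)" by (rule countableI_type)

lemma emeasure_cells:
  assumes "disjoint_family_on cell F"
  shows "vol (\<Union>Q\<in>F. cell Q) = (\<Sum>\<^sup>+Q\<in>F. ennreal (cv Q))"
  using assms by (subst emeasure_UN_countable) (auto simp: emeasure_cell)

lemma nn_integral_cells:
  assumes d: "disjoint_family_on cell F" and [measurable]: "g \<in> lmeas"
  shows "(\<integral>x\<in>(\<Union>Q\<in>F. cell Q). g x) = (\<Sum>\<^sup>+Q\<in>F. (\<integral>x\<in>cell Q. g x))"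
proof -
  have m: "(\<Union>Q\<in>F. cell Q) \<in> sets lebesgue" by (intro sets.countable_UN'') auto
  have "(\<integral>x\<in>(\<Union>Q\<in>F. cell Q). g x) = emeasure (density lebesgue g) (\<Union>Q\<in>F. cell Q)" using m by (simp add: emeasure_density)
  also have "... = (\<Sum>\<^sup>+Q\<in>F. emeasure (density lebesgue g) (cell Q))" using d by (intro emeasure_UN_countable) auto
  also have "... = (\<Sum>\<^sup>+Q\<in>F. (\<integral>x\<in>cell Q. g x))" by (intro nn_integral_cong) (simp add: emeasure_density)
  finally show ?thesis .
qed

lemma Union_cells_sets [measurable, simp]: "(\<Union>Q\<in>F. cell Q) \<in> sets lebesgue" by (intro sets.countable_UN'') auto

end

section \<open>The weight of small sets\<close>

definition kint :: "real \<Rightarrow> (real^'n \<Rightarrow> ennreal) \<Rightarrow> real^'n \<Rightarrow> real \<Rightarrow> ennreal" where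
  "kint \<sigma> w c r = (\<integral>y. w y * ennreal (kap \<sigma> c r y))"

text \<open>Growing both r and the distance by r' - r moves the quotient of radius and distance
  towards 1 when the distance exceeds r, and the distance to the new centre grows by no more than
  that.\<close>

lemma kap_mono:
  assumes "0 < r" "infnorm (c - c') + r \<le> r'" "0 \<le> \<sigma>"
  shows "kap \<sigma> c r y \<le> kap \<sigma> c' r' y"
proof -
  define d where "d = infnorm (y - c)"
  define d' where "d' = infnorm (y - c')"
  have d: "d' \<le> d + (r' - r)" "0 \<le> d" "0 \<le> d'" using infnorm_triangle_sub[of y c' c] assms(2) by (auto simp: d_def d'_def infnorm_pos_le)
  have r: "r \<le> r'" using assms(2) infnorm_pos_le[of "c - c'"] by linarith
  have "r / max r d \<le> r' / max r' d'"
  proof (cases "d \<le> r")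
    case True
    hence "d' \<le> r'" using d(1) by linarith
    thus ?thesis using True assms(1) r by (simp add: max_def)
  next
    case False
    hence "0 \<le> (r' - r) * (d - r)" using r by simp
    hence "r * (d + (r' - r)) \<le> r' * d" by (simp add: algebra_simps)
    moreover have "r * max r' d' \<le> r * (d + (r' - r))" using assms(1) d(1) False by (intro mult_left_mono) auto
    ultimately have "r * max r' d' \<le> r' * d" by linarith
    thus ?thesis using False assms(1) r by (simp add: field_simps max_def split: if_splits)
  qed
  thus ?thesis unfolding kap_def d_def d'_def using assms by (intro powr_mono2) auto
qed

lemma kap_scale:
  assumes "0 < r" "1 \<le> t" "0 \<le> \<sigma>"
  shows "kap \<sigma> c (t * r) y \<le> t powr \<sigma> * kap \<sigma> c r y"
proof -
  have tr: "r \<le> t * r" using assms by simp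
  have m: "0 < max r (infnorm (y - c))" "0 < max (t * r) (infnorm (y - c))" using assms by (auto simp: less_max_iff_disj)
  have "max r (infnorm (y - c)) \<le> max (t * r) (infnorm (y - c))" using tr by auto
  hence "t * r / max (t * r) (infnorm (y - c)) \<le> t * r / max r (infnorm (y - c))" using assms m by (intro divide_left_mono mult_pos_pos) auto
  also have "... = t * (r / max r (infnorm (y - c)))" by simp
  finally have *: "t * r / max (t * r) (infnorm (y - c)) \<le> t * (r / max r (infnorm (y - c)))" .
  have "0 \<le> t * r / max (t * r) (infnorm (y - c))" using assms m(2) by simp
  with * have "kap \<sigma> c (t * r) y \<le> (t * (r / max r (infnorm (y - c)))) powr \<sigma>" unfolding kap_def using assms by (intro powr_mono2) auto
  also have "... = t powr \<sigma> * kap \<sigma> c r y" unfolding kap_def using assms by (intro powr_mult)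
  finally show ?thesis .
qed

text \<open>Since c lies within r' of c' and y is further than 3 r' from c', the distance of y to c
  is at least 2/3 of its distance to c'. The gain is the full power
  \<open>(r / r') powr \<sigma>\<close>, smaller than the volume ratio as soon as r < r' and
  \<sigma> exceeds the dimension.\<close>

lemma kap_far:
  assumes "0 < r" "infnorm (c - c') + r \<le> r'" "y \<notin> qb c' (3 * r')" "0 \<le> \<sigma>"
  shows "kap \<sigma> c r y \<le> (3/2) powr \<sigma> * (r / r') powr \<sigma> * kap \<sigma> c' r' y"
proof -
  define d where "d = infnorm (y - c)"
  define d' where "d' = infnorm (y - c')"
  have r: "r \<le> r'" using assms(2) infnorm_pos_le[of "c - c'"] by linarith
  have d': "3 * r' < d'" using assms(3) by (simp add: mem_qb d'_def)
  have "d' \<le> d + infnorm (c - c')" using infnorm_triangle_sub[of y c' c] by (simp add: d_def d'_def)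
  hence dd: "2 / 3 * d' \<le> d" using assms(1,2) d' by linarith
  have "r / max r d \<le> 3 / 2 * (r / r') * (r' / max r' d')" using assms(1) r d' dd by (simp add: field_simps max_def)
  hence "kap \<sigma> c r y \<le> (3 / 2 * (r / r') * (r' / max r' d')) powr \<sigma>" unfolding kap_def d_def using assms by (intro powr_mono2) auto
  also have "... = (3/2) powr \<sigma> * (r / r') powr \<sigma> * kap \<sigma> c' r' y" unfolding kap_def d'_def using assms(1) r by (simp only: powr_mult)
  finally show ?thesis .
qed

lemma kint_mono:
  "0 < r \<Longrightarrow> infnorm (c - c') + r \<le> r' \<Longrightarrow> 0 \<le> \<sigma> \<Longrightarrow> kint \<sigma> w c r \<le> kint \<sigma> w c' r'"
  unfolding kint_def by (intro nn_integral_mono mult_left_mono ennreal_leI kap_mono) auto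

lemma kint_scale:
  assumes [measurable]: "w \<in> lmeas" and "0 < r" "1 \<le> t" "0 \<le> \<sigma>"
  shows "kint \<sigma> w c (t * r) \<le> ennreal (t powr \<sigma>) * kint \<sigma> w c r"
proof -
  have "kint \<sigma> w c (t * r) \<le> (\<integral>y. ennreal (t powr \<sigma>) * (w y * ennreal (kap \<sigma> c r y)))" unfolding kint_def
  proof (rule nn_integral_mono, goal_cases)
    case (1 y)
    have "w y * ennreal (kap \<sigma> c (t * r) y) \<le> w y * ennreal (t powr \<sigma> * kap \<sigma> c r y)"
      using assms by (intro mult_left_mono ennreal_leI kap_scale) auto
    thus ?case by (simp add: ennreal_mult mult_ac)
  qed
  also have "... = ennreal (t powr \<sigma>) * kint \<sigma> w c r" unfolding kint_def by (rule nn_integral_cmult) measurable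
  finally show ?thesis .
qed

lemma kint_ge:
  assumes "0 < r"
  shows "(\<integral>y\<in>qb c r. w y) \<le> kint \<sigma> w c r"
  unfolding kint_def
proof (rule nn_integral_mono, goal_cases)
  case (1 y)
  show ?case using assms by (auto simp: indicator_def mem_qb kap_def max_def)
qed

lemma ennreal_div_mult_cancel: "0 < v \<Longrightarrow> a / ennreal v * ennreal v = a" by (simp add: ennreal_divide_times mult_divide_eq_ennreal)

text \<open>The constant of \<open>nn_integral_kap_le\<close>, with n the dimension and e the excess
  of the decay exponent over n.\<close>

definition kC :: "nat \<Rightarrow> real \<Rightarrow> real" where "kC n e = 4^n / (1 - 2 powr - e)"

lemma kC_ge1: "0 < e \<Longrightarrow> 1 \<le> kC n e"
proof -
  assume e: "0 < e"
  have 1: "2 powr - e < 1" using e powr_less_mono[of "- e" 0 2] by simp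
  have "1 - 2 powr - e \<le> 1" by simp
  also have "(1::real) \<le> 4^n" by simp
  finally show ?thesis using 1 by (simp add: kC_def field_simps)
qed

lemma kap_average:
  fixes h :: "real^'n \<Rightarrow> ennreal"
  assumes "0 < r" "real CARD('n) < \<sigma>" "h \<in> lmeas" "x \<in> qb c r"
  shows "(\<integral>y. h y * ennreal (kap \<sigma> c r y)) \<le> ennreal (kC CARD('n) (\<sigma> - CARD('n)) * r^CARD('n)) * MM h x"
proof -
  have "(\<integral>y\<in>qb c \<rho>. h y) \<le> MM h x * ennreal ((2*\<rho>)^CARD('n))" if "r \<le> \<rho>" for \<rho>
    using that assms(1,4) by (intro MM_upper) (auto simp: mem_qb)
  from nn_integral_kap_le[OF assms(1) _ assms(3) this, of "\<sigma> - CARD('n)"] assms(2)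
  show ?thesis by (simp add: kC_def)
qed

text \<open>What survives of the \<open>C_q\<close> condition is the bound \<open>key\<close> of the
  local maximal function by the tail, applied with \<open>\<sigma> = n q\<close>. The normalisation
  \<open>1 \<le> W\<close> lets powers of W be compared; finiteness of the tails is supplied in the
  end by the finiteness of the norm of M f.\<close>

locale Cq_weight =
  fixes w :: "real^'n \<Rightarrow> ennreal" and \<sigma> W :: real
  assumes w_meas [measurable]: "w \<in> lmeas"
    and \<sigma>_gt: "real CARD('n) < \<sigma>"
    and W_ge1: "1 \<le> W"
    and kint_finite: "\<And>c r. 0 < r \<Longrightarrow> kint \<sigma> w c r < \<infinity>"
    and key: "\<And>c r. 0 < r \<Longrightarrow>
      (\<integral>x\<in>qb c r. MM (\<lambda>y. w y * indicator (qb c r) y) x) \<le> ennreal W * kint \<sigma> w c r"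
begin

lemma \<sigma>_pos: "0 < \<sigma>" using \<sigma>_gt by (meson of_nat_0_le_iff order_le_less_trans)

lemma kint_triple: "0 < r \<Longrightarrow> kint \<sigma> w c (3 * r) \<le> ennreal (3 powr \<sigma>) * kint \<sigma> w c r" using \<sigma>_pos by (intro kint_scale) auto

end

text \<open>All constants are functions of the dimension and the exponents alone, so that the final
  constant visibly ignores the weight. \<open>rC1\<close> compares \<open>Ma\<close> with the local
  maximal function, \<open>rC2 W l\<close> bounds the mean of \<open>Ma\<close> over a maximal cell,
  and \<open>rL\<close> is the ratio of consecutive levels.\<close>

definition rC1 :: "nat \<Rightarrow> real \<Rightarrow> real" where
  "rC1 n \<sigma> = kC n (\<sigma> - n) + (3/2) powr \<sigma> * 2^n"
definition rC2 :: "nat \<Rightarrow> real \<Rightarrow> real" where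
  "rC2 n \<sigma> = rC1 n \<sigma> * (3 powr \<sigma> * 2^n + 1)"
definition rL :: "nat \<Rightarrow> real \<Rightarrow> real" where
  "rL n \<sigma> = rC1 n \<sigma> * (1 + 2 * 3^n * (3 powr \<sigma> * 2^n))"

lemma rC1_ge1: "real n < \<sigma> \<Longrightarrow> 1 \<le> rC1 n \<sigma>" using kC_ge1[of "\<sigma> - n" n] by (auto simp: rC1_def intro: add_increasing2)

lemma rC2_ge1: "real n < \<sigma> \<Longrightarrow> 1 \<le> rC2 n \<sigma>" unfolding rC2_def by (rule order_trans[OF _ mult_mono[of 1 _ 1]]) (auto dest: rC1_ge1)

lemma rL_gt1: "real n < \<sigma> \<Longrightarrow> 1 < rL n \<sigma>"
proof -
  assume a: "real n < \<sigma>"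
  have "1 < 1 * (1 + 2 * 3^n * (3 powr \<sigma> * 2^n))" by simp
  also have "... \<le> rL n \<sigma>" unfolding rL_def using rC1_ge1[OF a] by (intro mult_right_mono) auto
  finally show ?thesis .
qed

section \<open>Geometric decay of the maximal function of tail averages\<close>

locale grid_weight = grid a s + Cq_weight w \<sigma> W for a :: "real^'n" and s and w :: "real^'n \<Rightarrow> ennreal" and \<sigma> W
begin

abbreviation kp :: "'n cube \<Rightarrow> real^'n \<Rightarrow> real" where "kp Q \<equiv> kap \<sigma> (ctr Q) (rad Q)"

abbreviation kq :: "'n cube \<Rightarrow> ennreal" where "kq Q \<equiv> kint \<sigma> w (ctr Q) (rad Q)"

definition al :: "'n cube \<Rightarrow> ennreal" where
  "al Q = kq Q / ennreal (cv Q)"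

definition subcells :: "'n cube set" where "subcells = {Q. cell Q \<subseteq> cell root}"

text \<open>Superlevel sets of this dyadic maximal function of \<open>al\<close> shrink geometrically in measure, which
  replaces the reverse Hoelder inequality.\<close>

definition Ma :: "real^'n \<Rightarrow> ennreal" where
  "Ma x = (SUP Q\<in>subcells. al Q * indicator (cell Q) x)"

definition Fl :: "real \<Rightarrow> 'n cube set" where "Fl l = {Q\<in>subcells. ennreal l < al Q}"

definition Om :: "real \<Rightarrow> (real^'n) set" where "Om l = (\<Union>Q\<in>Fl l. cell Q)"

definition Phi :: "real \<Rightarrow> ennreal" where "Phi l = (\<integral>x\<in>Om l. Ma x)"

lemma vol_pos: "0 < cv Q" by simp

lemma al_le_iff: "al Q \<le> l \<longleftrightarrow> kq Q \<le> l * ennreal (cv Q)" unfolding al_def by (rule ennreal_div_le_iff[OF vol_pos])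

lemma kint_al: "kq Q = al Q * ennreal (cv Q)" unfolding al_def by (rule ennreal_div_mult_cancel[OF vol_pos, symmetric])

lemma Ma_measurable [measurable]: "Ma \<in> lmeas" unfolding Ma_def by (intro borel_measurable_SUP) auto

lemma Om_iff: "x \<in> Om l \<longleftrightarrow> ennreal l < Ma x"
  unfolding Om_def Ma_def Fl_def by (auto simp: less_SUP_iff indicator_def split: if_splits intro!: bexI)

lemma Om_sets [measurable, simp]: "Om l \<in> sets lebesgue" unfolding Om_def by simp

lemma Om_antimono: "l \<le> l' \<Longrightarrow> Om l' \<subseteq> Om l" unfolding subset_iff Om_iff by (meson ennreal_leI order_le_less_trans)

lemma Om_maxc: "Om l = (\<Union>Q\<in>maxc (Fl l). cell Q)" unfolding Om_def by (rule maxc_Union[symmetric])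

lemma parent_subcells: "Q \<in> subcells \<Longrightarrow> parent Q \<in> subcells"
proof (cases "0 < fst Q")
  case True
  assume "Q \<in> subcells"
  hence "ctr Q \<in> cell root" "ctr Q \<in> cell (parent Q)" using ctr_in_cell[of Q] parent_cell[OF True] by (auto simp: subcells_def)
  hence "cell (parent Q) \<subseteq> cell root" by (rule cell_nested) simp
  thus ?thesis by (simp add: subcells_def)
next
  case False
  assume "Q \<in> subcells"
  hence "Q = root" using False cell_eq[of "ctr Q" Q root] ctr_in_cell[of Q] by (auto simp: subcells_def)
  thus ?thesis by (simp add: subcells_def parent_def)
qed

lemma subcells_gen0: "Q \<in> subcells \<Longrightarrow> fst Q = 0 \<Longrightarrow> Q = root"
  using cell_eq[of "ctr Q" Q root] ctr_in_cell[of Q] by (auto simp: subcells_def)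

text \<open>The parent misses the threshold l, its tail dominates that of Q and its volume is 2^n
  times larger. The bound on \<open>al root\<close> excludes the root, the one subcell without a
  proper parent.\<close>

lemma al_maxc:
  assumes Q: "Q \<in> maxc (Fl l)" and l: "al root \<le> ennreal l" "0 \<le> l"
  shows "al Q \<le> ennreal (2^CARD('n) * l)"
proof -
  have QF: "Q \<in> subcells" "ennreal l < al Q" using Q maxc_subset by (auto simp: Fl_def)
  have "Q \<noteq> root" using QF(2) l(1) by auto
  hence f: "0 < fst Q" using subcells_gen0[OF QF(1)] by auto
  have "parent Q \<notin> Fl l" using Q f by (rule maxc_parent)
  hence "al (parent Q) \<le> ennreal l" using parent_subcells[OF QF(1)] by (auto simp: Fl_def not_less)
  hence "kq (parent Q) \<le> ennreal l * ennreal ((2 * (2 * rad Q))^CARD('n))" by (simp only: al_le_iff rad_parent[OF f])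
  moreover have "kq Q \<le> kq (parent Q)" using cell_subset_ctr_rad[OF parent_cell[OF f]] \<sigma>_pos by (intro kint_mono) auto
  moreover have "ennreal ((2 * (2 * rad Q))^CARD('n)) = ennreal (2^CARD('n)) * ennreal (cv Q)" by (simp add: ennreal_mult[symmetric] power_mult_distrib[symmetric])
  moreover have "ennreal l * ennreal (2^CARD('n)) = ennreal (2^CARD('n) * l)" using l(2) by (simp add: ennreal_mult mult.commute)
  ultimately show ?thesis unfolding al_le_iff by (simp add: mult.assoc[symmetric])
qed

abbreviation trip :: "'n cube \<Rightarrow> (real^'n) set" where "trip Q \<equiv> qb (ctr Q) (3 * rad Q)"

text \<open>The tail of R is cut at the triple of Q. Inside, averaging gives the maximal function of
  the weight restricted to the triple; outside, \<open>kap_far\<close> and \<sigma> > n bound the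
  profile of R by the volume ratio times that of Q.\<close>

lemma al_subcell:
  assumes R: "cell R \<subseteq> cell Q" and x: "x \<in> cell R"
  shows "al R \<le> ennreal (kC CARD('n) (\<sigma> - CARD('n))) * MM (\<lambda>y. w y * indicator (trip Q) y) x + ennreal ((3/2) powr \<sigma>) * al Q"
proof -
  let ?h = "\<lambda>y. w y * indicator (trip Q) y"
  define t where "t = rad R / rad Q"
  have sub: "infnorm (ctr R - ctr Q) + rad R \<le> rad Q" by (rule cell_subset_ctr_rad[OF R])
  hence t: "0 < t" "t \<le> 1" using infnorm_pos_le[of "ctr R - ctr Q"] rad_pos[of R] rad_pos[of Q] unfolding t_def by (auto simp: divide_le_eq_1)
  have "kq R \<le> (\<integral>y. ?h y * ennreal (kp R y)
      + ennreal ((3/2) powr \<sigma> * t^CARD('n)) * (w y * ennreal (kp Q y)))" unfolding kint_def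
  proof (rule nn_integral_mono)
    fix y
    show "w y * ennreal (kp R y) \<le> ?h y * ennreal (kp R y)
      + ennreal ((3/2) powr \<sigma> * t^CARD('n)) * (w y * ennreal (kp Q y))"
    proof (cases "y \<in> trip Q")
      case False
      have "kp R y \<le> (3/2) powr \<sigma> * t powr \<sigma> * kp Q y" unfolding t_def using False \<sigma>_pos by (intro kap_far sub) auto
      also have "... \<le> (3/2) powr \<sigma> * t^CARD('n) * kp Q y"
      proof (intro mult_right_mono mult_left_mono)
        have "t powr \<sigma> \<le> t powr real CARD('n)" using t \<sigma>_gt by (intro powr_mono') auto
        thus "t powr \<sigma> \<le> t^CARD('n)" using t by (simp add: powr_realpow)
      qed auto
      finally have "w y * ennreal (kp R y) \<le> w y * ennreal ((3/2) powr \<sigma> * t^CARD('n) * kp Q y)" by (intro mult_left_mono ennreal_leI) auto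
      also have "... = ennreal ((3/2) powr \<sigma> * t^CARD('n)) * (w y * ennreal (kp Q y))" using t by (simp add: ennreal_mult mult_ac)
      finally show ?thesis using False by simp
    qed auto
  qed
  also have "... = (\<integral>y. ?h y * ennreal (kp R y))
      + ennreal ((3/2) powr \<sigma> * t^CARD('n)) * kq Q" unfolding kint_def by (subst nn_integral_add, simp, simp, subst nn_integral_cmult) auto
  also have "... \<le> ennreal (kC CARD('n) (\<sigma> - CARD('n)) * rad R^CARD('n)) * MM ?h x + ennreal ((3/2) powr \<sigma> * t^CARD('n)) * kq Q"
    using subsetD[OF cell_subset_qb x] \<sigma>_gt by (intro add_mono kap_average) auto
  also have "... \<le> (ennreal (kC CARD('n) (\<sigma> - CARD('n))) * MM ?h x + ennreal ((3/2) powr \<sigma>) * al Q) * ennreal (cv R)"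
  proof -
    have k: "0 \<le> kC CARD('n) (\<sigma> - CARD('n))" using kC_ge1[of "\<sigma> - CARD('n)" "CARD('n)"] \<sigma>_gt by simp
    have "ennreal (kC CARD('n) (\<sigma> - CARD('n)) * rad R^CARD('n)) * MM ?h x \<le> ennreal (kC CARD('n) (\<sigma> - CARD('n)) * cv R) * MM ?h x"
      using k by (intro mult_right_mono ennreal_leI mult_left_mono power_mono) auto
    also have "... = ennreal (kC CARD('n) (\<sigma> - CARD('n))) * MM ?h x * ennreal (cv R)" using k by (simp add: ennreal_mult mult_ac)
    finally have 1: "ennreal (kC CARD('n) (\<sigma> - CARD('n)) * rad R^CARD('n)) * MM ?h x \<le> ennreal (kC CARD('n) (\<sigma> - CARD('n))) * MM ?h x * ennreal (cv R)" .
    have "t * (2 * rad Q) = 2 * rad R" by (simp add: t_def)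
    hence "t^CARD('n) * cv Q = cv R" by (simp only: power_mult_distrib[symmetric])
    hence vR: "ennreal (t^CARD('n)) * ennreal (cv Q) = ennreal (cv R)" using t by (simp add: ennreal_mult[symmetric])
    hence 2: "ennreal ((3/2) powr \<sigma> * t^CARD('n)) * kq Q = ennreal ((3/2) powr \<sigma>) * al Q * ennreal (cv R)"
      using t unfolding kint_al vR[symmetric] by (simp add: ennreal_mult mult_ac)
    show ?thesis using 1 unfolding 2 distrib_right by (intro add_right_mono)
  qed
  finally show ?thesis unfolding al_le_iff .
qed

text \<open>Cells through x lie inside Q, where \<open>al_subcell\<close> applies, or strictly
  contain it, and then the maximality of Q keeps them at or below l.\<close>

lemma Ma_maxc:
  assumes Q: "Q \<in> maxc (Fl l)" and l: "al root \<le> ennreal l" "0 \<le> l" and x: "x \<in> cell Q"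
  shows "Ma x \<le> ennreal (rC1 CARD('n) \<sigma>) * (MM (\<lambda>y. w y * indicator (trip Q) y) x + ennreal l)"
  unfolding Ma_def
proof (rule SUP_least)
  fix R assume R: "R \<in> subcells"
  let ?m = "MM (\<lambda>y. w y * indicator (trip Q) y) x"
  have k: "1 \<le> kC CARD('n) (\<sigma> - CARD('n))" using kC_ge1[of "\<sigma> - CARD('n)" "CARD('n)"] \<sigma>_gt by simp
  have c: "kC CARD('n) (\<sigma> - CARD('n)) \<le> rC1 CARD('n) \<sigma>" "(3/2) powr \<sigma> * 2^CARD('n) \<le> rC1 CARD('n) \<sigma>" "1 \<le> rC1 CARD('n) \<sigma>"
    using k rC1_ge1[OF \<sigma>_gt] by (auto simp: rC1_def)
  have "al R \<le> ennreal (rC1 CARD('n) \<sigma>) * (?m + ennreal l)" if xR: "x \<in> cell R"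
  proof (cases "cell R \<subseteq> cell Q")
    case True
    have "ennreal ((3/2) powr \<sigma>) * al Q \<le> ennreal ((3/2) powr \<sigma>) * ennreal (2^CARD('n) * l)" by (intro mult_left_mono al_maxc[OF Q l]) auto
    also have "... = ennreal ((3/2) powr \<sigma> * 2^CARD('n)) * ennreal l" using l by (simp add: ennreal_mult mult_ac)
    also have "... \<le> ennreal (rC1 CARD('n) \<sigma>) * ennreal l" using c by (intro mult_right_mono ennreal_leI) auto
    finally have "al R \<le> ennreal (rC1 CARD('n) \<sigma>) * ?m + ennreal (rC1 CARD('n) \<sigma>) * ennreal l"
      using al_subcell[OF True xR] c(1) by (meson add_mono ennreal_leI mult_right_mono order_trans zero_le)
    thus ?thesis by (simp add: distrib_left)
  next
    case False
    hence "cell Q \<subseteq> cell R" using cell_disjoint_or_nested[of Q R] x xR by auto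
    hence "R \<notin> Fl l" using Q False unfolding maxc_def by auto
    hence "al R \<le> ennreal l" using R by (auto simp: Fl_def not_less)
    also have "... = 1 * ennreal l" by simp
    also have "... \<le> ennreal (rC1 CARD('n) \<sigma>) * (?m + ennreal l)"
      using c(3) by (intro mult_mono) (auto simp: ennreal_1[symmetric] intro!: ennreal_leI simp del: ennreal_1)
    finally show ?thesis .
  qed
  thus "al R * indicator (cell R) x \<le> ennreal (rC1 CARD('n) \<sigma>) * (?m + ennreal l)" by (auto simp: indicator_def)
qed

lemma kint_trip_maxc:
  assumes Q: "Q \<in> maxc (Fl l)" and l: "al root \<le> ennreal l" "0 \<le> l"
  shows "kint \<sigma> w (ctr Q) (3 * rad Q) \<le> ennreal (3 powr \<sigma> * 2^CARD('n) * l) * ennreal (cv Q)"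
proof -
  have "kint \<sigma> w (ctr Q) (3 * rad Q) \<le> ennreal (3 powr \<sigma>) * kq Q" by (rule kint_triple) simp
  also have "... \<le> ennreal (3 powr \<sigma>) * (ennreal (2^CARD('n) * l) * ennreal (cv Q))"
    unfolding kint_al by (intro mult_left_mono mult_right_mono al_maxc[OF Q l]) auto
  also have "... = ennreal (3 powr \<sigma> * 2^CARD('n) * l) * ennreal (cv Q)" using l by (simp add: ennreal_mult mult_ac)
  finally show ?thesis .
qed

text \<open>The \<open>C_q\<close> hypothesis enters the decay argument only here, through
  \<open>key\<close> on the triple of Q; the rest is geometry of cells. This is the origin of the
  factor W.\<close>

lemma Ma_integral_maxc:
  assumes Q: "Q \<in> maxc (Fl l)" and l: "al root \<le> ennreal l" "0 \<le> l"
  shows "(\<integral>x\<in>cell Q. Ma x) \<le> ennreal (rC2 CARD('n) \<sigma> * W * l) * ennreal (cv Q)"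
proof -
  let ?m = "MM (\<lambda>y. w y * indicator (trip Q) y)"
  have c: "1 \<le> rC1 CARD('n) \<sigma>" using rC1_ge1[OF \<sigma>_gt] .
  have "(\<integral>x\<in>cell Q. Ma x) \<le> (\<integral>x. ennreal (rC1 CARD('n) \<sigma>) * (?m x * indicator (trip Q) x + ennreal l * indicator (cell Q) x))"
  proof (rule nn_integral_mono, goal_cases)
    case (1 x)
    have "cell Q \<subseteq> trip Q" using cell_subset_qb[of Q] qb_mono_radius[of "rad Q" "3 * rad Q" "ctr Q"] by auto
    thus ?case using Ma_maxc[OF Q l, of x] by (auto simp: indicator_def)
  qed
  also have "... = ennreal (rC1 CARD('n) \<sigma>) * ((\<integral>x\<in>trip Q. ?m x) + ennreal l * ennreal (cv Q))"
    by (subst nn_integral_cmult, simp, subst nn_integral_add, simp, simp, simp add: nn_integral_cmult_indicator emeasure_cell)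
  also have "... \<le> ennreal (rC1 CARD('n) \<sigma>) * (ennreal W * (ennreal (3 powr \<sigma> * 2^CARD('n) * l) * ennreal (cv Q)) + ennreal l * ennreal (cv Q))"
  proof (intro mult_left_mono add_right_mono)
    have "(\<integral>x\<in>trip Q. ?m x) \<le> ennreal W * kint \<sigma> w (ctr Q) (3 * rad Q)" by (rule key) simp
    also have "... \<le> ennreal W * (ennreal (3 powr \<sigma> * 2^CARD('n) * l) * ennreal (cv Q))" by (intro mult_left_mono kint_trip_maxc[OF Q l]) auto
    finally show "(\<integral>x\<in>trip Q. ?m x) \<le> ennreal W * (ennreal (3 powr \<sigma> * 2^CARD('n) * l) * ennreal (cv Q))" .
  qed auto
  also have "... = ennreal (rC1 CARD('n) \<sigma> * (W * (3 powr \<sigma> * 2^CARD('n) * l) + l)) * ennreal (cv Q)"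
    using c W_ge1 l by (simp add: ennreal_mult mult_ac distrib_left)
  also have "... \<le> ennreal (rC2 CARD('n) \<sigma> * W * l) * ennreal (cv Q)"
  proof (intro mult_right_mono ennreal_leI)
    have "l \<le> W * l" using W_ge1 l by (simp add: mult_le_cancel_right1)
    hence "W * (3 powr \<sigma> * 2^CARD('n) * l) + l \<le> (3 powr \<sigma> * 2^CARD('n) + 1) * W * l" by (simp add: algebra_simps)
    thus "rC1 CARD('n) \<sigma> * (W * (3 powr \<sigma> * 2^CARD('n) * l) + l) \<le> rC2 CARD('n) \<sigma> * W * l" unfolding rC2_def using c by (simp add: mult.assoc)
  qed auto
  finally show ?thesis .
qed

lemma emeasure_Om: "vol (Om l) = (\<Sum>\<^sup>+Q\<in>maxc (Fl l). ennreal (cv Q))" unfolding Om_maxc by (rule emeasure_cells[OF maxc_disjoint])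

lemma Phi_le:
  assumes l: "al root \<le> ennreal l" "0 \<le> l"
  shows "Phi l \<le> ennreal (rC2 CARD('n) \<sigma> * W * l) * vol (Om l)"
proof -
  have "Phi l = (\<Sum>\<^sup>+Q\<in>maxc (Fl l). (\<integral>x\<in>cell Q. Ma x))" unfolding Phi_def Om_maxc by (intro nn_integral_cells maxc_disjoint) measurable
  also have "... \<le> (\<Sum>\<^sup>+Q\<in>maxc (Fl l). ennreal (rC2 CARD('n) \<sigma> * W * l) * ennreal (cv Q))" by (intro nn_integral_mono Ma_integral_maxc l) auto
  also have "... = ennreal (rC2 CARD('n) \<sigma> * W * l) * vol (Om l)" unfolding emeasure_Om by (rule nn_integral_cmult) auto
  finally show ?thesis .
qed

lemma Om_subset_root: "Om l \<subseteq> cell root" by (auto simp: Om_def Fl_def subcells_def)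

lemma emeasure_Om_finite: "vol (Om l) < \<infinity>" using emeasure_mono[OF Om_subset_root[of l] cell_sets] emeasure_cell[of root] by (simp add: order_le_less_trans)

text \<open>Inside a maximal cell of level l, a point of the next level has local maximal function
  above D l, and the weak type bound makes such points rare.\<close>

lemma Om_half:
  assumes l: "al root \<le> ennreal l" "0 < l"
  shows "2 * vol (Om (rL CARD('n) \<sigma> * l)) \<le> vol (Om l)"
proof -
  \<comment> \<open>Twice the product of the weak type constant and the tail constant of
    \<open>kint_trip_maxc\<close>, so that at most half of the cell is exceptional;
    \<open>rL\<close> equals \<open>rC1 * (1 + D)\<close>.\<close>
  define D where "D = 2 * 3^CARD('n) * (3 powr \<sigma> * 2^CARD('n))"
  have D: "0 < D" by (simp add: D_def)
  have c: "1 \<le> rC1 CARD('n) \<sigma>" using rC1_ge1[OF \<sigma>_gt] .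
  have each: "2 * vol (Om (rL CARD('n) \<sigma> * l) \<inter> cell Q) \<le> ennreal (cv Q)" if Q: "Q \<in> maxc (Fl l)" for Q
  proof -
    let ?h = "\<lambda>y. w y * indicator (trip Q) y"
    have "Om (rL CARD('n) \<sigma> * l) \<inter> cell Q \<subseteq> {x. ennreal (D * l) < MM ?h x}"
    proof safe
      fix x assume x: "x \<in> Om (rL CARD('n) \<sigma> * l)" "x \<in> cell Q"
      have "ennreal (rC1 CARD('n) \<sigma>) * ennreal ((1 + D) * l) = ennreal (rL CARD('n) \<sigma> * l)"
        using c D l by (simp add: rL_def D_def ennreal_mult[symmetric] mult_ac)
      also have "... < ennreal (rC1 CARD('n) \<sigma>) * (MM ?h x + ennreal l)"
        using x(1) Ma_maxc[OF Q l(1) less_imp_le[OF l(2)] x(2)] unfolding Om_iff by (rule less_le_trans)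
      finally have "ennreal ((1 + D) * l) < MM ?h x + ennreal l" by (metis mult_left_mono not_less zero_le)
      hence "ennreal (D * l) + ennreal l < MM ?h x + ennreal l" using D l by (simp add: distrib_right ennreal_plus[symmetric] add.commute del: ennreal_plus)
      thus "ennreal (D * l) < MM ?h x" by (metis add_right_mono not_less)
    qed
    hence "ennreal (D * l) * vol (Om (rL CARD('n) \<sigma> * l) \<inter> cell Q) \<le> ennreal (D * l) * vol {x. ennreal (D * l) < MM ?h x}"
      by (intro mult_left_mono emeasure_mono) (auto simp: open_MM)
    also have "... \<le> 3^CARD('n) * (\<integral>y. ?h y)" by (rule MM_weak_type) measurable
    also have "... \<le> 3^CARD('n) * (ennreal (3 powr \<sigma> * 2^CARD('n) * l) * ennreal (cv Q))"
      using kint_ge[of "3 * rad Q" w "ctr Q" \<sigma>] kint_trip_maxc[OF Q l(1) less_imp_le[OF l(2)]] by (intro mult_left_mono) (auto intro: order_trans)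
    finally have *: "ennreal (D * l) * vol (Om (rL CARD('n) \<sigma> * l) \<inter> cell Q) \<le> 3^CARD('n) * (ennreal (3 powr \<sigma> * 2^CARD('n) * l) * ennreal (cv Q))" .
    have fin: "vol (Om (rL CARD('n) \<sigma> * l) \<inter> cell Q) \<noteq> \<infinity>"
      using emeasure_mono[of "Om (rL CARD('n) \<sigma> * l) \<inter> cell Q" "cell Q" lebesgue] emeasure_cell[of Q] by (auto simp: top_unique)
    then obtain v where v: "vol (Om (rL CARD('n) \<sigma> * l) \<inter> cell Q) = ennreal v" "0 \<le> v" by (metis ennreal_cases infinity_ennreal_def)
    have "3^CARD('n) = ennreal (3^CARD('n))" by (simp add: ennreal_power[symmetric])
    hence "ennreal (D * l * v) \<le> ennreal (3^CARD('n) * (3 powr \<sigma> * 2^CARD('n) * l * cv Q))" using * v D l by (simp add: ennreal_mult[symmetric])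
    hence "D * l * v \<le> 3^CARD('n) * (3 powr \<sigma> * 2^CARD('n) * l * cv Q)" using l by (subst (asm) ennreal_le_iff) auto
    hence "D * l * (2 * v) \<le> D * l * cv Q" by (simp add: D_def mult_ac)
    hence "2 * v \<le> cv Q" using D l by simp
    thus ?thesis unfolding v(1) using v(2) by (simp add: ennreal_mult[symmetric] ennreal_numeral[symmetric] ennreal_leI del: ennreal_numeral)
  qed
  have "1 * l \<le> rL CARD('n) \<sigma> * l" using rL_gt1[OF \<sigma>_gt] l by (intro mult_right_mono) auto
  hence sub: "Om (rL CARD('n) \<sigma> * l) \<subseteq> Om l" using Om_antimono by simp
  have dis: "disjoint_family_on (\<lambda>Q. Om (rL CARD('n) \<sigma> * l) \<inter> cell Q) (maxc (Fl l))" using maxc_disjoint unfolding disjoint_family_on_def by blast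
  have "Om (rL CARD('n) \<sigma> * l) = (\<Union>Q\<in>maxc (Fl l). Om (rL CARD('n) \<sigma> * l) \<inter> cell Q)" using sub Om_maxc[of l] by blast
  hence "vol (Om (rL CARD('n) \<sigma> * l)) = (\<Sum>\<^sup>+Q\<in>maxc (Fl l). vol (Om (rL CARD('n) \<sigma> * l) \<inter> cell Q))"
    using emeasure_UN_countable[OF _ _ dis, of lebesgue] by simp
  hence "2 * vol (Om (rL CARD('n) \<sigma> * l)) = (\<Sum>\<^sup>+Q\<in>maxc (Fl l). 2 * vol (Om (rL CARD('n) \<sigma> * l) \<inter> cell Q))"
    by (simp add: nn_integral_cmult)
  also have "... \<le> vol (Om l)" unfolding emeasure_Om by (intro nn_integral_mono each) auto
  finally show ?thesis .
qed

lemma Phi_finite: assumes "al root \<le> ennreal l" "0 \<le> l" shows "Phi l < \<infinity>"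
  using Phi_le[OF assms] emeasure_Om_finite[of l] by (simp add: ennreal_mult_less_top order_le_less_trans)

text \<open>By \<open>Om_half\<close> the layer between the two levels has at least half of the
  measure of \<open>Om l\<close>, and \<open>Ma\<close> exceeds l on it; by \<open>Phi_le\<close>
  the whole integral is at most \<open>rC2 W l\<close> times that measure. So the layer carries at
  least the fraction 1 / (2 rC2 W) of \<open>Phi l\<close>, which is lost in passing to the next
  level.\<close>

lemma Phi_decay:
  assumes l: "al root \<le> ennreal l" "0 < l"
  shows "Phi (rL CARD('n) \<sigma> * l) \<le> ennreal (1 - 1 / (2 * rC2 CARD('n) \<sigma> * W)) * Phi l"
proof -
  define \<Lambda> where "\<Lambda> = rL CARD('n) \<sigma>"
  define C where "C = rC2 CARD('n) \<sigma> * W"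
  have C: "1 \<le> C" unfolding C_def by (rule order_trans[OF _ mult_mono[of 1 _ 1]]) (use rC2_ge1[OF \<sigma>_gt] W_ge1 in auto)
  have \<Lambda>: "1 < \<Lambda>" using rL_gt1[OF \<sigma>_gt] by (simp add: \<Lambda>_def)
  have ll: "l \<le> \<Lambda> * l" using \<Lambda> l by simp
  have sub: "Om (\<Lambda> * l) \<subseteq> Om l" using Om_antimono[OF ll] .
  have al2: "al root \<le> ennreal (\<Lambda> * l)" using l(1) ennreal_leI[OF ll] by (rule order_trans)
  have "Phi l = (\<integral>x. Ma x * indicator (Om (\<Lambda> * l)) x + Ma x * indicator (Om l - Om (\<Lambda> * l)) x)"
    unfolding Phi_def using sub by (intro nn_integral_cong) (auto simp: indicator_def)
  also have "... = Phi (\<Lambda> * l) + (\<integral>x\<in>Om l - Om (\<Lambda> * l). Ma x)" unfolding Phi_def by (rule nn_integral_add) measurable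
  finally have split: "Phi l = Phi (\<Lambda> * l) + (\<integral>x\<in>Om l - Om (\<Lambda> * l). Ma x)" .
  have "ennreal l * vol (Om l - Om (\<Lambda> * l)) = (\<integral>x. ennreal l * indicator (Om l - Om (\<Lambda> * l)) x)" by (simp add: nn_integral_cmult_indicator)
  also have "... \<le> (\<integral>x\<in>Om l - Om (\<Lambda> * l). Ma x)" by (intro nn_integral_mono) (auto simp: indicator_def Om_iff less_imp_le)
  finally have ge: "ennreal l * vol (Om l - Om (\<Lambda> * l)) \<le> (\<integral>x\<in>Om l - Om (\<Lambda> * l). Ma x)" .
  obtain p where p: "Phi l = ennreal p" "0 \<le> p" using Phi_finite[OF l(1)] l(2) by (metis ennreal_cases infinity_ennreal_def less_imp_le order_less_irrefl)
  obtain p' where p': "Phi (\<Lambda> * l) = ennreal p'" "0 \<le> p'"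
    using Phi_finite[OF al2] ll l(2) by (metis ennreal_cases infinity_ennreal_def less_imp_le order_less_irrefl order_trans)
  obtain u where u: "vol (Om l) = ennreal u" "0 \<le> u" using emeasure_Om_finite[of l] by (metis ennreal_cases infinity_ennreal_def order_less_irrefl)
  obtain u' where u': "vol (Om (\<Lambda> * l)) = ennreal u'" "0 \<le> u'"
    using emeasure_Om_finite[of "\<Lambda> * l"] by (metis ennreal_cases infinity_ennreal_def order_less_irrefl)
  have half: "2 * u' \<le> u" using Om_half[OF l] u u' by (simp add: \<Lambda>_def[symmetric] ennreal_mult[symmetric] ennreal_numeral[symmetric] del: ennreal_numeral)
  have "vol (Om l - Om (\<Lambda> * l)) = ennreal (u - u')" using sub u u' by (subst emeasure_Diff) (auto simp: ennreal_minus)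
  hence "ennreal p' + ennreal (l * (u - u')) \<le> ennreal p" using split ge p(1) p'(1) l(2) half u'(2) by (simp add: ennreal_mult add_left_mono)
  hence 1: "p' + l * (u - u') \<le> p" using p p' l half u' by (simp add: ennreal_plus[symmetric] del: ennreal_plus)
  have "0 \<le> C * l" using C l by simp
  hence "ennreal p \<le> ennreal (C * l * u)" using Phi_le[OF l(1)] l(2) u p by (simp add: C_def ennreal_mult[symmetric])
  hence 2: "p \<le> C * l * u" using C l u by simp
  have "l * (u / 2) \<le> l * (u - u')" using half l by (intro mult_left_mono) auto
  moreover have "p / (2 * C) \<le> l * (u / 2)" using 2 C by (simp add: field_simps)
  ultimately have "p / (2 * C) \<le> l * (u - u')" by linarith
  hence "p' \<le> (1 - 1 / (2 * C)) * p" using 1 by (simp add: algebra_simps)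
  moreover have "0 \<le> 1 - 1 / (2 * C)" using C by (simp add: field_simps)
  ultimately have "ennreal p' \<le> ennreal (1 - 1 / (2 * C)) * ennreal p" using p by (simp add: ennreal_mult[symmetric] ennreal_leI)
  thus ?thesis unfolding p(1)[symmetric] p'(1)[symmetric] \<Lambda>_def C_def by (simp add: mult.assoc)
qed

lemma Phi_iter:
  assumes l: "al root \<le> ennreal l" "0 < l"
  shows "Phi (rL CARD('n) \<sigma> ^ m * l) \<le> ennreal ((1 - 1 / (2 * rC2 CARD('n) \<sigma> * W))^m) * Phi l"
proof (induction m)
  case (Suc m)
  define \<Lambda> where "\<Lambda> = rL CARD('n) \<sigma>"
  define q where "q = 1 - 1 / (2 * rC2 CARD('n) \<sigma> * W)"
  have \<Lambda>: "1 < \<Lambda>" using rL_gt1[OF \<sigma>_gt] by (simp add: \<Lambda>_def)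
  have "1 * 1 \<le> rC2 CARD('n) \<sigma> * W" by (intro mult_mono) (use rC2_ge1[OF \<sigma>_gt] W_ge1 in auto)
  hence q: "0 \<le> q" by (simp add: q_def field_simps)
  have "1 * l \<le> \<Lambda>^m * l" using \<Lambda> l by (intro mult_right_mono one_le_power) auto
  hence al2: "al root \<le> ennreal (\<Lambda>^m * l)" "0 < \<Lambda>^m * l" using l order_trans[OF l(1) ennreal_leI] by auto
  have "Phi (\<Lambda>^Suc m * l) \<le> ennreal q * Phi (\<Lambda>^m * l)" using Phi_decay[OF al2] by (simp add: \<Lambda>_def q_def mult.assoc)
  also have "... \<le> ennreal q * (ennreal (q^m) * Phi l)" using Suc by (intro mult_left_mono) (auto simp: \<Lambda>_def q_def)
  also have "... = ennreal (q^Suc m) * Phi l" using q by (simp add: ennreal_mult mult.assoc)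
  finally show ?case by (simp add: \<Lambda>_def q_def)
qed auto

text \<open>The weight is never compared with \<open>Ma\<close> pointwise. An open set is tiled by
  maximal cells inside it, and on each of them the mass of w is at most the tail, which is the
  integral of the constant \<open>al Q\<close> and so at most that of \<open>Ma\<close>.\<close>

lemma weight_open_le:
  assumes U: "open U" and l: "0 \<le> l"
  shows "(\<integral>x\<in>U \<inter> cell root. w x) \<le> ennreal l * vol U + Phi l"
proof -
  have [measurable]: "U \<in> sets lebesgue" using U by simp
  define F where "F = {Q\<in>subcells. cell Q \<subseteq> U}"
  have "U \<inter> cell root \<subseteq> (\<Union>Q\<in>F. cell Q)"
  proof safe
    fix x assume x: "x \<in> U" "x \<in> cell root"
    then obtain k where "cell (at_gen k x) \<subseteq> U" using small_cell[OF U x(1)] by blast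
    moreover have "cell (at_gen k x) \<subseteq> cell root" using cell_at_gen_mono[of 0 k x] x(2) by (metis fst_conv le0 mem_cell_iff)
    ultimately have "at_gen k x \<in> F" by (simp add: F_def subcells_def)
    thus "x \<in> (\<Union>Q\<in>F. cell Q)" by (meson UN_I mem_at_gen)
  qed
  hence UF: "U \<inter> cell root = (\<Union>Q\<in>maxc F. cell Q)" unfolding maxc_Union by (auto simp: F_def subcells_def)
  have "(\<integral>x\<in>U \<inter> cell root. w x) = (\<Sum>\<^sup>+Q\<in>maxc F. (\<integral>x\<in>cell Q. w x))"
    unfolding UF by (intro nn_integral_cells maxc_disjoint) measurable
  also have "... \<le> (\<Sum>\<^sup>+Q\<in>maxc F. (\<integral>x\<in>cell Q. Ma x))"
  proof (rule nn_integral_mono)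
    fix Q assume "Q \<in> space (count_space (maxc F))"
    hence Q: "Q \<in> subcells" using maxc_subset[of F] by (auto simp: F_def)
    have "(\<integral>x\<in>cell Q. w x) \<le> (\<integral>x\<in>qb (ctr Q) (rad Q). w x)" by (intro nn_integral_mono_set cell_subset_qb)
    also have "... \<le> kq Q" by (rule kint_ge) simp
    also have "... = (\<integral>x\<in>cell Q. al Q)" by (simp add: kint_al nn_integral_cmult_indicator emeasure_cell)
    also have "... \<le> (\<integral>x\<in>cell Q. Ma x)"
    proof (rule nn_integral_mono, goal_cases)
      case (1 x)
      have "al Q * indicator (cell Q) x \<le> Ma x" unfolding Ma_def by (rule SUP_upper[OF Q])
      thus ?case by (auto simp: indicator_def)
    qed
    finally show "(\<integral>x\<in>cell Q. w x) \<le> (\<integral>x\<in>cell Q. Ma x)" .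
  qed
  also have "... = (\<integral>x\<in>U \<inter> cell root. Ma x)" unfolding UF by (intro nn_integral_cells[symmetric] maxc_disjoint) measurable
  also have "... \<le> (\<integral>x. ennreal l * indicator U x + Ma x * indicator (Om l) x)" by (intro nn_integral_mono) (auto simp: indicator_def Om_iff not_less)
  also have "... = ennreal l * vol U + Phi l" using U unfolding Phi_def by (subst nn_integral_add) (auto simp: nn_integral_cmult_indicator)
  finally show ?thesis .
qed

lemma weight_le_Phi:
  assumes E: "E \<in> sets lebesgue" "E \<subseteq> cell root" and l: "0 \<le> l"
  shows "(\<integral>x\<in>E. w x) \<le> ennreal l * vol E + Phi l"
proof (rule ennreal_le_epsilon)
  fix e :: real assume e: "0 < e"
  \<comment> \<open>The denominator l + 1 makes the error l e / (l + 1) at most e, including the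
    case l = 0.\<close>
  obtain U where U: "open U" "E \<subseteq> U" "U - E \<in> lmeasurable" "vol (U - E) < ennreal (e / (l + 1))"
    using sets_lebesgue_outer_open[OF E(1), of "e / (l + 1)"] e l by auto
  have "(\<integral>x\<in>E. w x) \<le> (\<integral>x\<in>U \<inter> cell root. w x)" using E U by (intro nn_integral_mono_set) auto
  also have "... \<le> ennreal l * vol U + Phi l" by (rule weight_open_le[OF U(1) l])
  also have "... \<le> ennreal l * (vol E + ennreal (e / (l + 1))) + Phi l"
  proof (intro add_right_mono mult_left_mono)
    have "vol U = vol (E \<union> (U - E))" using U(2) by (simp add: Un_absorb1)
    also have "... \<le> vol E + ennreal (e / (l + 1))" using E U by (intro order_trans[OF emeasure_subadditive] add_left_mono) auto
    finally show "vol U \<le> vol E + ennreal (e / (l + 1))" .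
  qed auto
  also have "ennreal l * (vol E + ennreal (e / (l + 1))) + Phi l
     = (ennreal l * vol E + Phi l) + ennreal (l * (e / (l + 1)))" using l e by (simp add: distrib_left ennreal_mult[symmetric] add_ac)
  also have "... \<le> (ennreal l * vol E + Phi l) + ennreal e" using l e by (intro add_left_mono ennreal_leI) (simp add: field_simps)
  finally show "(\<integral>x\<in>E. w x) \<le> ennreal l * vol E + Phi l + ennreal e" .
qed

text \<open>The level starts at the tail average of the root and is raised m times by the ratio
  \<open>rL\<close>: the first term is the level times the measure of E, the second is the decay of
  \<open>Phi\<close>.\<close>

lemma weight_power_le:
  assumes E: "E \<in> sets lebesgue" "E \<subseteq> cell root" and v: "vol E \<le> ennreal (v * cv root)" "0 \<le> v"
  shows "(\<integral>x\<in>E. w x)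
    \<le> ennreal (rL CARD('n) \<sigma> ^ m * v + rC2 CARD('n) \<sigma> * W * (1 - 1 / (2 * rC2 CARD('n) \<sigma> * W))^m) * kq root"
    (is "_ \<le> ennreal (?L * v + ?C * ?q) * ?A")
\<comment> \<open>A vanishing tail forces a vanishing weight; it is separated because the starting
  level must be positive.\<close>
proof (cases "?A = 0")
  case True
  have "(\<integral>x\<in>E. w x) \<le> (\<integral>x\<in>qb (ctr root) (rad root). w x)" using E(2) cell_subset_qb by (intro nn_integral_mono_set) auto
  also have "... \<le> ?A" by (rule kint_ge) simp
  finally show ?thesis using True by simp
next
  case False
  define V where "V = cv root"
  have V: "0 < V" unfolding V_def by (rule vol_pos)
  obtain A where A: "?A = ennreal A" "0 \<le> A" using kint_finite[of "rad root" "ctr root"] by (metis ennreal_cases infinity_ennreal_def order_less_irrefl rad_pos)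
  define l where "l = A / V"
  have "A > 0" using False A by (cases "A = 0") auto
  hence l: "0 < l" "A = l * V" using V by (auto simp: l_def)
  have al: "al root \<le> ennreal l" unfolding al_le_iff A(1) V_def[symmetric] l(2) using l V by (simp add: ennreal_mult)
  have "1 * 1 \<le> ?C" by (intro mult_mono) (use rC2_ge1[OF \<sigma>_gt] W_ge1 in auto)
  hence C: "1 \<le> ?C" by simp
  have q: "0 \<le> ?q" using C by (intro zero_le_power) (simp add: field_simps)
  have L: "0 \<le> ?L" using rL_gt1[OF \<sigma>_gt] by simp
  have "(\<integral>x\<in>E. w x) \<le> ennreal (?L * l) * vol E + Phi (?L * l)" using L l by (intro weight_le_Phi E) auto
  also have "... \<le> ennreal (?L * l) * ennreal (v * V) + ennreal ?q * (ennreal (?C * l) * ennreal V)"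
  proof (intro add_mono mult_left_mono)
    show "vol E \<le> ennreal (v * V)" using v by (simp add: V_def)
    have "Phi l \<le> ennreal (?C * l) * vol (Om l)" using Phi_le[OF al] l by (simp add: mult.assoc)
    also have "... \<le> ennreal (?C * l) * ennreal V"
      using emeasure_mono[OF Om_subset_root[of l] cell_sets] by (intro mult_left_mono) (simp_all add: emeasure_cell V_def)
    finally have P: "Phi l \<le> ennreal (?C * l) * ennreal V" .
    show "Phi (?L * l) \<le> ennreal ?q * (ennreal (?C * l) * ennreal V)" by (rule order_trans[OF Phi_iter[OF al l(1), of m] mult_left_mono[OF P]]) simp
  qed auto
  also have "... = ennreal (?L * v + ?C * ?q) * ?A"
  proof -
    have gen: "ennreal (L' * l) * ennreal (v * V) + ennreal q' * (ennreal (C' * l) * ennreal V)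
        = ennreal (L' * v + C' * q') * ennreal (l * V)" if "0 \<le> L'" "0 \<le> q'" "0 \<le> C'" for L' q' C'
      using that l V v by (simp add: ennreal_mult[symmetric] ennreal_plus[symmetric] algebra_simps del: ennreal_plus)
    have "0 \<le> ?C" using C by simp
    thus ?thesis unfolding A(1) l(2) by (rule gen[OF L q])
  qed
  finally show ?thesis .
qed

end

section \<open>Exponential smallness of the weight of small sets\<close>

definition rmu :: "nat \<Rightarrow> real \<Rightarrow> real" where "rmu n \<sigma> = ln 2 / (2 * ln (rL n \<sigma>))"
definition rA :: "nat \<Rightarrow> real \<Rightarrow> real" where "rA n \<sigma> = 1 + exp 1 * rC2 n \<sigma>"
definition rB :: "nat \<Rightarrow> real \<Rightarrow> real" where "rB n \<sigma> = min (ln 2 / 2) (rmu n \<sigma> / (2 * rC2 n \<sigma>))"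

lemma rmu_pos: "real n < \<sigma> \<Longrightarrow> 0 < rmu n \<sigma>" using rL_gt1[of n \<sigma>] by (simp add: rmu_def)
lemma rA_ge1: "real n < \<sigma> \<Longrightarrow> 1 \<le> rA n \<sigma>" using rC2_ge1[of n \<sigma>] by (simp add: rA_def)
lemma rB_pos: "real n < \<sigma> \<Longrightarrow> 0 < rB n \<sigma>" using rmu_pos[of n \<sigma>] rC2_ge1[of n \<sigma>] by (simp add: rB_def)

text \<open>The free parameter m of \<open>weight_power_le\<close> is balanced against j. The
  exponential rate 1/W and the single factor W in front are what the final constant depends
  on.\<close>

theorem (in Cq_weight) weight_small:
  assumes E: "E \<in> sets lebesgue" "E \<subseteq> qb c r" and r: "0 < r" and B: "1 \<le> B" and j: "0 \<le> j"
    and v: "vol E \<le> ennreal (B * 2 powr - j * (2 * r)^CARD('n))"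
  shows "(\<integral>x\<in>E. w x)
    \<le> ennreal (rA CARD('n) \<sigma> * B * W * exp (- rB CARD('n) \<sigma> * j / W)) * kint \<sigma> w c r"
proof -
  interpret grid_weight "c - (\<chi> i. r)" "2 * r" w \<sigma> W using r by unfold_locales auto
  have root: "ctr root = c" "rad root = r" by (auto simp: ctr_def rad_def vec_eq_iff)
  \<comment> \<open>The half-open root cell misses some faces of the closed cube, a null
    set.\<close>
  define N where "N = qb c r - cell root"
  have sub: "cell root \<subseteq> qb c r" using cell_subset_qb[of root] by (simp add: root)
  have "vol N = 0" unfolding N_def using sub emeasure_cell[of root] emeasure_qb[of r c] r by (subst emeasure_Diff) (auto simp: root)
  hence N: "N \<in> null_sets lebesgue" by (simp add: null_sets_def N_def)
  have ae: "AE x in lebesgue. w x * indicator E x = w x * indicator (E \<inter> cell root) x"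
    by (rule AE_I'[OF N]) (use E(2) in \<open>auto simp: N_def indicator_def split: if_splits\<close>)
  define \<mu> where "\<mu> = rmu CARD('n) \<sigma>"
  \<comment> \<open>Since \<open>rL powr \<mu> = 2 powr (1/2)\<close>, raising the level m times
    costs at most 2^(j/2), half of the exponent available in 2^(-j), while \<open>Phi\<close> decays
    by (1 - \<theta>)^m.\<close>
  define m where "m = nat \<lfloor>j * \<mu>\<rfloor>"
  define C2 where "C2 = rC2 CARD('n) \<sigma>"
  define \<theta> where "\<theta> = 1 / (2 * C2 * W)"
  define L where "L = rL CARD('n) \<sigma>"
  define b where "b = rB CARD('n) \<sigma>"
  have pos: "0 < \<mu>" "1 \<le> C2" "1 < L" "0 < b" "1 \<le> W" using rmu_pos[OF \<sigma>_gt] rC2_ge1[OF \<sigma>_gt] rL_gt1[OF \<sigma>_gt] rB_pos[OF \<sigma>_gt] W_ge1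
    by (auto simp: \<mu>_def C2_def L_def b_def)
  have m: "real m \<le> j * \<mu>" "j * \<mu> - 1 \<le> real m" using pos j by (auto simp: m_def)
  have "1 * 1 \<le> C2 * W" by (intro mult_mono) (use pos in auto)
  hence th: "0 < \<theta>" "\<theta> \<le> 1" by (auto simp: \<theta>_def field_simps)
  have bb: "b \<le> ln 2 / 2" "b \<le> \<mu> / (2 * C2)" by (auto simp: b_def rB_def \<mu>_def C2_def)
  have bjW: "b * j / W \<le> b * j" using divide_left_mono[of 1 W "b * j"] pos j by simp
  have first: "L^m * 2 powr - j \<le> exp (- b * j / W)"
  proof -
    have "L^m = exp (real m * ln L)" using pos by (simp add: exp_of_nat_mult)
    also have "... \<le> exp (j * \<mu> * ln L)" using m(1) pos by (intro exp_mono mult_right_mono) auto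
    also have "j * \<mu> * ln L = j * (ln 2 / 2)" using pos(3) by (simp add: \<mu>_def rmu_def L_def[symmetric])
    finally have "L^m * 2 powr - j \<le> exp (j * (ln 2 / 2)) * exp (- j * ln 2)" unfolding powr_def by (intro mult_mono) auto
    also have "... = exp (- (ln 2 / 2) * j)" by (simp add: exp_add[symmetric])
    also have "... \<le> exp (- b * j / W)"
    proof (rule exp_mono)
      have "b * j / W \<le> ln 2 / 2 * j" using mult_right_mono[OF bb(1) j] bjW by linarith
      thus "- (ln 2 / 2) * j \<le> - b * j / W" by simp
    qed
    finally show ?thesis .
  qed
  have second: "(1 - \<theta>)^m \<le> exp 1 * exp (- b * j / W)"
  proof -
    have "1 - \<theta> \<le> exp (- \<theta>)" using exp_ge_add_one_self[of "- \<theta>"] by simp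
    hence "(1 - \<theta>)^m \<le> exp (- \<theta>)^m" using th by (intro power_mono) auto
    also have "... = exp (- \<theta> * real m)" by (simp add: exp_of_nat_mult[symmetric] mult.commute)
    \<comment> \<open>The summand 1 pays for the integer part in m, which costs at most \<theta>
      \<le> 1.\<close>
    also have "... \<le> exp (1 + - b * j / W)"
    proof (rule exp_mono)
      have "\<theta> * (j * \<mu> - 1) \<le> \<theta> * real m" using th m by (intro mult_left_mono) auto
      moreover have "b * j / W \<le> \<mu> / (2 * C2) * j / W" using bb j pos by (intro divide_right_mono mult_right_mono) auto
      moreover have "\<mu> / (2 * C2) * j / W = \<theta> * (j * \<mu>)" by (simp add: \<theta>_def)
      ultimately show "- \<theta> * real m \<le> 1 + - b * j / W" using th by (simp add: algebra_simps)
    qed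
    finally show ?thesis unfolding exp_add .
  qed
  have "(\<integral>x\<in>E. w x) = (\<integral>x\<in>E \<inter> cell root. w x)" by (rule nn_integral_cong_AE[OF ae])
  also have "... \<le> ennreal (L^m * (B * 2 powr - j) + C2 * W * (1 - \<theta>)^m) * kint \<sigma> w c r"
    using weight_power_le[of "E \<inter> cell root" "B * 2 powr - j" m] E(1) v B
      order_trans[OF emeasure_mono[of "E \<inter> cell root" E lebesgue] v] by (simp add: root \<theta>_def L_def C2_def)
  also have "... \<le> ennreal (rA CARD('n) \<sigma> * B * W * exp (- b * j / W)) * kint \<sigma> w c r"
  proof (intro mult_right_mono ennreal_leI)
    define x where "x = exp (- b * j / W)"
    have x: "0 < x" by (simp add: x_def)
    have "L^m * (B * 2 powr - j) = B * (L^m * 2 powr - j)" by simp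
    also have "... \<le> B * x" using first B by (intro mult_left_mono) (auto simp: x_def)
    also have "... \<le> B * W * x" using B x pos by simp
    finally have 1: "L^m * (B * 2 powr - j) \<le> B * W * x" .
    have "C2 * W * (1 - \<theta>)^m \<le> C2 * W * (exp 1 * x)" using second pos by (intro mult_left_mono) (auto simp: x_def)
    also have "... \<le> C2 * W * (exp 1 * x) * B"  using mult_left_mono[OF B, of "C2 * W * (exp 1 * x)"] pos x by simp
    finally have 2: "C2 * W * (1 - \<theta>)^m \<le> C2 * W * (exp 1 * x) * B" .
    show "L^m * (B * 2 powr - j) + C2 * W * (1 - \<theta>)^m \<le> rA CARD('n) \<sigma> * B * W * exp (- b * j / W)"
      using 1 2 unfolding rA_def C2_def[symmetric] x_def[symmetric] by (simp add: algebra_simps)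
  qed auto
  finally show ?thesis by (simp add: b_def)
qed

section \<open>Sums of tails of disjoint cubes\<close>

lemma borel_measurable_nn_integral_count_space [measurable (raw)]:
  assumes I: "countable I" and f: "\<And>i. i \<in> I \<Longrightarrow> f i \<in> borel_measurable M"
  shows "(\<lambda>x. \<integral>\<^sup>+i. f i x \<partial>count_space I) \<in> borel_measurable M"
proof (cases "finite I")
  case True
  thus ?thesis using f by (simp add: nn_integral_count_space_finite)
next
  case False
  have b: "bij_betw (from_nat_into I) UNIV I" using I False by (rule bij_betw_from_nat_into)
  have eq: "(\<Sum>\<^sup>+i\<in>I. f i x) = (\<Sum>j. f (from_nat_into I j) x)" for x
    using nn_integral_bij_count_space[OF b, of "\<lambda>i. f i x"] by (simp add: nn_integral_count_space_nat)
  have "from_nat_into I j \<in> I" for j using False by (intro from_nat_into) auto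
  hence [measurable]: "f (from_nat_into I j) \<in> borel_measurable M" for j by (rule f)
  show ?thesis unfolding eq by measurable
qed

lemma ennreal_mult_assoc: "0 \<le> a \<Longrightarrow> 0 \<le> b \<Longrightarrow> ennreal a * (ennreal b * k) = ennreal (a * b) * k"
  by (simp add: ennreal_mult mult.assoc)

lemma MM_indicator_le_1: "MM (indicator E) x \<le> 1" unfolding MM_le_iff
proof (intro allI impI)
  fix c :: "real^'a" and r :: real assume "0 < r"
  have "(\<integral>y. indicator E y * indicator (qb c r) y) \<le> (\<integral>y. indicator (qb c r) y)" by (intro nn_integral_mono) (auto simp: indicator_def)
  also have "... = 1 * ennreal ((2*r)^CARD('a))" using \<open>0 < r\<close> by (simp add: emeasure_qb)
  finally show "(\<integral>y\<in>qb c r. indicator E y) \<le> 1 * ennreal ((2*r)^CARD('a))" .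
qed

lemma le_dyadic_levels:
  fixes g :: ennreal
  assumes "g \<le> 1"
  shows "g \<le> (\<Sum>i<J. ennreal ((1/2)^i) * of_bool (ennreal ((1/2)^(i+1)) < g)) + ennreal ((1/2)^J)"
proof (induction J)
  case 0 thus ?case using assms by simp
next
  case (Suc J)
  show ?case
  proof (cases "ennreal ((1/2)^(J+1)) < g")
    case True
    have "g \<le> (\<Sum>i<J. ennreal ((1/2)^i) * of_bool (ennreal ((1/2)^(i+1)) < g)) + ennreal ((1/2)^J)" by (rule Suc)
    also have "... = (\<Sum>i<Suc J. ennreal ((1/2)^i) * of_bool (ennreal ((1/2)^(i+1)) < g))" using True by simp
    also have "... \<le> ... + ennreal ((1/2)^Suc J)" by simp
    finally show ?thesis .
  next
    case False
    hence "g \<le> ennreal ((1/2)^Suc J)" by (simp add: not_less)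
    also have "... \<le> (\<Sum>i<Suc J. ennreal ((1/2)^i) * of_bool (ennreal ((1/2)^(i+1)) < g)) + ..." by simp
    finally show ?thesis .
  qed
qed

text \<open>A truncated form of the L log L estimate: each of the J dyadic levels between 2^(-J) and
  1 contributes the same amount by the weak type bound, and below the last level the measure of D is
  used. J is fitted to the level set in \<open>HH_level\<close>.\<close>

lemma MM_indicator_integral_le:
  fixes E D :: "(real^'n) set"
  assumes E [measurable]: "E \<in> sets lebesgue" and D [measurable]: "D \<in> sets lebesgue"
  shows "(\<integral>x\<in>D. MM (indicator E) x)
    \<le> ennreal (2 * 3^CARD('n) * real J) * vol E + ennreal ((1/2)^J) * vol D"
proof -
  let ?S = "\<lambda>i. {x. ennreal ((1/2)^(i+1)) < MM (indicator E) x}"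
  have S [measurable]: "?S i \<in> sets lebesgue" for i using open_MM by simp
  have "(\<integral>x\<in>D. MM (indicator E) x)
    \<le> (\<integral>x. (\<Sum>i<J. ennreal ((1/2)^i) * indicator (?S i) x) + ennreal ((1/2)^J) * indicator D x)"
  proof (rule nn_integral_mono, goal_cases)
    case (1 x)
    have "MM (indicator E) x \<le> (\<Sum>i<J. ennreal ((1/2)^i) * of_bool (ennreal ((1/2)^(i+1)) < MM (indicator E) x)) + ennreal ((1/2)^J)"
      by (rule le_dyadic_levels[OF MM_indicator_le_1])
    thus ?case by (cases "x \<in> D") (auto simp: indicator_def of_bool_def)
  qed
  also have "... = (\<Sum>i<J. ennreal ((1/2)^i) * vol (?S i)) + ennreal ((1/2)^J) * vol D"
    by (subst nn_integral_add, measurable, subst nn_integral_sum, measurable) (simp add: nn_integral_cmult_indicator)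
  also have "... \<le> (\<Sum>i<J. ennreal (2 * 3^CARD('n)) * vol E) + ennreal ((1/2)^J) * vol D"
  proof (intro add_right_mono sum_mono)
    fix i
    have "ennreal ((1/2)^i) = 2 * ennreal ((1/2)^(i+1))" by (simp add: ennreal_mult[symmetric] ennreal_numeral[symmetric] del: ennreal_numeral)
    hence "ennreal ((1/2)^i) * vol (?S i) = 2 * (ennreal ((1/2)^(i+1)) * vol (?S i))" by (simp add: mult.assoc)
    also have "... \<le> 2 * (3^CARD('n) * (\<integral>y. indicator E y))" by (intro mult_left_mono MM_weak_type) auto
    also have "... = ennreal (2 * 3^CARD('n)) * vol E" by (simp add: ennreal_mult ennreal_power[symmetric] mult.assoc)
    finally show "ennreal ((1/2)^i) * vol (?S i) \<le> ennreal (2 * 3^CARD('n)) * vol E" .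
  qed
  also have "(\<Sum>i<J. ennreal (2 * 3^CARD('n)) * vol E) = ennreal (2 * 3^CARD('n) * real J) * vol E" by (simp add: ennreal_mult ennreal_of_nat_eq_real_of_nat mult_ac)
  finally show ?thesis .
qed

text \<open>Unit steps above L count the excess; they are later matched with level sets whose weight
  decays geometrically in i.\<close>

lemma excess_le_levels:
  fixes h :: ennreal
  assumes L: "0 \<le> L"
  shows "h \<le> ennreal L + (\<Sum>i. of_bool (ennreal (L + real i) < h))"
proof -
  have ub: "ennreal (real N) \<le> (\<Sum>i. of_bool (ennreal (L + real i) < h))" if "\<And>i. i < N \<Longrightarrow> ennreal (L + real i) < h" for N
  proof -
    have "ennreal (real N) = (\<Sum>i<N. of_bool (ennreal (L + real i) < h))" using that by (simp add: ennreal_of_nat_eq_real_of_nat)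
    also have "... \<le> (\<Sum>i. of_bool (ennreal (L + real i) < h))" by (rule sum_le_suminf) auto
    finally show ?thesis .
  qed
  show ?thesis
  proof (cases h)
    case (real x)
    define N where "N = nat \<lceil>x - L\<rceil>"
    have "ennreal (L + real i) < h" if "i < N" for i
    proof -
      have "real i < x - L" using that by (simp add: N_def zless_nat_eq_int_zless less_ceiling_iff)
      thus ?thesis using real L by (simp add: ennreal_less_iff del: ennreal_plus)
    qed
    from ub[OF this] have 1: "ennreal (real N) \<le> (\<Sum>i. of_bool (ennreal (L + real i) < h))" by simp
    have "x \<le> L + real N" unfolding N_def by linarith
    hence "h \<le> ennreal L + ennreal (real N)" using real L by (simp add: ennreal_plus[symmetric] del: ennreal_plus)
    thus ?thesis using 1 by (meson add_left_mono order_trans)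
  next
    case top
    have "ennreal (real N) \<le> (\<Sum>i. of_bool (ennreal (L + real i) < h))" for N by (rule ub) (simp add: top)
    note N = this
    have s: "(\<Sum>i. of_bool (ennreal (L + real i) < h)) = (top :: ennreal)"
    proof (rule ccontr)
      assume "(\<Sum>i. of_bool (ennreal (L + real i) < h)) \<noteq> (top :: ennreal)"
      then obtain x where x: "(\<Sum>i. of_bool (ennreal (L + real i) < h)) = ennreal x" "0 \<le> x"
        by (cases "\<Sum>i. of_bool (ennreal (L + real i) < h) :: ennreal") auto
      obtain N where "x < real N" using reals_Archimedean2 by blast
      thus False using N[of N] x by (simp add: ennreal_le_iff)
    qed
    show ?thesis unfolding s by simp
  qed
qed

text \<open>\<open>mD\<close> is twice the coefficient of \<open>J * v\<close> in the estimate of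
  \<open>HH_level\<close>, so that with J of size t / mD half of the left side absorbs that term;
  \<open>mA\<close> and \<open>mB\<close> translate the outcome into weights by
  \<open>weight_small\<close> and \<open>kint_triple\<close>.\<close>

definition mD :: "nat \<Rightarrow> real \<Rightarrow> real" where "mD n \<sigma> = 4 * kC n (\<sigma> - n) * 3^n"
definition mA :: "nat \<Rightarrow> real \<Rightarrow> real" where "mA n \<sigma> = rA n \<sigma> * (4 * kC n (\<sigma> - n)) * 3 powr \<sigma>"
definition mB :: "nat \<Rightarrow> real \<Rightarrow> real" where "mB n \<sigma> = rB n \<sigma> / mD n \<sigma>"

lemma mD_pos: "real n < \<sigma> \<Longrightarrow> 0 < mD n \<sigma>" using kC_ge1[of "\<sigma> - n" n] by (auto simp: mD_def)
lemma mB_pos: "real n < \<sigma> \<Longrightarrow> 0 < mB n \<sigma>" using mD_pos rB_pos by (simp add: mB_def)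
lemma mA_pos: "real n < \<sigma> \<Longrightarrow> 0 < mA n \<sigma>" using kC_ge1[of "\<sigma> - n" n] rA_ge1[of n \<sigma>] by (auto simp: mA_def intro!: mult_pos_pos)

section \<open>Overlap of the tails of disjoint cells\<close>

context grid_weight
begin

definition HH :: "'n cube set \<Rightarrow> real^'n \<Rightarrow> ennreal" where
  "HH F y = (\<Sum>\<^sup>+Q\<in>F. ennreal (kp Q y))"

lemma HH_measurable [measurable]: "HH F \<in> lmeas" unfolding HH_def by measurable

lemma HH_integral:
  assumes [measurable]: "h \<in> lmeas"
  shows "(\<integral>y. h y * HH F y) = (\<Sum>\<^sup>+Q\<in>F. (\<integral>y. h y * ennreal (kp Q y)))"
proof -
  have "(\<integral>y. h y * HH F y) = (\<integral>y. (\<Sum>\<^sup>+Q\<in>F. h y * ennreal (kp Q y)))" unfolding HH_def by (simp add: nn_integral_cmult)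
  also have "... = (\<Sum>\<^sup>+Q\<in>F. (\<integral>y. h y * ennreal (kp Q y)))" by (rule nn_integral_count_space_nn_integral) auto
  finally show ?thesis .
qed

lemma Ce_ge1: "1 \<le> kC CARD('n) (\<sigma> - CARD('n))" using kC_ge1[of "\<sigma> - CARD('n)" "CARD('n)"] \<sigma>_gt by simp

text \<open>Averaging against the tails of disjoint cubes is dual to the maximal operator.\<close>

lemma HH_dual:
  assumes d: "disjoint_family_on cell F" and [measurable]: "h \<in> lmeas"
  shows "(\<integral>y. h y * HH F y)
    \<le> ennreal (kC CARD('n) (\<sigma> - CARD('n))) * (\<integral>x\<in>(\<Union>Q\<in>F. cell Q). MM h x)"
proof -
  let ?C = "kC CARD('n) (\<sigma> - CARD('n))"
  have each: "(\<integral>y. h y * ennreal (kp Q y)) \<le> ennreal ?C * (\<integral>x\<in>cell Q. MM h x)" (is "?X \<le> ennreal ?C * ?I") for Q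
  proof -
    let ?v = "ennreal (cv Q)"
    have "?v * ?X = (\<integral>x\<in>cell Q. ?X)" by (subst mult.commute) (simp add: nn_integral_cmult_indicator emeasure_cell)
    also have "... \<le> (\<integral>x. (ennreal (?C * rad Q^CARD('n))) * (MM h x * indicator (cell Q) x))"
    proof (rule nn_integral_mono, goal_cases)
      case (1 x)
      show ?case using kap_average[of "rad Q" \<sigma> h x "ctr Q"] \<sigma>_gt subsetD[OF cell_subset_qb, of x Q] by (auto simp: indicator_def)
    qed
    also have "... = ennreal (?C * rad Q^CARD('n)) * ?I" by (rule nn_integral_cmult) measurable
    also have "... \<le> ennreal (cv Q * ?C) * ?I" using Ce_ge1 by (intro mult_right_mono ennreal_leI) (simp_all add: mult.commute mult_left_mono power_mono)
    also have "... = ?v * (ennreal ?C * ?I)" using Ce_ge1 by (simp add: ennreal_mult mult.assoc)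
    finally show ?thesis using vol_pos[of Q] by (subst (asm) ennreal_mult_le_mult_iff) auto
  qed
  have "(\<integral>y. h y * HH F y) \<le> (\<Sum>\<^sup>+Q\<in>F. ennreal ?C * (\<integral>x\<in>cell Q. MM h x))"
    unfolding HH_integral[OF assms(2)] by (intro nn_integral_mono each)
  also have "... = ennreal ?C * (\<integral>x\<in>(\<Union>Q\<in>F. cell Q). MM h x)" by (simp add: nn_integral_cmult nn_integral_cells[OF d])
  finally show ?thesis .
qed

context
  fixes F :: "'n cube set" and P
  assumes F: "disjoint_family_on cell F" "\<And>Q. Q \<in> F \<Longrightarrow> cell Q \<subseteq> cell P"
begin

text \<open>Testing the duality on the indicator of the level set E bounds t |E| by the integral of
  the maximal function of E over P, which is of size |E| log(|P|/|E|). This self-reference forces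
  |E| to be exponentially small in t.\<close>

lemma HH_level:
  assumes t: "1 \<le> t"
  shows "vol {y\<in>trip P. ennreal t < HH F y}
    \<le> ennreal (4 * kC CARD('n) (\<sigma> - CARD('n)) * 2 powr - (t / mD CARD('n) \<sigma>) * cv P)"
proof -
  define C where "C = kC CARD('n) (\<sigma> - CARD('n))"
  define D where "D = mD CARD('n) \<sigma>"
  define E where "E = {y\<in>trip P. ennreal t < HH F y}"
  have C: "1 \<le> C" using Ce_ge1 by (simp add: C_def)
  have D: "D = 4 * C * 3^CARD('n)" "0 < D" using mD_pos[OF \<sigma>_gt] by (simp_all add: D_def mD_def C_def)
  have E [measurable]: "E \<in> sets lebesgue" unfolding E_def using HH_measurable[of F] by measurable
  define J where "J = nat \<lfloor>t / D\<rfloor>"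
  have J: "real J \<le> t / D" "t / D - 1 \<le> real J" using D t unfolding J_def by (auto simp: )
  have "vol E \<le> vol (trip P)" unfolding E_def by (intro emeasure_mono) auto
  hence "vol E < \<infinity>" using emeasure_qb[of "3 * rad P" "ctr P"] by (simp add: order_le_less_trans)
  then obtain v where v: "vol E = ennreal v" "0 \<le> v" by (metis ennreal_cases infinity_ennreal_def order_less_irrefl)
  define V where "V = cv P"
  have V: "0 < V" unfolding V_def by (rule vol_pos)
  have "ennreal (t * v) = (\<integral>y. ennreal t * indicator E y)" using t v by (simp add: nn_integral_cmult_indicator ennreal_mult)
  also have "... \<le> (\<integral>y. indicator E y * HH F y)" by (intro nn_integral_mono) (auto simp: indicator_def E_def less_imp_le)
  also have "... \<le> ennreal C * (\<integral>x\<in>(\<Union>Q\<in>F. cell Q). MM (indicator E) x)" unfolding C_def by (rule HH_dual[OF F(1)]) measurable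
  also have "... \<le> ennreal C * (\<integral>x\<in>cell P. MM (indicator E) x)" using F(2) by (intro mult_left_mono nn_integral_mono_set) auto
  also have "... \<le> ennreal C * (ennreal (2 * 3^CARD('n) * real J) * ennreal v + ennreal ((1/2)^J) * ennreal V)"
    using MM_indicator_integral_le[OF E cell_sets, of P J] by (intro mult_left_mono) (simp_all add: v V_def emeasure_cell)
  also have "... = ennreal (C * (2 * 3^CARD('n) * real J * v + (1/2)^J * V))" using C V v by (simp add: ennreal_mult[symmetric] ennreal_plus[symmetric] del: ennreal_plus)
  finally have "t * v \<le> C * (2 * 3^CARD('n) * real J * v + (1/2)^J * V)" using C V v by (subst (asm) ennreal_le_iff) auto
  also have "... = D * real J / 2 * v + C * (1/2)^J * V" by (simp add: D algebra_simps)
  also have "... \<le> t / 2 * v + C * (1/2)^J * V"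
  proof (intro add_right_mono mult_right_mono v)
    have "D * real J \<le> t" using J(1) D(2) by (simp add: field_simps)
    thus "D * real J / 2 \<le> t / 2" by simp
  qed
  finally have "t * v \<le> 2 * (C * (1/2)^J * V)" by simp
  moreover have "1 * v \<le> t * v" using t v by (intro mult_right_mono) auto
  ultimately have "v \<le> 2 * C * (1/2)^J * V" by simp
  also have "(1/2)^J \<le> 2 * 2 powr - (t / D)"
  proof -
    have "((1::real)/2)^J = 2 powr - real J"  by (simp add: powr_minus powr_realpow power_one_over inverse_eq_divide)
    also have "... \<le> 2 powr (1 - t / D)" using J by (intro powr_mono) auto
    also have "... = 2 * 2 powr - (t / D)" by (simp add: powr_diff powr_minus divide_inverse)
    finally show ?thesis .
  qed
  hence "2 * C * (1/2)^J * V \<le> 2 * C * (2 * 2 powr - (t / D)) * V" using C V by (intro mult_right_mono mult_left_mono) auto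
  finally have "v \<le> 4 * C * 2 powr - (t / D) * V" by (simp add: mult_ac)
  thus ?thesis unfolding E_def[symmetric] v(1) C_def[symmetric] D_def[symmetric] V_def[symmetric] by (rule ennreal_leI)
qed

lemma weight_HH_level:
  assumes t: "1 \<le> t"
  shows "(\<integral>y\<in>{y\<in>trip P. ennreal t < HH F y}. w y)
    \<le> ennreal (mA CARD('n) \<sigma> * W * exp (- mB CARD('n) \<sigma> * t / W)) * kq P"
proof -
  define C where "C = kC CARD('n) (\<sigma> - CARD('n))"
  define x where "x = t / mD CARD('n) \<sigma>"
  have C: "1 \<le> 4 * C" using Ce_ge1 by (simp add: C_def)
  have x: "0 \<le> x" using t mD_pos[OF \<sigma>_gt] by (simp add: x_def)
  have "cv P \<le> (2 * (3 * rad P))^CARD('n)" by (intro power_mono) auto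
  hence "4 * C * 2 powr - x * cv P \<le> 4 * C * 2 powr - x * (2 * (3 * rad P))^CARD('n)" using C by (intro mult_left_mono) auto
  hence "vol {y\<in>trip P. ennreal t < HH F y} \<le> ennreal (4 * C * 2 powr - x * (2 * (3 * rad P))^CARD('n))"
    using HH_level[OF t] unfolding C_def x_def by (meson ennreal_leI order_trans)
  hence "(\<integral>y\<in>{y\<in>trip P. ennreal t < HH F y}. w y)
    \<le> ennreal (rA CARD('n) \<sigma> * (4 * C) * W * exp (- rB CARD('n) \<sigma> * x / W)) * kint \<sigma> w (ctr P) (3 * rad P)"
    using C x HH_measurable[of F] by (intro weight_small) auto
  also have "... \<le> ennreal (rA CARD('n) \<sigma> * (4 * C) * W * exp (- rB CARD('n) \<sigma> * x / W)) * (ennreal (3 powr \<sigma>) * kq P)"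
    by (intro mult_left_mono kint_triple) auto
  also have "... = ennreal (mA CARD('n) \<sigma> * W * exp (- mB CARD('n) \<sigma> * t / W)) * kq P"
  proof -
    have "0 \<le> rA CARD('n) \<sigma> * (4 * C) * W * exp (- rB CARD('n) \<sigma> * x / W)" using C rA_ge1[OF \<sigma>_gt] W_ge1 by (intro mult_nonneg_nonneg) auto
    moreover have e: "- rB CARD('n) \<sigma> * x / W = - mB CARD('n) \<sigma> * t / W" by (simp add: x_def mB_def)
    moreover have "rA CARD('n) \<sigma> * (4 * C) * W * exp (- mB CARD('n) \<sigma> * t / W) * 3 powr \<sigma> = mA CARD('n) \<sigma> * W * exp (- mB CARD('n) \<sigma> * t / W)"
      by (simp add: mA_def C_def[symmetric])
    ultimately show ?thesis by (simp only: ennreal_mult_assoc powr_ge_zero)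
  qed
  finally show ?thesis .
qed

text \<open>A coarse bound without any smallness, with the full factor W. It is used with P the
  root, to see that all sums are finite and to control the first levels.\<close>

lemma weight_HH_near:
  "(\<integral>y. w y * indicator (trip P) y * HH F y)
    \<le> ennreal (kC CARD('n) (\<sigma> - CARD('n)) * W * 3 powr \<sigma>) * kq P"
proof -
  let ?C = "kC CARD('n) (\<sigma> - CARD('n))"
  let ?h = "\<lambda>y. w y * indicator (trip P) y"
  have "(\<Union>Q\<in>F. cell Q) \<subseteq> trip P" using F(2) cell_subset_qb[of P] qb_mono_radius[of "rad P" "3 * rad P" "ctr P"] by fastforce
  hence "(\<integral>y. ?h y * HH F y) \<le> ennreal ?C * (\<integral>x\<in>trip P. MM ?h x)"
    by (intro order_trans[OF HH_dual[OF F(1)]] mult_left_mono nn_integral_mono_set) auto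
  also have "... \<le> ennreal ?C * (ennreal W * (ennreal (3 powr \<sigma>) * kq P))" by (intro mult_left_mono order_trans[OF key] kint_triple) auto
  also have "... = ennreal (?C * W * 3 powr \<sigma>) * kq P" using Ce_ge1 W_ge1 by (simp add: ennreal_mult mult.assoc)
  finally show ?thesis .
qed

text \<open>Below height L the sum of profiles costs L times the weight of the triple, and triples
  of Whitney cells have bounded overlap; the part above is summed over unit levels, a geometric
  series of ratio exp(-mB / W).\<close>

lemma weight_HH_excess:
  assumes L: "1 \<le> L"
  shows "(\<integral>y. w y * indicator (trip P) y * HH F y)
    \<le> ennreal L * (\<integral>y\<in>trip P. w y)
      + ennreal (mA CARD('n) \<sigma> * W * (1 + W / mB CARD('n) \<sigma>) * exp (- mB CARD('n) \<sigma> * L / W)) * kq P"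
proof -
  define S where "S i = {y\<in>trip P. ennreal (L + real i) < HH F y}" for i :: nat
  have [measurable]: "S i \<in> sets lebesgue" for i unfolding S_def using HH_measurable[of F] by measurable
  define b where "b = mB CARD('n) \<sigma> / W"
  define A where "A = mA CARD('n) \<sigma> * W"
  have b: "0 < b" using mB_pos[OF \<sigma>_gt] W_ge1 by (simp add: b_def)
  have A: "0 \<le> A" using mA_pos[OF \<sigma>_gt] W_ge1 by (simp add: A_def)
  have "(\<integral>y. w y * indicator (trip P) y * HH F y)
     \<le> (\<integral>y. ennreal L * (w y * indicator (trip P) y) + (\<Sum>i. w y * indicator (S i) y))"
  proof (rule nn_integral_mono, goal_cases)
    case (1 y)
    show ?case
    proof (cases "y \<in> trip P")
      case True
      have "HH F y \<le> ennreal L + (\<Sum>i. of_bool (ennreal (L + real i) < HH F y))" using L by (intro excess_le_levels) auto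
      also have "(\<Sum>i. of_bool (ennreal (L + real i) < HH F y)) = (\<Sum>i. indicator (S i) y :: ennreal)"
        using True by (intro suminf_cong) (auto simp: S_def indicator_def)
      finally have "w y * HH F y \<le> w y * (ennreal L + (\<Sum>i. indicator (S i) y))" by (rule mult_left_mono) simp
      thus ?thesis using True by (simp add: distrib_left mult.commute)
    qed auto
  qed
  also have "... = ennreal L * (\<integral>y\<in>trip P. w y) + (\<Sum>i. \<integral>\<^sup>+y\<in>S i. w y \<partial>lebesgue)"
    by (subst nn_integral_add, measurable, subst nn_integral_cmult, measurable, subst nn_integral_suminf, measurable)
  also have "(\<Sum>i. \<integral>\<^sup>+y\<in>S i. w y \<partial>lebesgue) \<le> (\<Sum>i. ennreal (A * exp (- b * L) * exp (- b)^i) * kq P)"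
  proof (intro suminf_le summableI)
    fix i :: nat
    have "A * exp (- mB CARD('n) \<sigma> * (L + real i) / W) = A * exp (- b * L) * exp (- b)^i"
    proof -
      have "- mB CARD('n) \<sigma> * (L + real i) / W = - b * L + real i * (- b)" by (simp add: b_def algebra_simps add_divide_distrib diff_divide_distrib)
      thus ?thesis by (simp only: exp_add exp_of_nat_mult mult.assoc)
    qed
    moreover have "(\<integral>y\<in>S i. w y) \<le> ennreal (A * exp (- mB CARD('n) \<sigma> * (L + real i) / W)) * kq P"
      unfolding S_def A_def using L by (intro weight_HH_level) auto
    ultimately show "(\<integral>y\<in>S i. w y) \<le> ennreal (A * exp (- b * L) * exp (- b)^i) * kq P" by (simp only:)
  qed
  also have "... = ennreal (A * exp (- b * L) * (1 / (1 - exp (- b)))) * kq P"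
  proof -
    have "(\<lambda>i. A * exp (- b * L) * exp (- b)^i) sums (A * exp (- b * L) * (1 / (1 - exp (- b))))" using b by (intro sums_mult geometric_sums) auto
    hence "(\<Sum>i. ennreal (A * exp (- b * L) * exp (- b)^i)) = ennreal (A * exp (- b * L) * (1 / (1 - exp (- b))))"
      using A by (subst suminf_ennreal2) (auto simp: sums_iff)
    thus ?thesis by simp
  qed
  also have "... \<le> ennreal (A * exp (- b * L) * (1 + 1 / b)) * kq P"
  proof (intro mult_right_mono ennreal_leI mult_left_mono)
    \<comment> \<open>Gives 1 / (1 - exp(-b)) \<le> 1 + 1/b, so the series costs one more factor
      W.\<close>
    have "exp (- b) \<le> 1 / (1 + b)" using b exp_ge_add_one_self[of b] by (simp add: exp_minus field_simps)
    hence "b / (1 + b) \<le> 1 - exp (- b)" using b by (simp add: field_simps)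
    hence "1 / (1 - exp (- b)) \<le> 1 / (b / (1 + b))" using b by (intro divide_left_mono) auto
    thus "1 / (1 - exp (- b)) \<le> 1 + 1 / b" using b by (simp add: field_simps)
  qed (use A in auto)
  finally show ?thesis using W_ge1 mB_pos[OF \<sigma>_gt] by (simp add: A_def b_def mult_ac add_left_mono)
qed

text \<open>With t the ratio of volumes, each profile off the triple is at most a multiple of
  t^(\<sigma>/n) times that of P. One factor t is kept for summing the disjoint volumes to at most
  \<rho>, the rest is bounded by \<rho>^(\<sigma>/n - 1); for \<open>\<sigma> = n q\<close> the gain
  is \<rho>^q.\<close>

lemma weight_HH_far:
  assumes \<rho>: "0 < \<rho>" "vol (\<Union>Q\<in>F. cell Q) \<le> ennreal (\<rho> * cv P)"
  shows "(\<integral>y. w y * indicator (- trip P) y * HH F y)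
    \<le> ennreal ((3/2) powr \<sigma> * \<rho> powr (\<sigma> / CARD('n))) * kq P"
proof -
  define n where "n = real CARD('n)"
  have n: "0 < n" by (simp add: n_def)
  define V where "V = cv P"
  have V: "0 < V" unfolding V_def by (rule vol_pos)
  define t where "t Q = cv Q / V" for Q
  have t0: "0 < t Q" for Q using V vol_pos[of Q] by (simp add: t_def)
  have t\<rho>: "t Q \<le> \<rho>" if "Q \<in> F" for Q
  proof -
    have "ennreal (cv Q) = vol (cell Q)" by (simp add: emeasure_cell)
    also have "... \<le> vol (\<Union>Q\<in>F. cell Q)" using that by (intro emeasure_mono) auto
    also have "... \<le> ennreal (\<rho> * V)" using \<rho> by (simp add: V_def)
    finally show ?thesis using V \<rho> by (simp add: t_def ennreal_le_iff field_simps)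
  qed
  have tr: "(rad Q / rad P) powr \<sigma> = t Q powr (\<sigma> / n)" for Q
  proof -
    have "t Q = (rad Q / rad P)^CARD('n)" unfolding t_def V_def by (simp add: power_divide[symmetric])
    hence "t Q = (rad Q / rad P) powr n" by (simp add: powr_realpow n_def)
    thus ?thesis using n by (simp add: powr_powr)
  qed
  have tq: "(rad Q / rad P) powr \<sigma> \<le> \<rho> powr (\<sigma> / n - 1) * t Q" if "Q \<in> F" for Q
  using powr_add[of "t Q" "\<sigma> / n - 1" 1] t0[of Q] t\<rho>[OF that] \<sigma>_gt n tr by (auto simp: powr_mono2 n_def field_simps)
  have sumt: "(\<Sum>\<^sup>+Q\<in>F. ennreal (t Q)) \<le> ennreal \<rho>"
  proof -
    have "(\<Sum>\<^sup>+Q\<in>F. ennreal (t Q)) = (\<Sum>\<^sup>+Q\<in>F. ennreal (cv Q) * ennreal (1 / V))"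
      using V vol_pos by (intro nn_integral_cong) (simp add: t_def ennreal_mult[symmetric])
    also have "... = vol (\<Union>Q\<in>F. cell Q) * ennreal (1 / V)" by (subst nn_integral_multc) (auto simp: emeasure_cells[OF F(1)])
    also have "... \<le> ennreal (\<rho> * V) * ennreal (1 / V)" using \<rho> by (intro mult_right_mono) (auto simp: V_def)
    also have "... = ennreal \<rho>" using V \<rho> by (simp add: ennreal_mult[symmetric])
    finally show ?thesis .
  qed
  define K where "K = (3/2) powr \<sigma> * \<rho> powr (\<sigma> / n - 1)"
  have K: "0 \<le> K" by (simp add: K_def)
  have far: "HH F y \<le> ennreal ((3/2) powr \<sigma> * \<rho> powr (\<sigma> / n)) * ennreal (kp P y)" if y: "y \<notin> trip P" for y
  proof -
    have "HH F y \<le> (\<Sum>\<^sup>+Q\<in>F. ennreal (t Q) * ennreal (K * kp P y))" unfolding HH_def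
    proof (rule nn_integral_mono)
      fix Q assume "Q \<in> space (count_space F)"
      hence Q: "Q \<in> F" by simp
      have "kp Q y \<le> (3/2) powr \<sigma> * (rad Q / rad P) powr \<sigma> * kp P y" using cell_subset_ctr_rad[OF F(2)[OF Q]] y \<sigma>_pos by (intro kap_far) auto
      also have "... \<le> (3/2) powr \<sigma> * (\<rho> powr (\<sigma> / n - 1) * t Q) * kp P y" using tq[OF Q] by (intro mult_right_mono mult_left_mono) auto
      also have "... = t Q * (K * kp P y)" by (simp add: K_def)
      finally show "ennreal (kp Q y) \<le> ennreal (t Q) * ennreal (K * kp P y)" using K t0[of Q] by (subst ennreal_mult[symmetric]) (auto intro: ennreal_leI less_imp_le)
    qed
    also have "... = (\<Sum>\<^sup>+Q\<in>F. ennreal (t Q)) * ennreal (K * kp P y)" by (rule nn_integral_multc) auto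
    also have "... \<le> ennreal \<rho> * ennreal (K * kp P y)" by (intro mult_right_mono sumt) auto
    also have "... = ennreal (\<rho> * K) * ennreal (kp P y)" using \<rho> K by (simp add: ennreal_mult[symmetric])
    also have "\<rho> * K = (3/2) powr \<sigma> * \<rho> powr (\<sigma> / n)" using \<rho> powr_add[of \<rho> 1 "\<sigma> / n - 1"] by (simp add: K_def)
    finally show ?thesis .
  qed
  have "(\<integral>y. w y * indicator (- trip P) y * HH F y)
    \<le> (\<integral>y. ennreal ((3/2) powr \<sigma> * \<rho> powr (\<sigma> / n)) * (w y * ennreal (kp P y)))"
  proof (rule nn_integral_mono, goal_cases)
    case (1 y)
    show ?case using mult_left_mono[OF far[of y], of "w y"] by (auto simp: indicator_def mult_ac)
  qed
  also have "... = ennreal ((3/2) powr \<sigma> * \<rho> powr (\<sigma> / n)) * kq P" unfolding kint_def by (rule nn_integral_cmult) measurable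
  finally show ?thesis by (simp add: n_def)
qed

end

end

section \<open>Sawyer's inequality for Whitney cubes\<close>

lemma ennreal_mult_right_cancel: "0 < v \<Longrightarrow> a * ennreal v \<le> b * ennreal v \<Longrightarrow> a \<le> b"
  using ennreal_mult_le_mult_iff[of "ennreal v" a b] by (simp add: mult.commute)

lemma ennreal_powr_ge:
  assumes "ennreal x \<le> M" "0 \<le> x" "0 < p" shows "ennreal (x powr p) \<le> ennreal_powr M p"
proof (cases "M = \<infinity>")
  case False
  hence "x \<le> enn2real M" using assms(1,2) by (metis enn2real_ennreal enn2real_mono infinity_ennreal_def top.not_eq_extremum)
  thus ?thesis using False assms unfolding ennreal_powr_def by (auto intro!: ennreal_leI powr_mono2)
qed (simp add: ennreal_powr_def)

lemma ennreal_powr_measurable [measurable]: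
  assumes f [measurable]: "f \<in> borel_measurable M"
  shows "(\<lambda>x. ennreal_powr (f x) p) \<in> borel_measurable M"
using measurable_sets[OF f, of "{\<infinity>}"] by (auto simp: powr_real_measurable borel_measurable_const ennreal_powr_def measurable_If)

lemma ennreal_absorb_half:
  assumes "\<Phi> < top" "\<Phi> \<le> X + ennreal (1/2) * \<Phi>" shows "\<Phi> \<le> 2 * X"
proof (cases X)
  case (real x)
  obtain f where f: "\<Phi> = ennreal f" "0 \<le> f" using assms(1) by (cases \<Phi>) auto
  have "ennreal (1/2) * ennreal f = ennreal (1/2 * f)" using f by (intro ennreal_mult[symmetric]) auto
  moreover have "ennreal x + ennreal (1/2 * f) = ennreal (x + 1/2 * f)" using f real by (intro ennreal_plus[symmetric]) auto
  ultimately have "ennreal f \<le> ennreal (x + 1/2 * f)" using assms(2) real f by simp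
  hence "f \<le> x + 1/2 * f" using f real by (subst (asm) ennreal_le_iff) auto
  hence "f \<le> 2 * x" by simp
  thus ?thesis using f real by (simp add: ennreal_mult[symmetric] ennreal_numeral[symmetric] ennreal_leI del: ennreal_numeral)
qed (simp add: ennreal_mult_top)

text \<open>A term with x 2^j < m is a fixed multiple of the increment of the p-th power of the
  levels cut off at m, so the sum telescopes; the bound is uniform in J and x.\<close>

lemma sum_levels_le:
  fixes m x p :: real
  assumes "0 < x" "0 < p" "0 \<le> m"
  shows "(\<Sum>j<J. (x * 2^j) powr p * of_bool (x * 2^j < m)) \<le> 1 / (1 - 2 powr - p) * m powr p"
proof -
  define t where "t j = min m (x * 2^j / 2) powr p" for j :: nat
  define C where "C = 1 / (1 - 2 powr - p)"
  have "2 powr - p < 1" using assms(2) powr_less_mono[of "- p" 0 2] by simp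
  hence C: "0 < C" "C * (1 - 2 powr - p) = 1" by (auto simp: C_def)
  have "(x * 2^j) powr p * of_bool (x * 2^j < m) \<le> C * (t (Suc j) - t j)" for j
  proof (cases "x * 2^j < m")
    case True
    have "x * 2^j / 2 \<le> m" using True assms by (smt (verit) field_sum_of_halves mult_pos_pos zero_less_power)
    hence "t j = (x * 2^j / 2) powr p" by (simp add: t_def)
    also have "... = (x * 2^j) powr p * 2 powr - p"
      using powr_divide[of "x * 2^j" 2 p] powr_minus_divide[of 2 p] assms by (metis divide_inverse inverse_eq_divide less_imp_le mult_pos_pos zero_less_numeral zero_less_power)
    finally have "t (Suc j) - t j = (x * 2^j) powr p * (1 - 2 powr - p)" using True by (simp add: t_def algebra_simps)
    hence "C * (t (Suc j) - t j) = (x * 2^j) powr p" using C(2) by (simp add: mult.left_commute)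
    thus ?thesis using True by simp
  next
    case False
    have "t j \<le> t (Suc j)" unfolding t_def using assms by (intro powr_mono2) (auto simp: min_def)
    thus ?thesis using False C by simp
  qed
  hence "(\<Sum>j<J. (x * 2^j) powr p * of_bool (x * 2^j < m)) \<le> (\<Sum>j<J. C * (t (Suc j) - t j))" by (intro sum_mono)
  also have "... = C * (t J - t 0)" by (simp add: sum_distrib_left[symmetric] sum_lessThan_telescope)
  also have "... \<le> C * m powr p"
  proof (intro mult_left_mono)
    have "t J \<le> m powr p" unfolding t_def using assms by (intro powr_mono2) auto
    thus "t J - t 0 \<le> m powr p" by (smt (verit) t_def powr_ge_zero)
  qed (use C in auto)
  finally show ?thesis by (simp add: C_def)
qed

text \<open>The number of levels after which the gain of the far parts beats the factor 2^p per
  level; it exists since p < \<sigma>/n. The base 33^n is the density constant of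
  \<open>Wh_density\<close>, and 1/4 leaves an equal share for the near parts.\<close>

definition sN :: "nat \<Rightarrow> real \<Rightarrow> real \<Rightarrow> nat" where
  "sN n p \<sigma> = (LEAST N. (2 powr p)^N * ((3/2) powr \<sigma> * (33^n * (1/2)^N) powr (\<sigma> / n)) \<le> 1/4)"

lemma sN:
  assumes "0 < n" "real n * p < \<sigma>"
  shows "(2 powr p)^sN n p \<sigma> * ((3/2) powr \<sigma> * (33^n * (1/2)^sN n p \<sigma>) powr (\<sigma> / n)) \<le> 1/4"
proof -
  define K where "K = (3/2) powr \<sigma> * (33^n) powr (\<sigma> / n)"
  define b where "b = 2 powr (p - \<sigma> / n)"
  have K: "0 < K" by (simp add: K_def)
  have "p < \<sigma> / n" using assms by (simp add: field_simps)
  hence b: "0 < b" "b < 1" using powr_less_mono[of "p - \<sigma> / n" 0 2] by (auto simp: b_def)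
  obtain N where "b^N < 1 / (4 * K)" using real_arch_pow_inv[of "1 / (4 * K)" b] K b by auto
  hence "K * b^N \<le> 1/4" using K by (simp add: field_simps)
  moreover have "(2 powr p)^N * ((3/2) powr \<sigma> * (33^n * (1/2)^N) powr (\<sigma> / n)) = K * b^N"
  proof -
    have "((1/2)^N) powr (\<sigma> / n) = (2 powr - (\<sigma> / n))^N"
    proof -
      have "((1::real)/2)^N = 2 powr - real N" by (simp add: powr_minus powr_realpow power_one_over inverse_eq_divide)
      hence "((1/2)^N) powr (\<sigma> / n) = 2 powr (- (\<sigma> / n) * real N)" by (simp add: powr_powr mult.commute)
      also have "... = (2 powr - (\<sigma> / n)) powr real N" by (rule powr_powr[symmetric])
      also have "... = (2 powr - (\<sigma> / n))^N" by (rule powr_realpow) simp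
      finally show ?thesis .
    qed
    moreover have "b^N = (2 powr p)^N * (2 powr - (\<sigma> / n))^N" unfolding b_def power_mult_distrib[symmetric] powr_add[symmetric] by simp
    ultimately show ?thesis unfolding K_def by (subst powr_mult) auto
  qed
  ultimately have "(2 powr p)^N * ((3/2) powr \<sigma> * (33^n * (1/2)^N) powr (\<sigma> / n)) \<le> 1/4" by simp
  thus ?thesis unfolding sN_def by (rule LeastI)
qed

text \<open>Cutting at height scL W^2 instead of W log W lets exp(x) \<ge> x^2/2 suffice in
  \<open>scL_decay\<close>. The larger power of W is harmless, because Sawyer's constant ends up
  inside the logarithm.\<close>

definition scL :: "nat \<Rightarrow> real \<Rightarrow> real \<Rightarrow> real" where
  "scL n p \<sigma> = 1 + 8 * (2 powr p)^sN n p \<sigma> * mA n \<sigma> * (1 + 1 / mB n \<sigma>) / (mB n \<sigma>)^2"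

lemma scL_ge1: "real n < \<sigma> \<Longrightarrow> 1 \<le> scL n p \<sigma>" using mA_pos[of n \<sigma>] mB_pos[of n \<sigma>] by (simp add: scL_def)

lemma scL_decay:
  assumes "real n < \<sigma>" "1 \<le> W"
  shows "(2 powr p)^sN n p \<sigma> * (mA n \<sigma> * W * (1 + W / mB n \<sigma>) * exp (- mB n \<sigma> * (scL n p \<sigma> * W^2) / W)) \<le> 1/4"
proof -
  define q where "q = (2 powr p)^sN n p \<sigma>"
  define A where "A = mA n \<sigma>"
  define B where "B = mB n \<sigma>"
  define c where "c = scL n p \<sigma>"
  have pos: "0 < q" "0 < A" "0 < B" "1 \<le> c" using mA_pos mB_pos scL_ge1 assms(1) by (auto simp: q_def A_def B_def c_def)
  define X where "X = 8 * q * A * (1 + 1 / B) / B^2"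
  have X: "0 < X" "c = 1 + X" using pos by (auto simp: X_def c_def scL_def q_def A_def B_def intro!: divide_pos_pos mult_pos_pos add_pos_pos)
  have x: "0 < B * c * W" using pos assms(2) by simp
  have "(B * c * W)^2 / 2 \<le> exp (B * c * W)" using exp_lower_Taylor_quadratic[of "B * c * W"] x by simp
  hence e: "exp (- (B * c * W)) \<le> 2 / (B * c * W)^2"
  proof -
    have "1 / exp (B * c * W) \<le> 1 / ((B * c * W)^2 / 2)" using x \<open>(B * c * W)^2 / 2 \<le> exp (B * c * W)\<close> by (intro divide_left_mono mult_pos_pos) auto
    thus ?thesis by (simp add: exp_minus inverse_eq_divide)
  qed
  have "W * (1 + W / B) \<le> W^2 * (1 + 1 / B)" using assms(2) pos mult_left_mono[of 1 W W] by (simp add: algebra_simps power2_eq_square)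
  hence "q * (A * W * (1 + W / B) * exp (- (B * c * W))) \<le> q * (A * (W^2 * (1 + 1 / B)) * (2 / (B * c * W)^2))"
  proof -
    have "W * (1 + W / B) * exp (- (B * c * W)) \<le> W^2 * (1 + 1 / B) * (2 / (B * c * W)^2)"
      using pos by (intro mult_mono[OF \<open>W * (1 + W / B) \<le> W^2 * (1 + 1 / B)\<close> e]) auto
    hence "q * A * (W * (1 + W / B) * exp (- (B * c * W))) \<le> q * A * (W^2 * (1 + 1 / B) * (2 / (B * c * W)^2))" using pos by (intro mult_left_mono) auto
    thus ?thesis by (simp add: mult.assoc)
  qed
  also have "... = X / (4 * c^2)" using pos assms(2) by (simp add: X_def power_mult_distrib field_simps)
  also have "... \<le> 1/4"
  proof -
    have "X \<le> c^2" using X by (simp add: power2_eq_square algebra_simps)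
    thus ?thesis using pos by (simp add: field_simps)
  qed
  also have "- (B * c * W) = - B * (c * W^2) / W" using assms(2) by (simp add: power2_eq_square)
  finally show ?thesis by (simp add: q_def A_def B_def c_def)
qed

definition sR :: "nat \<Rightarrow> real \<Rightarrow> real" where
  "sR n \<sigma> = kC n (\<sigma> - n) * 3 powr \<sigma> + (3/2) powr \<sigma>"

definition sC :: "nat \<Rightarrow> real \<Rightarrow> real \<Rightarrow> real" where
  "sC n p \<sigma> = 2 * (2 powr p)^sN n p \<sigma> * (sN n p \<sigma> * sR n \<sigma> + scL n p \<sigma> * 196^n * (1 / (1 - 2 powr - p)))"

text \<open>g stands for the modulus of f. The bound G makes the level sets empty from some level
  on, and the support condition lets one cell carry all the mass.\<close>

locale sawyer = grid_weight a s w \<sigma> W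
  for a :: "real^'n" and s and w :: "real^'n \<Rightarrow> ennreal" and \<sigma> W +
  fixes g :: "real^'n \<Rightarrow> ennreal" and p G :: real
  assumes g_meas [measurable]: "g \<in> lmeas"
    and g_supp: "\<And>y. y \<notin> cell root \<Longrightarrow> g y = 0"
    and g_le: "\<And>y. g y \<le> ennreal G"
    and g_pos: "0 < (\<integral>y. g y)"
    and p_pos: "0 < p" and \<sigma>_gt_p: "real CARD('n) * p < \<sigma>"
begin

section \<open>Level sets of M g and their Whitney cells\<close>

definition five :: "'n cube \<Rightarrow> (real^'n) set" where "five Q = qb (ctr Q) (5 * rad Q)"

text \<open>Half of the average of g over the five-fold dilate of the root. Then M g exceeds the
  base level on \<open>five root\<close>, and the root is the only Whitney cell of level 0.\<close>

definition l0 :: real where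
  "l0 = enn2real (\<integral>y. g y) / (2 * (10 * rad root)^CARD('n))"

definition lev :: "nat \<Rightarrow> real" where "lev k = l0 * 2^k"

definition \<Omega> :: "nat \<Rightarrow> (real^'n) set" where "\<Omega> k = {x. ennreal (lev k) < MM g x}"

text \<open>Maximality is taken among the cells inside the root only, so the root can be a Whitney
  cell although the complement of the level set is far away; every use of a nearby point outside the
  level set has to treat it apart.\<close>

definition Wh :: "nat \<Rightarrow> 'n cube set" where "Wh k = maxc {Q\<in>subcells. five Q \<subseteq> \<Omega> k}"

lemma G_nonneg: "0 < G"
proof (rule ccontr)
  assume "\<not> 0 < G"
  hence "g y = 0" for y using g_le[of y] by (simp add: ennreal_neg)
  thus False using g_pos by simp
qed

lemma g_integral_le: "(\<integral>y. g y) \<le> ennreal (G * cv root)"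
proof -
  have "(\<integral>y. g y) \<le> (\<integral>y. ennreal G * indicator (cell root) y)" using g_supp g_le by (intro nn_integral_mono) (auto simp: indicator_def)
  also have "... = ennreal (G * cv root)" using G_nonneg by (simp add: nn_integral_cmult_indicator emeasure_cell ennreal_mult)
  finally show ?thesis .
qed

lemma g_integral: "(\<integral>y. g y) = ennreal (2 * l0 * (10 * rad root)^CARD('n))" using g_integral_le by (auto simp: order_le_less_trans l0_def less_top)

lemma l0_pos: "0 < l0"
proof -
  have "0 < 2 * l0 * (10 * rad root)^CARD('n)" using g_pos unfolding g_integral by simp
  moreover have "0 < (10 * rad root)^CARD('n)" by simp
  ultimately have "0 < 2 * l0" by (metis mult.commute zero_less_mult_pos)
  thus ?thesis by simp
qed

lemma lev_pos: "0 < lev k" using l0_pos by (simp add: lev_def)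

lemma lev_mono: "j \<le> k \<Longrightarrow> lev j \<le> lev k" using l0_pos by (simp add: lev_def)

lemma MM_g_le: "MM g x \<le> ennreal G" unfolding MM_le_iff
proof (intro allI impI)
  fix c :: "real^'n" and r :: real assume r: "0 < r"
  have "(\<integral>y\<in>qb c r. g y) \<le> (\<integral>y. ennreal G * indicator (qb c r) y)" using g_le by (intro nn_integral_mono mult_right_mono) auto
  also have "... = ennreal G * ennreal ((2*r)^CARD('n))" using r by (simp add: nn_integral_cmult_indicator emeasure_qb)
  finally show "(\<integral>y\<in>qb c r. g y) \<le> ennreal G * ennreal ((2*r)^CARD('n))" .
qed

text \<open>The cube about the centre of the root that reaches y contains the support of g.\<close>

lemma MM_g_ge: "ennreal (2 * l0 * 5^CARD('n) * kap CARD('n) (ctr root) (rad root) y) \<le> MM g y"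
proof -
  define R where "R = max (rad root) (infnorm (y - ctr root))"
  have R: "0 < R" "rad root \<le> R" "y \<in> qb (ctr root) R" using rad_pos[of root] by (auto simp: R_def mem_qb less_max_iff_disj)
  have "cell root \<subseteq> qb (ctr root) R" using cell_subset_qb[of root] qb_mono_radius[OF R(2)] by blast
  hence "(\<integral>y. g y) = (\<integral>y\<in>qb (ctr root) R. g y)" using g_supp by (intro nn_integral_cong) (auto simp: indicator_def)
  also have "... \<le> MM g y * ennreal ((2*R)^CARD('n))" using R by (intro MM_upper) auto
  finally have "ennreal (2 * l0 * (10 * rad root)^CARD('n)) \<le> MM g y * ennreal ((2*R)^CARD('n))" unfolding g_integral .
  moreover have "2 * l0 * (10 * rad root)^CARD('n) = 2 * l0 * 5^CARD('n) * kap CARD('n) (ctr root) (rad root) y * (2*R)^CARD('n)"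
  proof -
    have "10 * rad root = 5 * (rad root / R) * (2 * R)" using R by simp
    hence "(10 * rad root)^CARD('n) = 5^CARD('n) * (rad root / R)^CARD('n) * (2 * R)^CARD('n)" by (simp only: power_mult_distrib)
    moreover have "kap CARD('n) (ctr root) (rad root) y = (rad root / R)^CARD('n)" unfolding kap_def R_def[symmetric] using R by (simp add: powr_realpow)
    ultimately show ?thesis by simp
  qed
  ultimately have m: "ennreal (2 * l0 * 5^CARD('n) * kap CARD('n) (ctr root) (rad root) y) * ennreal ((2*R)^CARD('n)) \<le> MM g y * ennreal ((2*R)^CARD('n))"
    using R l0_pos by (simp add: ennreal_mult)
  have "0 < (2*R)^CARD('n)" using R by simp
  thus ?thesis using m by (rule ennreal_mult_right_cancel)
qed

lemma five_root: "five root \<subseteq> \<Omega> 0"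
proof
  fix x assume "x \<in> five root"
  hence i: "infnorm (x - ctr root) \<le> 5 * rad root" by (simp add: five_def mem_qb)
  have "1 / 5 \<le> rad root / max (rad root) (infnorm (x - ctr root))" using i rad_pos[of root] by (auto simp: less_max_iff_disj pos_le_divide_eq)
  hence "(1 / 5)^CARD('n) \<le> (rad root / max (rad root) (infnorm (x - ctr root)))^CARD('n)" by (intro power_mono) auto
  moreover have "0 < rad root / max (rad root) (infnorm (x - ctr root))" using rad_pos[of root] by (simp add: less_max_iff_disj)
  ultimately have "(1/5)^CARD('n) \<le> kap CARD('n) (ctr root) (rad root) x" by (simp add: kap_def powr_realpow)
  hence "1 \<le> 5^CARD('n) * kap CARD('n) (ctr root) (rad root) x" by (simp add: power_one_over field_simps)
  hence "lev 0 < 2 * l0 * (5^CARD('n) * kap CARD('n) (ctr root) (rad root) x)" using l0_pos mult_left_mono[of 1 _ "2 * l0"] by (fastforce simp: lev_def)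
  hence "ennreal (lev 0) < ennreal (2 * l0 * 5^CARD('n) * kap CARD('n) (ctr root) (rad root) x)" using lev_pos[of 0] by (simp add: ennreal_less_iff mult.assoc)
  thus "x \<in> \<Omega> 0" using MM_g_ge[of x] unfolding \<Omega>_def by (auto intro: less_le_trans)
qed

lemma \<Omega>_antimono: "j \<le> k \<Longrightarrow> \<Omega> k \<subseteq> \<Omega> j"
  unfolding \<Omega>_def using lev_mono by (auto intro: order_le_less_trans ennreal_leI)

lemma \<Omega>_sets [measurable, simp]: "\<Omega> k \<in> sets lebesgue" using open_MM[of "ennreal (lev k)" g] by (simp add: \<Omega>_def)

lemma Wh_in: "Q \<in> Wh k \<Longrightarrow> Q \<in> subcells \<and> five Q \<subseteq> \<Omega> k" using maxc_subset by (auto simp: Wh_def)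

lemma Wh_disjoint: "disjoint_family_on cell (Wh k)" unfolding Wh_def by (rule maxc_disjoint)

lemma Wh_cover: "Q \<in> subcells \<Longrightarrow> five Q \<subseteq> \<Omega> k \<Longrightarrow> \<exists>P\<in>Wh k. cell Q \<subseteq> cell P"
  unfolding Wh_def by (rule maxc_cover) auto

lemma Wh_ancestor: "j \<le> k \<Longrightarrow> Q \<in> Wh k \<Longrightarrow> \<exists>P\<in>Wh j. cell Q \<subseteq> cell P"
  using Wh_in[of Q k] \<Omega>_antimono[of j k] by (intro Wh_cover) auto

lemma ctr_in_five: "ctr Q \<in> five Q" by (simp add: five_def mem_qb infnorm_0)

lemma trip_five: "trip Q \<subseteq> five Q" unfolding five_def by (rule qb_mono_radius) simp

lemma cell_five: "cell Q \<subseteq> five Q"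
proof -
  have "qb (ctr Q) (rad Q) \<subseteq> five Q" unfolding five_def by (rule qb_mono_radius) simp
  thus ?thesis using cell_subset_qb[of Q] by blast
qed

text \<open>The parent violates the five-fold condition; measured in radii of P, 11 is 10 for the
  dilate of the parent plus 1 for the distance of the centres.\<close>

lemma Wh_witness:
  assumes P: "P \<in> Wh k" "P \<noteq> root"
  obtains z where "z \<notin> \<Omega> k" "infnorm (z - ctr P) \<le> 11 * rad P"
proof -
  have f: "0 < fst P" using subcells_gen0 Wh_in[OF P(1)] P(2) by blast
  have "parent P \<notin> {Q\<in>subcells. five Q \<subseteq> \<Omega> k}" using P(1) f unfolding Wh_def by (intro maxc_parent)
  moreover have "parent P \<in> subcells" using parent_subcells Wh_in[OF P(1)] by blast
  ultimately obtain z where z: "z \<in> five (parent P)" "z \<notin> \<Omega> k" by auto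
  have "infnorm (ctr P - ctr (parent P)) \<le> rad P" using cell_subset_ctr_rad[OF parent_cell[OF f]] rad_parent[OF f] by simp
  hence "infnorm (ctr (parent P) - ctr P) \<le> rad P" by (simp add: infnorm_sub)
  moreover have "infnorm (z - ctr (parent P)) \<le> 10 * rad P" using z(1) rad_parent[OF f] by (simp add: five_def mem_qb)
  ultimately have "infnorm (z - ctr P) \<le> 11 * rad P" using infnorm_triangle_sub[of z "ctr P" "ctr (parent P)"] by linarith
  thus ?thesis using z(2) that by blast
qed

lemma subcells_rad: "Q \<in> subcells \<Longrightarrow> rad Q \<le> rad root"
  using cell_subset_ctr_rad[of Q root] infnorm_pos_le[of "ctr Q - ctr root"] by (simp add: subcells_def)

text \<open>The point near P' outside the level set is also outside \<open>five P\<close>, so 5 rad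
  P < 11 rad P' + 3 rad P' + 3 rad P.\<close>

lemma Wh_comparable:
  assumes "P \<in> Wh k" "P' \<in> Wh k" "x \<in> trip P" "x \<in> trip P'"
  shows "rad P \<le> 7 * rad P'"
proof (cases "P' = root")
  case True
  hence "rad P \<le> rad P'" using subcells_rad[of P] Wh_in[OF assms(1)] by simp
  thus ?thesis using rad_nonneg[of P'] by linarith
next
  case False
  obtain z where z: "z \<notin> \<Omega> k" "infnorm (z - ctr P') \<le> 11 * rad P'" using Wh_witness[OF assms(2) False] .
  have "z \<notin> five P" using z(1) Wh_in[OF assms(1)] by blast
  hence "5 * rad P < infnorm (z - ctr P)" by (simp add: five_def mem_qb)
  moreover have "infnorm (z - ctr P) \<le> infnorm (z - ctr P') + (infnorm (ctr P' - x) + infnorm (x - ctr P))"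
    using infnorm_triangle_sub[of z "ctr P" "ctr P'"] infnorm_triangle_sub[of "ctr P'" "ctr P" x] by linarith
  moreover have "infnorm (x - ctr P) \<le> 3 * rad P" "infnorm (ctr P' - x) \<le> 3 * rad P'" using assms(3,4) by (auto simp: mem_qb infnorm_sub)
  ultimately show ?thesis using z(2) by linarith
qed

text \<open>Packing: cells whose triples share x have radii between r/7 and 7 r, are disjoint and
  lie in a cube of half side 28 r, and 196 is 28 times 7.\<close>

lemma Wh_overlap:
  "(\<Sum>\<^sup>+P\<in>Wh k. indicator (trip P) x) \<le> ennreal (196^CARD('n)) * indicator (\<Omega> k) x"
proof (cases "\<exists>P0\<in>Wh k. x \<in> trip P0")
  case False
  hence "(\<Sum>\<^sup>+P\<in>Wh k. indicator (trip P) x) = (\<Sum>\<^sup>+P\<in>Wh k. 0)" by (intro nn_integral_cong) auto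
  thus ?thesis by simp
next
  case True
  then obtain P0 where P0: "P0 \<in> Wh k" "x \<in> trip P0" by blast
  define r where "r = rad P0"
  have r: "0 < r" by (simp add: r_def)
  define I where "I = {P\<in>Wh k. x \<in> trip P}"
  have x: "x \<in> \<Omega> k" using P0 trip_five[of P0] Wh_in[OF P0(1)] by blast
  have radP: "r / 7 \<le> rad P" "rad P \<le> 7 * r" if "P \<in> I" for P using that P0 Wh_comparable[of P k P0 x] Wh_comparable[of P0 k P x] by (auto simp: I_def r_def)
  have sub: "cell P \<subseteq> qb x (28 * r)" if "P \<in> I" for P
  proof -
    have "infnorm (ctr P - x) \<le> 3 * rad P" using that by (simp add: I_def mem_qb infnorm_sub)
    hence "infnorm (ctr P - x) + rad P \<le> 28 * r" using radP(2)[OF that] by linarith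
    thus ?thesis using cell_subset_qb[of P] qb_mono by blast
  qed
  have "ennreal ((2 * r / 7)^CARD('n)) * (\<Sum>\<^sup>+P\<in>Wh k. indicator (trip P) x)
     = (\<Sum>\<^sup>+P\<in>Wh k. ennreal ((2 * r / 7)^CARD('n)) * indicator (trip P) x)" by (rule nn_integral_cmult[symmetric]) simp
  also have "... \<le> (\<Sum>\<^sup>+P\<in>Wh k. ennreal (cv P) * indicator I P)"
  proof (rule nn_integral_mono)
    fix P assume "P \<in> space (count_space (Wh k))"
    hence iff: "x \<in> trip P \<longleftrightarrow> P \<in> I" by (auto simp: I_def)
    show "ennreal ((2 * r / 7)^CARD('n)) * indicator (trip P) x \<le> ennreal (cv P) * indicator I P"
    proof (cases "P \<in> I")
      case True
      have "(2 * r / 7)^CARD('n) \<le> cv P" using radP[OF True] r by (intro power_mono) auto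
      thus ?thesis using True iff by (simp add: ennreal_leI)
    qed (use iff in auto)
  qed
  also have "... = (\<Sum>\<^sup>+P\<in>I. ennreal (cv P))" by (subst nn_integral_count_space_indicator[of I], simp, subst nn_integral_count_space_indicator, simp)
       (auto intro!: nn_integral_cong simp: indicator_def I_def)
  also have "... = vol (\<Union>P\<in>I. cell P)" by (rule emeasure_cells[symmetric]) (use Wh_disjoint[of k] in \<open>auto simp: disjoint_family_on_def I_def\<close>)
  also have "... \<le> vol (qb x (28 * r))" using sub by (intro emeasure_mono) auto
  also have "... = ennreal ((2 * r / 7)^CARD('n)) * ennreal (196^CARD('n))"
  proof -
    have "2 * (28 * r) = (2 * r / 7) * 196" by simp
    hence "(2 * (28 * r))^CARD('n) = (2 * r / 7)^CARD('n) * 196^CARD('n)" by (simp only: power_mult_distrib)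
    thus ?thesis using r by (simp add: emeasure_qb ennreal_mult[symmetric])
  qed
  finally have "(\<Sum>\<^sup>+P\<in>Wh k. indicator (trip P) x) \<le> ennreal (196^CARD('n))" using r by (subst (asm) ennreal_mult_le_mult_iff) auto
  thus ?thesis using x by simp
qed

text \<open>After restricting g to the triple of P, the weak type bound at level k sees only the
  mass that a point outside the level set j allows near P. The constant 33 is 3 from the weak type
  bound times 11 from \<open>Wh_witness\<close>.\<close>

lemma Wh_density:
  assumes jk: "j \<le> k" and P: "P \<in> Wh j"
  shows "vol (\<Union>Q\<in>{Q\<in>Wh k. cell Q \<subseteq> cell P}. cell Q) \<le> ennreal (33^CARD('n) * (1/2)^(k - j) * cv P)"
proof -
  define V where "V = cv P"
  have V: "0 < V" unfolding V_def by (rule vol_pos)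
  define U where "U = (\<Union>Q\<in>{Q\<in>Wh k. cell Q \<subseteq> cell P}. cell Q)"
  have U_sub: "U \<subseteq> \<Omega> k \<inter> cell P" unfolding U_def using Wh_in[of _ k] cell_five by blast
  have U_sets: "U \<in> sets lebesgue" unfolding U_def by simp
  have levk: "lev k * (1/2)^(k - j) = lev j"
  proof -
    have "(2::real)^k = 2^j * 2^(k - j)" using jk by (simp flip: power_add)
    moreover have "(2::real)^(k - j) * (1/2)^(k - j) = 1" unfolding power_mult_distrib[symmetric] by simp
    ultimately show ?thesis by (simp add: lev_def)
  qed
  have weak: "vol U \<le> ennreal (33^CARD('n) * (1/2)^(k - j) * V)"
    if h [measurable]: "h \<in> lmeas" and Uh: "U \<subseteq> {x. ennreal (lev k) < MM h x}"
      and hi: "(\<integral>y. h y) \<le> ennreal (11^CARD('n) * lev j * V)" for h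
  proof -
    have "ennreal (lev k) * vol U \<le> ennreal (lev k) * vol {x. ennreal (lev k) < MM h x}" using Uh by (intro mult_left_mono emeasure_mono) (auto simp: open_MM)
    also have "... \<le> 3^CARD('n) * (\<integral>y. h y)" by (rule MM_weak_type[OF h])
    also have "... \<le> 3^CARD('n) * ennreal (11^CARD('n) * lev j * V)" by (intro mult_left_mono hi) simp
    also have "... = ennreal (3^CARD('n)) * ennreal (11^CARD('n) * lev j * V)" by (simp add: ennreal_power[symmetric])
    also have "... = ennreal (lev k) * ennreal (33^CARD('n) * (1/2)^(k - j) * V)"
    using lev_pos[of k] lev_pos[of j] V by (auto simp: power_mult_distrib[symmetric] levk[symmetric] ennreal_mult[symmetric])
    finally show ?thesis using lev_pos[of k] by (subst (asm) ennreal_mult_le_mult_iff) auto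
  qed
  have "vol U \<le> ennreal (33^CARD('n) * (1/2)^(k - j) * V)"
  proof (cases "P = root")
    \<comment> \<open>The root has no witness outside the level set; the normalisation of
      \<open>l0\<close> bounds the total mass instead.\<close>
    case True
    show ?thesis
    proof (rule weak[of g])
      show "U \<subseteq> {x. ennreal (lev k) < MM g x}" using U_sub by (auto simp: \<Omega>_def)
      have "10 * rad root = 5 * (2 * rad root)" by simp
      hence "2 * l0 * (10 * rad root)^CARD('n) = 2 * 5^CARD('n) * l0 * V" unfolding V_def True by (simp only: power_mult_distrib[symmetric] mult_ac)
      also have "... \<le> 11^CARD('n) * lev j * V"
      proof -
        have "(2::real) * 5^CARD('n) \<le> 2^CARD('n) * 5^CARD('n)" by (intro mult_right_mono self_le_power) auto
        also have "... = 10^CARD('n)" unfolding power_mult_distrib[symmetric] by simp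
        also have "... \<le> 11^CARD('n)" by (intro power_mono) auto
        finally show ?thesis using V l0_pos lev_mono[of 0 j] by (intro mult_right_mono mult_mono) (auto simp: lev_def)
      qed
      finally show "(\<integral>y. g y) \<le> ennreal (11^CARD('n) * lev j * V)" unfolding g_integral by (rule ennreal_leI)
    qed simp
  next
    case False
    obtain z where z: "z \<notin> \<Omega> j" "infnorm (z - ctr P) \<le> 11 * rad P" using Wh_witness[OF P False] .
    have Mz: "MM g z \<le> ennreal (lev j)" using z(1) by (simp add: \<Omega>_def not_less)
    show ?thesis
    \<comment> \<open>For k close to j the claim follows from the volume of P alone. Otherwise cubes
      of half side at least rad P cannot have average above \<open>lev k\<close>, and the
      localisation of g is possible.\<close>
    proof (cases "13^CARD('n) * (1/2)^(k - j) \<ge> (1::real)")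
      case True
      have "vol U \<le> vol (cell P)" using U_sub by (intro emeasure_mono) auto
      also have "... = ennreal (1 * V)" by (simp add: V_def emeasure_cell)
      also have "... \<le> ennreal (33^CARD('n) * (1/2)^(k - j) * V)"
      proof (intro ennreal_leI mult_right_mono)
        have "(13::real)^CARD('n) \<le> 33^CARD('n)" by (intro power_mono) auto
        hence "(13::real)^CARD('n) * (1/2)^(k - j) \<le> 33^CARD('n) * (1/2)^(k - j)" by (intro mult_right_mono) auto
        thus "1 \<le> (33::real)^CARD('n) * (1/2)^(k - j)" using True by linarith
      qed (use V in auto)
      finally show ?thesis .
    next
      case small: False
      show ?thesis
      proof (rule weak[of "\<lambda>y. g y * indicator (trip P) y"])
        show "U \<subseteq> {x. ennreal (lev k) < MM (\<lambda>y. g y * indicator (trip P) y) x}"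
        proof clarify
          fix x assume "x \<in> U"
          hence x: "ennreal (lev k) < MM g x" "x \<in> cell P" using U_sub by (auto simp: \<Omega>_def)
          obtain c r where cr: "0 < r" "x \<in> qb c r" "ennreal (lev k) * ennreal ((2*r)^CARD('n)) < (\<integral>y\<in>qb c r. g y)"
            using x(1) unfolding less_MM_iff by blast
          have xP: "infnorm (x - ctr P) \<le> rad P" using subsetD[OF cell_subset_qb x(2)] by (simp add: mem_qb)
          have xc: "infnorm (x - c) \<le> r" using cr(2) by (simp add: mem_qb)
          \<comment> \<open>A cube of half side at least rad P reaches z after dilation by 13, since
            13 = 1 + 1 + 11, and z caps its average by 13^n \<open>lev j\<close>, which is less than
            \<open>lev k\<close>.\<close>
          have "r < rad P"
          proof (rule ccontr)
            assume "\<not> r < rad P"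
            hence "infnorm (z - c) \<le> 13 * r"
              using z(2) xP xc infnorm_triangle_sub[of z c x] infnorm_triangle_sub[of z x "ctr P"] infnorm_sub[of x "ctr P"] by linarith
            hence "(\<integral>y\<in>qb c (13 * r). g y) \<le> MM g z * ennreal ((2*(13*r))^CARD('n))" using cr(1) by (intro MM_upper) (auto simp: mem_qb)
            also have "... \<le> ennreal (lev j) * ennreal ((2*(13*r))^CARD('n))" by (intro mult_right_mono Mz) auto
            finally have 1: "(\<integral>y\<in>qb c (13 * r). g y) \<le> ennreal (lev j) * ennreal ((2*(13*r))^CARD('n))" .
            have "(\<integral>y\<in>qb c r. g y) \<le> (\<integral>y\<in>qb c (13 * r). g y)" using cr(1) by (intro nn_integral_mono_set qb_mono_radius) auto
            hence "ennreal (lev k) * ennreal ((2*r)^CARD('n)) < ennreal (lev j) * ennreal ((2*(13*r))^CARD('n))" using cr(3) 1 by (meson less_le_trans)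
            hence "lev k * (2*r)^CARD('n) < lev j * (2*(13*r))^CARD('n)" using lev_pos[of k] lev_pos[of j] cr(1) by (simp add: ennreal_mult[symmetric] ennreal_less_iff)
            also have "2*(13*r) = 13 * (2 * r)" by simp
            finally have "lev k * (2*r)^CARD('n) < lev k * ((1/2)^(k - j) * 13^CARD('n)) * (2*r)^CARD('n)"
              unfolding levk[symmetric] power_mult_distrib[of 13 "2*r"] by (simp add: mult_ac)
            hence "lev k < lev k * ((1/2)^(k - j) * 13^CARD('n))" using cr(1) by (subst (asm) mult_less_cancel_right_pos) auto
            hence "1 < (1/2)^(k - j) * (13::real)^CARD('n)" using lev_pos[of k] by simp
            thus False using small by (simp add: mult.commute)
          qed
          hence "infnorm (c - ctr P) + r \<le> 3 * rad P" using xP xc infnorm_triangle_sub[of c "ctr P" x] infnorm_sub[of c x] by linarith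
          hence "qb c r \<subseteq> trip P" by (rule qb_mono)
          hence "(\<integral>y\<in>qb c r. g y) = (\<integral>y\<in>qb c r. g y * indicator (trip P) y)" by (intro nn_integral_cong) (auto simp: indicator_def)
          thus "ennreal (lev k) < MM (\<lambda>y. g y * indicator (trip P) y) x" unfolding less_MM_iff using cr by (intro exI[of _ c] exI[of _ r]) simp
        qed
        have "(\<integral>y\<in>trip P. g y) \<le> (\<integral>y\<in>qb (ctr P) (11 * rad P). g y)" by (intro nn_integral_mono_set qb_mono_radius) auto
        also have "... \<le> MM g z * ennreal ((2*(11*rad P))^CARD('n))" using z(2) by (intro MM_upper) (auto simp: mem_qb)
        also have "... \<le> ennreal (lev j) * ennreal ((2*(11*rad P))^CARD('n))" by (intro mult_right_mono Mz) auto
        also have "... = ennreal (11^CARD('n) * lev j * V)"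
        proof -
          have "2*(11*rad P) = 11 * (2 * rad P)" by simp
          hence "(2*(11*rad P))^CARD('n) = 11^CARD('n) * V" by (simp only: power_mult_distrib V_def)
          thus ?thesis using lev_pos[of j] V by (simp add: ennreal_mult[symmetric] mult_ac)
        qed
        finally show "(\<integral>y. g y * indicator (trip P) y) \<le> ennreal (11^CARD('n) * lev j * V)" .
      qed simp
    qed
  qed
  thus ?thesis by (simp add: U_def V_def)
qed

section \<open>Descent of the weighted tail sums through the levels\<close>

definition S :: "nat \<Rightarrow> ennreal" where
  "S k = (\<Sum>\<^sup>+Q\<in>Wh k. kq Q)"

lemma Wh_partition_le:
  assumes "j \<le> k"
  shows "(\<Sum>\<^sup>+Q\<in>Wh k. \<phi> Q)
    \<le> (\<integral>\<^sup>+P. (\<integral>\<^sup>+Q. \<phi> Q \<partial>count_space {Q\<in>Wh k. cell Q \<subseteq> cell P}) \<partial>count_space (Wh j))"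
proof -
  have "(\<Sum>\<^sup>+Q\<in>Wh k. \<phi> Q)
    \<le> (\<integral>\<^sup>+Q. (\<Sum>\<^sup>+P\<in>Wh j. \<phi> Q * of_bool (cell Q \<subseteq> cell P)) \<partial>count_space (Wh k))"
  proof (rule nn_integral_mono)
    fix Q assume "Q \<in> space (count_space (Wh k))"
    hence "Q \<in> Wh k" by simp
    from Wh_ancestor[OF assms this] obtain P where P: "P \<in> Wh j" "cell Q \<subseteq> cell P" by blast
    have "\<phi> Q * of_bool (cell Q \<subseteq> cell P) \<le> (\<Sum>\<^sup>+P\<in>Wh j. \<phi> Q * of_bool (cell Q \<subseteq> cell P))"
      by (rule nn_integral_ge_point[OF P(1)])
    thus "\<phi> Q \<le> (\<Sum>\<^sup>+P\<in>Wh j. \<phi> Q * of_bool (cell Q \<subseteq> cell P))" using P(2) by simp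
  qed
  also have "... = (\<integral>\<^sup>+P. (\<Sum>\<^sup>+Q\<in>Wh k. \<phi> Q * of_bool (cell Q \<subseteq> cell P)) \<partial>count_space (Wh j))"
    by (rule nn_integral_count_space_nn_integral) auto
  also have "... = (\<integral>\<^sup>+P. (\<integral>\<^sup>+Q. \<phi> Q \<partial>count_space {Q\<in>Wh k. cell Q \<subseteq> cell P}) \<partial>count_space (Wh j))"
  proof (rule nn_integral_cong)
    fix P
    show "(\<Sum>\<^sup>+Q\<in>Wh k. \<phi> Q * of_bool (cell Q \<subseteq> cell P)) = (\<integral>\<^sup>+Q. \<phi> Q \<partial>count_space {Q\<in>Wh k. cell Q \<subseteq> cell P})"
      by (subst nn_integral_count_space_indicator[of "Wh k"], simp, subst nn_integral_count_space_indicator, simp)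
         (auto intro!: nn_integral_cong simp: indicator_def of_bool_def)
  qed
  finally show ?thesis .
qed

lemma HH_split:
  "(\<Sum>\<^sup>+Q\<in>F. kq Q)
    = (\<integral>y. w y * indicator (trip P) y * HH F y) + (\<integral>y. w y * indicator (- trip P) y * HH F y)"
proof -
  have "(\<Sum>\<^sup>+Q\<in>F. kq Q) = (\<integral>y. w y * HH F y)" unfolding kint_def HH_integral[OF w_meas] ..
  also have "... = (\<integral>y. w y * indicator (trip P) y * HH F y + w y * indicator (- trip P) y * HH F y)" by (intro nn_integral_cong) (auto simp: indicator_def)
  also have "... = (\<integral>y. w y * indicator (trip P) y * HH F y) + (\<integral>y. w y * indicator (- trip P) y * HH F y)"
  proof (rule nn_integral_add)
    have "- trip P \<in> sets lebesgue" by simp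
    thus "(\<lambda>y. w y * indicator (- trip P) y * HH F y) \<in> lmeas" by measurable
  qed measurable
  finally show ?thesis .
qed

text \<open>Cells of level k are grouped below those of level j. Near each P the profiles are cut at
  height L, and the resulting weights of triples sum by bounded overlap to the weight of \<Omega> j;
  far from P the density of \<open>Wh_density\<close> gives the gain.\<close>

lemma S_step:
  assumes jk: "j \<le> k" and L: "1 \<le> L"
  shows "S k \<le> ennreal (L * 196^CARD('n)) * (\<integral>x\<in>\<Omega> j. w x)
    + ennreal (mA CARD('n) \<sigma> * W * (1 + W / mB CARD('n) \<sigma>) * exp (- mB CARD('n) \<sigma> * L / W)
        + (3/2) powr \<sigma> * (33^CARD('n) * (1/2)^(k - j)) powr (\<sigma> / CARD('n))) * S j"
    (is "_ \<le> _ + ennreal (?\<delta> + ?\<phi>) * _")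
proof -
  have d0: "0 \<le> ?\<delta>" using mA_pos[OF \<sigma>_gt] mB_pos[OF \<sigma>_gt] W_ge1 by (intro mult_nonneg_nonneg add_nonneg_nonneg) auto
  have each: "(\<integral>\<^sup>+Q. kq Q \<partial>count_space {Q\<in>Wh k. cell Q \<subseteq> cell P})
     \<le> ennreal L * (\<integral>y\<in>trip P. w y) + ennreal (?\<delta> + ?\<phi>) * kq P" if P: "P \<in> Wh j" for P
  proof -
    let ?F = "{Q\<in>Wh k. cell Q \<subseteq> cell P}"
    have F: "disjoint_family_on cell ?F" "\<And>Q. Q \<in> ?F \<Longrightarrow> cell Q \<subseteq> cell P" using Wh_disjoint[of k] by (auto simp: disjoint_family_on_def)
    have "(\<integral>y. w y * indicator (- trip P) y * HH ?F y) \<le> ennreal ?\<phi> * kq P" using Wh_density[OF jk P] by (intro weight_HH_far F) auto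
    hence "(\<integral>\<^sup>+Q. kq Q \<partial>count_space ?F)
      \<le> (ennreal L * (\<integral>y\<in>trip P. w y) + ennreal ?\<delta> * kq P) + ennreal ?\<phi> * kq P"
      unfolding HH_split[of ?F P] by (intro add_mono weight_HH_excess F L)
    also have "... = ennreal L * (\<integral>y\<in>trip P. w y) + ennreal (?\<delta> + ?\<phi>) * kq P" using d0 by (simp add: distrib_right add.assoc)
    finally show ?thesis .
  qed
  have "S k \<le> (\<Sum>\<^sup>+P\<in>Wh j. ennreal L * (\<integral>y\<in>trip P. w y) + ennreal (?\<delta> + ?\<phi>) * kq P)"
    unfolding S_def by (rule order_trans[OF Wh_partition_le[OF jk]]) (intro nn_integral_mono each, simp)
  also have "... = ennreal L * (\<Sum>\<^sup>+P\<in>Wh j. (\<integral>y\<in>trip P. w y)) + ennreal (?\<delta> + ?\<phi>) * S j"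
    unfolding S_def by (simp add: nn_integral_add nn_integral_cmult)
  also have "(\<Sum>\<^sup>+P\<in>Wh j. (\<integral>y\<in>trip P. w y)) = (\<integral>y. (\<Sum>\<^sup>+P\<in>Wh j. w y * indicator (trip P) y))"
    by (rule nn_integral_count_space_nn_integral[symmetric]) auto
  also have "... = (\<integral>y. w y * (\<Sum>\<^sup>+P\<in>Wh j. indicator (trip P) y))" by (simp add: nn_integral_cmult)
  also have "ennreal L * ... + ennreal (?\<delta> + ?\<phi>) * S j \<le> ennreal L * (\<integral>y. ennreal (196^CARD('n)) * (w y * indicator (\<Omega> j) y)) + ennreal (?\<delta> + ?\<phi>) * S j"
  proof (intro add_right_mono mult_left_mono nn_integral_mono)
    fix y
    show "w y * (\<Sum>\<^sup>+P\<in>Wh j. indicator (trip P) y) \<le> ennreal (196^CARD('n)) * (w y * indicator (\<Omega> j) y)"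
      using mult_left_mono[OF Wh_overlap[where x=y and k=j], of "w y"] by (simp add: mult_ac)
  qed simp
  also have "... = ennreal (L * 196^CARD('n)) * (\<integral>x\<in>\<Omega> j. w x) + ennreal (?\<delta> + ?\<phi>) * S j"
    using L by (subst nn_integral_cmult) (auto simp: ennreal_mult mult.assoc)
  finally show ?thesis .
qed

lemma Wh_sub_root: "Q \<in> Wh k \<Longrightarrow> cell Q \<subseteq> cell root" using Wh_in[of Q k] by (simp add: subcells_def)

lemma S_root: "S k \<le> ennreal (sR CARD('n) \<sigma> * W) * kq root"
proof -
  let ?C = "kC CARD('n) (\<sigma> - CARD('n))" and ?A = "kq root"
  have "vol (\<Union>Q\<in>Wh k. cell Q) \<le> vol (cell root)" using Wh_sub_root by (intro emeasure_mono) auto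
  hence d: "vol (\<Union>Q\<in>Wh k. cell Q) \<le> ennreal (1 * cv root)" by (simp add: emeasure_cell)
  have "S k \<le> ennreal (?C * W * 3 powr \<sigma>) * ?A + ennreal ((3/2) powr \<sigma> * 1 powr (\<sigma> / CARD('n))) * ?A"
    unfolding S_def HH_split[of "Wh k" root] by (intro add_mono weight_HH_near weight_HH_far Wh_disjoint Wh_sub_root d) auto
  also have "... = ennreal (?C * W * 3 powr \<sigma> + (3/2) powr \<sigma>) * ?A" using Ce_ge1 W_ge1 by (simp add: distrib_right)
  also have "... \<le> ennreal (sR CARD('n) \<sigma> * W) * ?A"
    using W_ge1 by (intro mult_right_mono ennreal_leI) (simp_all add: sR_def algebra_simps mult_le_cancel_right1)
  finally show ?thesis .
qed

definition Nrm :: ennreal where "Nrm = (\<integral>x. ennreal_powr (MM g x) p * w x)"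

text \<open>M g decays no faster than the profile with exponent n, whose p-th power dominates the
  profile with exponent \<sigma>, as n p < \<sigma>. The first levels of the Whitney sum are paid
  for by this.\<close>

lemma root_le_Nrm: "ennreal (l0 powr p) * kq root \<le> Nrm"
proof -
  have "ennreal (l0 powr p) * kq root = (\<integral>y. ennreal (l0 powr p) * (w y * ennreal (kp root y)))"
    unfolding kint_def by (rule nn_integral_cmult[symmetric]) measurable
  also have "... \<le> Nrm" unfolding Nrm_def
  proof (rule nn_integral_mono, goal_cases)
    case (1 y)
    define x where "x = rad root / max (rad root) (infnorm (y - ctr root))"
    have x: "0 < x" "x \<le> 1" using rad_pos[of root] by (auto simp: x_def less_max_iff_disj)
    have kn: "kap CARD('n) (ctr root) (rad root) y = x powr CARD('n)" by (simp add: kap_def x_def)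
    have "kp root y = x powr \<sigma>" by (simp add: kap_def x_def)
    also have "... \<le> x powr (CARD('n) * p)" using x \<sigma>_gt_p by (intro powr_mono') auto
    also have "... = (kap CARD('n) (ctr root) (rad root) y) powr p" unfolding kn by (simp add: powr_powr)
    finally have "l0 powr p * kp root y \<le> (l0 * kap CARD('n) (ctr root) (rad root) y) powr p" using l0_pos by (simp add: powr_mult mult_left_mono)
    moreover have "ennreal ((l0 * kap CARD('n) (ctr root) (rad root) y) powr p) \<le> ennreal_powr (MM g y) p"
    proof (rule ennreal_powr_ge[OF _ _ p_pos])
      have "1 \<le> 2 * (5::real)^CARD('n)" by (rule order_trans[OF _ mult_mono[of 1 _ 1]]) (auto intro: one_le_power)
      hence "1 * (l0 * kap CARD('n) (ctr root) (rad root) y) \<le> 2 * 5^CARD('n) * (l0 * kap CARD('n) (ctr root) (rad root) y)"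
        using l0_pos by (intro mult_right_mono) auto
      thus "ennreal (l0 * kap CARD('n) (ctr root) (rad root) y) \<le> MM g y" by (intro order_trans[OF _ MM_g_ge[of y]] ennreal_leI) (simp add: mult_ac)
    qed (use l0_pos in auto)
    ultimately have "ennreal (l0 powr p * kp root y) \<le> ennreal_powr (MM g y) p" by (meson ennreal_leI order_trans)
    hence "ennreal (l0 powr p * kp root y) * w y \<le> ennreal_powr (MM g y) p * w y" by (rule mult_right_mono) simp
    thus ?case by (simp add: ennreal_mult mult_ac)
  qed
  finally show ?thesis .
qed

lemma levels_le_Nrm:
  "(\<Sum>j<J. ennreal (lev j powr p) * (\<integral>x\<in>\<Omega> j. w x)) \<le> ennreal (1 / (1 - 2 powr - p)) * Nrm"
proof -
  have "(\<Sum>j<J. ennreal (lev j powr p) * (\<integral>x\<in>\<Omega> j. w x))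
     = (\<integral>x. (\<Sum>j<J. ennreal (lev j powr p) * (w x * indicator (\<Omega> j) x)))" by (subst nn_integral_sum) (auto simp: nn_integral_cmult)
  also have "... \<le> (\<integral>x. ennreal (1 / (1 - 2 powr - p)) * (ennreal_powr (MM g x) p * w x))"
  proof (rule nn_integral_mono, goal_cases)
    case (1 x)
    have "MM g x < top" using MM_g_le[of x] by (rule order_le_less_trans) simp
    then obtain m where m: "MM g x = ennreal m" "0 \<le> m" by (cases "MM g x") auto
    have "(\<Sum>j<J. ennreal (lev j powr p) * indicator (\<Omega> j) x) = (\<Sum>j<J. ennreal ((l0 * 2^j) powr p * of_bool (l0 * 2^j < m)))"
      using l0_pos m by (intro sum.cong) (auto simp: indicator_def \<Omega>_def lev_def ennreal_less_iff)
    also have "... = ennreal (\<Sum>j<J. (l0 * 2^j) powr p * of_bool (l0 * 2^j < m))" by (rule sum_ennreal) simp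
    also have "... \<le> ennreal (1 / (1 - 2 powr - p) * m powr p)" by (intro ennreal_leI sum_levels_le l0_pos p_pos m)
    also have "... = ennreal (1 / (1 - 2 powr - p)) * ennreal (m powr p)" using p_pos powr_less_mono[of "- p" 0 2] by (intro ennreal_mult) auto
    also have "ennreal (m powr p) = ennreal_powr (MM g x) p" using m by (simp add: ennreal_powr_def)
    finally have "w x * (\<Sum>j<J. ennreal (lev j powr p) * indicator (\<Omega> j) x) \<le> w x * (ennreal (1 / (1 - 2 powr - p)) * ennreal_powr (MM g x) p)"
      by (rule mult_left_mono) simp
    moreover have "(\<Sum>j<J. ennreal (lev j powr p) * (w x * indicator (\<Omega> j) x)) = w x * (\<Sum>j<J. ennreal (lev j powr p) * indicator (\<Omega> j) x)"
      unfolding sum_distrib_left by (intro sum.cong) (simp_all only: mult_ac)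
    ultimately show ?case by (simp only: mult_ac)
  qed
  also have "... = ennreal (1 / (1 - 2 powr - p)) * Nrm" unfolding Nrm_def by (rule nn_integral_cmult) measurable
  finally show ?thesis .
qed

text \<open>Levels from N on are compared with those N steps earlier; the coefficient q (\<delta> +
  \<phi>) is at most 1/2 and the sum is absorbed into itself. The first N levels are charged to the
  root. The bound is uniform in K.\<close>

theorem Whitney_sum_le:
  "(\<Sum>k<K. ennreal (lev k powr p) * S k) \<le> ennreal (sC CARD('n) p \<sigma> * W^2) * Nrm"
proof -
  define N where "N = sN CARD('n) p \<sigma>"
  define c where "c = scL CARD('n) p \<sigma>"
  define q where "q = (2 powr p)^N"
  define L where "L = c * W^2"
  define R where "R = sR CARD('n) \<sigma>"
  define Cp where "Cp = 1 / (1 - 2 powr - p)"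
  define A where "A = kq root"
  define e where "e k = ennreal (lev k powr p)" for k
  define \<Phi> where "\<Phi> = (\<Sum>k<K. e k * S k)"
  define \<delta> where "\<delta> = mA CARD('n) \<sigma> * W * (1 + W / mB CARD('n) \<sigma>) * exp (- mB CARD('n) \<sigma> * L / W)"
  define \<phi> where "\<phi> = (3/2) powr \<sigma> * (33^CARD('n) * (1/2)^N) powr (\<sigma> / CARD('n))"
  have c: "1 \<le> c" using scL_ge1[OF \<sigma>_gt] by (simp add: c_def)
  have W2: "1 \<le> W^2" using W_ge1 by simp
  have L: "1 \<le> L" unfolding L_def by (rule order_trans[OF _ mult_mono[of 1 _ 1]]) (use c W2 in auto)
  have q: "0 < q" by (simp add: q_def)
  have q1: "1 \<le> q" unfolding q_def using p_pos by (intro one_le_power ge_one_powr_ge_zero) auto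
  have R: "0 \<le> R" using Ce_ge1 by (simp add: R_def sR_def)
  have Cp: "0 \<le> Cp" using p_pos powr_less_mono[of "- p" 0 2] by (simp add: Cp_def)
  have d0: "0 \<le> \<delta>" unfolding \<delta>_def using mA_pos[OF \<sigma>_gt] mB_pos[OF \<sigma>_gt] W_ge1 by (intro mult_nonneg_nonneg add_nonneg_nonneg) auto
  have qd: "q * \<delta> \<le> 1/4" using scL_decay[OF \<sigma>_gt W_ge1, of p] by (simp add: q_def \<delta>_def L_def c_def N_def)
  have q\<phi>: "q * \<phi> \<le> 1/4" using sN[of "CARD('n)" p \<sigma>] \<sigma>_gt_p by (simp add: q_def \<phi>_def N_def)
  have q\<delta>\<phi>: "q * (\<delta> + \<phi>) \<le> 1/2" using qd q\<phi> by (simp add: distrib_left)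
  have eN: "e (j + N) = ennreal q * e j" for j
  proof -
    have "lev (j + N) = 2^N * lev j" by (simp add: lev_def power_add)
    hence "lev (j + N) powr p = (2^N) powr p * lev j powr p" using lev_pos[of j] by (simp add: powr_mult)
    also have "(2^N) powr p = q" by (simp add: q_def powr_realpow[symmetric] powr_powr mult.commute)
    finally show ?thesis using q by (simp add: e_def ennreal_mult)
  qed
  have Afin: "A < top" using kint_finite[of "rad root" "ctr root"] by (simp add: A_def)
  \<comment> \<open>Absorption is licit because finitely many levels are summed and each is finite
    by \<open>S_root\<close>.\<close>
  have fin: "\<Phi> < top"
  proof -
    have "S k < top" for k using Afin S_root[of k] by (auto simp: ennreal_mult_less_top A_def order_le_less_trans)
    thus ?thesis by (simp add: \<Phi>_def e_def ennreal_mult_less_top)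
  qed
  have base: "e k * S k \<le> ennreal (q * R * W) * Nrm" if "k < N" for k
  proof -
    have "lev k \<le> lev N" using that by (intro lev_mono) simp
    hence "lev k powr p \<le> lev N powr p" using lev_pos[of k] p_pos by (intro powr_mono2) auto
    hence "e k \<le> e N" by (simp add: e_def ennreal_leI)
    also have "... = ennreal q * e 0" using eN[of 0] by simp
    finally have "e k * S k \<le> ennreal q * e 0 * (ennreal (R * W) * A)" using S_root[of k] by (intro mult_mono) (auto simp: R_def A_def)
    also have "... = ennreal (q * R * W) * (e 0 * A)" using q R W_ge1 by (simp add: ennreal_mult mult_ac)
    also have "... \<le> ennreal (q * R * W) * Nrm" using root_le_Nrm by (intro mult_left_mono) (auto simp: e_def A_def lev_def)
    finally show ?thesis .
  qed
  have step: "e (j + N) * S (j + N) \<le> ennreal (q * (L * 196^CARD('n))) * (e j * (\<integral>x\<in>\<Omega> j. w x)) + ennreal (1/2) * (e j * S j)" for j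
  proof -
    have "e (j + N) * S (j + N) \<le> ennreal q * e j * (ennreal (L * 196^CARD('n)) * (\<integral>x\<in>\<Omega> j. w x) + ennreal (\<delta> + \<phi>) * S j)"
      unfolding eN using S_step[of j "j + N" L] L by (intro mult_left_mono) (simp_all add: \<delta>_def \<phi>_def)
    also have "... = ennreal (q * (L * 196^CARD('n))) * (e j * (\<integral>x\<in>\<Omega> j. w x)) + ennreal (q * (\<delta> + \<phi>)) * (e j * S j)"
    proof -
      have "ennreal (q * (L * 196^CARD('n))) = ennreal q * ennreal (L * 196^CARD('n))" using q L by (intro ennreal_mult) auto
      moreover have "ennreal (q * (\<delta> + \<phi>)) = ennreal q * ennreal (\<delta> + \<phi>)" using q d0 by (intro ennreal_mult) (auto simp: \<phi>_def)
      ultimately show ?thesis by (simp only: distrib_left mult_ac)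
    qed
    also have "... \<le> ennreal (q * (L * 196^CARD('n))) * (e j * (\<integral>x\<in>\<Omega> j. w x)) + ennreal (1/2) * (e j * S j)"
      using q\<delta>\<phi> by (intro add_left_mono mult_right_mono ennreal_leI) auto
    finally show ?thesis .
  qed
  have "\<Phi> \<le> (\<Sum>k<N. ennreal (q * R * W) * Nrm) + (\<Sum>j<K - N. e (j + N) * S (j + N))"
  proof -
    have "\<Phi> = (\<Sum>k\<in>{..<K} \<inter> {..<N}. e k * S k) + (\<Sum>k\<in>{..<K} - {..<N}. e k * S k)" unfolding \<Phi>_def by (rule sum.Int_Diff) simp
    also have "(\<Sum>k\<in>{..<K} - {..<N}. e k * S k) = (\<Sum>j<K - N. e (j + N) * S (j + N))"
      by (rule sum.reindex_bij_witness[of _ "\<lambda>j. j + N" "\<lambda>k. k - N"]) auto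
    also have "(\<Sum>k\<in>{..<K} \<inter> {..<N}. e k * S k) \<le> (\<Sum>k\<in>{..<K} \<inter> {..<N}. ennreal (q * R * W) * Nrm)" by (intro sum_mono base) auto
    also have "... \<le> (\<Sum>k<N. ennreal (q * R * W) * Nrm)" by (intro sum_mono2) auto
    finally show ?thesis by (simp add: add_right_mono)
  qed
  also have "... \<le> (\<Sum>k<N. ennreal (q * R * W) * Nrm) + (ennreal (q * (L * 196^CARD('n)) * Cp) * Nrm + ennreal (1/2) * \<Phi>)"
  proof (rule add_left_mono)
    have "(\<Sum>j<K - N. e (j + N) * S (j + N)) \<le> (\<Sum>j<K - N. ennreal (q * (L * 196^CARD('n))) * (e j * (\<integral>x\<in>\<Omega> j. w x)) + ennreal (1/2) * (e j * S j))"
      by (intro sum_mono step)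
    also have "... = ennreal (q * (L * 196^CARD('n))) * (\<Sum>j<K - N. e j * (\<integral>x\<in>\<Omega> j. w x)) + ennreal (1/2) * (\<Sum>j<K - N. e j * S j)"
      by (simp only: sum.distrib sum_distrib_left)
    also have "... \<le> ennreal (q * (L * 196^CARD('n))) * (ennreal Cp * Nrm) + ennreal (1/2) * \<Phi>"
    proof (intro add_mono mult_left_mono)
      show "(\<Sum>j<K - N. e j * (\<integral>x\<in>\<Omega> j. w x)) \<le> ennreal Cp * Nrm" using levels_le_Nrm unfolding e_def Cp_def .
      show "(\<Sum>j<K - N. e j * S j) \<le> \<Phi>" unfolding \<Phi>_def by (rule sum_mono2) auto
    qed auto
    also have "ennreal (q * (L * 196^CARD('n))) * (ennreal Cp * Nrm) = ennreal (q * (L * 196^CARD('n)) * Cp) * Nrm" using q L Cp by (intro ennreal_mult_assoc) auto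
    finally show "(\<Sum>j<K - N. e (j + N) * S (j + N)) \<le> ennreal (q * (L * 196^CARD('n)) * Cp) * Nrm + ennreal (1/2) * \<Phi>" .
  qed
  finally have "\<Phi> \<le> ((\<Sum>k<N. ennreal (q * R * W) * Nrm) + ennreal (q * (L * 196^CARD('n)) * Cp) * Nrm) + ennreal (1/2) * \<Phi>" by (simp add: add.assoc)
  from ennreal_absorb_half[OF fin this]
  have "\<Phi> \<le> 2 * ((\<Sum>k<N. ennreal (q * R * W) * Nrm) + ennreal (q * (L * 196^CARD('n)) * Cp) * Nrm)" .
  also have "... = ennreal (2 * (real N * (q * R * W) + q * (L * 196^CARD('n)) * Cp)) * Nrm"
  proof -
    have "(\<Sum>k<N. ennreal (q * R * W) * Nrm) = ennreal (real N * (q * R * W)) * Nrm"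
      using q R W_ge1 by (simp add: ennreal_mult ennreal_of_nat_eq_real_of_nat mult.assoc)
    moreover have "0 \<le> real N * (q * R * W)" "0 \<le> q * (L * 196^CARD('n)) * Cp" using q R W_ge1 L Cp by auto
    moreover from this(1,2) have "ennreal (2 * (real N * (q * R * W) + q * (L * 196^CARD('n)) * Cp))
       = 2 * (ennreal (real N * (q * R * W)) + ennreal (q * (L * 196^CARD('n)) * Cp))"
      by (simp only: ennreal_mult ennreal_plus zero_le_numeral add_nonneg_nonneg ennreal_numeral)
    ultimately show ?thesis by (simp only: distrib_left distrib_right mult.assoc)
  qed
  also have "... \<le> ennreal (sC CARD('n) p \<sigma> * W^2) * Nrm"
  proof (intro mult_right_mono ennreal_leI)
    have "W \<le> W^2" using W_ge1 by (simp add: power2_eq_square)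
    hence "real N * (q * R * W) \<le> real N * (q * R * W^2)" using q R by (intro mult_left_mono) auto
    thus "2 * (real N * (q * R * W) + q * (L * 196^CARD('n)) * Cp) \<le> sC CARD('n) p \<sigma> * W^2"
      by (simp add: sC_def N_def[symmetric] q_def[symmetric] R_def[symmetric] c_def[symmetric] Cp_def[symmetric] L_def algebra_simps)
  qed simp
  finally show ?thesis by (simp add: \<Phi>_def e_def)
qed

end

section \<open>Smooth cutoffs\<close>

text \<open>A class closed under partial derivatives by construction, over a set B whose derivatives
  are to stay in the class; membership replaces the bookkeeping of mixed derivatives. The rule
  \<open>flat\<close> has a free power m because differentiating exp(-1/t) t^(-m) raises it.\<close>

inductive smcl :: "(real^'n \<Rightarrow> complex) set \<Rightarrow> (real^'n \<Rightarrow> complex) \<Rightarrow> bool" for B where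
  base: "f \<in> B \<Longrightarrow> smcl B f"
| const: "smcl B (\<lambda>x. c)"
| coord: "smcl B (\<lambda>x. of_real (x$i))"
| add: "smcl B f \<Longrightarrow> smcl B g \<Longrightarrow> smcl B (\<lambda>x. f x + g x)"
| mult: "smcl B f \<Longrightarrow> smcl B g \<Longrightarrow> smcl B (\<lambda>x. f x * g x)"
| re: "smcl B f \<Longrightarrow> smcl B (\<lambda>x. of_real (Re (f x)))"
| inv: "smcl B f \<Longrightarrow> (\<And>x. f x \<noteq> 0) \<Longrightarrow> smcl B (\<lambda>x. inverse (f x))"
| flat: "smcl B f \<Longrightarrow> smcl B (\<lambda>x. of_real (if Re (f x) > 0 then exp (- 1 / Re (f x)) / Re (f x)^m else 0))"

definition flat_fun :: "nat \<Rightarrow> real \<Rightarrow> real" where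
  "flat_fun m t = (if t > 0 then exp (- 1 / t) / t^m else 0)"

text \<open>The term of order m + 2 in the series of exp(1/t) gives quadratic vanishing at 0, which
  is what makes the derivative at the origin 0.\<close>

lemma flat_fun_bounds: "0 \<le> flat_fun m t" "flat_fun m t \<le> fact (m + 2) * t^2"
proof -
  show "0 \<le> flat_fun m t" by (simp add: flat_fun_def)
  show "flat_fun m t \<le> fact (m + 2) * t^2"
  proof (cases "t > 0")
    case True
    have "(1/t)^(m+2) / fact (m+2) \<le> (\<Sum>k<Suc (m+2). (1/t)^k / fact k)" using True by (intro member_le_sum) auto
    also have "... \<le> exp (1/t)"
    proof -
      have s: "(\<lambda>k. (1/t)^k / fact k) sums exp (1/t)" using exp_converges[of "1/t"] by (simp add: divide_inverse mult.commute)
      have "(\<Sum>k<Suc (m+2). (1/t)^k / fact k) \<le> (\<Sum>k. (1/t)^k / fact k)" using True by (intro sum_le_suminf sums_summable[OF s]) auto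
      also have "... = exp (1/t)" using s by (rule sums_unique[symmetric])
      finally show ?thesis .
    qed
    finally have *: "(1/t)^(m+2) / fact (m+2) \<le> exp (1/t)" .
    have pos: "0 < (1/t)^(m+2) / fact (m+2)" using True by simp
    have "exp (- 1 / t) = 1 / exp (1/t)" by (simp add: exp_minus inverse_eq_divide)
    also have "... \<le> 1 / ((1/t)^(m+2) / fact (m+2))" by (intro divide_left_mono[OF *] mult_pos_pos pos exp_gt_zero zero_le_one)
    also have "... = fact (m+2) * t^(m+2)" using True by (simp add: power_one_over)
    finally have "exp (- 1 / t) / t^m \<le> fact (m+2) * t^(m+2) / t^m" using True by (intro divide_right_mono) auto
    also have "... = fact (m+2) * t^2" using True by (simp add: power_add power2_eq_square)
    finally show ?thesis using True by (simp add: flat_fun_def)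
  qed (simp add: flat_fun_def)
qed

lemma flat_fun_deriv: "(flat_fun m has_real_derivative (flat_fun (m+2) t - real m * flat_fun (m+1) t)) (at t)"
proof -
  consider "t > 0" | "t < 0" | "t = 0" by linarith
  thus ?thesis
  proof cases
    case 1
    have "((\<lambda>t. exp (- 1 / t) / t^m) has_real_derivative (exp (- 1 / t) * (1 / t^2) * t^m - exp (- 1 / t) * (real m * t^(m - 1))) / (t^m * t^m)) (at t)"
      using 1 by (auto intro!: derivative_eq_intros simp: power2_eq_square)
    moreover have "(exp (- 1 / t) * (1 / t^2) * t^m - exp (- 1 / t) * (real m * t^(m - 1))) / (t^m * t^m) = flat_fun (m+2) t - real m * flat_fun (m+1) t"
      using 1 by (cases m) (auto simp: flat_fun_def field_simps power2_eq_square)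
    ultimately have "((\<lambda>t. exp (- 1 / t) / t^m) has_real_derivative (flat_fun (m+2) t - real m * flat_fun (m+1) t)) (at t)" by simp
    thus ?thesis by (rule has_field_derivative_transform_within_open[where S="{0<..}"]) (use 1 in \<open>auto simp: flat_fun_def\<close>)
  next
    case 2
    have "((\<lambda>t. 0) has_real_derivative (flat_fun (m+2) t - real m * flat_fun (m+1) t)) (at t)" using 2 by (simp add: flat_fun_def)
    thus ?thesis by (rule has_field_derivative_transform_within_open[where S="{..<0}"]) (use 2 in \<open>auto simp: flat_fun_def\<close>)
  next
    case 3
    have "((\<lambda>h. (flat_fun m (0 + h) - flat_fun m 0) / h) \<longlongrightarrow> 0) (at 0)"
    proof (rule Lim_null_comparison)
      show "\<forall>\<^sub>F h in at 0. norm ((flat_fun m (0 + h) - flat_fun m 0) / h) \<le> fact (m + 2) * \<bar>h\<bar>"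
      proof (rule always_eventually, rule allI)
        fix h :: real
        have "\<bar>flat_fun m h / h\<bar> = flat_fun m h / \<bar>h\<bar>" using flat_fun_bounds(1)[of m h] by simp
        also have "... \<le> fact (m + 2) * h^2 / \<bar>h\<bar>" by (intro divide_right_mono flat_fun_bounds) auto
        also have "... = fact (m + 2) * \<bar>h\<bar>" by (cases "h = 0") (auto simp: power2_eq_square abs_if)
        finally show "norm ((flat_fun m (0 + h) - flat_fun m 0) / h) \<le> fact (m + 2) * \<bar>h\<bar>" by (simp add: flat_fun_def)
      qed
      show "((\<lambda>h. fact (m + 2) * \<bar>h\<bar>) \<longlongrightarrow> 0) (at (0::real))" by (rule tendsto_eq_intros refl | simp)+
    qed
    thus ?thesis using 3 by (simp add: DERIV_def flat_fun_def)
  qed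
qed

lemma smcl_flat: "smcl B f \<Longrightarrow> smcl B (\<lambda>x. of_real (flat_fun m (Re (f x))))" unfolding flat_fun_def by (rule smcl.flat)

lemma smcl_diff: "smcl B f \<Longrightarrow> smcl B g \<Longrightarrow> smcl B (\<lambda>x. f x - g x)"
  using smcl.add[OF _ smcl.mult[OF smcl.const[of B "-1"]], of f g] by simp

lemma smcl_uminus: "smcl B f \<Longrightarrow> smcl B (\<lambda>x. - f x)" using smcl.mult[OF smcl.const[of B "-1"], of f] by simp

lemma smcl_sum: "finite I \<Longrightarrow> (\<And>i. i \<in> I \<Longrightarrow> smcl B (f i)) \<Longrightarrow> smcl B (\<lambda>x. \<Sum>i\<in>I. f i x)"
  by (induction I rule: finite_induct) (auto intro: smcl.intros)

text \<open>The induction carries a derivative and the membership of its coordinates together, since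
  the product rule needs the former for the latter.\<close>

lemma smcl_deriv:
  assumes B: "\<And>f x. f \<in> B \<Longrightarrow> f differentiable at x"
    "\<And>f i. f \<in> B \<Longrightarrow> smcl B (\<lambda>x. frechet_derivative f (at x) (axis i 1))"
    and f: "smcl B f"
  shows "\<exists>f'. (\<forall>x. (f has_derivative f' x) (at x)) \<and> (\<forall>i. smcl B (\<lambda>x. f' x (axis i 1)))"
  using f
proof (induction rule: smcl.induct)
  case (base f)
  thus ?case using B by (intro exI[of _ "\<lambda>x. frechet_derivative f (at x)"]) (auto simp: frechet_derivative_works[symmetric])
next
  case (const c)
  show ?case by (intro exI[of _ "\<lambda>x h. 0"]) (auto intro: smcl.const)
next
  case (coord i)
  have "((\<lambda>x. complex_of_real (x$i)) has_derivative (\<lambda>h. of_real (h$i))) (at x)" for x :: "real^'a"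
    by (intro has_derivative_of_real bounded_linear.has_derivative[OF bounded_linear_vec_nth] has_derivative_ident)
  thus ?case by (intro exI[of _ "\<lambda>x h. of_real (h$i)"]) (auto intro: smcl.const)
next
  case (add f g)
  then obtain f' g' where "\<And>x. (f has_derivative f' x) (at x)" "\<And>i. smcl B (\<lambda>x. f' x (axis i 1))"
    "\<And>x. (g has_derivative g' x) (at x)" "\<And>i. smcl B (\<lambda>x. g' x (axis i 1))" by blast
  thus ?case by (intro exI[of _ "\<lambda>x h. f' x h + g' x h"]) (auto intro!: has_derivative_add smcl.add)
next
  case (mult f g)
  then obtain f' g' where "\<And>x. (f has_derivative f' x) (at x)" "\<And>i. smcl B (\<lambda>x. f' x (axis i 1))"
    "\<And>x. (g has_derivative g' x) (at x)" "\<And>i. smcl B (\<lambda>x. g' x (axis i 1))" by blast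
  with mult show ?case by (intro exI[of _ "\<lambda>x h. f x * g' x h + f' x h * g x"]) (auto intro!: has_derivative_mult smcl.add smcl.mult)
next
  case (re f)
  then obtain f' where f': "\<And>x. (f has_derivative f' x) (at x)" "\<And>i. smcl B (\<lambda>x. f' x (axis i 1))" by blast
  have "((\<lambda>x. complex_of_real (Re (f x))) has_derivative (\<lambda>h. of_real (Re (f' x h)))) (at x)" for x by (intro has_derivative_of_real has_derivative_Re f')
  thus ?case using f' by (intro exI[of _ "\<lambda>x h. of_real (Re (f' x h))"]) (auto intro!: smcl.re)
next
  case (inv f)
  then obtain f' where f': "\<And>x. (f has_derivative f' x) (at x)" "\<And>i. smcl B (\<lambda>x. f' x (axis i 1))" by blast
  have d: "((\<lambda>x. inverse (f x)) has_derivative (\<lambda>h. - (inverse (f x) * f' x h * inverse (f x)))) (at x)" for x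
    by (rule Deriv.has_derivative_inverse[OF inv(2) f'(1)])
  have "smcl B (\<lambda>x. - (inverse (f x) * f' x (axis i 1) * inverse (f x)))" for i
    by (rule smcl_uminus[OF smcl.mult[OF smcl.mult[OF smcl.inv[OF inv(1,2)] f'(2)] smcl.inv[OF inv(1,2)]]])
  with d show ?case by (intro exI[of _ "\<lambda>x h. - (inverse (f x) * f' x h * inverse (f x))"] conjI allI)
next
  case (flat f m)
  then obtain f' where f': "\<And>x. (f has_derivative f' x) (at x)" "\<And>i. smcl B (\<lambda>x. f' x (axis i 1))" by blast
  let ?d = "\<lambda>x. flat_fun (m+2) (Re (f x)) - real m * flat_fun (m+1) (Re (f x))"
  have "((\<lambda>x. complex_of_real (flat_fun m (Re (f x)))) has_derivative (\<lambda>h. of_real (?d x) * of_real (Re (f' x h)))) (at x)" for x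
  proof -
    have "(flat_fun m \<circ> (\<lambda>x. Re (f x)) has_derivative ((*) (?d x)) \<circ> (\<lambda>h. Re (f' x h))) (at x)"
      using flat_fun_deriv[of m "Re (f x)"] unfolding has_field_derivative_def by (intro diff_chain_at has_derivative_Re f') auto
    hence "((\<lambda>x. flat_fun m (Re (f x))) has_derivative (\<lambda>h. ?d x * Re (f' x h))) (at x)" by (simp add: o_def)
    thus ?thesis using has_derivative_of_real by fastforce
  qed
  moreover have "smcl B (\<lambda>x. of_real (?d x) * of_real (Re (f' x (axis i 1))))" for i
    using flat f' by (simp only: of_real_diff of_real_mult) (intro smcl.mult smcl_diff smcl_flat smcl.const smcl.re)
  ultimately show ?case unfolding flat_fun_def[symmetric] by (intro exI[of _ "\<lambda>x h. of_real (?d x) * of_real (Re (f' x h))"]) auto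
qed

lemma smcl_closed:
  assumes "\<And>f x. f \<in> B \<Longrightarrow> f differentiable at x"
    "\<And>f i. f \<in> B \<Longrightarrow> smcl B (\<lambda>x. frechet_derivative f (at x) (axis i 1))"
    and f: "smcl B f"
  shows "f differentiable at x" "smcl B (\<lambda>x. frechet_derivative f (at x) (axis i 1))"
proof -
  obtain f' where f': "\<And>x. (f has_derivative f' x) (at x)" "\<And>i. smcl B (\<lambda>x. f' x (axis i 1))" using smcl_deriv[OF assms] by blast
  show "f differentiable at x" using f'(1) by (rule differentiableI)
  have "frechet_derivative f (at x) = f' x" for x by (rule frechet_derivative_at[symmetric, OF f'(1)])
  thus "smcl B (\<lambda>x. frechet_derivative f (at x) (axis i 1))" using f'(2) by simp
qed

lemma smcl_smooth:
  assumes B: "\<And>f x. f \<in> B \<Longrightarrow> f differentiable at x"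
    "\<And>f i. f \<in> B \<Longrightarrow> smcl B (\<lambda>x. frechet_derivative f (at x) (axis i 1))"
    and f: "smcl B f"
  shows "smooth f"
proof -
  have "smcl B (iter_partial is f)" for "is" by (induction "is") (auto intro: f smcl_closed[OF B])
  thus ?thesis unfolding smooth_def using smcl_closed(1)[OF B] by blast
qed

lemma smcl_mono: "smcl B f \<Longrightarrow> B \<subseteq> C \<Longrightarrow> smcl C f" by (induction rule: smcl.induct) (auto intro: smcl.intros)

lemma smooth_smcl: "smcl {} f \<Longrightarrow> smooth f" by (rule smcl_smooth) auto

text \<open>The base set is the family of all iterated partials of f, closed under differentiation
  by definition; this stands in for a Leibniz formula for higher derivatives.\<close>

lemma smooth_mult_smcl:
  assumes f: "smooth f" and g: "smcl {} g"
  shows "smooth (\<lambda>x. f x * g x)"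
proof (rule smcl_smooth[where B="range (\<lambda>is. iter_partial is f)"])
  let ?B = "range (\<lambda>is. iter_partial is f)"
  have "f \<in> ?B" by (rule range_eqI[of _ _ "[]"]) simp
  thus "smcl ?B (\<lambda>x. f x * g x)" by (rule smcl.mult[OF smcl.base smcl_mono[OF g]]) simp
  fix h assume "h \<in> ?B"
  then obtain js where h: "h = iter_partial js f" by blast
  show "h differentiable at x" for x using f h by (auto simp: smooth_def)
  show "smcl ?B (\<lambda>x. frechet_derivative h (at x) (axis i 1))" for i by (rule smcl.base, rule range_eqI[of _ _ "i # js"]) (simp add: h)
qed

lemma smcl_of_real_norm2: "smcl B (\<lambda>x::real^'n. of_real ((norm (x - c))\<^sup>2))"
proof -
  have "(\<lambda>x::real^'n. complex_of_real ((norm (x - c))\<^sup>2)) = (\<lambda>x. \<Sum>i\<in>UNIV. (of_real (x$i) - of_real (c$i)) * (of_real (x$i) - of_real (c$i)))"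
    by (rule ext) (simp add: norm_vec_def L2_set_def sum_nonneg power2_eq_square)
  thus ?thesis by (auto intro!: smcl_sum smcl.mult smcl_diff smcl.coord smcl.const)
qed

text \<open>Equal to 1 on the ball of radius r and 0 off the ball of radius R. The squared norm is a
  polynomial, which keeps the function smooth at the centre.\<close>

definition cutoff :: "real^'n \<Rightarrow> real \<Rightarrow> real \<Rightarrow> real^'n \<Rightarrow> real" where
  "cutoff c r R x = flat_fun 0 (R\<^sup>2 - (norm (x - c))\<^sup>2) / (flat_fun 0 (R\<^sup>2 - (norm (x - c))\<^sup>2) + flat_fun 0 ((norm (x - c))\<^sup>2 - r\<^sup>2))"

lemma flat_fun_0_pos: "flat_fun 0 t > 0 \<longleftrightarrow> t > 0" by (simp add: flat_fun_def)
lemma flat_fun_0_eq: "flat_fun 0 t = 0 \<longleftrightarrow> t \<le> 0" by (simp add: flat_fun_def)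

lemma cutoff_denominator:
  assumes "0 \<le> r" "r < R"
  shows "0 < flat_fun 0 (R\<^sup>2 - u) + flat_fun 0 (u - r\<^sup>2)"
proof -
  have "r\<^sup>2 < R\<^sup>2" using assms by (simp add: power_strict_mono)
  hence "R\<^sup>2 - u > 0 \<or> u - r\<^sup>2 > 0" by linarith
  thus ?thesis using flat_fun_bounds(1)[of 0 "R\<^sup>2 - u"] flat_fun_bounds(1)[of 0 "u - r\<^sup>2"] by (metis add_nonneg_pos add_pos_nonneg flat_fun_0_pos)
qed

lemma cutoff_smcl:
  assumes "0 \<le> r" "r < R"
  shows "smcl B (\<lambda>x. of_real (cutoff c r R x))"
proof -
  define u where "u x = complex_of_real ((norm (x - c))\<^sup>2)" for x
  have u: "smcl B u" unfolding u_def by (rule smcl_of_real_norm2)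
  have 1: "smcl B (\<lambda>x. of_real (flat_fun 0 (R\<^sup>2 - (norm (x - c))\<^sup>2)))"
    using smcl_flat[OF smcl_diff[OF smcl.const[of B "of_real (R\<^sup>2)"] u], of 0] by (simp add: u_def)
  have 2: "smcl B (\<lambda>x. of_real (flat_fun 0 ((norm (x - c))\<^sup>2 - r\<^sup>2)))"
    using smcl_flat[OF smcl_diff[OF u smcl.const[of B "of_real (r\<^sup>2)"]], of 0] by (simp add: u_def)
  have nz: "complex_of_real (flat_fun 0 (R\<^sup>2 - (norm (x - c))\<^sup>2)) + of_real (flat_fun 0 ((norm (x - c))\<^sup>2 - r\<^sup>2)) \<noteq> 0" for x
    using cutoff_denominator[OF assms, of "(norm (x - c))\<^sup>2"] unfolding of_real_add[symmetric] of_real_eq_0_iff by linarith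
  have "smcl B (\<lambda>x. complex_of_real (flat_fun 0 (R\<^sup>2 - (norm (x - c))\<^sup>2)) *
      inverse (of_real (flat_fun 0 (R\<^sup>2 - (norm (x - c))\<^sup>2)) + of_real (flat_fun 0 ((norm (x - c))\<^sup>2 - r\<^sup>2))))"
    by (intro smcl.mult smcl.inv smcl.add 1 2 nz)
  thus ?thesis by (simp add: cutoff_def divide_inverse)
qed

lemma cutoff_range:
  assumes "0 \<le> r" "r < R"
  shows "0 \<le> cutoff c r R x" "cutoff c r R x \<le> 1"
  using cutoff_denominator[OF assms, of "(norm (x - c))\<^sup>2"] flat_fun_bounds(1)[of 0 "R\<^sup>2 - (norm (x - c))\<^sup>2"]
    flat_fun_bounds(1)[of 0 "(norm (x - c))\<^sup>2 - r\<^sup>2"] by (auto simp: cutoff_def divide_le_eq_1)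

lemma cutoff_eq_1:
  assumes "0 \<le> r" "r < R" "norm (x - c) \<le> r"
  shows "cutoff c r R x = 1"
using assms cutoff_denominator[OF assms(1,2), of "(norm (x - c))\<^sup>2"] by (auto simp: flat_fun_0_eq power_mono cutoff_def)

lemma cutoff_eq_0:
  assumes "0 \<le> r" "r < R" "R \<le> norm (x - c)"
  shows "cutoff c r R x = 0"
using assms by (auto simp: flat_fun_0_eq power_mono cutoff_def)

section \<open>Test functions and approximation by them\<close>

lemma test_functionI:
  assumes "smooth f" "bounded S" "\<And>x. x \<notin> S \<Longrightarrow> f x = 0"
  shows "f \<in> test_functions"
proof -
  have "bounded {x. f x \<noteq> 0}" using assms(2,3) by (rule_tac bounded_subset[OF assms(2)]) auto
  thus ?thesis using assms(1) by (simp add: test_functions_def supp_def compact_closure)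
qed

lemma test_function_mult_smcl:
  assumes f: "f \<in> test_functions" and g: "smcl {} g"
  shows "(\<lambda>x. f x * g x) \<in> test_functions"
proof (rule test_functionI[of _ "supp f"])
  show "smooth (\<lambda>x. f x * g x)" using f g by (intro smooth_mult_smcl) (auto simp: test_functions_def)
  show "bounded (supp f)" using f by (auto simp: test_functions_def compact_imp_bounded)
  show "f x * g x = 0" if "x \<notin> supp f" for x using that closure_subset[of "{x. f x \<noteq> 0}"] by (auto simp: supp_def)
qed

lemma cutoff_test_function:
  assumes "0 \<le> r" "r < R"
  shows "(\<lambda>x. of_real (cutoff c r R x)) \<in> test_functions"
proof (rule test_functionI[of _ "cball c R"])
  show "smooth (\<lambda>x. complex_of_real (cutoff c r R x))" by (intro smooth_smcl cutoff_smcl assms)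
  show "complex_of_real (cutoff c r R x) = 0" if "x \<notin> cball c R" for x using that assms by (simp add: cutoff_eq_0 dist_norm norm_minus_commute)
qed simp

lemma smooth_continuous: "smooth f \<Longrightarrow> continuous_on S f" unfolding smooth_def
  by (metis continuous_at_imp_continuous_on differentiable_imp_continuous_within iter_partial.simps(1))

lemma test_function_zero: "f \<in> test_functions \<Longrightarrow> x \<notin> supp f \<Longrightarrow> f x = 0"
  using closure_subset[of "{x. f x \<noteq> 0}"] by (auto simp: supp_def)

lemma test_functions_schwartz: "f \<in> test_functions \<Longrightarrow> f \<in> schwartz"
proof -
  assume f: "f \<in> test_functions"
  have sm: "smooth f" and cp: "compact (supp f)" using f by (auto simp: test_functions_def)
  have z: "\<forall>x. x \<notin> supp f \<longrightarrow> iter_partial is f x = 0" for "is"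
  proof (induction "is")
    case Nil thus ?case using test_function_zero[OF f] by simp
  next
    case (Cons i js)
    have "frechet_derivative (iter_partial js f) (at x) = (\<lambda>h. 0)" if "x \<notin> supp f" for x
    proof -
      have o: "open (- supp f)" by (simp add: supp_def open_Compl)
      have "(iter_partial js f has_derivative (\<lambda>h. 0)) (at x)"
        by (rule has_derivative_transform_within_open[OF has_derivative_const[of 0] o]) (use Cons that in auto)
      thus ?thesis by (rule frechet_derivative_at[symmetric])
    qed
    thus ?case by simp
  qed
  have "bounded (range (\<lambda>x. (1 + norm x)^k * norm (iter_partial is f x)))" for "is" k
  proof -
    have c: "continuous_on (supp f) (iter_partial is f)" using sm by (auto simp: smooth_def intro!: continuous_at_imp_continuous_on differentiable_imp_continuous_within)
    have "compact ((\<lambda>x. (1 + norm x)^k * norm (iter_partial is f x)) ` supp f)" by (intro compact_continuous_image cp continuous_intros c)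
    hence b: "bounded (insert 0 ((\<lambda>x. (1 + norm x)^k * norm (iter_partial is f x)) ` supp f))" by (simp add: compact_imp_bounded)
    have "range (\<lambda>x. (1 + norm x)^k * norm (iter_partial is f x)) \<subseteq> insert 0 ((\<lambda>x. (1 + norm x)^k * norm (iter_partial is f x)) ` supp f)"
      using z[of "is"] by auto
    with b show ?thesis by (rule bounded_subset)
  qed
  thus ?thesis using sm by (simp add: schwartz_def)
qed

lemma real_polynomial_smcl: "real_polynomial_function f \<Longrightarrow> smcl B (\<lambda>x::real^'n. of_real (f x))"
proof (induction rule: real_polynomial_function.induct)
  case (linear f)
  then interpret bounded_linear f .
  have "f x = (\<Sum>i\<in>UNIV. x$i * f (axis i 1))" for x
  proof -
    have "x = (\<Sum>i\<in>UNIV. x$i *\<^sub>R axis i 1)" by (simp add: basis_expansion scalar_mult_eq_scaleR[symmetric])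
    hence "f x = f (\<Sum>i\<in>UNIV. x$i *\<^sub>R axis i 1)" by simp
    also have "... = (\<Sum>i\<in>UNIV. x$i * f (axis i 1))" by (simp add: sum scaleR)
    finally show ?thesis .
  qed
  hence "complex_of_real (f x) = (\<Sum>i\<in>UNIV. of_real (x$i) * of_real (f (axis i 1)))" for x by (metis (no_types, lifting) of_real_mult of_real_sum sum.cong)
  hence "(\<lambda>x. complex_of_real (f x)) = (\<lambda>x. \<Sum>i\<in>UNIV. of_real (x$i) * of_real (f (axis i 1)))" by (rule ext)
  thus ?case by (auto intro!: smcl_sum smcl.mult smcl.coord smcl.const)
qed (auto intro: smcl.intros)

text \<open>Continuous functions converging almost everywhere are clipped to the bound M, replaced
  by polynomials uniformly on a ball, and cut off; uniform bounds and a common support are what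
  dominated convergence asks for.\<close>

lemma approx_test_real:
  fixes G :: "real^'n \<Rightarrow> real"
  assumes G: "G \<in> lmeas" and b: "\<And>x. \<bar>G x\<bar> \<le> M" and R: "0 < R" and z: "\<And>x. R < norm x \<Longrightarrow> G x = 0"
  shows "\<exists>g :: nat \<Rightarrow> real^'n \<Rightarrow> complex. (\<forall>m. g m \<in> test_functions) \<and> (\<forall>m x. norm (g m x) \<le> M + 1) \<and>
    (\<forall>m x. R + 1 \<le> norm x \<longrightarrow> g m x = 0) \<and> (AE x in lebesgue. (\<lambda>m. g m x) \<longlonglongrightarrow> of_real (G x))"
proof -
  have M: "0 \<le> M" using b[of 0] by linarith
  have "G measurable_on UNIV" using G by (simp add: lebesgue_measurable_imp_measurable_on)
  then obtain N h where N: "negligible N" and h: "\<And>n. continuous_on UNIV (h n)"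
    "\<And>x. x \<notin> N \<Longrightarrow> (\<lambda>n. h n x) \<longlonglongrightarrow> G x" unfolding measurable_on_def by auto
  define h' where "h' n x = max (- M) (min M (h n x))" for n :: nat and x
  have h': "continuous_on UNIV (h' n)" for n unfolding h'_def by (intro continuous_intros h)
  have h'b: "\<bar>h' n x\<bar> \<le> M" for n x using M by (auto simp: h'_def)
  have h'l: "(\<lambda>n. h' n x) \<longlonglongrightarrow> G x" if "x \<notin> N" for x
  proof -
    have "(\<lambda>n. h' n x) \<longlonglongrightarrow> max (- M) (min M (G x))" unfolding h'_def by (intro tendsto_intros h that)
    moreover have "max (- M) (min M (G x)) = G x" using b[of x] by auto
    ultimately show ?thesis by simp
  qed
  have "\<exists>P. real_polynomial_function P \<and> (\<forall>x\<in>cball 0 (R + 1). \<bar>h' n x - P x\<bar> < 1 / (real n + 1))" for n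
  proof -
    obtain P where "real_polynomial_function P" "\<And>x. x \<in> cball 0 (R + 1) \<Longrightarrow> \<bar>h' n x - P x\<bar> < 1 / (real n + 1)"
      using Stone_Weierstrass_real_polynomial_function[of "cball 0 (R + 1)" "h' n" "1 / (real n + 1)"] continuous_on_subset[OF h'] by auto
    thus ?thesis by blast
  qed
  then obtain P where P: "\<And>n. real_polynomial_function (P n)" "\<And>n x. x \<in> cball 0 (R + 1) \<Longrightarrow> \<bar>h' n x - P n x\<bar> < 1 / (real n + 1)"
    by metis
  define \<theta> where "\<theta> x = cutoff 0 R (R + 1) x" for x :: "real^'n"
  define g where "g n x = complex_of_real (\<theta> x) * of_real (P n x)" for n x
  have \<theta>: "0 \<le> \<theta> x" "\<theta> x \<le> 1" "norm x \<le> R \<Longrightarrow> \<theta> x = 1" "R + 1 \<le> norm x \<Longrightarrow> \<theta> x = 0" for x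
    using R by (auto simp: \<theta>_def cutoff_range cutoff_eq_1 cutoff_eq_0)
  have gt: "g n \<in> test_functions" for n unfolding g_def \<theta>_def using R P(1) by (intro test_function_mult_smcl cutoff_test_function real_polynomial_smcl) auto
  have Pb: "\<bar>P n x\<bar> \<le> M + 1" if "norm x \<le> R + 1" for n x
  proof -
    have "1 / (real n + 1) \<le> 1" by simp
    moreover have "\<bar>h' n x - P n x\<bar> < 1 / (real n + 1)" using P(2)[of x n] that by simp
    ultimately show ?thesis using h'b[of n x] by linarith
  qed
  have gb: "norm (g n x) \<le> M + 1" for n x
  proof (cases "norm x \<le> R + 1")
    case True
    have "norm (g n x) = \<theta> x * \<bar>P n x\<bar>" using \<theta>(1)[of x] by (simp add: g_def norm_mult)
    also have "... \<le> 1 * (M + 1)" using \<theta>[of x] Pb[OF True] by (intro mult_mono) auto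
    finally show ?thesis by simp
  next
    case False thus ?thesis using \<theta>(4)[of x] M by (simp add: g_def)
  qed
  have gz: "g n x = 0" if "R + 1 \<le> norm x" for n x using \<theta>(4)[OF that] by (simp add: g_def)
  have lim: "(\<lambda>n. g n x) \<longlonglongrightarrow> of_real (G x)" if x: "x \<notin> N" for x
  proof (cases "norm x \<le> R + 1")
    case True
    have "(\<lambda>n. P n x - h' n x) \<longlonglongrightarrow> 0"
    proof (rule Lim_null_comparison)
      show "\<forall>\<^sub>F n in sequentially. norm (P n x - h' n x) \<le> 1 / (real n + 1)"
      proof (rule always_eventually, rule allI)
        fix n show "norm (P n x - h' n x) \<le> 1 / (real n + 1)" using P(2)[of x n] True by (simp add: abs_minus_commute)
      qed
      show "(\<lambda>n. 1 / (real n + 1)) \<longlonglongrightarrow> 0" using LIMSEQ_inverse_real_of_nat by (simp add: inverse_eq_divide add.commute)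
    qed
    from tendsto_add[OF this h'l[OF x]] have "(\<lambda>n. P n x) \<longlonglongrightarrow> G x" by simp
    hence "(\<lambda>n. g n x) \<longlonglongrightarrow> of_real (\<theta> x) * of_real (G x)" unfolding g_def by (intro tendsto_intros)
    moreover have "of_real (\<theta> x) * of_real (G x) = complex_of_real (G x)" using \<theta>(3)[of x] z[of x] by (cases "norm x \<le> R") auto
    ultimately show ?thesis by simp
  next
    case False
    thus ?thesis using gz[of x] z[of x] R by simp
  qed
  have "AE x in lebesgue. (\<lambda>n. g n x) \<longlonglongrightarrow> of_real (G x)" using N lim by (intro AE_I'[of N]) (auto simp: negligible_iff_null_sets)
  thus ?thesis using gt gb gz by blast
qed

lemma test_functions_add: "f \<in> test_functions \<Longrightarrow> g \<in> test_functions \<Longrightarrow> (\<lambda>x. f x + c * g x) \<in> test_functions"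
proof -
  assume f: "f \<in> test_functions" and g: "g \<in> test_functions"
  let ?B = "range (\<lambda>is. iter_partial is f) \<union> range (\<lambda>is. iter_partial is g)"
  show ?thesis
  proof (rule test_functionI[of _ "supp f \<union> supp g"])
    show "smooth (\<lambda>x. f x + c * g x)"
    proof (rule smcl_smooth[where B="?B"])
      have "f \<in> ?B" "g \<in> ?B" by (metis UnCI iter_partial.simps(1) rangeI)+
      thus "smcl ?B (\<lambda>x. f x + c * g x)" by (intro smcl.add smcl.mult smcl.const smcl.base)
      fix h assume "h \<in> ?B"
      then obtain js where h: "h = iter_partial js f \<or> h = iter_partial js g" by blast
      thus "h differentiable at x" for x using f g by (auto simp: smooth_def test_functions_def)
      have "(\<lambda>x. frechet_derivative h (at x) (axis i 1)) \<in> ?B" for i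
      proof -
        have "(\<lambda>x. frechet_derivative h (at x) (axis i 1)) = iter_partial (i # js) f
          \<or> (\<lambda>x. frechet_derivative h (at x) (axis i 1)) = iter_partial (i # js) g" using h by auto
        thus ?thesis by (metis UnCI rangeI)
      qed
      thus "smcl ?B (\<lambda>x. frechet_derivative h (at x) (axis i 1))" for i by (intro smcl.base)
    qed
    show "bounded (supp f \<union> supp g)" using f g by (auto simp: test_functions_def compact_imp_bounded)
    show "f x + c * g x = 0" if "x \<notin> supp f \<union> supp g" for x using that test_function_zero[OF f, of x] test_function_zero[OF g, of x] by auto
  qed
qed

lemma approx_test:
  fixes G :: "real^'n \<Rightarrow> complex"
  assumes G: "G \<in> lmeas" and b: "\<And>x. norm (G x) \<le> M" and R: "0 < R" and z: "\<And>x. R < norm x \<Longrightarrow> G x = 0"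
  shows "\<exists>g :: nat \<Rightarrow> real^'n \<Rightarrow> complex. (\<forall>m. g m \<in> test_functions) \<and> (\<forall>m x. norm (g m x) \<le> 2 * (M + 1)) \<and>
    (\<forall>m x. R + 1 \<le> norm x \<longrightarrow> g m x = 0) \<and> (AE x in lebesgue. (\<lambda>m. g m x) \<longlonglongrightarrow> G x)"
proof -
  have "\<exists>g1 :: nat \<Rightarrow> real^'n \<Rightarrow> complex. (\<forall>m. g1 m \<in> test_functions) \<and> (\<forall>m x. norm (g1 m x) \<le> M + 1) \<and>
    (\<forall>m x. R + 1 \<le> norm x \<longrightarrow> g1 m x = 0) \<and> (AE x in lebesgue. (\<lambda>m. g1 m x) \<longlonglongrightarrow> of_real (Re (G x)))"
    using G z b abs_Re_le_cmod by (intro approx_test_real R) (auto intro: order_trans)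
  moreover have "\<exists>g2 :: nat \<Rightarrow> real^'n \<Rightarrow> complex. (\<forall>m. g2 m \<in> test_functions) \<and> (\<forall>m x. norm (g2 m x) \<le> M + 1) \<and>
    (\<forall>m x. R + 1 \<le> norm x \<longrightarrow> g2 m x = 0) \<and> (AE x in lebesgue. (\<lambda>m. g2 m x) \<longlonglongrightarrow> of_real (Im (G x)))"
    using G z b abs_Im_le_cmod by (intro approx_test_real R) (auto intro: order_trans)
  ultimately obtain g1 g2 :: "nat \<Rightarrow> real^'n \<Rightarrow> complex" where
    g1: "\<And>m. g1 m \<in> test_functions" "\<And>m x. norm (g1 m x) \<le> M + 1" "\<And>m x. R + 1 \<le> norm x \<Longrightarrow> g1 m x = 0"
      "AE x in lebesgue. (\<lambda>m. g1 m x) \<longlonglongrightarrow> of_real (Re (G x))"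
    and g2: "\<And>m. g2 m \<in> test_functions" "\<And>m x. norm (g2 m x) \<le> M + 1" "\<And>m x. R + 1 \<le> norm x \<Longrightarrow> g2 m x = 0"
      "AE x in lebesgue. (\<lambda>m. g2 m x) \<longlonglongrightarrow> of_real (Im (G x))" by blast
  define g where "g m x = g1 m x + \<i> * g2 m x" for m x
  have "g m \<in> test_functions" for m unfolding g_def by (intro test_functions_add g1 g2)
  moreover have "norm (g m x) \<le> 2 * (M + 1)" for m x
    unfolding g_def using norm_triangle_ineq[of "g1 m x" "\<i> * g2 m x"] g1(2)[of m x] g2(2)[of m x] by (simp add: norm_mult)
  moreover have "g m x = 0" if "R + 1 \<le> norm x" for m x using that g1(3) g2(3) by (simp add: g_def)
  moreover have "AE x in lebesgue. (\<lambda>m. g m x) \<longlonglongrightarrow> G x" using g1(4) g2(4)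
  proof eventually_elim
    case (elim x)
    hence "(\<lambda>m. g m x) \<longlonglongrightarrow> of_real (Re (G x)) + \<i> * of_real (Im (G x))" unfolding g_def by (intro tendsto_intros)
    thus ?case by (simp add: complex_eq[symmetric])
  qed
  ultimately show ?thesis by blast
qed

section \<open>Cotlar's inequality\<close>

lemma norm_integral_le_nn_integral:
  fixes f :: "'a \<Rightarrow> 'b::{banach, second_countable_topology}"
  shows "enorm (integral\<^sup>L M f) \<le> (\<integral>\<^sup>+x. enorm (f x) \<partial>M)"
  by (cases "integrable M f") (auto intro: integral_norm_bound_ennreal simp: not_integrable_integral_eq)

text \<open>Bounded, measurable, of bounded support: unlike test functions this class is stable
  under restriction to cubes and under subtracting means on them, and truncated integrals of its
  members converge absolutely.\<close>

definition nice :: "(real^'n \<Rightarrow> complex) \<Rightarrow> bool" where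
  "nice f \<longleftrightarrow> f \<in> lmeas \<and> (\<exists>M. \<forall>x. norm (f x) \<le> M) \<and> (\<exists>R. \<forall>x. R < norm x \<longrightarrow> f x = 0)"

lemma nice_measurable: "nice f \<Longrightarrow> f \<in> lmeas" by (simp add: nice_def)

lemma nice_bounds:
  assumes "nice f"
  obtains M R where "0 < M" "0 < R" "\<And>x. norm (f x) \<le> M" "\<And>x. R < norm x \<Longrightarrow> f x = 0"
proof -
  obtain M R where "\<And>x. norm (f x) \<le> M" "\<And>x. R < norm x \<Longrightarrow> f x = 0" using assms unfolding nice_def by blast
  thus ?thesis using that[of "max 1 M" "max 1 R"] by (metis less_max_iff_disj max.coboundedI2 max_less_iff_conj zero_less_one)
qed

lemma emeasure_cball_finite: "vol (cball (c::real^'n) r) < \<infinity>" using emeasure_lborel_cball_finite[of c r] by (simp add: emeasure_completion)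

lemma nice_integrable: fixes f :: "real^'n \<Rightarrow> complex" assumes "nice f" shows "integrable lebesgue f"
proof -
  obtain M R where MR: "0 < M" "0 < R" "\<And>x. norm (f x) \<le> M" "\<And>x. R < norm x \<Longrightarrow> f x = 0" using nice_bounds[OF assms] by blast
  have "integrable lebesgue (\<lambda>x::real^'n. M * indicator (cball 0 R) x :: real)"
    using emeasure_cball_finite[of "0::real^'n" R] by (intro integrable_mult_right integrable_real_indicator) auto
  thus ?thesis by (rule Bochner_Integration.integrable_bound)
       (use MR nice_measurable[OF assms] in \<open>auto simp: indicator_def not_le intro!: AE_I2\<close>)
qed

lemma nice_mult_bounded:
  assumes f: "nice f" and g: "g \<in> lmeas" "\<And>x. norm (g x) \<le> C"
  shows "nice (\<lambda>x. f x * g x)"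
proof -
  obtain M R where MR: "0 < M" "0 < R" "\<And>x. norm (f x) \<le> M" "\<And>x. R < norm x \<Longrightarrow> f x = 0" using nice_bounds[OF f] by blast
  have "norm (f x * g x) \<le> M * C" for x unfolding norm_mult using MR g(2)[of x] by (intro mult_mono) (auto intro: order_trans[OF norm_ge_zero])
  thus ?thesis unfolding nice_def using f g(1) MR(4) by (auto simp: nice_def)
qed

lemma nice_diff: assumes f: "nice f" and g: "nice g" shows "nice (\<lambda>x. f x - g x)"
proof -
  obtain M R where MR: "0 < M" "0 < R" "\<And>x. norm (f x) \<le> M" "\<And>x. R < norm x \<Longrightarrow> f x = 0" using nice_bounds[OF f] by blast
  obtain M' R' where MR': "0 < M'" "0 < R'" "\<And>x. norm (g x) \<le> M'" "\<And>x. R' < norm x \<Longrightarrow> g x = 0" using nice_bounds[OF g] by blast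
  have "norm (f x - g x) \<le> M + M'" for x using norm_triangle_ineq4[of "f x" "g x"] MR(3)[of x] MR'(3)[of x] by linarith
  moreover have "f x - g x = 0" if "max R R' < norm x" for x using MR(4)[of x] MR'(4)[of x] that by simp
  ultimately show ?thesis unfolding nice_def using f g by (intro conjI exI[of _ "M + M'"] exI[of _ "max R R'"] allI impI borel_measurable_diff nice_measurable) auto
qed

lemma test_function_nice: assumes f: "f \<in> test_functions" shows "nice f"
proof -
  have sm: "smooth f" and cp: "compact (supp f)" using f by (auto simp: test_functions_def)
  have c: "continuous_on UNIV f" using sm by (rule smooth_continuous)
  have "bounded (f ` supp f)" by (intro compact_imp_bounded compact_continuous_image cp) (rule continuous_on_subset[OF c], simp)
  then obtain M where M: "\<And>x. x \<in> supp f \<Longrightarrow> norm (f x) \<le> M" unfolding bounded_iff by auto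
  obtain R where R: "\<And>x. x \<in> supp f \<Longrightarrow> norm x \<le> R" using compact_imp_bounded[OF cp] unfolding bounded_iff by auto
  have "f \<in> lmeas" using c by (intro measurable_completion) (simp add: borel_measurable_continuous_onI)
  moreover have "norm (f x) \<le> max M 0" for x using M[of x] test_function_zero[OF f, of x] by (cases "x \<in> supp f") auto
  moreover have "f x = 0" if "R < norm x" for x using R[of x] that test_function_zero[OF f, of x] by fastforce
  ultimately show ?thesis unfolding nice_def by blast
qed

lemma AM_GM_weighted: "0 < \<beta> \<Longrightarrow> a * b \<le> (a\<^sup>2 / \<beta> + \<beta> * b\<^sup>2) / (2::real)"
proof -
  assume b: "0 < \<beta>"
  have "0 \<le> (a / sqrt \<beta> - sqrt \<beta> * b)\<^sup>2" by simp
  also have "... = a\<^sup>2 / \<beta> + \<beta> * b\<^sup>2 - 2 * (a * b)" using b by (simp add: power2_diff power_divide power_mult_distrib)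
  finally show ?thesis by simp
qed

lemma ennreal_le_mult_add:
  "x \<le> a * b + c \<Longrightarrow> 0 \<le> a \<Longrightarrow> 0 \<le> b \<Longrightarrow> 0 \<le> c \<Longrightarrow> ennreal x \<le> ennreal a * ennreal b + ennreal c"
  by (metis ennreal_leI ennreal_mult ennreal_plus mult_nonneg_nonneg)

text \<open>The Cauchy-Schwarz inequality on S, phrased through the weighted arithmetic-geometric
  mean so that no roots of possibly infinite integrals occur.\<close>

lemma nn_integral_le_of_square:
  assumes b: "0 < \<beta>" and v: "0 \<le> v" and [measurable]: "h \<in> borel_measurable M" "S \<in> sets M"
    and nonneg: "\<And>x. 0 \<le> h x" and S: "emeasure M S \<le> ennreal v"
    and sq: "(\<integral>\<^sup>+x\<in>S. ennreal ((h x)\<^sup>2) \<partial>M) \<le> ennreal (\<beta>\<^sup>2 * v)"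
  shows "(\<integral>\<^sup>+x\<in>S. ennreal (h x) \<partial>M) \<le> ennreal (\<beta> * v)"
proof -
  have "(\<integral>\<^sup>+x\<in>S. ennreal (h x) \<partial>M) \<le> (\<integral>\<^sup>+x. ennreal (1 / (2 * \<beta>)) * (ennreal ((h x)\<^sup>2) * indicator S x) + ennreal (\<beta> / 2) * indicator S x \<partial>M)"
  proof (rule nn_integral_mono, goal_cases)
    case (1 x)
    have "h x \<le> 1 / (2 * \<beta>) * (h x)\<^sup>2 + \<beta> / 2" using AM_GM_weighted[OF b, of "h x" 1] by (simp add: field_simps)
    hence "ennreal (h x) \<le> ennreal (1 / (2 * \<beta>)) * ennreal ((h x)\<^sup>2) + ennreal (\<beta> / 2)" using b by (intro ennreal_le_mult_add) auto
    thus ?case by (auto simp: indicator_def)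
  qed
  also have "... = ennreal (1 / (2 * \<beta>)) * (\<integral>\<^sup>+x\<in>S. ennreal ((h x)\<^sup>2) \<partial>M) + ennreal (\<beta> / 2) * emeasure M S"
    by (subst nn_integral_add, measurable, subst nn_integral_cmult, measurable, subst nn_integral_cmult_indicator, measurable)
  also have "... \<le> ennreal (1 / (2 * \<beta>)) * ennreal (\<beta>\<^sup>2 * v) + ennreal (\<beta> / 2) * ennreal v" by (intro add_mono mult_left_mono sq S) auto
  also have "... = ennreal (\<beta> * v)" using b v by (auto simp: field_simps power2_eq_square ennreal_mult[symmetric] ennreal_plus[symmetric] ennreal_plus)
  finally show ?thesis .
qed

section \<open>Truncated integrals against the kernel\<close>

locale cz_kernel =
  fixes K :: "real^'n \<Rightarrow> real^'n \<Rightarrow> complex" and A \<eta> :: real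
  assumes A_pos: "0 < A" and \<eta>_pos: "0 < \<eta>"
    and size: "\<And>x y. x \<noteq> y \<Longrightarrow> norm (K x y) \<le> A / norm (x - y)^CARD('n)"
    and reg1: "\<And>x x' y. x \<noteq> y \<Longrightarrow> 2 * norm (x - x') \<le> norm (x - y) \<Longrightarrow>
       norm (K x y - K x' y) \<le> A * norm (x - x') powr \<eta> / norm (x - y) powr (real CARD('n) + \<eta>)"
    and reg2: "\<And>x y y'. x \<noteq> y \<Longrightarrow> 2 * norm (y - y') \<le> norm (x - y) \<Longrightarrow>
       norm (K x y - K x y') \<le> A * norm (y - y') powr \<eta> / norm (x - y) powr (real CARD('n) + \<eta>)"
begin

abbreviation far :: "real \<Rightarrow> real^'n \<Rightarrow> real^'n \<Rightarrow> 'a::zero_neq_one" where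
  "far t x y \<equiv> indicator {y. norm (x - y) > t} y"

definition tr :: "real \<Rightarrow> (real^'n \<Rightarrow> complex) \<Rightarrow> real^'n \<Rightarrow> complex" where
  "tr t f x = (LINT y|lebesgue. far t x y *\<^sub>R (K x y * f y))"

lemma max_truncation_tr: "max_truncation K f x = (SUP t\<in>{0<..}. enorm (tr t f x))" by (simp add: max_truncation_def tr_def set_lebesgue_integral_def)

lemma max_truncation_le_iff: "max_truncation K f x \<le> l \<longleftrightarrow> (\<forall>t>0. enorm (tr t f x) \<le> l)" by (auto simp: max_truncation_tr SUP_le_iff)

text \<open>Measurability of the kernel is not part of the definition; regularity in the second
  variable provides it through continuity off the diagonal.\<close>

lemma K_continuous: "continuous_on (- {x}) (K x)" unfolding continuous_on_def
proof
  fix y assume "y \<in> - {x}"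
  hence xy: "x \<noteq> y" by simp
  define d where "d = norm (x - y)"
  have d: "0 < d" using xy by (simp add: d_def)
  have "((\<lambda>y'. K x y' - K x y) \<longlongrightarrow> 0) (at y within - {x})"
  proof (rule Lim_null_comparison)
    show "\<forall>\<^sub>F y' in at y within - {x}. norm (K x y' - K x y) \<le> A * norm (y - y') powr \<eta> / d powr (real CARD('n) + \<eta>)" unfolding eventually_at
    proof (intro exI[of _ "d / 2"] conjI ballI impI)
      fix y' assume "y' \<noteq> y \<and> dist y' y < d / 2"
      hence "2 * norm (y - y') \<le> norm (x - y)" by (simp add: d_def dist_norm norm_minus_commute)
      from reg2[OF xy this] show "norm (K x y' - K x y) \<le> A * norm (y - y') powr \<eta> / d powr (real CARD('n) + \<eta>)" by (simp add: d_def norm_minus_commute)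
    qed (use d in auto)
    have "((\<lambda>y'. A * norm (y - y') powr \<eta> / d powr (real CARD('n) + \<eta>)) \<longlongrightarrow> A * norm (y - y) powr \<eta> / d powr (real CARD('n) + \<eta>)) (at y within - {x})"
      using \<eta>_pos d by (intro tendsto_intros) auto
    thus "((\<lambda>y'. A * norm (y - y') powr \<eta> / d powr (real CARD('n) + \<eta>)) \<longlongrightarrow> 0) (at y within - {x})" using \<eta>_pos by simp
  qed
  thus "(K x \<longlongrightarrow> K x y) (at y within - {x})" by (simp add: LIM_zero_iff)
qed

lemma K_measurable:
  assumes "0 \<le> t" shows "(\<lambda>y. far t x y *\<^sub>R K x y) \<in> lmeas"
proof -
  have "continuous_on {y. norm (x - y) > t} (K x)" by (rule continuous_on_subset[OF K_continuous]) (use assms in auto)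
  hence "(\<lambda>y. far t x y *\<^sub>R K x y) \<in> borel_measurable borel" by (intro borel_measurable_continuous_on_indicator) auto
  thus ?thesis by (intro measurable_completion) simp
qed

lemma K_bound: "0 < t \<Longrightarrow> norm (far t x y *\<^sub>R K x y) \<le> A / t^CARD('n)"
proof (cases "norm (x - y) > t")
  case True
  assume t: "0 < t"
  have "0 < norm (x - y)" using True t by linarith
  hence "norm (K x y) \<le> A / norm (x - y)^CARD('n)" by (intro size) auto
  also have "... \<le> A / t^CARD('n)" using True t A_pos \<open>0 < norm (x - y)\<close> by (intro divide_left_mono power_mono mult_pos_pos) auto
  finally show ?thesis using True by simp
qed (use A_pos in auto)

lemma tr_nice: assumes "nice f" "0 < t" shows "nice (\<lambda>y. far t x y *\<^sub>R (K x y * f y))"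
proof -
  have "nice (\<lambda>y. f y * (far t x y *\<^sub>R K x y))" using assms K_measurable[of t x] K_bound[of t x] by (intro nice_mult_bounded) auto
  thus ?thesis by (simp add: mult.commute)
qed

lemma tr_diff:
  assumes "nice f" "nice g" "0 < t" shows "tr t (\<lambda>y. f y - g y) x = tr t f x - tr t g x"
proof -
  have i: "integrable lebesgue (\<lambda>y. far t x y *\<^sub>R (K x y * h y))" if "nice h" for h by (rule nice_integrable[OF tr_nice[OF that assms(3)]])
  show ?thesis unfolding tr_def Bochner_Integration.integral_diff[OF i[OF assms(1)] i[OF assms(2)], symmetric]
    by (intro Bochner_Integration.integral_cong) (simp_all add: scaleR_diff_right right_diff_distrib)
qed

lemma tr_le_nn: "enorm (tr t f x) \<le> (\<integral>y. far t x y * enorm (K x y * f y))"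
  unfolding tr_def by (rule order_trans[OF norm_integral_le_nn_integral]) (auto intro!: nn_integral_mono simp: indicator_def)

text \<open>The tail integrals of the regularity estimates, expressed through \<^const>\<open>kap\<close>; the factor
  \<open>sqrt n\<close> converts between the Euclidean and the maximum norm.\<close>

lemma norm_tail_le_kap:
  assumes t: "0 < t" and y: "t \<le> norm (y - x :: real^'n)"
  shows "t powr \<eta> / norm (y - x) powr (real CARD('n) + \<eta>)
    \<le> (sqrt CARD('n)) powr (real CARD('n) + \<eta>) / t^CARD('n) * kap (real CARD('n) + \<eta>) x t y"
proof -
  define s where "s = real CARD('n) + \<eta>"
  define D where "D = infnorm (y - x)"
  have s: "0 < s" using \<eta>_pos by (simp add: s_def)
  have n1: "1 \<le> sqrt CARD('n)" by (simp add: Suc_leI)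
  have D: "norm (y - x) \<le> sqrt CARD('n) * D" "D \<le> norm (y - x)" "0 \<le> D"
    using norm_le_infnorm_cart[of "y - x"] infnorm_le_norm[of "y - x"] infnorm_pos_le by (auto simp: D_def)
  have "max t D \<le> norm (y - x)" using y D by simp
  have m: "0 < max t D" using t by simp
  have "t powr \<eta> / norm (y - x) powr s \<le> t powr \<eta> / max t D powr s"
    using m s \<open>max t D \<le> norm (y - x)\<close> by (intro divide_left_mono powr_mono2 mult_pos_pos) auto
  also have "... = 1 / t^CARD('n) * kap s x t y" using t m by (auto simp: kap_def D_def powr_divide s_def powr_add powr_realpow)
  also have "... \<le> (sqrt CARD('n)) powr s / t^CARD('n) * kap s x t y" using t n1 s by (intro mult_right_mono divide_right_mono ge_one_powr_ge_zero) auto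
  finally show ?thesis by (simp add: s_def)
qed

definition cE :: real where "cE = A * (sqrt CARD('n)) powr (real CARD('n) + \<eta>) * kC CARD('n) \<eta>"

lemma cE_pos: "0 < cE" using A_pos kC_ge1[OF \<eta>_pos, of "CARD('n)"] by (simp add: cE_def)

lemma tail_integral_le:
  fixes f :: "real^'n \<Rightarrow> complex"
  assumes t: "0 < t" and [measurable]: "f \<in> lmeas"
    and m: "\<And>\<rho>. t \<le> \<rho> \<Longrightarrow> (\<integral>y\<in>qb x \<rho>. enorm (f y)) \<le> m * ennreal ((2*\<rho>)^CARD('n))"
  shows "(\<integral>y. indicator {y. t \<le> norm (y - x)} y * ennreal (A * t powr \<eta> / norm (y - x) powr (real CARD('n) + \<eta>) * norm (f y)))
    \<le> ennreal cE * m"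
proof -
  define s where "s = real CARD('n) + \<eta>"
  define k where "k = A * (sqrt CARD('n)) powr s / t^CARD('n)"
  have k: "0 \<le> k" using A_pos t by (simp add: k_def)
  have "(\<integral>y. indicator {y. t \<le> norm (y - x)} y * ennreal (A * t powr \<eta> / norm (y - x) powr s * norm (f y)))
    \<le> (\<integral>y. ennreal k * (enorm (f y) * ennreal (kap s x t y)))"
  proof (rule nn_integral_mono, goal_cases)
    case (1 y)
    show ?case
    proof (cases "t \<le> norm (y - x)")
      case True
      have "A * (t powr \<eta> / norm (y - x) powr s) * norm (f y) \<le> A * ((sqrt CARD('n)) powr s / t^CARD('n) * kap s x t y) * norm (f y)"
        using norm_tail_le_kap[OF t True] A_pos by (intro mult_right_mono mult_left_mono) (auto simp: s_def)
      hence "A * t powr \<eta> / norm (y - x) powr s * norm (f y) \<le> k * (norm (f y) * kap s x t y)" by (simp add: k_def mult_ac)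
      thus ?thesis using True k by (simp add: ennreal_mult[symmetric] ennreal_leI)
    qed auto
  qed
  also have "... = ennreal k * (\<integral>y. enorm (f y) * ennreal (kap s x t y))" by (rule nn_integral_cmult) measurable
  also have "... \<le> ennreal k * (ennreal (kC CARD('n) \<eta> * t^CARD('n)) * m)"
    unfolding s_def kC_def using m by (intro mult_left_mono nn_integral_kap_le t \<eta>_pos) auto
  also have "... = ennreal (k * (kC CARD('n) \<eta> * t^CARD('n))) * m" using k kC_ge1[OF \<eta>_pos, of "CARD('n)"] t by (simp add: ennreal_mult mult.assoc)
  also have "k * (kC CARD('n) \<eta> * t^CARD('n)) = cE" using t by (simp add: k_def cE_def s_def)
  finally show ?thesis by (simp add: s_def)
qed

definition cD :: real where "cD = cE + (2 * A * (4 * real CARD('n))^CARD('n) + A * 4^CARD('n))"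

lemma cD_pos: "0 < cD" unfolding cD_def using cE_pos A_pos by (intro add_pos_nonneg) auto

text \<open>Three regions for y. Within \<tau> of x' the size bound at distance 2 \<rho> is enough;
  further out, the regularity of K handles points kept by both truncations, and points kept by only
  one lie within 2 t of x', where the size bound at distance t applies.\<close>

lemma tr_shift:
  fixes \<rho> t :: real
  assumes g: "nice g" and \<rho>: "0 < \<rho>" and t: "0 < t"
    and supp: "\<And>y. g y \<noteq> 0 \<Longrightarrow> 2 * \<rho> \<le> norm (x - y) \<and> 2 * \<rho> \<le> norm (x' - y)"
    and xx: "norm (x - x') \<le> 2 * (CARD('n) * \<rho>)"
    and mr: "\<And>r. 0 < r \<Longrightarrow> (\<integral>y\<in>qb x' r. enorm (g y)) \<le> m * ennreal ((2 * r)^CARD('n))"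
  shows "enorm (tr t g x - tr t g x') \<le> ennreal cD * m"
proof -
  define n where "n = real CARD('n)"
  \<comment> \<open>At least twice the distance of x and x', so that beyond it the first regularity
    condition holds.\<close>
  define \<tau> where "\<tau> = 4 * (n * \<rho>)"
  have [measurable]: "g \<in> lmeas" by (rule nice_measurable[OF g])
  have n1: "1 \<le> n" unfolding n_def using zero_less_card_finite[where 'a='n] by linarith
  have \<tau>: "0 < \<tau>" using n1 \<rho> by (simp add: \<tau>_def)
  have xx': "2 * norm (x' - x) \<le> \<tau>" using xx norm_minus_commute[of x x'] unfolding \<tau>_def n_def by linarith
  let ?k = "\<lambda>x y. far t x y *\<^sub>R (K x y * g y)"
  let ?T1 = "\<lambda>y. indicator {y. \<tau> \<le> norm (y - x')} y * ennreal (A * \<tau> powr \<eta> / norm (y - x') powr (real CARD('n) + \<eta>) * norm (g y))"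
  let ?T2 = "\<lambda>y. ennreal (2 * A / (2 * \<rho>)^CARD('n)) * (enorm (g y) * indicator (qb x' \<tau>) y)"
  let ?T3 = "\<lambda>y. ennreal (A / t^CARD('n)) * (enorm (g y) * indicator (qb x' (2 * t)) y)"
  have i: "integrable lebesgue (?k x)" for x by (rule nice_integrable[OF tr_nice[OF g t]])
  have Kb: "norm (K z y) \<le> A / d^CARD('n)" if "d \<le> norm (z - y)" "0 < d" for z y d
  proof -
    have "norm (K z y) \<le> A / norm (z - y)^CARD('n)" using that by (intro size) auto
    also have "... \<le> A / d^CARD('n)" using that A_pos by (intro divide_left_mono power_mono mult_pos_pos zero_less_power) auto
    finally show ?thesis .
  qed
  have pw: "enorm (?k x y - ?k x' y) \<le> ?T1 y + (?T2 y + ?T3 y)" for y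
  proof (cases "g y = 0")
    case False
    have d: "2 * \<rho> \<le> norm (x - y)" "2 * \<rho> \<le> norm (x' - y)" using supp[OF False] by auto
    have inf: "infnorm (y - x') \<le> norm (x' - y)" using infnorm_le_norm[of "y - x'"] by (simp add: norm_minus_commute)
    show ?thesis
    proof (cases "norm (x' - y) < \<tau>")
      case True
      have b: "norm (?k z y) \<le> A / (2 * \<rho>)^CARD('n) * norm (g y)" if "z \<in> {x, x'}" for z
      proof -
        have "norm (K z y) \<le> A / (2 * \<rho>)^CARD('n)" using d that \<rho> by (intro Kb) auto
        hence "norm (K z y) * norm (g y) \<le> A / (2 * \<rho>)^CARD('n) * norm (g y)" by (intro mult_right_mono) auto
        thus ?thesis using A_pos \<rho> by (auto simp: indicator_def norm_mult)
      qed
      have "norm (?k x y - ?k x' y) \<le> norm (?k x y) + norm (?k x' y)" by (rule norm_triangle_ineq4)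
      also have "... \<le> 2 * A / (2 * \<rho>)^CARD('n) * norm (g y)" using b[of x] b[of x'] by simp
      finally have "enorm (?k x y - ?k x' y) \<le> ?T2 y" using True inf A_pos \<rho> by (simp add: ennreal_mult[symmetric] ennreal_leI mem_qb)
      thus ?thesis by (simp add: add_increasing add_increasing2)
    next
      case far: False
      have t1: "norm (x - y) \<le> norm (x' - y) + norm (x' - x)" using norm_triangle_ineq4[of "x' - y" "x' - x"] by simp
      have t2: "norm (x' - y) \<le> norm (x - y) + norm (x' - x)" using norm_triangle_ineq[of "x - y" "x' - x"] by simp
      have T3: "enorm (K z y * g y) \<le> ?T3 y" if "t \<le> norm (z - y)" "norm (x' - y) \<le> 2 * t" for z
      proof -
        have "norm (K z y) * norm (g y) \<le> A / t^CARD('n) * norm (g y)" using that t by (intro mult_right_mono Kb) auto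
        thus ?thesis using that inf A_pos t by (simp add: ennreal_mult[symmetric] ennreal_leI mem_qb norm_mult)
      qed
      consider "norm (x - y) > t" "norm (x' - y) > t" | "norm (x - y) \<le> t" "norm (x' - y) \<le> t"
        | "norm (x - y) > t" "norm (x' - y) \<le> t" | "norm (x - y) \<le> t" "norm (x' - y) > t" by linarith
      thus ?thesis
      proof cases
        case 1
        have "norm (K x' y - K x y) \<le> A * norm (x' - x) powr \<eta> / norm (x' - y) powr (real CARD('n) + \<eta>)" using far xx' \<tau> by (intro reg1) auto
        also have "... \<le> A * \<tau> powr \<eta> / norm (x' - y) powr (real CARD('n) + \<eta>)"
        proof -
          have "norm (x' - x) \<le> \<tau>" using xx' norm_ge_zero[of "x' - x"] by linarith
          thus ?thesis using A_pos \<eta>_pos by (intro divide_right_mono mult_left_mono powr_mono2) auto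
        qed
        finally have "norm (K x' y - K x y) * norm (g y) \<le> A * \<tau> powr \<eta> / norm (x' - y) powr (real CARD('n) + \<eta>) * norm (g y)"
          by (intro mult_right_mono) auto
        moreover have "norm (?k x y - ?k x' y) = norm (K x' y - K x y) * norm (g y)" using 1 by (simp add: left_diff_distrib[symmetric] norm_mult norm_minus_commute)
        ultimately have "enorm (?k x y - ?k x' y) \<le> ?T1 y" using far by (simp add: ennreal_leI norm_minus_commute[of y x'])
        thus ?thesis by (simp add: add_increasing2)
      next
        case 2 thus ?thesis by simp
      next
        case 3
        hence "enorm (?k x y - ?k x' y) \<le> ?T3 y" using T3[of x] t by simp
        thus ?thesis by (simp add: add_increasing)
      next
        \<comment> \<open>Here |x' - y| \<le> t + |x' - x| and |x' - x| \<le> |x' - y| / 2, hence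
          |x' - y| \<le> 2 t.\<close>
        case 4
        hence "enorm (?k x y - ?k x' y) \<le> ?T3 y" using T3[of x'] far xx' t2 by simp
        thus ?thesis by (simp add: add_increasing)
      qed
    qed
  qed simp
  have I1: "(\<integral>y. ?T1 y) \<le> ennreal cE * m" using \<tau> by (intro tail_integral_le mr) auto
  have I2: "(\<integral>y. ?T2 y) \<le> ennreal (2 * A * (4 * n)^CARD('n)) * m"
  proof -
    have "(\<integral>y. ?T2 y) = ennreal (2 * A / (2 * \<rho>)^CARD('n)) * (\<integral>y\<in>qb x' \<tau>. enorm (g y))" by (rule nn_integral_cmult) measurable
    also have "... \<le> ennreal (2 * A / (2 * \<rho>)^CARD('n)) * (m * ennreal ((2 * \<tau>)^CARD('n)))" by (intro mult_left_mono mr \<tau>) auto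
    also have "... = ennreal (2 * A / (2 * \<rho>)^CARD('n) * (2 * \<tau>)^CARD('n)) * m" using A_pos \<rho> \<tau> by (subst ennreal_mult) (auto simp: mult_ac)
    also have "2 * A / (2 * \<rho>)^CARD('n) * (2 * \<tau>)^CARD('n) = 2 * A * ((2 * \<tau>) / (2 * \<rho>))^CARD('n)"
      by (simp only: power_divide times_divide_eq_left times_divide_eq_right)
    also have "(2 * \<tau>) / (2 * \<rho>) = 4 * n" using \<rho> by (simp add: \<tau>_def)
    finally show ?thesis .
  qed
  have I3: "(\<integral>y. ?T3 y) \<le> ennreal (A * 4^CARD('n)) * m"
  proof -
    have "(\<integral>y. ?T3 y) = ennreal (A / t^CARD('n)) * (\<integral>y\<in>qb x' (2 * t). enorm (g y))" by (rule nn_integral_cmult) measurable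
    also have "... \<le> ennreal (A / t^CARD('n)) * (m * ennreal ((2 * (2 * t))^CARD('n)))" using t by (intro mult_left_mono mr) auto
    also have "... = ennreal (A / t^CARD('n) * (2 * (2 * t))^CARD('n)) * m" using A_pos t by (subst ennreal_mult) (auto simp: mult_ac)
    also have "A / t^CARD('n) * (2 * (2 * t))^CARD('n) = A * ((2 * (2 * t)) / t)^CARD('n)" by (simp only: power_divide times_divide_eq_left times_divide_eq_right)
    also have "(2 * (2 * t)) / t = 4" using t by simp
    finally show ?thesis .
  qed
  have "tr t g x - tr t g x' = (LINT y|lebesgue. ?k x y - ?k x' y)" unfolding tr_def by (rule Bochner_Integration.integral_diff[symmetric]) (rule i)+
  hence "enorm (tr t g x - tr t g x') \<le> (\<integral>y. enorm (?k x y - ?k x' y))" by (simp only: norm_integral_le_nn_integral)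
  also have "... \<le> (\<integral>y. ?T1 y + (?T2 y + ?T3 y))" by (intro nn_integral_mono pw)
  also have "... = (\<integral>y. ?T1 y) + ((\<integral>y. ?T2 y) + (\<integral>y. ?T3 y))"
  proof -
    have [measurable]: "(\<lambda>y. norm (y - x')) \<in> lmeas" by (rule measurable_completion) measurable
    have "closed {y. \<tau> \<le> norm (y - x')}" by (intro closed_Collect_le continuous_intros)
    hence s: "{y. \<tau> \<le> norm (y - x')} \<in> sets lebesgue" by (intro sets_completionI_sets lborelD borel_closed)
    have "?T1 \<in> lmeas" by (intro borel_measurable_times_ennreal borel_measurable_indicator s) measurable
    moreover have "?T2 \<in> lmeas" by measurable
    moreover have "?T3 \<in> lmeas" by measurable
    ultimately
    show ?thesis by (simp only: nn_integral_add borel_measurable_add)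
  qed
  also have "... \<le> ennreal cE * m + (ennreal (2 * A * (4 * n)^CARD('n)) * m + ennreal (A * 4^CARD('n)) * m)" by (intro add_mono I1 I2 I3)
  also have "... = ennreal cD * m"
  proof -
    have "0 \<le> cE" "0 \<le> 2 * A * (4 * n)^CARD('n)" "0 \<le> A * 4^CARD('n)" using cE_pos A_pos n1 by auto
    thus ?thesis unfolding cD_def n_def[symmetric] by (simp only: ennreal_plus add_nonneg_nonneg distrib_right)
  qed
  finally show ?thesis .
qed

end

section \<open>Pointwise control by the maximal function of squares\<close>

locale cz_operator = cz_kernel K A \<eta> for K :: "real^'n \<Rightarrow> real^'n \<Rightarrow> complex" and A \<eta> +
  fixes T :: "(real^'n \<Rightarrow> complex) \<Rightarrow> (real^'n \<Rightarrow> complex) \<Rightarrow> complex" and B :: real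
  assumes T_lin: "\<And>f g \<phi> a b. f \<in> schwartz \<Longrightarrow> g \<in> schwartz \<Longrightarrow> \<phi> \<in> schwartz \<Longrightarrow>
      T (\<lambda>x. a * f x + b * g x) \<phi> = a * T f \<phi> + b * T g \<phi>"
    and T_L2: "\<And>f. f \<in> test_functions \<Longrightarrow> \<exists>g. g \<in> lmeas \<and>
      (\<forall>\<phi>\<in>schwartz. T f \<phi> = (LINT x|lebesgue. g x * \<phi> x)) \<and>
      (\<integral>x. ennreal ((norm (g x))\<^sup>2)) \<le> ennreal (B\<^sup>2) * (\<integral>x. ennreal ((norm (f x))\<^sup>2))"
    and T_rep: "\<And>f \<phi>. f \<in> test_functions \<Longrightarrow> \<phi> \<in> test_functions \<Longrightarrow> supp f \<inter> supp \<phi> = {} \<Longrightarrow>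
      T f \<phi> = (LINT x|lebesgue. (LINT y|lebesgue. K x y * f y) * \<phi> x)"
begin

definition cK :: real where "cK = (4 * sqrt CARD('n))^CARD('n) * ((1/2)^CARD('n) + (B\<^sup>2 + 1) * 4^CARD('n))"

definition cot :: real where
  "cot = cD + cK + A * 4^CARD('n)"

lemma cK_nonneg [simp]: "0 \<le> cK" by (simp add: cK_def)

lemma cot_pos: "0 < cot" unfolding cot_def using cD_pos A_pos by (intro add_pos_nonneg) auto

text \<open>The value of \<open>T\<close> on the far part of \<open>f\<close> is tested against a bump at the scale of the truncation.\<close>

lemma cotlar_tr:
  assumes f: "f \<in> test_functions" and g [measurable]: "g \<in> lmeas"
    and gT: "\<And>\<phi>. \<phi> \<in> schwartz \<Longrightarrow> T f \<phi> = (LINT x|lebesgue. g x * \<phi> x)"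
    and \<beta>: "0 < \<beta>" and MM: "MM (\<lambda>y. ennreal ((norm (f y))\<^sup>2 + (norm (g y))\<^sup>2)) x \<le> ennreal (\<beta>\<^sup>2)"
    and t: "0 < t"
  shows "norm (tr t f x) \<le> cot * \<beta>"
proof -
  have f_meas [measurable]: "f \<in> lmeas" by (rule nice_measurable[OF test_function_nice[OF f]])
  have sq: "(\<integral>y\<in>qb x \<rho>. ennreal ((norm (f y))\<^sup>2 + (norm (g y))\<^sup>2)) \<le> ennreal (\<beta>\<^sup>2 * (2*\<rho>)^CARD('n))" if "0 < \<rho>" for \<rho>
  proof -
    have "x \<in> qb x \<rho>" using that by (simp add: mem_qb infnorm_0)
    have "(\<integral>y\<in>qb x \<rho>. ennreal ((norm (f y))\<^sup>2 + (norm (g y))\<^sup>2)) \<le> ennreal (\<beta>\<^sup>2) * ennreal ((2*\<rho>)^CARD('n))"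
      by (rule order_trans[OF MM_upper[OF that \<open>x \<in> qb x \<rho>\<close>] mult_right_mono[OF MM]]) simp
    thus ?thesis using that by (simp add: ennreal_mult)
  qed
  have sqf: "(\<integral>y\<in>qb x \<rho>. ennreal ((norm (f y))\<^sup>2)) \<le> ennreal (\<beta>\<^sup>2 * (2*\<rho>)^CARD('n))" if "0 < \<rho>" for \<rho>
    by (rule order_trans[OF nn_integral_mono sq[OF that]]) (auto intro!: mult_right_mono ennreal_leI)
  have sqg: "(\<integral>y\<in>qb x \<rho>. ennreal ((norm (g y))\<^sup>2)) \<le> ennreal (\<beta>\<^sup>2 * (2*\<rho>)^CARD('n))" if "0 < \<rho>" for \<rho>
    by (rule order_trans[OF nn_integral_mono sq[OF that]]) (auto intro!: mult_right_mono ennreal_leI)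
  have f1: "(\<integral>y\<in>qb x \<rho>. enorm (f y)) \<le> ennreal (\<beta> * (2*\<rho>)^CARD('n))" if "0 < \<rho>" for \<rho>
    using that emeasure_qb[of \<rho> x] by (intro nn_integral_le_of_square[OF \<beta>] sqf) auto
  have g1: "(\<integral>y\<in>qb x \<rho>. enorm (g y)) \<le> ennreal (\<beta> * (2*\<rho>)^CARD('n))" if "0 < \<rho>" for \<rho>
    using that emeasure_qb[of \<rho> x] by (intro nn_integral_le_of_square[OF \<beta>] sqg) auto
  \<comment> \<open>\<psi> splits f at scale t into F1, living within 2 t of x, and F2, vanishing
    within t. The bump \<phi> lives within t/4 of x, away from the support of F2.\<close>
  define \<psi> where "\<psi> y = cutoff x t (2*t) y" for y
  define \<phi> where "\<phi> y = cutoff x (t/8) (t/4) y" for y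
  have \<psi>: "0 \<le> \<psi> y" "\<psi> y \<le> 1" "norm (y - x) \<le> t \<Longrightarrow> \<psi> y = 1" "2*t \<le> norm (y - x) \<Longrightarrow> \<psi> y = 0" for y
    using t by (auto simp: \<psi>_def cutoff_range cutoff_eq_1 cutoff_eq_0)
  have \<phi>: "0 \<le> \<phi> y" "\<phi> y \<le> 1" "norm (y - x) \<le> t/8 \<Longrightarrow> \<phi> y = 1" "t/4 \<le> norm (y - x) \<Longrightarrow> \<phi> y = 0" for y
    using t by (auto simp: \<phi>_def cutoff_range cutoff_eq_1 cutoff_eq_0)
  define F1 where "F1 y = f y * complex_of_real (\<psi> y)" for y
  define F2 where "F2 y = 1 * f y + (-1) * F1 y" for y
  define \<Phi> where "\<Phi> y = complex_of_real (\<phi> y)" for y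
  have F1: "F1 \<in> test_functions" unfolding F1_def \<psi>_def using t f by (intro test_function_mult_smcl cutoff_smcl) auto
  have F2: "F2 \<in> test_functions" unfolding F2_def using test_functions_add[OF f F1, of "-1"] by simp
  have \<Phi>: "\<Phi> \<in> test_functions" unfolding \<Phi>_def \<phi>_def using t by (intro cutoff_test_function) auto
  have F2eq: "F2 y = f y * complex_of_real (1 - \<psi> y)" for y by (simp add: F2_def F1_def algebra_simps)
  have F2z: "F2 y = 0" if "norm (y - x) \<le> t" for y using \<psi>(3)[OF that] by (simp add: F2eq)
  have F2le: "norm (F2 y) \<le> norm (f y)" for y
    unfolding F2eq norm_mult using \<psi>(1,2)[of y] mult_left_mono[of "1 - \<psi> y" 1 "norm (f y)"] by (simp only: norm_of_real) simp
  note nF2 = test_function_nice[OF F2] and n\<Phi> = test_function_nice[OF \<Phi>] and nF1 = test_function_nice[OF F1]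
  have [measurable]: "F2 \<in> lmeas" "\<Phi> \<in> lmeas" "F1 \<in> lmeas" using nF2 n\<Phi> nF1 by (auto simp: nice_def)
  have \<phi>_meas [measurable]: "\<phi> \<in> lmeas"
  proof -
    have "(\<lambda>y. Re (\<Phi> y)) \<in> lmeas" by measurable
    thus ?thesis by (simp add: \<Phi>_def)
  qed
  define h where "h z = (LINT y|lebesgue. K z y * F2 y)" for z
  \<comment> \<open>the singularity of the kernel is not seen by \<open>F2\<close>\<close>
  have KF2: "K z y * F2 y = indicator {y. norm (z - y) > t/2} y *\<^sub>R (K z y * F2 y)" if z: "norm (z - x) \<le> t/4" for z y
  proof (cases "norm (z - y) > t/2")
    case False
    have "norm (y - x) \<le> norm (z - y) + norm (z - x)" using norm_triangle_ineq4[of "z - x" "z - y"] by simp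
    hence "norm (y - x) \<le> t" using False z t by linarith
    thus ?thesis using F2z by simp
  qed auto
  have int: "integrable lebesgue (\<lambda>y. K z y * F2 y)" if "norm (z - x) \<le> t/4" for z
  proof -
    have "integrable lebesgue (\<lambda>y. indicator {y. norm (z - y) > t/2} y *\<^sub>R (K z y * F2 y))" using t by (intro nice_integrable tr_nice nF2) auto
    thus ?thesis using KF2[OF that] by (simp cong: Bochner_Integration.integrable_cong)
  qed
  have hdiff: "norm (h z - h x) \<le> cD * \<beta>" if z: "norm (z - x) \<le> t/4" for z
  proof -
    \<comment> \<open>Truncation at t/2 leaves the integral unchanged, since F2 vanishes within t of
      x; this brings \<open>tr_shift\<close> to bear.\<close>
    have hz: "h z = tr (t/2) F2 z" if "norm (z - x) \<le> t/4" for z unfolding h_def tr_def by (rule Bochner_Integration.integral_cong[OF refl KF2[OF that]])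
    have n1: "1 \<le> real CARD('n)" using zero_less_card_finite[where 'a='n] by linarith
    have "enorm (tr (t/2) F2 z - tr (t/2) F2 x) \<le> ennreal cD * ennreal \<beta>"
    proof (rule tr_shift[OF nF2, where \<rho>="t/4"])
      fix y assume "F2 y \<noteq> 0"
      hence "t \<le> norm (x - y)" using F2z[of y] norm_minus_commute[of x y] by force
      moreover have "norm (x - y) \<le> norm (z - y) + norm (z - x)" using norm_triangle_ineq4[of "z - y" "z - x"] by simp
      ultimately show "2 * (t/4) \<le> norm (z - y) \<and> 2 * (t/4) \<le> norm (x - y)" using z t by linarith
    next
      show "norm (z - x) \<le> 2 * (CARD('n) * (t/4))" using z t mult_right_mono[OF n1, of "t/4"] by linarith
    next
      fix r :: real assume r: "0 < r"
      have "(\<integral>y\<in>qb x r. enorm (F2 y)) \<le> (\<integral>y\<in>qb x r. enorm (f y))" by (intro nn_integral_mono mult_right_mono ennreal_leI F2le) simp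
      thus "(\<integral>y\<in>qb x r. enorm (F2 y)) \<le> ennreal \<beta> * ennreal ((2 * r)^CARD('n))" using f1[OF r] \<beta> r by (simp add: ennreal_mult)
    qed (use t in auto)
    thus ?thesis using hz[OF z] hz[of x] t cD_pos \<beta> by (simp add: ennreal_mult[symmetric] ennreal_le_iff)
  qed
  \<comment> \<open>Continuity of h serves the measurability of its product with the bump.\<close>
  have hcont: "continuous_on (cball x (t/4)) h" unfolding continuous_on_def
  proof
    fix z assume "z \<in> cball x (t/4)"
    hence z: "norm (z - x) \<le> t/4" by (simp add: dist_norm norm_minus_commute)
    define D where "D = A / (t/2) powr (real CARD('n) + \<eta>)"
    have D: "0 < D" using A_pos t by (simp add: D_def)
    define N where "N = enn2real (\<integral>y. enorm (F2 y))"
    have Nf: "(\<integral>y. enorm (F2 y)) = ennreal N" using nice_integrable[OF nF2] unfolding N_def by (simp add: integrable_iff_bounded less_top)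
    have "((\<lambda>z'. h z' - h z) \<longlongrightarrow> 0) (at z within cball x (t/4))"
    proof (rule Lim_null_comparison)
      show "\<forall>\<^sub>F z' in at z within cball x (t/4). norm (h z' - h z) \<le> D * norm (z - z') powr \<eta> * N" unfolding eventually_at
      proof (intro exI[of _ "t/4"] conjI ballI impI)
        fix z' assume z': "z' \<in> cball x (t/4)" "z' \<noteq> z \<and> dist z' z < t / 4"
        hence z'': "norm (z' - x) \<le> t/4" by (simp add: dist_norm norm_minus_commute)
        have "h z' - h z = (LINT y|lebesgue. K z' y * F2 y - K z y * F2 y)"
          unfolding h_def by (rule Bochner_Integration.integral_diff[symmetric]) (use z z'' in \<open>auto intro: int\<close>)
        hence "enorm (h z' - h z) \<le> (\<integral>y. enorm (K z' y * F2 y - K z y * F2 y))" using norm_integral_le_nn_integral by metis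
        also have "... \<le> (\<integral>y. ennreal (D * norm (z - z') powr \<eta>) * enorm (F2 y))"
        proof (rule nn_integral_mono, goal_cases)
          case (1 y)
          show ?case
          proof (cases "norm (y - x) \<le> t")
            case True thus ?thesis using F2z by simp
          next
            case False
            have "norm (y - x) \<le> norm (z - y) + norm (z - x)" using norm_triangle_ineq4[of "z - x" "z - y"] by simp
            hence zy: "t/2 \<le> norm (z - y)" using False z t by linarith
            hence "norm (K z y - K z' y) \<le> A * norm (z - z') powr \<eta> / norm (z - y) powr (real CARD('n) + \<eta>)"
              using t z'(2) by (intro reg1) (auto simp: dist_norm norm_minus_commute)
            also have "... \<le> A * norm (z - z') powr \<eta> / (t/2) powr (real CARD('n) + \<eta>)"
              using zy t A_pos \<eta>_pos by (intro divide_left_mono powr_mono2 mult_pos_pos mult_nonneg_nonneg) auto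
            also have "... = D * norm (z - z') powr \<eta>" by (simp add: D_def)
            finally have "norm (K z y - K z' y) * norm (F2 y) \<le> D * norm (z - z') powr \<eta> * norm (F2 y)" by (intro mult_right_mono) auto
            moreover have "norm (K z' y * F2 y - K z y * F2 y) = norm (K z y - K z' y) * norm (F2 y)"
              by (simp add: norm_mult[symmetric] left_diff_distrib[symmetric]) (simp add: norm_mult norm_minus_commute)
            ultimately show ?thesis using D by (simp add: ennreal_mult[symmetric] ennreal_leI)
          qed
        qed
        also have "... = ennreal (D * norm (z - z') powr \<eta>) * ennreal N" unfolding Nf[symmetric] by (rule nn_integral_cmult) measurable
        also have "... = ennreal (D * norm (z - z') powr \<eta> * N)" using D by (simp add: ennreal_mult N_def)
        finally show "norm (h z' - h z) \<le> D * norm (z - z') powr \<eta> * N" using D by (subst (asm) ennreal_le_iff) (auto simp: N_def)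
      qed (use t in auto)
      have "((\<lambda>z'. D * norm (z - z') powr \<eta> * N) \<longlongrightarrow> D * norm (z - z) powr \<eta> * N) (at z within cball x (t/4))"
        using \<eta>_pos by (intro tendsto_intros) auto
      thus "((\<lambda>z'. D * norm (z - z') powr \<eta> * N) \<longlongrightarrow> 0) (at z within cball x (t/4))" using \<eta>_pos by simp
    qed
    thus "(h \<longlongrightarrow> h z) (at z within cball x (t/4))" by (simp add: LIM_zero_iff)
  qed
  have nh: "nice (\<lambda>z. h z * \<Phi> z)"
  proof -
    have "(\<lambda>z. indicator (cball x (t/4)) z *\<^sub>R h z) \<in> borel_measurable borel" by (intro borel_measurable_continuous_on_indicator hcont) auto
    hence m: "(\<lambda>z. indicator (cball x (t/4)) z *\<^sub>R h z) \<in> lmeas" by (intro measurable_completion) simp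
    have b: "norm (indicator (cball x (t/4)) z *\<^sub>R h z) \<le> norm (h x) + cD * \<beta>" for z
    proof (cases "z \<in> cball x (t/4)")
      case True
      hence "norm (h z - h x) \<le> cD * \<beta>" by (intro hdiff) (simp add: dist_norm norm_minus_commute)
      thus ?thesis using True norm_triangle_ineq2[of "h z" "h x"] by simp
    qed (use cD_pos \<beta> in auto)
    have "nice (\<lambda>z. \<Phi> z * (indicator (cball x (t/4)) z *\<^sub>R h z))" by (rule nice_mult_bounded[OF n\<Phi> m b])
    moreover have "\<Phi> z * (indicator (cball x (t/4)) z *\<^sub>R h z) = h z * \<Phi> z" for z
      using \<phi>(4)[of z] by (auto simp: indicator_def \<Phi>_def dist_norm norm_minus_commute)
    ultimately show ?thesis by simp
  qed
  \<comment> \<open>The supports are separated, so the kernel represents T here; this is the passage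
    from the operator to the function h.\<close>
  have TF2: "T F2 \<Phi> = (LINT z|lebesgue. h z * \<Phi> z)" unfolding h_def
  proof (rule T_rep[OF F2 \<Phi>])
    have "supp F2 \<subseteq> {y. t \<le> norm (y - x)}" unfolding supp_def
    proof (rule closure_minimal)
      show "closed {y. t \<le> norm (y - x)}" by (intro closed_Collect_le continuous_intros)
      show "{x. F2 x \<noteq> 0} \<subseteq> {y. t \<le> norm (y - x)}" using F2z by (auto simp: not_le) (meson linorder_le_cases)
    qed
    moreover have "supp \<Phi> \<subseteq> {y. norm (y - x) \<le> t/4}" unfolding supp_def
    proof (rule closure_minimal)
      show "closed {y. norm (y - x) \<le> t/4}" by (intro closed_Collect_le continuous_intros)
      show "{y. \<Phi> y \<noteq> 0} \<subseteq> {y. norm (y - x) \<le> t/4}" using \<phi>(4) by (auto simp: \<Phi>_def) (meson linorder_le_cases)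
    qed
    ultimately show "supp F2 \<inter> supp \<Phi> = {}" using t by fastforce
  qed
  have TF2': "T F2 \<Phi> = T f \<Phi> - T F1 \<Phi>"
    using T_lin[OF test_functions_schwartz[OF f] test_functions_schwartz[OF F1] test_functions_schwartz[OF \<Phi>], of 1 "-1"] unfolding F2_def[symmetric] by simp
  define I where "I = (LINT z|lebesgue. \<phi> z)"
  have int\<Phi>: "integrable lebesgue \<Phi>" by (rule nice_integrable[OF n\<Phi>])
  have int\<phi>: "integrable lebesgue \<phi>" using integrable_Re[OF int\<Phi>] by (simp add: \<Phi>_def)
  have \<Phi>I: "(LINT z|lebesgue. \<Phi> z) = of_real I" unfolding I_def \<Phi>_def by (rule integral_complex_of_real)
  have Inn: "(\<integral>z. ennreal (\<phi> z)) = ennreal I" unfolding I_def by (rule nn_integral_eq_integral[OF int\<phi>]) (simp add: \<phi>)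
  have qsup: "y \<in> qb x (t/4)" if "\<phi> y \<noteq> 0" for y using \<phi>(4)[of y] that infnorm_le_norm[of "y - x"] by (force simp: mem_qb)
  define I0 where "I0 = (t / (4 * sqrt CARD('n)))^CARD('n)"
  have n0: "0 < sqrt CARD('n)" by simp
  have I0: "0 < I0" unfolding I0_def using t n0 by (intro zero_less_power divide_pos_pos) auto
  have I_ge: "I0 \<le> I"
  proof -
    define r where "r = t / (8 * sqrt CARD('n))"
    have r: "0 < r" unfolding r_def using t n0 by (intro divide_pos_pos) auto
    have "qb x r \<subseteq> {y. \<phi> y = 1}"
    proof
      fix y assume "y \<in> qb x r"
      hence "sqrt CARD('n) * infnorm (y - x) \<le> sqrt CARD('n) * r" using n0 by (intro mult_left_mono) (auto simp: mem_qb)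
      also have "... = t/8" using n0 by (simp add: r_def)
      finally have "norm (y - x) \<le> t/8" using norm_le_infnorm_cart[of "y - x"] by linarith
      thus "y \<in> {y. \<phi> y = 1}" using \<phi>(3) by simp
    qed
    hence "(\<integral>z. indicator (qb x r) z) \<le> (\<integral>z. ennreal (\<phi> z))" by (intro nn_integral_mono) (auto simp: indicator_def)
    hence "ennreal ((2*r)^CARD('n)) \<le> ennreal I" unfolding Inn using r by (simp add: emeasure_qb)
    moreover have "2 * r = t / (4 * sqrt CARD('n))" by (simp add: r_def)
    moreover have "0 \<le> I" unfolding I_def using \<phi> by simp
    ultimately show ?thesis by (simp add: I0_def)
  qed
  define V where "V = (t/2)^CARD('n)"
  have V: "0 < V" using t by (simp add: V_def)
  have Vq: "(2 * (t/4))^CARD('n) = V" by (simp add: V_def)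
  have Tf: "norm (T f \<Phi>) \<le> \<beta> * V"
  proof -
    have "T f \<Phi> = (LINT z|lebesgue. g z * \<Phi> z)" by (rule gT[OF test_functions_schwartz[OF \<Phi>]])
    hence "enorm (T f \<Phi>) \<le> (\<integral>z. enorm (g z * \<Phi> z))" using norm_integral_le_nn_integral by metis
    also have "... \<le> (\<integral>z\<in>qb x (t/4). enorm (g z))"
    proof (rule nn_integral_mono, goal_cases)
      case (1 z)
      show ?case
      proof (cases "\<phi> z = 0")
        case False
        hence "z \<in> qb x (t/4)" by (rule qsup)
        moreover have "norm (g z * \<Phi> z) \<le> norm (g z)" using \<phi>(1,2)[of z] mult_left_mono[of "\<phi> z" 1 "norm (g z)"] by (simp add: norm_mult \<Phi>_def)
        ultimately show ?thesis by (simp add: ennreal_leI)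
      qed (simp add: \<Phi>_def)
    qed
    also have "... \<le> ennreal (\<beta> * V)" using g1[of "t/4"] t by (simp only: Vq)
    finally show ?thesis using \<beta> V by (subst (asm) ennreal_le_iff) auto
  qed
  \<comment> \<open>Boundedness on L2 is applied to the local piece, whose square mean is controlled
    by \<beta>.\<close>
  have TF1: "norm (T F1 \<Phi>) \<le> (B\<^sup>2 + 1) * (\<beta> * (4*t)^CARD('n))"
  proof -
    obtain G where G [measurable]: "G \<in> lmeas" and GT: "\<And>\<phi>. \<phi> \<in> schwartz \<Longrightarrow> T F1 \<phi> = (LINT x|lebesgue. G x * \<phi> x)"
      and GB: "(\<integral>x. ennreal ((norm (G x))\<^sup>2)) \<le> ennreal (B\<^sup>2) * (\<integral>x. ennreal ((norm (F1 x))\<^sup>2))"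
      using T_L2[OF F1] by blast
    have "(\<integral>x. ennreal ((norm (F1 x))\<^sup>2)) \<le> (\<integral>y\<in>qb x (2*t). ennreal ((norm (f y))\<^sup>2))"
    proof (rule nn_integral_mono, goal_cases)
      case (1 y)
      show ?case
      proof (cases "y \<in> qb x (2*t)")
        case True
        have "norm (F1 y) \<le> norm (f y)" using \<psi>(1,2)[of y] mult_left_mono[of "\<psi> y" 1 "norm (f y)"] by (simp add: norm_mult F1_def)
        hence "(norm (F1 y))\<^sup>2 \<le> (norm (f y))\<^sup>2" by (intro power_mono) auto
        thus ?thesis using True by (simp add: ennreal_leI)
      next
        case False
        hence "2*t \<le> norm (y - x)" using infnorm_le_norm[of "y - x"] by (simp add: mem_qb)
        thus ?thesis using \<psi>(4) by (simp add: F1_def)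
      qed
    qed
    also have "... \<le> ennreal (\<beta>\<^sup>2 * (4*t)^CARD('n))" using sqf[of "2*t"] t by simp
    finally have "(\<integral>x. ennreal ((norm (G x))\<^sup>2)) \<le> ennreal (B\<^sup>2) * ennreal (\<beta>\<^sup>2 * (4*t)^CARD('n))"
      using GB by (meson mult_left_mono order_trans zero_le)
    hence GB': "(\<integral>x. ennreal ((norm (G x))\<^sup>2)) \<le> ennreal (B\<^sup>2 * (\<beta>\<^sup>2 * (4*t)^CARD('n)))" using t by (simp add: ennreal_mult)
    have "T F1 \<Phi> = (LINT z|lebesgue. G z * \<Phi> z)" by (rule GT[OF test_functions_schwartz[OF \<Phi>]])
    hence "enorm (T F1 \<Phi>) \<le> (\<integral>z. enorm (G z * \<Phi> z))" using norm_integral_le_nn_integral by metis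
    also have "... \<le> (\<integral>z. ennreal (1 / (2*\<beta>)) * ennreal ((norm (G z))\<^sup>2) + ennreal (\<beta>/2) * indicator (qb x (2*t)) z)"
    proof (rule nn_integral_mono, goal_cases)
      case (1 z)
      show ?case
      proof (cases "\<phi> z = 0")
        case False
        hence "z \<in> qb x (t/4)" by (rule qsup)
        hence z: "z \<in> qb x (2*t)" using t by (simp add: mem_qb)
        have "norm (G z * \<Phi> z) \<le> norm (G z) * 1" using \<phi>(1,2)[of z] mult_left_mono[of "\<phi> z" 1 "norm (G z)"] by (simp add: norm_mult \<Phi>_def)
        also have "... \<le> 1 / (2*\<beta>) * (norm (G z))\<^sup>2 + \<beta>/2" using AM_GM_weighted[OF \<beta>, of "norm (G z)" 1] by (simp add: field_simps)
        finally have "enorm (G z * \<Phi> z) \<le> ennreal (1 / (2*\<beta>)) * ennreal ((norm (G z))\<^sup>2) + ennreal (\<beta>/2)"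
          using \<beta> by (intro ennreal_le_mult_add) auto
        thus ?thesis using z by simp
      qed (simp add: \<Phi>_def)
    qed
    also have "... = ennreal (1 / (2*\<beta>)) * (\<integral>z. ennreal ((norm (G z))\<^sup>2)) + ennreal (\<beta>/2) * ennreal ((4*t)^CARD('n))"
      using t emeasure_qb[of "2*t" x] by (subst nn_integral_add, measurable, subst nn_integral_cmult, measurable, subst nn_integral_cmult_indicator) auto
    also have "... \<le> ennreal (1 / (2*\<beta>)) * ennreal (B\<^sup>2 * (\<beta>\<^sup>2 * (4*t)^CARD('n))) + ennreal (\<beta>/2) * ennreal ((4*t)^CARD('n))"
      by (intro add_right_mono mult_left_mono GB') auto
    also have "... = ennreal ((B\<^sup>2 + 1) * (\<beta> * (4*t)^CARD('n)) / 2)"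
    proof -
      have "1 / (2*\<beta>) * (B\<^sup>2 * (\<beta>\<^sup>2 * (4*t)^CARD('n))) + \<beta>/2 * (4*t)^CARD('n) = (B\<^sup>2 + 1) * (\<beta> * (4*t)^CARD('n)) / 2"
        using \<beta> by (simp add: field_simps power2_eq_square)
      thus ?thesis using \<beta> t by (simp add: ennreal_mult[symmetric] ennreal_plus[symmetric] del: ennreal_plus)
    qed
    finally have "norm (T F1 \<Phi>) \<le> (B\<^sup>2 + 1) * (\<beta> * (4*t)^CARD('n)) / 2" using \<beta> t by (subst (asm) ennreal_le_iff) auto
    moreover have "0 \<le> (B\<^sup>2 + 1) * (\<beta> * (4*t)^CARD('n))" using \<beta> t by simp
    ultimately show ?thesis by linarith
  qed
  \<comment> \<open>h is nearly constant on the support of the bump, so up to an error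
    \<open>cD * \<beta>\<close> its value at x is its mean against \<Phi>, that is, T F2 tested on
    \<Phi>; dividing by the integral I of the bump yields \<open>cK\<close>.\<close>
  have hx: "norm (h x) \<le> cD * \<beta> + cK * \<beta>"
  proof -
    have ih: "integrable lebesgue (\<lambda>z. h z * \<Phi> z)" by (rule nice_integrable[OF nh])
    have "(LINT z|lebesgue. h x * \<Phi> z - h z * \<Phi> z) = h x * of_real I - T F2 \<Phi>"
      unfolding TF2 by (subst Bochner_Integration.integral_diff) (use int\<Phi> ih in \<open>auto simp: \<Phi>I\<close>)
    hence "enorm (h x * of_real I - T F2 \<Phi>) \<le> (\<integral>z. enorm (h x * \<Phi> z - h z * \<Phi> z))" using norm_integral_le_nn_integral by metis
    also have "... \<le> (\<integral>z. ennreal (cD * \<beta>) * ennreal (\<phi> z))"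
    proof (rule nn_integral_mono, goal_cases)
      case (1 z)
      show ?case
      proof (cases "norm (z - x) \<le> t/4")
        case True
        have "norm (h x * \<Phi> z - h z * \<Phi> z) = norm (h z - h x) * \<phi> z"
          using \<phi>(1)[of z] by (simp add: left_diff_distrib[symmetric] norm_mult \<Phi>_def norm_minus_commute)
        also have "... \<le> cD * \<beta> * \<phi> z" using hdiff[OF True] \<phi>(1)[of z] by (intro mult_right_mono) auto
        finally show ?thesis using cD_pos \<beta> \<phi>(1)[of z] by (simp add: ennreal_mult[symmetric] ennreal_leI)
      next
        case False
        thus ?thesis using \<phi>(4)[of z] by (simp add: \<Phi>_def)
      qed
    qed
    also have "... = ennreal (cD * \<beta>) * ennreal I" unfolding Inn[symmetric] by (rule nn_integral_cmult) measurable
    also have "... = ennreal (cD * \<beta> * I)" using cD_pos \<beta> I_ge I0 by (simp add: ennreal_mult)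
    finally have "norm (h x * of_real I - T F2 \<Phi>) \<le> cD * \<beta> * I" using cD_pos \<beta> I_ge I0 by (subst (asm) ennreal_le_iff) auto
    hence "norm (h x * of_real I) \<le> cD * \<beta> * I + (\<beta> * V + (B\<^sup>2 + 1) * (\<beta> * (4*t)^CARD('n)))"
      using norm_triangle_ineq2[of "h x * of_real I" "T F2 \<Phi>"] norm_triangle_ineq4[of "T f \<Phi>" "T F1 \<Phi>"] Tf TF1 unfolding TF2' by linarith
    hence "norm (h x) * I \<le> cD * \<beta> * I + \<beta> * (V + (B\<^sup>2 + 1) * (4*t)^CARD('n))" using I_ge I0 by (simp add: norm_mult algebra_simps)
    also have "... \<le> cD * \<beta> * I + \<beta> * cK * I"
    proof -
      have e1: "(4 * sqrt CARD('n))^CARD('n) * I0 = t^CARD('n)" unfolding I0_def power_mult_distrib[symmetric] using n0 by simp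
      have "V + (B\<^sup>2 + 1) * (4*t)^CARD('n) = ((1/2)^CARD('n) + (B\<^sup>2 + 1) * 4^CARD('n)) * t^CARD('n)"
        by (simp add: V_def power_divide power_mult_distrib algebra_simps)
      also have "... = cK * I0" unfolding e1[symmetric] cK_def by simp
      also have "... \<le> cK * I" using I_ge by (intro mult_left_mono) auto
      finally show ?thesis using \<beta> by (simp add: mult.assoc)
    qed
    also have "... = (cD * \<beta> + cK * \<beta>) * I" by (simp add: algebra_simps)
    finally show ?thesis using I_ge I0 by (simp add: mult_le_cancel_right)
  qed
  \<comment> \<open>The truncation of f differs from h x only through F1 on the annulus between t
    and 2 t.\<close>
  have "tr t f x - h x = tr t F1 x"
  proof -
    have "h x = tr t F2 x"
      unfolding h_def tr_def by (rule Bochner_Integration.integral_cong) (use F2z in \<open>auto simp: indicator_def norm_minus_commute not_less\<close>)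
    also have "... = tr t f x - tr t F1 x" unfolding F2_def using tr_diff[OF test_function_nice[OF f] nF1 t, of x] by simp
    finally show ?thesis by simp
  qed
  moreover have "norm (tr t F1 x) \<le> A * 4^CARD('n) * \<beta>"
  proof -
    have "enorm (tr t F1 x) \<le> (\<integral>y. far t x y * enorm (K x y * F1 y))" by (rule tr_le_nn)
    also have "... \<le> (\<integral>y. ennreal (A / t^CARD('n)) * (enorm (f y) * indicator (qb x (2*t)) y))"
    proof (rule nn_integral_mono, goal_cases)
      case (1 y)
      show ?case
      proof (cases "norm (x - y) > t \<and> y \<in> qb x (2*t)")
        case True
        have "norm (F1 y) \<le> norm (f y)" using \<psi>(1,2)[of y] mult_left_mono[of "\<psi> y" 1 "norm (f y)"] by (simp add: norm_mult F1_def)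
        moreover have "norm (K x y) \<le> A / t^CARD('n)" using K_bound[OF t, of x y] True by simp
        ultimately have "norm (K x y * F1 y) \<le> A / t^CARD('n) * norm (f y)" unfolding norm_mult using A_pos t by (intro mult_mono) auto
        thus ?thesis using True A_pos t by (simp add: ennreal_mult[symmetric] ennreal_leI)
      next
        case False
        have "F1 y = 0" if "y \<notin> qb x (2*t)" using that infnorm_le_norm[of "y - x"] \<psi>(4) by (auto simp: mem_qb F1_def)
        thus ?thesis using False by (auto simp: indicator_def)
      qed
    qed
    also have "... = ennreal (A / t^CARD('n)) * (\<integral>y\<in>qb x (2*t). enorm (f y))" by (rule nn_integral_cmult) measurable
    also have "... \<le> ennreal (A / t^CARD('n)) * ennreal (\<beta> * (2*(2*t))^CARD('n))" using t by (intro mult_left_mono f1) auto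
    also have "... = ennreal (A * 4^CARD('n) * \<beta>)" using t A_pos \<beta> by (auto simp: power_mult_distrib ennreal_mult[symmetric])
    finally show ?thesis using A_pos \<beta> by (subst (asm) ennreal_le_iff) auto
  qed
  ultimately have "norm (tr t f x) \<le> norm (h x) + A * 4^CARD('n) * \<beta>" using norm_triangle_ineq2[of "tr t f x" "h x"] by simp
  thus ?thesis using hx by (simp add: cot_def algebra_simps)
qed

end

section \<open>Weak type of the maximal truncation\<close>

context cz_operator
begin

text \<open>Outside this dilate of a cell, x is further than 4 n rad from the centre, while the cell
  lies within n rad of it; this is enough for the regularity of K.\<close>

definition \<Theta> :: real where "\<Theta> = 4 * CARD('n)"

lemma \<Theta>: "4 \<le> \<Theta>" unfolding \<Theta>_def using zero_less_card_finite[where 'a='n] by linarith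

definition c22 :: real where "c22 = 3^CARD('n) * cot\<^sup>2 * (1 + B\<^sup>2)"

lemma c22_pos: "0 < c22" unfolding c22_def using cot_pos by (intro mult_pos_pos add_pos_nonneg) auto

text \<open>Cotlar's inequality puts the superlevel set into that of the maximal function of |f|^2 +
  |T f|^2, to which the weak type (1,1) bound and the L2 bound apply. A measurable superset is
  asserted, which bypasses the measurability of the maximal truncation.\<close>

lemma weak22_test:
  assumes f: "f \<in> test_functions" and l: "0 < l"
  shows "\<exists>U\<in>sets lebesgue. {x. ennreal l < max_truncation K f x} \<subseteq> U \<and>
    ennreal (l\<^sup>2) * vol U \<le> ennreal c22 * (\<integral>x. ennreal ((norm (f x))\<^sup>2))"
proof -
  obtain g where g [measurable]: "g \<in> lmeas"
    and gT: "\<And>\<phi>. \<phi> \<in> schwartz \<Longrightarrow> T f \<phi> = (LINT x|lebesgue. g x * \<phi> x)"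
    and gB: "(\<integral>x. ennreal ((norm (g x))\<^sup>2)) \<le> ennreal (B\<^sup>2) * (\<integral>x. ennreal ((norm (f x))\<^sup>2))"
    using T_L2[OF f] by blast
  have [measurable]: "f \<in> lmeas" by (rule nice_measurable[OF test_function_nice[OF f]])
  let ?F = "\<lambda>y. ennreal ((norm (f y))\<^sup>2 + (norm (g y))\<^sup>2)"
  define \<beta> where "\<beta> = l / cot"
  have \<beta>: "0 < \<beta>" using l cot_pos by (simp add: \<beta>_def)
  define U where "U = {x. ennreal (\<beta>\<^sup>2) < MM ?F x}"
  have Us: "U \<in> sets lebesgue" unfolding U_def using open_MM by simp
  have "max_truncation K f x \<le> ennreal l" if "x \<notin> U" for x unfolding max_truncation_le_iff
  proof (intro allI impI)
    fix t :: real assume t: "0 < t"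
    have "norm (tr t f x) \<le> cot * \<beta>" using that t by (intro cotlar_tr[OF f g gT \<beta>]) (auto simp: U_def not_less)
    thus "enorm (tr t f x) \<le> ennreal l" using cot_pos by (intro ennreal_leI) (simp add: \<beta>_def)
  qed
  hence sub: "{x. ennreal l < max_truncation K f x} \<subseteq> U" by (auto simp: not_le[symmetric])
  let ?I = "\<integral>x. ennreal ((norm (f x))\<^sup>2)"
  have "ennreal (\<beta>\<^sup>2) * vol U \<le> 3^CARD('n) * (\<integral>y. ?F y)" unfolding U_def by (rule MM_weak_type) measurable
  also have "(\<integral>y. ?F y) = ?I + (\<integral>x. ennreal ((norm (g x))\<^sup>2))" by (subst nn_integral_add[symmetric]) (auto intro!: nn_integral_cong)
  also have "3^CARD('n) * (?I + (\<integral>x. ennreal ((norm (g x))\<^sup>2))) \<le> 3^CARD('n) * (?I + ennreal (B\<^sup>2) * ?I)"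
    by (intro mult_left_mono add_left_mono gB) auto
  also have "... = ennreal (3^CARD('n)) * (ennreal (1 + B\<^sup>2) * ?I)" by (simp add: distrib_right ennreal_power[symmetric])
  finally have 1: "ennreal (\<beta>\<^sup>2) * vol U \<le> ennreal (3^CARD('n)) * (ennreal (1 + B\<^sup>2) * ?I)" .
  have "ennreal (l\<^sup>2) * vol U = ennreal (cot\<^sup>2) * (ennreal (\<beta>\<^sup>2) * vol U)"
    using cot_pos by (simp add: ennreal_mult_assoc \<beta>_def power_divide)
  also have "... \<le> ennreal (cot\<^sup>2) * (ennreal (3^CARD('n)) * (ennreal (1 + B\<^sup>2) * ?I))" by (intro mult_left_mono 1) auto
  also have "... = ennreal (cot\<^sup>2 * (3^CARD('n) * (1 + B\<^sup>2))) * ?I"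
    by (simp only: ennreal_mult_assoc zero_le_power2 zero_le_power zero_le_numeral add_nonneg_nonneg zero_le_one mult_nonneg_nonneg)
  also have "cot\<^sup>2 * (3^CARD('n) * (1 + B\<^sup>2)) = c22" by (simp add: c22_def)
  finally show ?thesis using Us sub by blast
qed

text \<open>Meant for the good part of a Calderon-Zygmund decomposition, which is not smooth. For
  each t and x the truncations of the approximants converge, so the superlevel set of the limit lies
  in the lower limit of the sets U m.\<close>

lemma weak22:
  assumes G: "nice G" and l: "0 < l"
  shows "\<exists>U\<in>sets lebesgue. {x. ennreal l < max_truncation K G x} \<subseteq> U \<and>
    ennreal (l\<^sup>2) * vol U \<le> ennreal c22 * (\<integral>x. ennreal ((norm (G x))\<^sup>2))"
proof -
  obtain M R where MR: "0 < M" "0 < R" "\<And>x. norm (G x) \<le> M" "\<And>x. R < norm x \<Longrightarrow> G x = 0" using nice_bounds[OF G] by blast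
  have [measurable]: "G \<in> lmeas" by (rule nice_measurable[OF G])
  obtain g :: "nat \<Rightarrow> real^'n \<Rightarrow> complex" where g: "\<And>m. g m \<in> test_functions" "\<And>m x. norm (g m x) \<le> 2 * (M + 1)"
    "\<And>m x. R + 1 \<le> norm x \<Longrightarrow> g m x = 0" "AE x in lebesgue. (\<lambda>m. g m x) \<longlonglongrightarrow> G x"
    using approx_test[OF nice_measurable[OF G] MR(3) MR(2) MR(4)] by blast
  have [measurable]: "g m \<in> lmeas" for m by (rule nice_measurable[OF test_function_nice[OF g(1)]])
  have "\<exists>U. U \<in> sets lebesgue \<and> {x. ennreal l < max_truncation K (g m) x} \<subseteq> U \<and>
    ennreal (l\<^sup>2) * vol U \<le> ennreal c22 * (\<integral>x. ennreal ((norm (g m x))\<^sup>2))" for m using weak22_test[OF g(1) l, of m] by blast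
  then obtain U where U: "\<And>m. U m \<in> sets lebesgue" "\<And>m. {x. ennreal l < max_truncation K (g m) x} \<subseteq> U m"
    "\<And>m. ennreal (l\<^sup>2) * vol (U m) \<le> ennreal c22 * (\<integral>x. ennreal ((norm (g m x))\<^sup>2))" by metis
  have ind: "integrable lebesgue (\<lambda>x::real^'n. C * indicator (cball 0 (R + 1)) x :: real)" for C
    using emeasure_cball_finite[of "0::real^'n" "R + 1"] by (intro integrable_mult_right integrable_real_indicator) auto
  have tr_lim: "(\<lambda>m. tr t (g m) x) \<longlonglongrightarrow> tr t G x" if t: "0 < t" for t x unfolding tr_def
  proof (rule integral_dominated_convergence[where w="\<lambda>y. A / t^CARD('n) * (2 * (M + 1)) * indicator (cball 0 (R + 1)) y"])
    show "(\<lambda>y. far t x y *\<^sub>R (K x y * G y)) \<in> lmeas" by (rule nice_measurable[OF tr_nice[OF G t]])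
    show "(\<lambda>y. far t x y *\<^sub>R (K x y * g m y)) \<in> lmeas" for m by (rule nice_measurable[OF tr_nice[OF test_function_nice[OF g(1)] t]])
    show "integrable lebesgue (\<lambda>y::real^'n. A / t^CARD('n) * (2 * (M + 1)) * indicator (cball 0 (R + 1)) y)" by (rule ind)
    show "AE y in lebesgue. (\<lambda>m. far t x y *\<^sub>R (K x y * g m y)) \<longlonglongrightarrow> far t x y *\<^sub>R (K x y * G y)"
      using g(4) by eventually_elim (intro tendsto_intros)
    show "AE y in lebesgue. norm (far t x y *\<^sub>R (K x y * g m y)) \<le> A / t^CARD('n) * (2 * (M + 1)) * indicator (cball 0 (R + 1)) y" for m
    proof (intro AE_I2)
      fix y
      show "norm (far t x y *\<^sub>R (K x y * g m y)) \<le> A / t^CARD('n) * (2 * (M + 1)) * indicator (cball 0 (R + 1)) y"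
      proof (cases "norm y \<le> R + 1")
        case True
        have "norm (far t x y *\<^sub>R (K x y * g m y)) = norm (far t x y *\<^sub>R K x y) * norm (g m y)" by (simp add: norm_mult)
        also have "... \<le> A / t^CARD('n) * (2 * (M + 1))" using K_bound[OF t, of x y] g(2)[of m y] A_pos t by (intro mult_mono) auto
        finally show ?thesis using True by simp
      next
        case False thus ?thesis using g(3)[of y m] A_pos t MR(1) by simp
      qed
    qed
  qed
  define V where "V = (\<Union>N. \<Inter>m\<in>{N..}. U m)"
  have Vs: "V \<in> sets lebesgue" unfolding V_def using U(1) by (intro sets.countable_UN sets.countable_INT'') auto
  have sub: "{x. ennreal l < max_truncation K G x} \<subseteq> V"
  proof clarify
    fix x assume "ennreal l < max_truncation K G x"
    then obtain t where t: "0 < t" "l < norm (tr t G x)" using l unfolding max_truncation_tr less_SUP_iff by (auto simp: ennreal_less_iff)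
    have "(\<lambda>m. norm (tr t (g m) x)) \<longlonglongrightarrow> norm (tr t G x)" by (intro tendsto_norm tr_lim t)
    hence "eventually (\<lambda>m. l < norm (tr t (g m) x)) sequentially" using t(2) by (rule order_tendstoD)
    then obtain N where N: "\<And>m. N \<le> m \<Longrightarrow> l < norm (tr t (g m) x)" unfolding eventually_sequentially by blast
    have "x \<in> U m" if "N \<le> m" for m
    proof -
      have "ennreal l < enorm (tr t (g m) x)" using N[OF that] l by (simp add: ennreal_less_iff)
      also have "... \<le> max_truncation K (g m) x" unfolding max_truncation_tr using t by (intro SUP_upper) auto
      finally show ?thesis using U(2) by blast
    qed
    thus "x \<in> V" unfolding V_def by blast
  qed
  let ?I = "\<integral>x. ennreal ((norm (G x))\<^sup>2)"
  have lim: "(\<lambda>m. \<integral>\<^sup>+x. ennreal ((norm (g m x))\<^sup>2) \<partial>lebesgue) \<longlonglongrightarrow> ?I"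
  proof (rule nn_integral_dominated_convergence[where w="\<lambda>x::real^'n. ennreal ((2 * (M + 1))\<^sup>2 * indicator (cball 0 (R + 1)) x)"])
    show "(\<integral>x. ennreal ((2 * (M + 1))\<^sup>2 * indicator (cball (0::real^'n) (R + 1)) x)) < \<infinity>"
      using has_bochner_integral_implies_finite_norm[OF has_bochner_integral_integrable[OF ind[of "(2 * (M + 1))\<^sup>2"]]] by (simp add: abs_mult)
    show "AE x in lebesgue. ennreal ((norm (g m x))\<^sup>2) \<le> ennreal ((2 * (M + 1))\<^sup>2 * indicator (cball 0 (R + 1)) x)" for m
    proof (intro AE_I2 ennreal_leI)
      fix x
      show "(norm (g m x))\<^sup>2 \<le> (2 * (M + 1))\<^sup>2 * indicator (cball 0 (R + 1)) x"
      proof (cases "norm x \<le> R + 1")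
        case True thus ?thesis using g(2)[of m x] power_mono[of "norm (g m x)" "2 * (M + 1)" 2] by simp
      next
        case False thus ?thesis using g(3)[of x m] by simp
      qed
    qed
    show "AE x in lebesgue. (\<lambda>m. ennreal ((norm (g m x))\<^sup>2)) \<longlonglongrightarrow> ennreal ((norm (G x))\<^sup>2)"
      using g(4) by eventually_elim (intro tendsto_intros)
    show "(\<lambda>x::real^'n. ennreal ((2 * (M + 1))\<^sup>2 * indicator (cball 0 (R + 1)) x)) \<in> lmeas"
      using borel_measurable_integrable[OF ind[of "(2 * (M + 1))\<^sup>2"]] by (rule measurable_compose[OF _ measurable_ennreal])
  qed auto
  have limc: "(\<lambda>m. ennreal c22 * (\<integral>x. ennreal ((norm (g m x))\<^sup>2))) \<longlonglongrightarrow> ennreal c22 * ?I"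
    using lim by (intro ennreal_tendsto_cmult) auto
  have each: "ennreal (l\<^sup>2) * vol (\<Inter>m\<in>{N..}. U m) \<le> ennreal c22 * ?I" for N
  proof (rule LIMSEQ_le_const[OF limc], intro exI[of _ N] allI impI)
    fix m assume "N \<le> m"
    hence "ennreal (l\<^sup>2) * vol (\<Inter>m\<in>{N..}. U m) \<le> ennreal (l\<^sup>2) * vol (U m)" using U(1) by (intro mult_left_mono emeasure_mono) auto
    thus "ennreal (l\<^sup>2) * vol (\<Inter>m\<in>{N..}. U m) \<le> ennreal c22 * (\<integral>x. ennreal ((norm (g m x))\<^sup>2))"
      using U(3)[of m] by (rule order_trans)
  qed
  have "incseq (\<lambda>N. \<Inter>m\<in>{N..}. U m)" unfolding incseq_def by force
  moreover have "(\<Inter>m\<in>{N..}. U m) \<in> sets lebesgue" for N using U(1) by (intro sets.countable_INT'') auto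
  ultimately have "vol V = (SUP N. vol (\<Inter>m\<in>{N..}. U m))" unfolding V_def by (intro SUP_emeasure_incseq[symmetric]) auto
  hence "ennreal (l\<^sup>2) * vol V = (SUP N. ennreal (l\<^sup>2) * vol (\<Inter>m\<in>{N..}. U m))" by (simp only: SUP_mult_left_ennreal)
  also have "... \<le> ennreal c22 * ?I" by (rule SUP_least) (rule each)
  finally show ?thesis using Vs sub by blast
qed

text \<open>In this order: the good part, the dilated cells, the maximal function of the atoms that
  meet the truncation sphere, and the kernel tails of the remaining atoms.\<close>

definition c11 :: real where
  "c11 = 4 * c22 * (2^(CARD('n) + 1) * 3) + \<Theta>^CARD('n) + 3^CARD('n) * (4 * A * 6^CARD('n)) * 2
     + 4 * (A * CARD('n) powr \<eta> * kC CARD('n) \<eta>) * 2"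

lemma c11_pos: "0 < c11" unfolding c11_def using c22_pos \<Theta> A_pos kC_ge1[OF \<eta>_pos, of "CARD('n)"]
  by (intro add_pos_nonneg add_nonneg_nonneg mult_nonneg_nonneg mult_pos_pos) auto

end

text \<open>Half-open like the cells, so that any such cube is exactly the root cell of a grid of
  its own; see \<open>weak11_hc\<close>.\<close>

definition hc :: "real^'n \<Rightarrow> real \<Rightarrow> (real^'n) set" where
  "hc c r = {y. \<forall>i. c$i - r \<le> y$i \<and> y$i < c$i + r}"

lemma (in grid) cell_hc: "cell Q = hc (ctr Q) (rad Q)" by (auto simp: hc_def mem_cell_coord)

lemma hc_borel [measurable, simp]: "hc c r \<in> sets borel" by (auto simp: hc_def)

lemma hc_sets [measurable, simp]: "hc c r \<in> sets lebesgue" by simp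

lemma hc_subset_qb: "hc c r \<subseteq> qb c r"
proof
  fix y assume "y \<in> hc c r"
  hence "\<bar>(y - c)$i\<bar> \<le> r" for i unfolding hc_def vector_minus_component abs_le_iff by (smt (verit, best) mem_Collect_eq)
  thus "y \<in> qb c r" by (simp add: mem_qb infnorm_le_iff)
qed

definition loc :: "(real^'n \<Rightarrow> complex) \<Rightarrow> (real^'n) set \<Rightarrow> real^'n \<Rightarrow> complex" where
  "loc F S y = F y * indicator S y"

lemma nice_loc: "nice F \<Longrightarrow> S \<in> sets lebesgue \<Longrightarrow> nice (loc F S)"
  unfolding loc_def by (rule nice_mult_bounded[where C=1]) (auto simp: indicator_def)

section \<open>Atoms and the Calderon-Zygmund decomposition\<close>

locale cz_grid = grid a s + cz_operator K A \<eta> T B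
  for a :: "real^'n" and s and K :: "real^'n \<Rightarrow> real^'n \<Rightarrow> complex" and A \<eta>
    and T :: "(real^'n \<Rightarrow> complex) \<Rightarrow> (real^'n \<Rightarrow> complex) \<Rightarrow> complex" and B
begin

lemma cell_norm: "y \<in> cell Q \<Longrightarrow> norm (y - ctr Q) \<le> CARD('n) * rad Q"
proof -
  assume "y \<in> cell Q"
  hence i: "infnorm (y - ctr Q) \<le> rad Q" using cell_subset_qb[of Q] unfolding mem_qb[symmetric] by blast
  have "sqrt CARD('n) \<le> sqrt ((real CARD('n))\<^sup>2)" using zero_less_card_finite[where 'a='n] by (intro real_sqrt_le_mono) (simp add: power2_eq_square)
  hence "sqrt CARD('n) \<le> CARD('n)" by simp
  hence "sqrt CARD('n) * infnorm (y - ctr Q) \<le> CARD('n) * rad Q" using i by (intro mult_mono) (auto simp: infnorm_pos_le)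
  thus ?thesis using norm_le_infnorm_cart[of "y - ctr Q"] by linarith
qed

text \<open>A cube seen from outside its dilate either lies on one side of the truncation sphere or has
  distance comparable to the truncation radius.\<close>

lemma tr_atom:
  assumes b: "nice b" and supp: "\<And>y. y \<notin> cell Q \<Longrightarrow> b y = 0" and mean: "(LINT y|lebesgue. b y) = 0"
    and x: "x \<notin> qb (ctr Q) (\<Theta> * rad Q)" and t: "0 < t"
  shows "enorm (tr t b x) \<le>
      ennreal (A * CARD('n) powr \<eta> / rad Q^CARD('n) * kap (CARD('n) + \<eta>) (ctr Q) (rad Q) x) * (\<integral>y. enorm (b y))
      + ennreal (A / t^CARD('n)) * (\<integral>y\<in>qb x (3 * t). enorm (b y))"
proof -
  define n where "n = real CARD('n)"
  define c where "c = ctr Q"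
  define r where "r = rad Q"
  have [measurable]: "b \<in> lmeas" by (rule nice_measurable[OF b])
  have n1: "1 \<le> n" unfolding n_def using zero_less_card_finite[where 'a='n] by linarith
  have r: "0 < r" by (simp add: r_def)
  have xi: "\<Theta> * r < infnorm (x - c)" using x by (simp add: mem_qb c_def r_def)
  have xn: "4 * (n * r) < norm (x - c)" using xi infnorm_le_norm[of "x - c"] by (simp add: \<Theta>_def n_def)
  have yn: "norm (y - c) \<le> n * r" if "y \<in> cell Q" for y using cell_norm[OF that] by (simp add: n_def c_def r_def)
  consider (far) "\<And>y. y \<in> cell Q \<Longrightarrow> t < norm (x - y)" | (inside) "\<And>y. y \<in> cell Q \<Longrightarrow> norm (x - y) \<le> t"
    | (mixed) y1 y2 where "y1 \<in> cell Q" "norm (x - y1) \<le> t" "y2 \<in> cell Q" "t < norm (x - y2)" by (meson not_le)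
  thus ?thesis
  proof cases
    case inside
    have "tr t b x = (LINT y::real^'n|lebesgue. 0)" unfolding tr_def
    proof (rule Bochner_Integration.integral_cong[OF refl])
      show "indicator {y. t < norm (x - y)} y *\<^sub>R (K x y * b y) = 0" for y using inside[of y] supp[of y] by (cases "y \<in> cell Q") auto
    qed
    thus ?thesis by simp
  next
    case far
    have e: "far t x y *\<^sub>R (K x y * b y) = K x y * b y" for y using far[of y] supp[of y] by (auto simp: indicator_def)
    have i1: "integrable lebesgue (\<lambda>y. K x y * b y)" using nice_integrable[OF tr_nice[OF b t, of x]] unfolding e .
    have i2: "integrable lebesgue (\<lambda>y. K x c * b y)" using nice_integrable[OF b] by (rule integrable_mult_right)
    have "tr t b x = (LINT y|lebesgue. K x y * b y - K x c * b y)" unfolding tr_def e by (subst Bochner_Integration.integral_diff[OF i1 i2]) (simp add: mean)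
    hence "enorm (tr t b x) \<le> (\<integral>y. enorm (K x y * b y - K x c * b y))" using norm_integral_le_nn_integral by metis
    also have "... \<le> (\<integral>y. ennreal (A * n powr \<eta> / r^CARD('n) * kap (n + \<eta>) c r x) * enorm (b y))"
    proof (rule nn_integral_mono, goal_cases)
      case (1 y)
      show ?case
      proof (cases "y \<in> cell Q")
        case True
        have nr: "0 < n * r" using n1 r by simp
        have "norm (K x c - K x y) \<le> A * norm (c - y) powr \<eta> / norm (x - c) powr (n + \<eta>)"
          unfolding n_def using yn[OF True] xn nr by (intro reg2) (auto simp: norm_minus_commute)
        also have "... \<le> A * (n * r) powr \<eta> / infnorm (x - c) powr (n + \<eta>)"
        proof (intro frac_le mult_left_mono powr_mono2)
          show "0 < infnorm (x - c) powr (n + \<eta>)" using xi \<Theta> r by (smt (verit) mult_pos_pos powr_gt_zero)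
        qed (use yn[OF True] A_pos \<eta>_pos n1 infnorm_le_norm[of "x - c"] in \<open>auto simp: norm_minus_commute infnorm_pos_le\<close>)
        also have "... = A * n powr \<eta> / r^CARD('n) * kap (n + \<eta>) c r x"
        proof -
          have "1 * r \<le> \<Theta> * r" using \<Theta> r by (intro mult_right_mono) auto
          hence "r < infnorm (x - c)" using xi by linarith
          hence m: "max r (infnorm (x - c)) = infnorm (x - c)" "0 < infnorm (x - c)" using r by auto
          have "kap (n + \<eta>) c r x = r powr (n + \<eta>) / infnorm (x - c) powr (n + \<eta>)" using r m by (simp add: kap_def powr_divide)
          moreover have "r powr (n + \<eta>) = r^CARD('n) * r powr \<eta>" using r by (simp add: powr_add n_def powr_realpow)
          ultimately show ?thesis using r n1 by (simp add: powr_mult)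
        qed
        finally have "norm (K x c - K x y) * norm (b y) \<le> A * n powr \<eta> / r^CARD('n) * kap (n + \<eta>) c r x * norm (b y)" by (intro mult_right_mono) auto
        moreover have "norm (K x y * b y - K x c * b y) = norm (K x c - K x y) * norm (b y)" by (simp add: left_diff_distrib[symmetric] norm_mult norm_minus_commute)
        ultimately show ?thesis using A_pos r by (simp add: ennreal_mult[symmetric] ennreal_leI)
      qed (simp add: supp)
    qed
    also have "... = ennreal (A * n powr \<eta> / r^CARD('n) * kap (n + \<eta>) c r x) * (\<integral>y. enorm (b y))" by (rule nn_integral_cmult) measurable
    finally show ?thesis by (simp add: n_def c_def r_def add_increasing2)
  next
    case mixed
    have "norm (x - c) \<le> norm (x - y1) + norm (y1 - c)" using norm_triangle_ineq[of "x - y1" "y1 - c"] by simp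
    \<comment> \<open>The sphere cuts the cell; together with 4 n r < |x - c| this gives n r < t/3,
      and the whole cell lies within 3 t of x.\<close>
    hence xc: "norm (x - c) \<le> t + n * r" using mixed(2) yn[OF mixed(1)] by linarith
    have near: "y \<in> qb x (3 * t)" if "y \<in> cell Q" for y
    using norm_triangle_ineq[of "y - c" "c - x"] t xc xn yn[OF that] norm_minus_commute[of c x] infnorm_le_norm[of "y - x"] by (auto simp: mem_qb)
    have "enorm (tr t b x) \<le> (\<integral>y. far t x y * enorm (K x y * b y))" by (rule tr_le_nn)
    also have "... \<le> (\<integral>y. ennreal (A / t^CARD('n)) * (enorm (b y) * indicator (qb x (3 * t)) y))"
    proof (rule nn_integral_mono, goal_cases)
      case (1 y)
      show ?case
      proof (cases "norm (x - y) > t \<and> y \<in> cell Q")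
        case True
        have "norm (K x y) \<le> A / t^CARD('n)" using K_bound[OF t, of x y] True by simp
        hence "norm (K x y * b y) \<le> A / t^CARD('n) * norm (b y)" unfolding norm_mult by (intro mult_right_mono) auto
        thus ?thesis using True near A_pos t by (simp add: ennreal_mult[symmetric] ennreal_leI)
      qed (auto simp: supp)
    qed
    also have "... = ennreal (A / t^CARD('n)) * (\<integral>y\<in>qb x (3 * t). enorm (b y))" by (rule nn_integral_cmult) measurable
    finally show ?thesis by (simp add: add_increasing)
  qed
qed

lemma finite_cells_upto: "finite {Q. cell Q \<subseteq> cell root \<and> fst Q \<le> m}"
proof -
  have "{Q. cell Q \<subseteq> cell root \<and> fst Q \<le> m} \<subseteq> {..m} \<times> (PiE UNIV (\<lambda>_. {0..2^m}))"
  proof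
    fix Q assume "Q \<in> {Q. cell Q \<subseteq> cell root \<and> fst Q \<le> m}"
    hence Q: "cell Q \<subseteq> cell root" "fst Q \<le> m" by auto
    have c: "ctr Q \<in> cell Q" "ctr Q \<in> cell root" using ctr_in_cell[of Q] Q(1) by auto
    have "snd Q i \<in> {0..2^m}" for i
    proof -
      have "snd Q i = \<lfloor>(ctr Q $ i - a $ i) / s * 2^fst Q\<rfloor>" using c(1) by (metis at_gen_def gidx_def mem_cell_iff snd_conv)
      moreover have u: "0 \<le> (ctr Q $ i - a $ i) / s" "(ctr Q $ i - a $ i) / s < 1" using c(2) s_pos unfolding cell_root by (auto simp: field_simps)
      moreover have "(ctr Q $ i - a $ i) / s * 2^fst Q \<le> 1 * 2^m" using u Q(2) by (intro mult_mono) auto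
      moreover have "0 \<le> (ctr Q $ i - a $ i) / s * 2^fst Q" using u by (intro mult_nonneg_nonneg) auto
      ultimately show ?thesis by (simp only: atLeastAtMost_iff) (simp add: floor_le_iff)
    qed
    thus "Q \<in> {..m} \<times> (PiE UNIV (\<lambda>_. {0..2^m}))" using Q(2) by (cases Q) (auto simp: PiE_UNIV_domain)
  qed
  moreover have "finite ({..m} \<times> (PiE (UNIV::'n set) (\<lambda>_. {0..2^m::int})))" by (intro finite_cartesian_product finite_PiE) auto
  ultimately show ?thesis by (rule finite_subset)
qed

text \<open>A Calderon-Zygmund decomposition at height l that stops at a generation m where F
  oscillates by at most l. Finitely many cells are then selected, and the good part is bounded
  directly instead of by differentiation of integrals. The hypothesis on the average keeps the root
  from being selected.\<close>

theorem weak11_root: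
  assumes F: "F \<in> test_functions" and l: "0 < l"
    and avg: "(\<integral>y\<in>cell root. enorm (F y)) \<le> ennreal (l * cv root)"
  shows "\<exists>U\<in>sets lebesgue. {x. ennreal l < max_truncation K (loc F (cell root)) x} \<subseteq> U \<and>
    ennreal l * vol U \<le> ennreal c11 * (\<integral>y\<in>cell root. enorm (F y))"
proof -
  define f0 where "f0 = loc F (cell root)"
  define I1 where "I1 = (\<integral>y\<in>cell root. enorm (F y))"
  have nF: "nice F" by (rule test_function_nice[OF F])
  have [measurable]: "F \<in> lmeas" by (rule nice_measurable[OF nF])
  have nf0: "nice f0" unfolding f0_def by (intro nice_loc nF cell_sets)
  have f0norm: "enorm (f0 y) = enorm (F y) * indicator (cell root) y" for y by (auto simp: f0_def loc_def indicator_def)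
  \<comment> \<open>Uniform continuity of F on the closed root cube supplies the stopping
    generation.\<close>
  have "\<exists>m. \<forall>x\<in>cell root. \<forall>y\<in>cell (at_gen m x). norm (F y - F x) \<le> l"
  proof -
    have "continuous_on (qb (ctr root) (rad root)) F" using F by (intro smooth_continuous) (simp add: test_functions_def)
    hence "uniformly_continuous_on (qb (ctr root) (rad root)) F" by (rule compact_uniformly_continuous[OF _ compact_qb])
    then obtain d where d: "0 < d" "\<And>x y. x \<in> qb (ctr root) (rad root) \<Longrightarrow> y \<in> qb (ctr root) (rad root) \<Longrightarrow> dist y x < d \<Longrightarrow> dist (F y) (F x) < l"
      unfolding uniformly_continuous_on_def using l by metis
    define C where "C = sqrt CARD('n)"
    have C: "0 < C" by (simp add: C_def)
    obtain m where m: "C * s / d < 2^m" using real_arch_pow[of 2] by auto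
    show ?thesis
    proof (intro exI[of _ m] ballI)
      fix x y assume x: "x \<in> cell root" and y: "y \<in> cell (at_gen m x)"
      have "cell (at_gen m x) \<subseteq> cell root" using cell_at_gen_mono[of 0 m x] x by (metis fst_conv le0 mem_cell_iff)
      hence y': "y \<in> cell root" using y by blast
      have "infnorm (y - x) \<le> s / 2^m" using cell_subset_qb_point[of x "at_gen m x"] y by (auto simp: mem_qb rad_at_gen)
      hence "C * infnorm (y - x) \<le> C * (s / 2^m)" using C by (intro mult_left_mono) auto
      also have "... < d" using m d(1) by (simp add: field_simps)
      finally have "norm (y - x) < d" using norm_le_infnorm_cart[of "y - x"] by (simp add: C_def)
      thus "norm (F y - F x) \<le> l" using d(2)[of x y] x y' cell_subset_qb[of root] by (simp add: dist_norm subset_iff less_imp_le)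
    qed
  qed
  then obtain m where osc: "\<And>x y. x \<in> cell root \<Longrightarrow> y \<in> cell (at_gen m x) \<Longrightarrow> norm (F y - F x) \<le> l" by blast
  define IQ where "IQ Q = (\<integral>y\<in>cell Q. enorm (F y))" for Q
  define v where "v Q = cv Q" for Q
  have v: "0 < v Q" for Q by (simp add: v_def)
  have vE: "vol (cell Q) = ennreal (v Q)" for Q by (simp add: v_def emeasure_cell)
  define Fam where "Fam = {Q. cell Q \<subseteq> cell root \<and> fst Q \<le> m \<and> ennreal (l * v Q) < IQ Q}"
  define J where "J = maxc Fam"
  have finJ: "finite J" using finite_subset[OF maxc_subset, of Fam] finite_subset[OF _ finite_cells_upto[of m], of Fam] by (auto simp: Fam_def J_def)
  have disJ: "disjoint_family_on cell J" unfolding J_def by (rule maxc_disjoint)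
  have J: "cell Q \<subseteq> cell root" "fst Q \<le> m" "ennreal (l * v Q) < IQ Q" if "Q \<in> J" for Q using that maxc_subset[of Fam] by (auto simp: J_def Fam_def)
  have IJ: "IQ Q \<le> ennreal (2^CARD('n) * l * v Q)" if Q: "Q \<in> J" for Q
  proof -
    have "Q \<noteq> root" using J(3)[OF Q] avg by (auto simp: IQ_def v_def)
    moreover have "Q = root" if "fst Q = 0" using that J(1)[OF Q] cell_eq[of "ctr Q" Q root] ctr_in_cell[of Q] by auto
    ultimately have f: "0 < fst Q" by blast
    have "parent Q \<notin> Fam" using Q f unfolding J_def by (rule maxc_parent)
    moreover have "cell (parent Q) \<subseteq> cell root"
    proof -
      have "ctr Q \<in> cell root" "ctr Q \<in> cell (parent Q)" using ctr_in_cell[of Q] J(1)[OF Q] parent_cell[OF f] by auto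
      thus ?thesis by (rule cell_nested) simp
    qed
    ultimately have "IQ (parent Q) \<le> ennreal (l * v (parent Q))" using J(2)[OF Q] by (auto simp: Fam_def not_less)
    moreover have "IQ Q \<le> IQ (parent Q)" unfolding IQ_def by (intro nn_integral_mono_set parent_cell f)
    moreover have "v (parent Q) = 2^CARD('n) * v Q" unfolding v_def rad_parent[OF f] power_mult_distrib[symmetric] by simp
    ultimately show ?thesis by (simp add: mult_ac)
  qed
  define \<mu> where "\<mu> Q = (LINT y|lebesgue. loc F (cell Q) y) / of_real (v Q)" for Q
  have locnorm: "enorm (loc F (cell Q) y) = enorm (F y) * indicator (cell Q) y" for Q y by (auto simp: loc_def indicator_def)
  have \<mu>I: "ennreal (norm (\<mu> Q) * v Q) \<le> IQ Q" for Q
  using v[of Q] by (auto simp: IQ_def locnorm[symmetric] norm_integral_le_nn_integral \<mu>_def norm_divide)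
  have \<mu>l: "norm (\<mu> Q) \<le> 2^CARD('n) * l" if Q: "Q \<in> J" for Q
  proof -
    have "ennreal (norm (\<mu> Q) * v Q) \<le> ennreal (2^CARD('n) * l * v Q)" using \<mu>I[of Q] IJ[OF Q] by (rule order_trans)
    hence "norm (\<mu> Q) * v Q \<le> 2^CARD('n) * l * v Q" using l v[of Q] by (subst (asm) ennreal_le_iff) auto
    thus ?thesis using v[of Q] by simp
  qed
  define b where "b Q y = (F y - \<mu> Q) * indicator (cell Q) y" for Q y
  have nb: "nice (b Q)" for Q
  proof -
    have "nice (\<lambda>y. loc (\<lambda>_. \<mu> Q) (cell Q) y)" unfolding nice_def
    proof (intro conjI)
      show "(\<lambda>y. loc (\<lambda>_. \<mu> Q) (cell Q) y) \<in> lmeas" unfolding loc_def by measurable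
      show "\<exists>M. \<forall>x. norm (loc (\<lambda>_. \<mu> Q) (cell Q) x) \<le> M" by (intro exI[of _ "norm (\<mu> Q)"]) (auto simp: loc_def indicator_def)
      obtain R where "\<And>y. y \<in> cell Q \<Longrightarrow> norm y \<le> R" using bounded_subset[OF bounded_qb cell_subset_qb[of Q]] unfolding bounded_iff by blast
      thus "\<exists>R. \<forall>x. R < norm x \<longrightarrow> loc (\<lambda>_. \<mu> Q) (cell Q) x = 0"
        by (intro exI[of _ R]) (auto simp: loc_def indicator_def dest: leD)
    qed
    hence "nice (\<lambda>y. loc F (cell Q) y - loc (\<lambda>_. \<mu> Q) (cell Q) y)" by (intro nice_diff nice_loc[OF nF cell_sets])
    thus ?thesis by (simp add: loc_def b_def[abs_def] left_diff_distrib)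
  qed
  have [measurable]: "b Q \<in> lmeas" for Q by (rule nice_measurable[OF nb])
  have bsupp: "b Q y = 0" if "y \<notin> cell Q" for Q y using that by (simp add: b_def)
  have bmean: "(LINT y|lebesgue. b Q y) = 0" for Q
  proof -
    have ii: "integrable lebesgue (\<lambda>y. indicator (cell Q) y :: complex)"
      by (rule integrable_of_real[of lebesgue "\<lambda>y. indicator (cell Q) y :: real", unfolded of_real_indicator]) (use vE[of Q] in \<open>simp add: integrable_real_indicator\<close>)
    have "(LINT y|lebesgue. indicator (cell Q) y :: complex) = of_real (v Q)"
      using integral_complex_of_real[of lebesgue "\<lambda>y. indicator (cell Q) y :: real"] vE[of Q] v[of Q] unfolding of_real_indicator by (simp add: measure_def)
    moreover have "(LINT y|lebesgue. b Q y) = (LINT y|lebesgue. loc F (cell Q) y - \<mu> Q * indicator (cell Q) y)"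
      by (intro Bochner_Integration.integral_cong) (auto simp: b_def loc_def left_diff_distrib)
    moreover have "... = (LINT y|lebesgue. loc F (cell Q) y) - \<mu> Q * (LINT y|lebesgue. indicator (cell Q) y)"
      using nice_integrable[OF nice_loc[OF nF cell_sets]] ii by (subst Bochner_Integration.integral_diff) auto
    ultimately show ?thesis using v[of Q] by (simp add: \<mu>_def)
  qed
  define bn where "bn Q = (\<integral>y. enorm (b Q y))" for Q
  have bn: "bn Q \<le> 2 * IQ Q" for Q
  proof -
    have "bn Q \<le> (\<integral>y. enorm (F y) * indicator (cell Q) y + enorm (\<mu> Q) * indicator (cell Q) y)" unfolding bn_def
    proof (rule nn_integral_mono, goal_cases)
      case (1 y)
      have "enorm (F y - \<mu> Q) \<le> enorm (F y) + enorm (\<mu> Q)" by (metis ennreal_leI ennreal_plus norm_ge_zero norm_triangle_ineq4)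
      thus ?case by (auto simp: b_def indicator_def)
    qed
    also have "... = IQ Q + enorm (\<mu> Q) * ennreal (v Q)" unfolding IQ_def by (subst nn_integral_add, measurable, subst nn_integral_cmult_indicator) (auto simp: vE)
    also have "... \<le> IQ Q + IQ Q" using \<mu>I[of Q] v[of Q] by (intro add_left_mono) (simp add: ennreal_mult)
    finally show ?thesis by (simp add: mult_2)
  qed
  have sumIQ: "(\<Sum>Q\<in>J. IQ Q) \<le> I1"
  proof -
    have "(\<Sum>Q\<in>J. IQ Q) = (\<integral>y. (\<Sum>Q\<in>J. enorm (F y) * indicator (cell Q) y))" unfolding IQ_def by (subst nn_integral_sum) auto
    also have "... = (\<integral>y. enorm (F y) * indicator (\<Union>Q\<in>J. cell Q) y)"
      by (intro nn_integral_cong) (simp only: sum_distrib_left[symmetric] indicator_UN_disjoint[OF finJ disJ])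
    also have "... \<le> I1" unfolding I1_def using J(1) by (intro nn_integral_mono_set) auto
    finally show ?thesis .
  qed
  have sumbn: "(\<Sum>Q\<in>J. bn Q) \<le> 2 * I1"
  proof -
    have "(\<Sum>Q\<in>J. bn Q) \<le> (\<Sum>Q\<in>J. 2 * IQ Q)" by (intro sum_mono bn)
    also have "... \<le> 2 * I1" unfolding sum_distrib_left[symmetric] by (intro mult_left_mono sumIQ) simp
    finally show ?thesis .
  qed
  define bb where "bb y = (\<Sum>Q\<in>J. b Q y)" for y
  define G where "G y = f0 y - bb y" for y
  have nsum: "nice (\<lambda>y. \<Sum>Q\<in>J'. b Q y)" if "finite J'" for J' using that
  proof (induction J' rule: finite_induct)
    case empty show ?case unfolding nice_def by auto
  next
    case (insert Q J')
    have "nice (\<lambda>y. 0 - b Q y)" by (intro nice_diff nb) (auto simp: nice_def)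
    hence "nice (\<lambda>y. (\<Sum>Q\<in>J'. b Q y) - (0 - b Q y))" by (rule nice_diff[OF insert.IH])
    thus ?case using insert by (simp add: add.commute)
  qed
  have nbb: "nice bb" unfolding bb_def by (rule nsum[OF finJ])
  have nG: "nice G" unfolding G_def by (rule nice_diff[OF nf0 nbb])
  have [measurable]: "G \<in> lmeas" "f0 \<in> lmeas" "bb \<in> lmeas" using nG nf0 nbb by (auto simp: nice_def)
  have tr_bb: "tr t bb x = (\<Sum>Q\<in>J. tr t (b Q) x)" if t: "0 < t" for t x
  proof -
    have "tr t (\<lambda>y. \<Sum>Q\<in>J'. b Q y) x = (\<Sum>Q\<in>J'. tr t (b Q) x)" if "finite J'" for J' using that
    proof (induction J' rule: finite_induct)
      case empty show ?case by (simp add: tr_def)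
    next
      case (insert Q J')
      have "tr t (\<lambda>y. (\<Sum>Q\<in>insert Q J'. b Q y) - b Q y) x = tr t (\<lambda>y. \<Sum>Q\<in>insert Q J'. b Q y) x - tr t (b Q) x"
        by (rule tr_diff[OF nsum nb t]) (use insert in auto)
      moreover have "(\<lambda>y. (\<Sum>Q\<in>insert Q J'. b Q y) - b Q y) = (\<lambda>y. \<Sum>Q\<in>J'. b Q y)" using insert by auto
      ultimately show ?case using insert by (simp add: algebra_simps)
    qed
    thus ?thesis unfolding bb_def using finJ by blast
  qed
  have bbQ: "bb y = F y - \<mu> Q" if "Q \<in> J" "y \<in> cell Q" for Q y
  proof -
    have "b Q' y = 0" if "Q' \<in> J - {Q}" for Q'
    proof -
      have "cell Q' \<inter> cell Q = {}" using disJ that \<open>Q \<in> J\<close> by (auto simp: disjoint_family_on_def)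
      thus ?thesis using \<open>y \<in> cell Q\<close> by (intro bsupp) auto
    qed
    hence "(\<Sum>Q'\<in>J - {Q}. b Q' y) = 0" by (rule sum.neutral[OF ballI])
    hence "(\<Sum>Q'\<in>J. b Q' y) = b Q y" using sum.remove[OF finJ \<open>Q \<in> J\<close>, of "\<lambda>Q'. b Q' y"] by simp
    thus ?thesis using that by (simp add: bb_def b_def)
  qed
  \<comment> \<open>On a selected cell the good part is the mean of F, bounded through the parent.
    Elsewhere the cell of generation m through y is not in the family, so F has average at most l on
    it and oscillates by at most l.\<close>
  have Gle: "norm (G y) \<le> 2^(CARD('n) + 1) * l" for y
  proof (cases "\<exists>Q\<in>J. y \<in> cell Q")
    case True
    then obtain Q where Q: "Q \<in> J" "y \<in> cell Q" by blast
    hence "G y = \<mu> Q" using J(1)[OF Q(1)] bbQ[OF Q] by (auto simp: G_def f0_def loc_def)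
    moreover have "norm (\<mu> Q) \<le> 2^CARD('n) * l" by (rule \<mu>l[OF Q(1)])
    moreover have "0 \<le> 2^CARD('n) * l" using l by simp
    ultimately show ?thesis by simp
  next
    case False
    hence bb0: "bb y = 0" unfolding bb_def by (intro sum.neutral) (auto intro: bsupp)
    show ?thesis
    proof (cases "y \<in> cell root")
      case False thus ?thesis using bb0 l by (simp add: G_def f0_def loc_def)
    next
      case True
      let ?D = "at_gen m y"
      have D: "cell ?D \<subseteq> cell root" using cell_at_gen_mono[of 0 m y] True by (metis fst_conv le0 mem_cell_iff)
      have "?D \<notin> Fam"
      proof
        assume "?D \<in> Fam"
        then obtain P where "P \<in> J" "cell ?D \<subseteq> cell P" unfolding J_def using maxc_cover by blast
        thus False using False \<open>\<not> (\<exists>Q\<in>J. y \<in> cell Q)\<close> mem_at_gen[of y m] by blast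
      qed
      hence ID: "IQ ?D \<le> ennreal (l * v ?D)" using D by (auto simp: Fam_def not_less)
      have "enorm (F y) * ennreal (v ?D) = (\<integral>z. enorm (F y) * indicator (cell ?D) z)" by (simp add: nn_integral_cmult_indicator vE)
      also have "... \<le> (\<integral>z. enorm (F z) * indicator (cell ?D) z + ennreal l * indicator (cell ?D) z)"
      proof (rule nn_integral_mono, goal_cases)
        case (1 z)
        have "enorm (F y) \<le> enorm (F z) + ennreal l" if "z \<in> cell ?D"
        proof -
          have "norm (F y) \<le> norm (F z) + l" using osc[OF True that] norm_triangle_ineq2[of "F y" "F z"] by (simp add: norm_minus_commute)
          thus ?thesis using l by (simp add: ennreal_plus[symmetric] ennreal_leI del: ennreal_plus)
        qed
        thus ?case by (auto simp: indicator_def)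
      qed
      also have "... = IQ ?D + ennreal l * ennreal (v ?D)" unfolding IQ_def by (subst nn_integral_add, measurable, subst nn_integral_cmult_indicator) (auto simp: vE)
      also have "... \<le> ennreal (l * v ?D) + ennreal l * ennreal (v ?D)" by (intro add_right_mono ID)
      also have "... = ennreal (2 * l * v ?D)" using l v[of ?D] by (simp add: ennreal_mult[symmetric] ennreal_plus[symmetric] del: ennreal_plus)
      finally have "ennreal (norm (F y) * v ?D) \<le> ennreal (2 * l * v ?D)" using v[of ?D] by (simp add: ennreal_mult)
      hence "norm (F y) * v ?D \<le> 2 * l * v ?D" using l v[of ?D] by (subst (asm) ennreal_le_iff) auto
      hence "norm (F y) \<le> 2 * l" using v[of ?D] by simp
      also have "... \<le> 2^(CARD('n) + 1) * l" using l by (intro mult_right_mono) auto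
      finally show ?thesis using True bb0 by (simp add: G_def f0_def loc_def)
    qed
  qed
  have G1: "(\<integral>y. enorm (G y)) \<le> 3 * I1"
  proof -
    have "(\<integral>y. enorm (G y)) \<le> (\<integral>y. enorm (f0 y) + (\<Sum>Q\<in>J. enorm (b Q y)))"
    proof (rule nn_integral_mono, goal_cases)
      case (1 y)
      have "norm (G y) \<le> norm (f0 y) + (\<Sum>Q\<in>J. norm (b Q y))" unfolding G_def bb_def by (rule order_trans[OF norm_triangle_ineq4 add_left_mono[OF norm_sum]])
      hence "enorm (G y) \<le> ennreal (norm (f0 y) + (\<Sum>Q\<in>J. norm (b Q y)))" by (rule ennreal_leI)
      thus ?case by (simp add: sum_ennreal sum_nonneg)
    qed
    also have "... = I1 + (\<Sum>Q\<in>J. bn Q)" unfolding I1_def bn_def f0norm[symmetric] by (subst nn_integral_add, measurable, subst nn_integral_sum) auto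
    also have "... \<le> I1 + 2 * I1" by (intro add_left_mono sumbn)
    also have "... = 3 * I1" using distrib_right[of 1 2 I1] by simp
    finally show ?thesis .
  qed
  have G2: "(\<integral>y. ennreal ((norm (G y))\<^sup>2)) \<le> ennreal (2^(CARD('n) + 1) * 3 * l) * I1"
  proof -
    have "(\<integral>y. ennreal ((norm (G y))\<^sup>2)) \<le> (\<integral>y. ennreal (2^(CARD('n) + 1) * l) * enorm (G y))"
    proof (rule nn_integral_mono, goal_cases)
      case (1 y)
      have "(norm (G y))\<^sup>2 \<le> 2^(CARD('n) + 1) * l * norm (G y)" unfolding power2_eq_square by (intro mult_right_mono Gle) simp
      thus ?case using l by (simp add: ennreal_mult[symmetric] ennreal_leI)
    qed
    also have "... \<le> ennreal (2^(CARD('n) + 1) * l) * (ennreal 3 * I1)" using G1 by (subst nn_integral_cmult) (auto intro: mult_left_mono)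
    also have "... = ennreal (2^(CARD('n) + 1) * l * 3) * I1" using l by (intro ennreal_mult_assoc) auto
    finally show ?thesis by (simp add: mult_ac)
  qed
  obtain UG where UG: "UG \<in> sets lebesgue" "{x. ennreal (l/2) < max_truncation K G x} \<subseteq> UG"
    "ennreal ((l/2)\<^sup>2) * vol UG \<le> ennreal c22 * (\<integral>x. ennreal ((norm (G x))\<^sup>2))" using weak22[OF nG, of "l/2"] l by auto
  have mUG: "ennreal l * vol UG \<le> ennreal (4 * c22 * (2^(CARD('n) + 1) * 3)) * I1"
  proof -
    have "ennreal (l/4) * (ennreal l * vol UG) = ennreal ((l/2)\<^sup>2) * vol UG" using l by (simp add: ennreal_mult_assoc power2_eq_square)
    also have "... \<le> ennreal c22 * (ennreal (2^(CARD('n) + 1) * 3 * l) * I1)" using UG(3) G2 by (meson mult_left_mono order_trans zero_le)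
    also have "... = ennreal (c22 * (2^(CARD('n) + 1) * 3 * l)) * I1" using c22_pos l by (intro ennreal_mult_assoc) auto
    also have "c22 * (2^(CARD('n) + 1) * 3 * l) = l/4 * (4 * c22 * (2^(CARD('n) + 1) * 3))" by simp
    also have "ennreal (l/4 * (4 * c22 * (2^(CARD('n) + 1) * 3))) * I1 = ennreal (l/4) * (ennreal (4 * c22 * (2^(CARD('n) + 1) * 3)) * I1)"
      using c22_pos l by (intro ennreal_mult_assoc[symmetric]) auto
    finally show ?thesis using l by (subst (asm) ennreal_mult_le_mult_iff) auto
  qed
  define h where "h y = (\<Sum>Q\<in>J. enorm (b Q y))" for y
  have [measurable]: "h \<in> lmeas" unfolding h_def by measurable
  have hI: "(\<integral>y. h y) \<le> 2 * I1" unfolding h_def using sumbn by (subst nn_integral_sum) (auto simp: bn_def)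
  define \<kappa> where "\<kappa> Q x = A * CARD('n) powr \<eta> / rad Q^CARD('n) * kap (CARD('n) + \<eta>) (ctr Q) (rad Q) x" for Q x
  have \<kappa>: "0 \<le> \<kappa> Q x" for Q x using A_pos by (simp add: \<kappa>_def)
  have [measurable]: "\<kappa> Q \<in> lmeas" for Q unfolding \<kappa>_def by measurable
  define \<Psi> where "\<Psi> x = (\<Sum>Q\<in>J. ennreal (\<kappa> Q x) * bn Q)" for x
  have [measurable]: "\<Psi> \<in> lmeas" unfolding \<Psi>_def by measurable
  define ck where "ck = A * CARD('n) powr \<eta> * kC CARD('n) \<eta>"
  have ck: "0 \<le> ck" using A_pos kC_ge1[OF \<eta>_pos, of "CARD('n)"] by (simp add: ck_def)
  have \<kappa>I: "(\<integral>x. ennreal (\<kappa> Q x)) \<le> ennreal ck" for Q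
  proof -
    have "(\<integral>x. 1 * ennreal (kap (CARD('n) + \<eta>) (ctr Q) (rad Q) x)) \<le> ennreal (kC CARD('n) \<eta> * rad Q^CARD('n)) * 1" unfolding kC_def
    proof (rule nn_integral_kap_le[OF rad_pos \<eta>_pos])
      fix \<rho> assume "rad Q \<le> \<rho>"
      hence "0 \<le> \<rho>" using rad_pos[of Q] by linarith
      thus "(\<integral>y\<in>qb (ctr Q) \<rho>. 1) \<le> 1 * ennreal ((2 * \<rho>)^CARD('n))" by (simp add: emeasure_qb)
    qed simp
    hence i: "(\<integral>x. ennreal (kap (CARD('n) + \<eta>) (ctr Q) (rad Q) x)) \<le> ennreal (kC CARD('n) \<eta> * rad Q^CARD('n))" by simp
    have "(\<integral>x. ennreal (\<kappa> Q x)) = ennreal (A * CARD('n) powr \<eta> / rad Q^CARD('n)) * (\<integral>x. ennreal (kap (CARD('n) + \<eta>) (ctr Q) (rad Q) x))"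
      unfolding \<kappa>_def using A_pos by (subst nn_integral_cmult[symmetric]) (auto simp: ennreal_mult[symmetric] mult_ac intro!: nn_integral_cong)
    also have "... \<le> ennreal (A * CARD('n) powr \<eta> / rad Q^CARD('n)) * ennreal (kC CARD('n) \<eta> * rad Q^CARD('n))" by (intro mult_left_mono i) auto
    also have "... = ennreal (A * CARD('n) powr \<eta> / rad Q^CARD('n) * (kC CARD('n) \<eta> * rad Q^CARD('n)))"
      using A_pos kC_ge1[OF \<eta>_pos, of "CARD('n)"] by (intro ennreal_mult[symmetric]) auto
    also have "A * CARD('n) powr \<eta> / rad Q^CARD('n) * (kC CARD('n) \<eta> * rad Q^CARD('n)) = ck" by (simp add: ck_def)
    finally show ?thesis .
  qed
  have \<Psi>I: "(\<integral>x. \<Psi> x) \<le> ennreal ck * (2 * I1)"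
  proof -
    have "(\<integral>x. \<Psi> x) = (\<Sum>Q\<in>J. (\<integral>x. ennreal (\<kappa> Q x)) * bn Q)"
      unfolding \<Psi>_def by (subst nn_integral_sum) (auto simp: nn_integral_multc)
    also have "... \<le> (\<Sum>Q\<in>J. ennreal ck * bn Q)" by (intro sum_mono mult_right_mono \<kappa>I) auto
    also have "... \<le> ennreal ck * (2 * I1)" unfolding sum_distrib_left[symmetric] by (intro mult_left_mono sumbn) auto
    finally show ?thesis .
  qed
  define Dil where "Dil = (\<Union>Q\<in>J. qb (ctr Q) (\<Theta> * rad Q))"
  define cM where "cM = A * 6^CARD('n)"
  have cM: "0 < cM" using A_pos by (simp add: cM_def)
  \<comment> \<open>Atoms on one side of the sphere are summed in \<Psi>; those cut by it have their
    mass within 3 t of x, so together they are bounded by the maximal function of h.\<close>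
  have bad: "max_truncation K bb x \<le> ennreal cM * MM h x + \<Psi> x" if x: "x \<notin> Dil" for x unfolding max_truncation_le_iff
  proof (intro allI impI)
    fix t :: real assume t: "0 < t"
    have "enorm (tr t bb x) \<le> (\<Sum>Q\<in>J. enorm (tr t (b Q) x))" unfolding tr_bb[OF t] by (subst sum_ennreal) (auto intro!: ennreal_leI norm_sum)
    also have "... \<le> (\<Sum>Q\<in>J. ennreal (\<kappa> Q x) * bn Q + ennreal (A / t^CARD('n)) * (\<integral>y\<in>qb x (3 * t). enorm (b Q y)))"
    proof (rule sum_mono)
      fix Q assume "Q \<in> J"
      hence "x \<notin> qb (ctr Q) (\<Theta> * rad Q)" using x by (auto simp: Dil_def)
      thus "enorm (tr t (b Q) x) \<le> ennreal (\<kappa> Q x) * bn Q + ennreal (A / t^CARD('n)) * (\<integral>y\<in>qb x (3 * t). enorm (b Q y))"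
        unfolding \<kappa>_def bn_def by (intro tr_atom nb bsupp bmean t)
    qed
    also have "... = \<Psi> x + ennreal (A / t^CARD('n)) * (\<integral>y\<in>qb x (3 * t). h y)"
      unfolding sum.distrib \<Psi>_def h_def sum_distrib_left[symmetric] sum_distrib_right by (subst nn_integral_sum) auto
    also have "... \<le> \<Psi> x + ennreal (A / t^CARD('n)) * (MM h x * ennreal ((2 * (3 * t))^CARD('n)))"
      using t by (intro add_left_mono mult_left_mono MM_upper) (auto simp: mem_qb infnorm_0)
    also have "ennreal (A / t^CARD('n)) * (MM h x * ennreal ((2 * (3 * t))^CARD('n))) = ennreal cM * MM h x"
    proof -
      have "2 * (3 * t) = 6 * t" by simp
      hence "A / t^CARD('n) * (2 * (3 * t))^CARD('n) = cM" using t by (simp add: cM_def power_mult_distrib)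
      hence "ennreal (A / t^CARD('n)) * ennreal ((2 * (3 * t))^CARD('n)) = ennreal cM" using A_pos t by (simp add: ennreal_mult[symmetric])
      thus ?thesis by (metis mult.assoc mult.commute)
    qed
    finally show "enorm (tr t bb x) \<le> ennreal cM * MM h x + \<Psi> x" by (simp add: add.commute)
  qed
  define UM where "UM = {x. ennreal (l / (4 * cM)) < MM h x}"
  define UP where "UP = {x\<in>space lebesgue. ennreal (l/4) < \<Psi> x}"
  have sUM: "UM \<in> sets lebesgue" unfolding UM_def using open_MM by simp
  have sUP: "UP \<in> sets lebesgue" unfolding UP_def by measurable
  have sD: "Dil \<in> sets lebesgue" unfolding Dil_def using finJ by (intro sets.finite_UN) auto
  have mD: "ennreal l * vol Dil \<le> ennreal (\<Theta>^CARD('n)) * I1"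
  proof -
    have "ennreal l * vol Dil \<le> ennreal l * (\<Sum>Q\<in>J. vol (qb (ctr Q) (\<Theta> * rad Q)))"
      unfolding Dil_def using finJ by (intro mult_left_mono emeasure_subadditive_finite) auto
    also have "... = (\<Sum>Q\<in>J. ennreal (\<Theta>^CARD('n)) * ennreal (l * v Q))" unfolding sum_distrib_left
    proof (intro sum.cong refl)
      fix Q
      have \<Theta>n: "0 < \<Theta>^CARD('n)" using \<Theta> by (intro zero_less_power) linarith
      have "2 * (\<Theta> * rad Q) = \<Theta> * (2 * rad Q)" by simp
      hence "(2 * (\<Theta> * rad Q))^CARD('n) = \<Theta>^CARD('n) * v Q" by (simp only: power_mult_distrib v_def)
      thus "ennreal l * vol (qb (ctr Q) (\<Theta> * rad Q)) = ennreal (\<Theta>^CARD('n)) * ennreal (l * v Q)"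
        using l \<Theta> v[of Q] \<Theta>n by (simp add: emeasure_qb ennreal_mult[symmetric] mult_ac)
    qed
    also have "... \<le> (\<Sum>Q\<in>J. ennreal (\<Theta>^CARD('n)) * IQ Q)" by (intro sum_mono mult_left_mono less_imp_le[OF J(3)]) auto
    also have "... \<le> ennreal (\<Theta>^CARD('n)) * I1" unfolding sum_distrib_left[symmetric] by (intro mult_left_mono sumIQ) auto
    finally show ?thesis .
  qed
  have mUM: "ennreal l * vol UM \<le> ennreal (3^CARD('n) * (4 * A * 6^CARD('n)) * 2) * I1"
  proof -
    have "ennreal l * vol UM = ennreal (4 * cM) * (ennreal (l / (4 * cM)) * vol UM)" using l cM by (simp add: ennreal_mult_assoc)
    also have "... \<le> ennreal (4 * cM) * (3^CARD('n) * (2 * I1))" unfolding UM_def by (intro mult_left_mono order_trans[OF MM_weak_type] hI) auto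
    also have "... = ennreal (4 * cM) * (ennreal (3^CARD('n)) * (ennreal 2 * I1))" by (simp add: ennreal_power[symmetric])
    also have "... = ennreal (4 * cM * (3^CARD('n) * 2)) * I1" using cM by (simp only: ennreal_mult_assoc less_imp_le zero_le_power zero_le_numeral mult_nonneg_nonneg)
    also have "4 * cM * (3^CARD('n) * 2) = 3^CARD('n) * (4 * A * 6^CARD('n)) * 2" by (simp add: cM_def)
    finally show ?thesis .
  qed
  have mUP: "ennreal l * vol UP \<le> ennreal (4 * ck * 2) * I1"
  proof -
    have "ennreal l * vol UP = ennreal 4 * (ennreal (l/4) * vol UP)" using l ennreal_mult_assoc[of 4 "l/4" "vol UP"] by simp
    also have "ennreal (l/4) * vol UP = (\<integral>x. ennreal (l/4) * indicator UP x)" using sUP by (simp add: nn_integral_cmult_indicator)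
    also have "... \<le> (\<integral>x. \<Psi> x)" by (intro nn_integral_mono) (auto simp: indicator_def UP_def less_imp_le)
    also have "... \<le> ennreal ck * (ennreal 2 * I1)" using \<Psi>I by simp
    finally have "ennreal l * vol UP \<le> ennreal 4 * (ennreal ck * (ennreal 2 * I1))" by (simp add: mult_left_mono)
    also have "... = ennreal (4 * (ck * 2)) * I1" using ck by (simp only: ennreal_mult_assoc zero_le_numeral mult_nonneg_nonneg)
    finally show ?thesis by (simp add: mult.assoc)
  qed
  define U where "U = UG \<union> (Dil \<union> (UM \<union> UP))"
  have sU: "U \<in> sets lebesgue" unfolding U_def using UG(1) sD sUM sUP by auto
  \<comment> \<open>The threshold l is split as l/2 for the good part and l/4 for each of the two
    bounds of the bad part.\<close>
  have sub: "{x. ennreal l < max_truncation K f0 x} \<subseteq> U"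
  proof (rule subsetI, rule ccontr)
    fix x assume "x \<in> {x. ennreal l < max_truncation K f0 x}" "x \<notin> U"
    hence x: "ennreal l < max_truncation K f0 x" "x \<notin> UG" "x \<notin> Dil" "x \<notin> UM" "x \<notin> UP" by (auto simp: U_def)
    have g: "max_truncation K G x \<le> ennreal (l/2)" using x(2) UG(2) not_less by blast
    have "ennreal cM * MM h x \<le> ennreal cM * ennreal (l / (4 * cM))" using x(4) by (intro mult_left_mono) (auto simp: UM_def not_less)
    also have "... = ennreal (l/4)" using cM l by (simp add: ennreal_mult[symmetric])
    finally have 1: "ennreal cM * MM h x \<le> ennreal (l/4)" .
    have 2: "\<Psi> x \<le> ennreal (l/4)" using x(5) by (simp add: UP_def not_less)
    have "max_truncation K bb x \<le> ennreal (l/4) + ennreal (l/4)" using bad[OF x(3)] 1 2 by (meson add_mono order_trans)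
    also have "... = ennreal (l/2)" using l by (simp add: ennreal_plus[symmetric] del: ennreal_plus)
    finally have bd: "max_truncation K bb x \<le> ennreal (l/2)" .
    have "max_truncation K f0 x \<le> ennreal l" unfolding max_truncation_le_iff
    proof (intro allI impI)
      fix t :: real assume t: "0 < t"
      have "tr t G x = tr t f0 x - tr t bb x" unfolding G_def by (rule tr_diff[OF nf0 nbb t])
      hence "norm (tr t f0 x) \<le> norm (tr t G x) + norm (tr t bb x)" using norm_triangle_ineq[of "tr t G x" "tr t bb x"] by simp
      moreover have "norm (tr t G x) \<le> l/2" using g t l unfolding max_truncation_le_iff by (simp add: ennreal_le_iff)
      moreover have "norm (tr t bb x) \<le> l/2" using bd t l unfolding max_truncation_le_iff by (simp add: ennreal_le_iff)
      ultimately show "enorm (tr t f0 x) \<le> ennreal l" by (intro ennreal_leI) linarith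
    qed
    thus False using x(1) by simp
  qed
  have "ennreal l * vol U \<le> ennreal l * (vol UG + (vol Dil + (vol UM + vol UP)))" unfolding U_def using UG(1) sD sUM sUP
    by (intro mult_left_mono order_trans[OF emeasure_subadditive] add_left_mono order_refl) auto
  also have "... \<le> ennreal (4 * c22 * (2^(CARD('n) + 1) * 3)) * I1 + (ennreal (\<Theta>^CARD('n)) * I1 + (ennreal (3^CARD('n) * (4 * A * 6^CARD('n)) * 2) * I1 + ennreal (4 * ck * 2) * I1))"
    unfolding distrib_left by (intro add_mono mUG mD mUM mUP)
  also have "... = ennreal c11 * I1"
  proof -
    have "c11 = 4 * c22 * (2^(CARD('n) + 1) * 3) + (\<Theta>^CARD('n) + (3^CARD('n) * (4 * A * 6^CARD('n)) * 2 + 4 * ck * 2))" by (simp add: c11_def ck_def)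
    moreover have "0 \<le> 4 * c22 * (2^(CARD('n) + 1) * 3)" "0 \<le> \<Theta>^CARD('n)" "0 \<le> 3^CARD('n) * (4 * A * 6^CARD('n)) * 2" "0 \<le> 4 * ck * 2"
      using c22_pos \<Theta> A_pos ck by auto
    ultimately show ?thesis by (simp only: ennreal_plus add_nonneg_nonneg distrib_right)
  qed
  finally show ?thesis using sU sub unfolding f0_def I1_def by blast
qed

end

section \<open>Sparse domination\<close>

context cz_kernel
begin

lemma tr_le_integral:
  assumes "nice f" "0 < t"
  shows "enorm (tr t f x) \<le> ennreal (A / t^CARD('n)) * (\<integral>y. enorm (f y))"
proof -
  have [measurable]: "f \<in> lmeas" by (rule nice_measurable[OF assms(1)])
  have "far t x y * enorm (K x y * f y) \<le> ennreal (A / t^CARD('n)) * enorm (f y)" for y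
  proof (cases "norm (x - y) > t")
    case True
    hence "norm (K x y * f y) \<le> A / t^CARD('n) * norm (f y)" using K_bound[OF assms(2), of x y] unfolding norm_mult by (intro mult_right_mono) auto
    thus ?thesis using True A_pos assms(2) by (simp add: ennreal_mult[symmetric] ennreal_leI)
  qed simp
  hence "enorm (tr t f x) \<le> (\<integral>y. ennreal (A / t^CARD('n)) * enorm (f y))" by (intro order_trans[OF tr_le_nn] nn_integral_mono)
  thus ?thesis by (simp add: nn_integral_cmult)
qed

end

context cz_operator
begin

lemma weak11_hc:
  fixes c :: "real^'n"
  assumes F: "F \<in> test_functions" and r: "0 < r" and l: "0 < l"
    and avg: "(\<integral>y\<in>hc c r. enorm (F y)) \<le> ennreal (l * (2 * r)^CARD('n))"
  shows "\<exists>U\<in>sets lebesgue. {x. ennreal l < max_truncation K (loc F (hc c r)) x} \<subseteq> U \<and>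
    ennreal l * vol U \<le> ennreal c11 * (\<integral>y\<in>hc c r. enorm (F y))"
proof -
  interpret cz_grid "c - (\<chi> i. r)" "2 * r" K A \<eta> T B by unfold_locales (use r in auto)
  have "ctr root = c" by (simp add: ctr_def vec_eq_iff)
  moreover have rr: "rad root = r" by (simp add: rad_def)
  ultimately have cr: "cell root = hc c r" using cell_hc[of root] by simp
  show ?thesis using weak11_root[OF F l] avg unfolding cr rr by blast
qed

text \<open>Large enough that the exceptional set at height \<open>cL * av F Q\<close> has at most
  2^(-n-3) of the volume of Q, and that a second application, at \<open>cL\<close> times this
  height, spoils at most a quarter of a child.\<close>

definition cL :: real where "cL = 2^(CARD('n) + 4) * 3^CARD('n) * (c11 + 3^CARD('n))"

lemma cL: "1 \<le> cL" "4 * c11 * 3^CARD('n) \<le> cL"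
proof -
  have c: "0 < c11" by (rule c11_pos)
  have "(1::real) \<le> 2^(CARD('n) + 4)" "(1::real) \<le> 3^CARD('n)" by (rule one_le_power, simp)+
  hence "(1::real) * 1 \<le> 2^(CARD('n) + 4) * 3^CARD('n)" by (intro mult_mono) auto
  hence "(1 * 1) * (0 + 1) \<le> 2^(CARD('n) + 4) * 3^CARD('n) * (c11 + 3^CARD('n))" using c by (intro mult_mono add_mono one_le_power) auto
  thus "1 \<le> cL" by (simp add: cL_def)
  have "(1::real) \<le> 2^CARD('n)" by (rule one_le_power) simp
  moreover have "(2::real)^(CARD('n) + 4) = 16 * 2^CARD('n)" by (simp add: power_add)
  ultimately have "(4::real) \<le> 2^(CARD('n) + 4)" by linarith
  hence "4 * 3^CARD('n) * c11 \<le> 2^(CARD('n) + 4) * 3^CARD('n) * (c11 + 3^CARD('n))" using c by (intro mult_mono) auto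
  thus "4 * c11 * 3^CARD('n) \<le> cL" by (simp add: cL_def mult_ac)
qed

definition cS :: real where "cS = cL * (1 + cL + cD)"

lemma cS_pos: "0 < cS" using cL cD_pos by (simp add: cS_def)

end

context cz_grid
begin

definition dil :: "'n cube \<Rightarrow> (real^'n) set" where "dil Q = hc (ctr Q) (3 * rad Q)"

definition av :: "(real^'n \<Rightarrow> complex) \<Rightarrow> 'n cube \<Rightarrow> real" where
  "av F Q = enn2real (\<integral>y\<in>dil Q. enorm (F y)) / (6 * rad Q)^CARD('n)"

abbreviation Tdil :: "(real^'n \<Rightarrow> complex) \<Rightarrow> 'n cube \<Rightarrow> real^'n \<Rightarrow> ennreal" where
  "Tdil F Q \<equiv> max_truncation K (loc F (dil Q))"

lemma dil_sets [measurable, simp]: "dil Q \<in> sets lebesgue" by (simp add: dil_def)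

lemma dil_mono: "cell P \<subseteq> cell Q \<Longrightarrow> dil P \<subseteq> dil Q"
proof
  fix y assume PQ: "cell P \<subseteq> cell Q" and y: "y \<in> dil P"
  have i: "infnorm (ctr P - ctr Q) + rad P \<le> rad Q" by (rule cell_subset_ctr_rad[OF PQ])
  have "ctr Q $ i - 3 * rad Q \<le> y $ i \<and> y $ i < ctr Q $ i + 3 * rad Q" for i
  proof -
    have "\<bar>ctr P $ i - ctr Q $ i\<bar> \<le> infnorm (ctr P - ctr Q)" using component_le_infnorm_cart[of "ctr P - ctr Q" i] by simp
    moreover have "ctr P $ i - 3 * rad P \<le> y $ i \<and> y $ i < ctr P $ i + 3 * rad P" using y by (simp add: dil_def hc_def)
    moreover have "0 < rad P" by simp
    ultimately show ?thesis using i by linarith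
  qed
  thus "y \<in> dil Q" by (simp add: dil_def hc_def)
qed

lemma nn_integral_loc: "(\<integral>y. enorm (loc F S y)) = (\<integral>y\<in>S. enorm (F y))" by (intro nn_integral_cong) (simp add: loc_def indicator_def)

lemma nice_nn_integral_finite: "nice F \<Longrightarrow> (\<integral>y. enorm (F y)) < \<infinity>" using nice_integrable[of F] by (simp add: integrable_iff_bounded)

lemma av_integral:
  assumes F: "nice F"
  shows "0 \<le> av F Q" "(\<integral>y\<in>dil Q. enorm (F y)) = ennreal (av F Q * (6 * rad Q)^CARD('n))"
proof -
  show "0 \<le> av F Q" by (simp add: av_def)
  have "(\<integral>y\<in>dil Q. enorm (F y)) < \<infinity>" using nice_nn_integral_finite[OF nice_loc[OF F dil_sets], of Q] by (simp add: nn_integral_loc)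
  thus "(\<integral>y\<in>dil Q. enorm (F y)) = ennreal (av F Q * (6 * rad Q)^CARD('n))" by (simp add: av_def)
qed

lemma outside_dil:
  assumes "x \<in> cell P" "y \<notin> dil P" shows "2 * rad P \<le> norm (x - y)"
proof -
  obtain i where i: "\<not> (ctr P $ i - 3 * rad P \<le> y $ i \<and> y $ i < ctr P $ i + 3 * rad P)" using assms(2) by (auto simp: dil_def hc_def)
  have "ctr P $ i - rad P \<le> x $ i \<and> x $ i < ctr P $ i + rad P" using assms(1) by (simp add: mem_cell_coord)
  hence "2 * rad P \<le> \<bar>(x - y) $ i\<bar>" using i by auto
  thus ?thesis using component_le_norm_cart[of "x - y" i] by linarith
qed

text \<open>The children are the maximal cells in which the open exceptional set U has density above
  2^(-n-1). A density condition, unlike inclusion in U, leaves half of each child outside U, as its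
  parent shows, and a point z there transports the bounds from Q to the child.\<close>

theorem sparse_step:
  assumes F: "F \<in> test_functions"
  shows "\<exists>C. (\<forall>P\<in>C. cell P \<subseteq> cell Q) \<and> disjoint_family_on cell C \<and>
    2 * vol (\<Union>P\<in>C. cell P) \<le> vol (cell Q) \<and>
    (\<forall>x\<in>cell Q. x \<notin> (\<Union>P\<in>C. cell P) \<longrightarrow> Tdil F Q x \<le> ennreal (cS * av F Q)) \<and>
    (\<forall>P\<in>C. \<forall>x\<in>cell P. Tdil F Q x \<le> ennreal (cS * av F Q) + Tdil F P x)"
proof -
  have nF: "nice F" by (rule test_function_nice[OF F])
  have nl: "nice (loc F (dil P))" for P by (rule nice_loc[OF nF dil_sets])
  define I where "I P = (\<integral>y\<in>dil P. enorm (F y))" for P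
  define v where "v P = cv P" for P
  have v: "0 < v P" for P by (simp add: v_def)
  have v6: "(6 * rad P)^CARD('n) = 3^CARD('n) * v P" for P unfolding v_def power_mult_distrib[symmetric] by simp
  have vE: "vol (cell P) = ennreal (v P)" for P by (simp add: emeasure_cell v_def)
  have IQ: "I P = ennreal (av F P * (3^CARD('n) * v P))" for P unfolding I_def v6[symmetric] by (rule av_integral[OF nF])
  have av0: "0 \<le> av F P" for P by (rule av_integral[OF nF])
  show ?thesis
  \<comment> \<open>With vanishing average F vanishes almost everywhere on the dilate and no
    children are selected; afterwards the height l is positive.\<close>
  proof (cases "av F Q = 0")
    case True
    have "Tdil F Q x \<le> ennreal (cS * av F Q)" for x unfolding max_truncation_le_iff
      using tr_le_integral[OF nl, of _ Q x] True IQ[of Q] unfolding nn_integral_loc I_def by auto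
    thus ?thesis by (intro exI[of _ "{}"]) (auto simp: disjoint_family_on_def)
  next
    case False
    hence avQ: "0 < av F Q" using av0[of Q] by linarith
    define l where "l = cL * av F Q"
    have l: "0 < l" "av F Q \<le> l" using avQ cL(1) mult_right_mono[of 1 cL "av F Q"] by (auto simp: l_def)
    let ?h = "\<lambda>y. enorm (loc F (dil Q) y)"
    have [measurable]: "loc F (dil P) \<in> lmeas" for P by (rule nice_measurable[OF nl])
    have "I Q \<le> ennreal (l * (2 * (3 * rad Q))^CARD('n))" using l v[of Q] v6[of Q] by (auto simp: IQ ennreal_leI)
    then obtain U1 where U1: "U1 \<in> sets lebesgue" "{x. ennreal l < Tdil F Q x} \<subseteq> U1"
      "ennreal l * vol U1 \<le> ennreal c11 * I Q" using weak11_hc[OF F _ l(1), of "3 * rad Q" "ctr Q"] unfolding dil_def I_def by auto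
    define U2 where "U2 = {x. ennreal l < MM ?h x}"
    have U2: "U2 \<in> sets lebesgue" "ennreal l * vol U2 \<le> 3^CARD('n) * I Q"
      using open_MM[of "ennreal l" ?h] MM_weak_type[of ?h "ennreal l"] unfolding U2_def nn_integral_loc I_def by simp_all
    have sU: "U1 \<union> U2 \<in> sets lebesgue" using U1 U2 by auto
    define e where "e = v Q / 2^(CARD('n) + 3)"
    have e: "0 < e" using v[of Q] by (simp add: e_def)
    have mU: "vol (U1 \<union> U2) \<le> ennreal e"
    proof -
      have "ennreal l * vol (U1 \<union> U2) \<le> ennreal l * (vol U1 + vol U2)" using U1 U2 by (intro mult_left_mono emeasure_subadditive) auto
      also have "... \<le> ennreal c11 * I Q + 3^CARD('n) * I Q" unfolding distrib_left by (intro add_mono U1 U2)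
      also have "... = ennreal (c11 + 3^CARD('n)) * I Q" using c11_pos by (simp add: distrib_right ennreal_power[symmetric])
      also have "... = ennreal ((c11 + 3^CARD('n)) * (av F Q * (3^CARD('n) * v Q)))" using c11_pos av0[of Q] v[of Q] unfolding IQ by (intro ennreal_mult[symmetric]) auto
      also have "... \<le> ennreal (l * e)"
      proof (rule ennreal_leI)
        have "l * e = 2 * ((c11 + 3^CARD('n)) * (av F Q * (3^CARD('n) * v Q)))" by (simp add: l_def e_def cL_def power_add)
        moreover have "0 \<le> (c11 + 3^CARD('n)) * (av F Q * (3^CARD('n) * v Q))" using c11_pos av0[of Q] v[of Q] by simp
        ultimately show "(c11 + 3^CARD('n)) * (av F Q * (3^CARD('n) * v Q)) \<le> l * e" by linarith
      qed
      finally show ?thesis using l(1) e by (simp add: ennreal_mult ennreal_mult_le_mult_iff)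
    qed
    obtain U where U: "open U" "U1 \<union> U2 \<subseteq> U" "vol (U - (U1 \<union> U2)) < ennreal e" using sets_lebesgue_outer_open[OF sU e] by metis
    have Us [measurable]: "U \<in> sets lebesgue" using U(1) by simp
    have U2e: "vol U \<le> ennreal (2 * e)"
    proof -
      have "vol U \<le> vol (U1 \<union> U2) + vol (U - (U1 \<union> U2))"
        using emeasure_subadditive[of "U1 \<union> U2" lebesgue "U - (U1 \<union> U2)"] sU Us U(2) by (simp add: Un_absorb1)
      also have "... \<le> ennreal e + ennreal e" using mU U(3) by (intro add_mono) auto
      finally show ?thesis using e by (simp add: ennreal_plus[symmetric] del: ennreal_plus)
    qed
    define C where "C = maxc {P. cell P \<subseteq> cell Q \<and> ennreal (v P) < ennreal (2^(CARD('n) + 1)) * vol (cell P \<inter> U)}"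
    have C: "cell P \<subseteq> cell Q" "ennreal (v P) < ennreal (2^(CARD('n) + 1)) * vol (cell P \<inter> U)" if "P \<in> C" for P
      using that maxc_subset unfolding C_def by blast+
    have dC: "disjoint_family_on cell C" unfolding C_def by (rule maxc_disjoint)
    have mC: "2 * vol (\<Union>P\<in>C. cell P) \<le> vol (cell Q)"
    proof -
      have dU: "disjoint_family_on (\<lambda>P. cell P \<inter> U) C" using dC unfolding disjoint_family_on_def by blast
      have "vol (\<Union>P\<in>C. cell P) = (\<Sum>\<^sup>+P\<in>C. ennreal (v P))" unfolding v_def by (rule emeasure_cells[OF dC])
      also have "... \<le> (\<Sum>\<^sup>+P\<in>C. ennreal (2^(CARD('n) + 1)) * vol (cell P \<inter> U))" by (rule nn_integral_mono) (rule less_imp_le[OF C(2)], simp)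
      also have "... = ennreal (2^(CARD('n) + 1)) * (\<Sum>\<^sup>+P\<in>C. vol (cell P \<inter> U))" by (rule nn_integral_cmult) simp
      also have "(\<Sum>\<^sup>+P\<in>C. vol (cell P \<inter> U)) = vol (\<Union>P\<in>C. cell P \<inter> U)" using dU by (subst emeasure_UN_countable) auto
      also have "ennreal (2^(CARD('n) + 1)) * vol (\<Union>P\<in>C. cell P \<inter> U) \<le> ennreal (2^(CARD('n) + 1)) * ennreal (2 * e)"
        by (intro mult_left_mono order_trans[OF emeasure_mono U2e]) auto
      finally have "2 * vol (\<Union>P\<in>C. cell P) \<le> ennreal 2 * (ennreal (2^(CARD('n) + 1)) * ennreal (2 * e))" by (simp add: mult_left_mono)
      also have "... = ennreal (2 * (2^(CARD('n) + 1) * (2 * e)))" using e by (simp only: ennreal_mult less_imp_le mult_nonneg_nonneg zero_le_power zero_le_numeral)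
      also have "2 * (2^(CARD('n) + 1) * (2 * e)) = v Q" by (simp add: e_def power_add)
      finally show ?thesis by (simp add: vE)
    qed
    have off: "Tdil F Q x \<le> ennreal l" "MM ?h x \<le> ennreal l" if "x \<notin> U" for x
      proof -
      have "x \<notin> U1" "x \<notin> U2" using that U(2) by auto
      thus "Tdil F Q x \<le> ennreal l" "MM ?h x \<le> ennreal l" using U1(2) by (auto simp: U2_def not_le[symmetric])
    qed
    have lS: "l \<le> cS * av F Q"
    proof -
      have "cL * 1 \<le> cL * (1 + cL + cD)" using cL cD_pos by (intro mult_left_mono) auto
      thus ?thesis unfolding l_def cS_def using av0[of Q] by (intro mult_right_mono) auto
    qed
    have P1: "Tdil F Q x \<le> ennreal (cS * av F Q)" if x: "x \<in> cell Q" "x \<notin> (\<Union>P\<in>C. cell P)" for x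
    proof -
      \<comment> \<open>U is open, so small cells around a point of U lie in it and have density 1:
        every point of U in Q is covered by children.\<close>
      have "x \<notin> U"
      proof
        assume "x \<in> U"
        then obtain k0 where k0: "\<And>k. k0 \<le> k \<Longrightarrow> cell (at_gen k x) \<subseteq> U" using small_cell[OF U(1)] by blast
        define P where "P = at_gen (max k0 (fst Q)) x"
        have xP: "x \<in> cell P" and PU: "cell P \<subseteq> U" and PQ: "cell P \<subseteq> cell Q"
          using k0[of "max k0 (fst Q)"] cell_nested[of x Q P] x(1) by (auto simp: P_def)
        have "cell P \<inter> U = cell P" using PU by blast
        moreover have "ennreal (v P) < ennreal (2^(CARD('n) + 1)) * ennreal (v P)"
        proof -
          have "1 < (2::real)^(CARD('n) + 1)" by (rule one_less_power) auto
          hence "1 * v P < 2^(CARD('n) + 1) * v P" using v[of P] by (intro mult_strict_right_mono) auto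
          thus ?thesis using v[of P] by (simp add: ennreal_mult[symmetric] ennreal_less_iff)
        qed
        ultimately have "P \<in> {P. cell P \<subseteq> cell Q \<and> ennreal (v P) < ennreal (2^(CARD('n) + 1)) * vol (cell P \<inter> U)}" using PQ by (simp add: vE)
        from maxc_cover[OF this] obtain R where "R \<in> C" "cell P \<subseteq> cell R" unfolding C_def by blast
        thus False using x(2) xP by blast
      qed
      hence "Tdil F Q x \<le> ennreal l" by (rule off)
      thus ?thesis using lS by (meson ennreal_leI order_trans)
    qed
    have P2: "Tdil F Q x \<le> ennreal (cS * av F Q) + Tdil F P x" if P: "P \<in> C" and x: "x \<in> cell P" for P x
    proof -
      have PQ: "cell P \<subseteq> cell Q" by (rule C(1)[OF P])
      \<comment> \<open>P is not Q because the children fill at most half of Q; hence the parent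
        lies in Q and was rejected, and its volume is 2^n times that of P.\<close>
      have half: "2 * vol (cell P \<inter> U) \<le> ennreal (v P)"
      proof -
        have "P \<noteq> Q"
        proof
          assume "P = Q"
          hence "ennreal (v Q) \<le> vol (\<Union>P\<in>C. cell P)" unfolding vE[symmetric] using P by (intro emeasure_mono) auto
          hence "2 * ennreal (v Q) \<le> ennreal (v Q)" using mC unfolding vE by (meson mult_left_mono order_trans zero_le)
          hence "ennreal (2 * v Q) \<le> ennreal (v Q)" using v[of Q] by (simp add: ennreal_mult)
          thus False using v[of Q] by (simp add: ennreal_le_iff)
        qed
        hence fl: "fst Q < fst P" using cell_subset_fst[OF PQ] cell_eq[OF ctr_in_cell[of P], of Q] ctr_in_cell[of P] PQ by force
        hence f0: "0 < fst P" by linarith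
        have "cell (parent P) \<subseteq> cell Q" using parent_cell[OF f0] ctr_in_cell[of P] PQ fl by (intro cell_nested[of "ctr P"]) auto
        hence "\<not> ennreal (v (parent P)) < ennreal (2^(CARD('n) + 1)) * vol (cell (parent P) \<inter> U)" using maxc_parent[of P] P f0 unfolding C_def by blast
        hence "ennreal (2^(CARD('n) + 1)) * vol (cell (parent P) \<inter> U) \<le> ennreal (v (parent P))" by (simp add: not_less)
        also have "v (parent P) = 2^CARD('n) * v P" unfolding v_def rad_parent[OF f0] by (rule power_mult_distrib)
        finally have 1: "ennreal (2^(CARD('n) + 1)) * vol (cell (parent P) \<inter> U) \<le> ennreal (2^CARD('n) * v P)" .
        have "ennreal (2^CARD('n)) * (2 * vol (cell P \<inter> U)) = ennreal (2^(CARD('n) + 1)) * vol (cell P \<inter> U)"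
        proof -
          have "ennreal (2^(CARD('n) + 1)) = ennreal (2^CARD('n)) * 2" by (simp add: ennreal_mult mult.commute)
          thus ?thesis by (simp only: mult.assoc)
        qed
        also have "... \<le> ennreal (2^(CARD('n) + 1)) * vol (cell (parent P) \<inter> U)" using parent_cell[OF f0] by (intro mult_left_mono emeasure_mono) auto
        also note 1
        finally show ?thesis using v[of P] by (simp add: ennreal_mult ennreal_mult_le_mult_iff)
      qed
      \<comment> \<open>U takes at most half of P and V at most a quarter.\<close>
      have ptx: "\<exists>z\<in>cell P. z \<notin> U \<and> z \<notin> V" if V: "V \<in> sets lebesgue" "4 * vol V \<le> ennreal (v P)" for V
      proof (rule ccontr)
        assume "\<not> ?thesis"
        hence "cell P \<subseteq> (cell P \<inter> U) \<union> V" by blast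
        hence "ennreal (v P) \<le> vol (cell P \<inter> U) + vol V" unfolding vE[symmetric] using V(1) by (intro order_trans[OF emeasure_mono emeasure_subadditive]) auto
        hence "4 * ennreal (v P) \<le> 4 * (vol (cell P \<inter> U) + vol V)" by (intro mult_left_mono) auto
        also have "... = 2 * (2 * vol (cell P \<inter> U)) + 4 * vol V" by (simp add: distrib_left mult.assoc[symmetric])
        also have "... \<le> 2 * ennreal (v P) + ennreal (v P)" by (intro add_mono mult_left_mono half V) auto
        also have "4 * ennreal (v P) = ennreal (4 * v P)" using v[of P] by (simp add: ennreal_mult)
        also have "2 * ennreal (v P) + ennreal (v P) = ennreal (2 * v P + v P)" using v[of P] by (subst ennreal_plus) (auto simp: ennreal_mult)
        finally show False using v[of P] by (simp add: ennreal_le_iff del: ennreal_plus)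
      qed
      have IP: "I P \<le> ennreal (l * (3^CARD('n) * v P))"
      proof -
        obtain z where z: "z \<in> cell P" "z \<notin> U" using ptx[of "{}"] by auto
        have zq: "z \<in> qb (ctr P) (3 * rad P)" using z(1) cell_subset_qb[of P] qb_mono_radius[of "rad P" "3 * rad P" "ctr P"] rad_pos[of P] by auto
        have sub: "dil P \<subseteq> qb (ctr P) (3 * rad P)" unfolding dil_def by (rule hc_subset_qb)
        have "I P \<le> (\<integral>y\<in>qb (ctr P) (3 * rad P). ?h y)"
          unfolding I_def using sub dil_mono[OF PQ] by (intro nn_integral_mono) (auto simp: loc_def indicator_def)
        also have "... \<le> MM ?h z * ennreal ((2 * (3 * rad P))^CARD('n))" using zq by (intro MM_upper) auto
        also have "... \<le> ennreal l * ennreal ((2 * (3 * rad P))^CARD('n))" by (intro mult_right_mono off z) auto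
        also have "... = ennreal (l * (3^CARD('n) * v P))" using l v6[of P] v[of P] by (simp add: ennreal_mult[symmetric])
        finally show ?thesis .
      qed
      have cl: "0 < cL * l" using cL(1) l(1) by simp
      have "I P \<le> ennreal (cL * l * (2 * (3 * rad P))^CARD('n))"
      proof -
        have "1 * l \<le> cL * l" using cL(1) l(1) by (intro mult_right_mono) auto
        hence "l * (3^CARD('n) * v P) \<le> cL * l * (3^CARD('n) * v P)" using v[of P] by (intro mult_right_mono) auto
        hence "ennreal (l * (3^CARD('n) * v P)) \<le> ennreal (cL * l * (3^CARD('n) * v P))" by (rule ennreal_leI)
        thus ?thesis using IP v6[of P] by simp
      qed
      then obtain V where V: "V \<in> sets lebesgue" "{x. ennreal (cL * l) < Tdil F P x} \<subseteq> V"
        "ennreal (cL * l) * vol V \<le> ennreal c11 * I P" using weak11_hc[OF F _ cl, of "3 * rad P" "ctr P"] unfolding dil_def I_def by auto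
      have V4: "4 * vol V \<le> ennreal (v P)"
      proof -
        have "ennreal (cL * l) * (4 * vol V) = 4 * (ennreal (cL * l) * vol V)" by (simp add: mult_ac)
        also have "... \<le> ennreal 4 * (ennreal c11 * ennreal (l * (3^CARD('n) * v P)))"
          using order_trans[OF V(3) mult_left_mono[OF IP, of "ennreal c11"]] by (simp add: mult_left_mono)
        also have "... = ennreal (4 * (c11 * (l * (3^CARD('n) * v P))))" using c11_pos l(1) v[of P] by (simp add: ennreal_mult)
        also have "... \<le> ennreal (cL * l * v P)"
        proof (rule ennreal_leI)
          have "4 * c11 * 3^CARD('n) * (l * v P) \<le> cL * (l * v P)" using cL(2) l(1) v[of P] by (intro mult_right_mono) auto
          thus "4 * (c11 * (l * (3^CARD('n) * v P))) \<le> cL * l * v P" by (simp add: mult_ac)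
        qed
        finally have "ennreal (cL * l) * (4 * vol V) \<le> ennreal (cL * l) * ennreal (v P)" using cl v[of P] by (simp add: ennreal_mult)
        thus ?thesis using cl by (metis ennreal_mult_le_mult_iff ennreal_neq_top ennreal_eq_0_iff not_le)
      qed
      obtain z where z: "z \<in> cell P" "z \<notin> U" "z \<notin> V" using ptx[OF V(1) V4] by blast
      have zP: "Tdil F P z \<le> ennreal (cL * l)" using z(3) V(2) not_le by blast
      \<comment> \<open>The part of F on the dilate of Q off that of P. It stays 2 rad P away from
        P, so its truncations at x and z differ little, and at z both localised truncations are
        bounded.\<close>
      define g where "g y = loc F (dil Q) y - loc F (dil P) y" for y
      have gn: "nice g" unfolding g_def by (rule nice_diff[OF nl nl])
      have g0: "y \<notin> dil P" if "g y \<noteq> 0" for y using that dil_mono[OF PQ] by (auto simp: g_def loc_def indicator_def split: if_splits)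
      have gh: "enorm (g y) \<le> ?h y" for y using dil_mono[OF PQ] by (auto simp: g_def loc_def indicator_def)
      have Mg: "MM (\<lambda>y. enorm (g y)) z \<le> ennreal l" using MM_mono[of "\<lambda>y. enorm (g y)" ?h z] gh off(2)[OF z(2)] by (meson order_trans)
      have xz: "norm (x - z) \<le> 2 * (CARD('n) * rad P)" using norm_triangle_ineq4[of "x - ctr P" "z - ctr P"] cell_norm[OF x] cell_norm[OF z(1)] by force
      show ?thesis unfolding max_truncation_le_iff[of "loc F (dil Q)"]
      proof (intro allI impI)
        fix t :: real assume t: "0 < t"
        have "enorm (tr t g x - tr t g z) \<le> ennreal cD * ennreal l"
        proof (rule tr_shift[OF gn rad_pos[of P] t _ xz])
          fix y assume "g y \<noteq> 0"
          thus "2 * rad P \<le> norm (x - y) \<and> 2 * rad P \<le> norm (z - y)" using outside_dil[OF x g0] outside_dil[OF z(1) g0] by blast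
        next
          fix r :: real assume r: "0 < r"
          hence "z \<in> qb z r" by (simp add: mem_qb infnorm_0)
          thus "(\<integral>y\<in>qb z r. enorm (g y)) \<le> ennreal l * ennreal ((2 * r)^CARD('n))" using Mg r unfolding MM_le_iff by blast
        qed
        hence d1: "norm (tr t g x - tr t g z) \<le> cD * l" using cD_pos l(1) by (simp add: ennreal_mult[symmetric] ennreal_le_iff)
        have tg: "tr t g y = tr t (loc F (dil Q)) y - tr t (loc F (dil P)) y" for y unfolding g_def by (rule tr_diff[OF nl nl t])
        have d2: "norm (tr t (loc F (dil Q)) z) \<le> l" using off(1)[OF z(2)] t l(1) unfolding max_truncation_le_iff by (simp add: ennreal_le_iff)
        have d3: "norm (tr t (loc F (dil P)) z) \<le> cL * l" using zP t cl unfolding max_truncation_le_iff by (simp add: ennreal_le_iff)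
        have eq: "tr t (loc F (dil Q)) x = (tr t g x - tr t g z) + (tr t (loc F (dil Q)) z - tr t (loc F (dil P)) z) + tr t (loc F (dil P)) x" by (simp add: tg)
        have "norm (tr t (loc F (dil Q)) x) \<le> norm (tr t g x - tr t g z) + (norm (tr t (loc F (dil Q)) z) + norm (tr t (loc F (dil P)) z)) + norm (tr t (loc F (dil P)) x)"
          by (subst eq) (intro norm_triangle_mono norm_triangle_ineq4 order_refl)
        also have "... \<le> cD * l + (l + cL * l) + norm (tr t (loc F (dil P)) x)" by (intro add_mono d1 d2 d3 order_refl)
        also have "cD * l + (l + cL * l) = cS * av F Q" by (simp add: cS_def l_def algebra_simps)
        finally have "enorm (tr t (loc F (dil Q)) x) \<le> ennreal (cS * av F Q + norm (tr t (loc F (dil P)) x))" by (rule ennreal_leI)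
        also have "... = ennreal (cS * av F Q) + enorm (tr t (loc F (dil P)) x)" using cS_pos av0[of Q] by (intro ennreal_plus) auto
        also have "... \<le> ennreal (cS * av F Q) + Tdil F P x" unfolding max_truncation_tr using t by (intro add_left_mono SUP_upper) auto
        finally show "enorm (tr t (loc F (dil Q)) x) \<le> ennreal (cS * av F Q) + Tdil F P x" .
      qed
    qed
    show ?thesis using C(1) dC mC P1 P2 by blast
  qed
qed

end

section \<open>Counting the selected cubes of a level\<close>

lemma powr_le_exp: fixes x a \<delta> :: real
  assumes "0 < a" "0 < \<delta>" "0 < x" shows "x powr a \<le> (a / \<delta>) powr a * exp (\<delta> * x)"
proof -
  have "\<delta> * x / a \<le> exp (\<delta> * x / a)" using exp_ge_add_one_self[of "\<delta> * x / a"] by linarith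
  hence "(\<delta> * x / a) powr a \<le> exp (\<delta> * x / a) powr a" using assms by (intro powr_mono2) auto
  also have "... = exp (\<delta> * x)" using assms by (simp add: exp_powr_real)
  finally have 1: "(\<delta> * x / a) powr a \<le> exp (\<delta> * x)" .
  have "x powr a = ((a / \<delta>) * (\<delta> * x / a)) powr a" using assms by simp
  also have "... = (a / \<delta>) powr a * (\<delta> * x / a) powr a" by (rule powr_mult)
  also have "... \<le> (a / \<delta>) powr a * exp (\<delta> * x)" by (intro mult_left_mono 1) auto
  finally show ?thesis .
qed

text \<open>Half of the exponential is spent on the power and the other half is summed as a
  geometric series; with \<delta> of size 1/W the cost is W^(a+1).\<close>

lemma suminf_powr_exp_le:
  fixes a \<delta> :: real
  assumes a: "0 < a" and \<delta>: "0 < \<delta>" "\<delta> \<le> 1"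
  shows "(\<Sum>i. ennreal ((real i + 1) powr a * exp (- \<delta> * real i))) \<le> ennreal ((2 * a / \<delta>) powr a * exp 1 * (4 / \<delta>))"
proof -
  define q where "q = exp (- \<delta> / 2)"
  define c where "c = (2 * a / \<delta>) powr a * exp 1"
  have c: "0 \<le> c" by (simp add: c_def)
  have q: "0 < q" "q < 1" using \<delta> by (auto simp: q_def)
  have t: "(real i + 1) powr a * exp (- \<delta> * real i) \<le> c * q^i" for i
  proof -
    have "(real i + 1) powr a \<le> (a / (\<delta> / 2)) powr a * exp (\<delta> / 2 * (real i + 1))" using a \<delta> by (intro powr_le_exp) auto
    hence "(real i + 1) powr a * exp (- \<delta> * real i) \<le> (a / (\<delta> / 2)) powr a * exp (\<delta> / 2 * (real i + 1)) * exp (- \<delta> * real i)"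
      by (intro mult_right_mono) auto
    also have "... = (2 * a / \<delta>) powr a * (exp (\<delta> / 2) * q^i)"
    proof -
      have "\<delta> / 2 * (real i + 1) + (- \<delta> * real i) = \<delta> / 2 + real i * (- \<delta> / 2)" by (simp add: field_simps)
      hence "exp (\<delta> / 2 * (real i + 1)) * exp (- \<delta> * real i) = exp (\<delta> / 2) * q^i"
        unfolding q_def exp_of_nat_mult[symmetric] exp_add[symmetric] by (rule arg_cong)
      thus ?thesis by (simp add: mult.assoc mult.commute)
    qed
    also have "... \<le> (2 * a / \<delta>) powr a * (exp 1 * q^i)" using \<delta> q by (intro mult_left_mono mult_right_mono) auto
    finally show ?thesis by (simp add: c_def mult.assoc)
  qed
  have "(\<Sum>i. ennreal ((real i + 1) powr a * exp (- \<delta> * real i))) \<le> (\<Sum>i. ennreal (c * q^i))" by (intro suminf_le ennreal_leI t) auto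
  also have "... = ennreal (\<Sum>i. c * q^i)" using c q by (intro suminf_ennreal2) (auto intro!: summable_mult summable_geometric)
  also have "(\<Sum>i. c * q^i) = c * (1 / (1 - q))" using q by (subst suminf_mult) (auto intro!: summable_geometric simp: suminf_geometric)
  also have "ennreal (c * (1 / (1 - q))) \<le> ennreal (c * (4 / \<delta>))"
  proof (intro ennreal_leI mult_left_mono c)
    have "1 + \<delta> / 2 \<le> exp (\<delta> / 2)" by (rule exp_ge_add_one_self)
    hence "q \<le> 1 / (1 + \<delta> / 2)" using \<delta> unfolding q_def by (simp add: exp_minus field_simps)
    also have "... \<le> 1 - \<delta> / 4"
    proof -
      have "\<delta> * \<delta> \<le> \<delta> * 1" using \<delta> by (intro mult_left_mono) auto
      hence "1 \<le> (1 - \<delta> / 4) * (1 + \<delta> / 2)" using \<delta> by (simp add: algebra_simps)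
      thus ?thesis using \<delta> by (simp add: pos_divide_le_eq)
    qed
    finally have "q \<le> 1 - \<delta> / 4" .
    hence "\<delta> \<le> 4 * (1 - q)" by simp
    thus "1 / (1 - q) \<le> 4 / \<delta>" using \<delta> q by (simp add: field_simps)
  qed
  finally show ?thesis by (simp add: c_def)
qed

lemma geometric_le_top:
  fixes c \<theta> \<mu> :: real
  assumes c: "0 < c" and \<theta>: "1 < \<theta>" and A: "finite A" "\<And>k. k \<in> A \<Longrightarrow> c * \<theta>^k \<le> \<mu>" and \<mu>: "0 \<le> \<mu>"
  shows "(\<Sum>k\<in>A. c * \<theta>^k) \<le> \<theta> / (\<theta> - 1) * \<mu>"
proof (cases "A = {}")
  case False
  define m where "m = Max A"
  have m: "m \<in> A" "A \<subseteq> {..<Suc m}" using A(1) False Max_in[of A] Max_ge[of A] by (auto simp: m_def less_Suc_eq_le)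
  have "(\<Sum>k\<in>A. c * \<theta>^k) \<le> (\<Sum>k<Suc m. c * \<theta>^k)" using m c \<theta> by (intro sum_mono2) auto
  also have "... = c * ((\<theta>^Suc m - 1) / (\<theta> - 1))" using \<theta> geometric_sum[of \<theta> "Suc m"] by (simp only: sum_distrib_left[symmetric])
  also have "... \<le> c * (\<theta>^Suc m / (\<theta> - 1))" using c \<theta> by (intro mult_left_mono divide_right_mono) auto
  also have "... = \<theta> / (\<theta> - 1) * (c * \<theta>^m)" by simp
  also have "... \<le> \<theta> / (\<theta> - 1) * \<mu>" using \<theta> by (intro mult_left_mono A m) auto
  finally show ?thesis .
qed (use \<theta> \<mu> in auto)

section \<open>Trees of cells with halving children\<close>

locale sparse_tree = grid a s for a :: "real^'n" and s +
  fixes ch :: "'n cube \<Rightarrow> 'n cube set"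
  assumes ch_sub: "P \<in> ch Q \<Longrightarrow> cell P \<subseteq> cell Q"
    and ch_disj: "disjoint_family_on cell (ch Q)"
    and ch_half: "2 * vol (\<Union>P\<in>ch Q. cell P) \<le> vol (cell Q)"
begin

text \<open>Powers of the child relation, so that generations can be split at either end by
  \<open>relpow_add\<close>.\<close>

definition desc :: "nat \<Rightarrow> 'n cube \<Rightarrow> 'n cube set" where
  "desc m Q = {P. (Q, P) \<in> {(Q, P). P \<in> ch Q} ^^ m}"

definition descs :: "'n cube \<Rightarrow> 'n cube set" where "descs Q = (\<Union>m. desc m Q)"

definition Um :: "nat \<Rightarrow> 'n cube \<Rightarrow> (real^'n) set" where "Um m Q = (\<Union>P\<in>desc m Q. cell P)"

lemma desc_0 [simp]: "desc 0 Q = {Q}" by (auto simp: desc_def)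

lemma desc_add: "desc (i + j) Q = (\<Union>P\<in>desc i Q. desc j P)" by (auto simp: desc_def relpow_add)

lemma desc_1: "desc (Suc 0) Q = ch Q" by (auto simp: desc_def)

lemma desc_Suc: "desc (Suc m) Q = (\<Union>P\<in>desc m Q. ch P)" using desc_add[of m "Suc 0" Q] by (simp add: desc_1)

lemma desc_Suc2: "desc (Suc m) Q = (\<Union>P\<in>ch Q. desc m P)" using desc_add[of "Suc 0" m Q] by (simp add: desc_1)

lemma desc_sub: "P \<in> desc m Q \<Longrightarrow> cell P \<subseteq> cell Q"
proof (induction m arbitrary: P)
  case (Suc m)
  then obtain R where "R \<in> desc m Q" "P \<in> ch R" by (auto simp: desc_Suc)
  thus ?case using Suc.IH ch_sub by blast
qed simp

lemma descs_sub: "P \<in> descs Q \<Longrightarrow> cell P \<subseteq> cell Q" using desc_sub unfolding descs_def by blast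

lemma desc_disj: "disjoint_family_on cell (desc m Q)"
proof (induction m)
  case (Suc m)
  show ?case unfolding disjoint_family_on_def
  proof (intro ballI impI)
    fix P P' assume "P \<in> desc (Suc m) Q" "P' \<in> desc (Suc m) Q" and ne: "P \<noteq> P'"
    then obtain R R' where R: "R \<in> desc m Q" "P \<in> ch R" "R' \<in> desc m Q" "P' \<in> ch R'" unfolding desc_Suc by blast
    show "cell P \<inter> cell P' = {}"
    proof (cases "R = R'")
      case True
      thus ?thesis using ch_disj[of R] R ne unfolding disjoint_family_on_def by blast
    next
      case False
      hence "cell R \<inter> cell R' = {}" using Suc R unfolding disjoint_family_on_def by blast
      thus ?thesis using ch_sub[OF R(2)] ch_sub[OF R(4)] by blast
    qed
  qed
qed (simp add: disjoint_family_on_def)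

lemma Um_sets [measurable, simp]: "Um m Q \<in> sets lebesgue" by (simp add: Um_def)

lemma Um_sub: "Um m Q \<subseteq> cell Q" using desc_sub unfolding Um_def by blast

lemma Um_antimono: "i \<le> j \<Longrightarrow> Um j Q \<subseteq> Um i Q" using desc_add[of i "j - i" Q] Um_sub by (force simp: Um_def)

lemma Um_measure: "ennreal (2^m) * vol (Um m Q) \<le> vol (cell Q)"
proof (induction m)
  case 0 show ?case by (simp add: Um_def)
next
  case (Suc m)
  have d: "disjoint_family_on (\<lambda>P. \<Union>R\<in>ch P. cell R) (desc m Q)" unfolding disjoint_family_on_def
  proof (intro ballI impI)
    fix P P' assume "P \<in> desc m Q" "P' \<in> desc m Q" "P \<noteq> P'"
    hence "cell P \<inter> cell P' = {}" using desc_disj[of m Q] unfolding disjoint_family_on_def by blast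
    thus "(\<Union>R\<in>ch P. cell R) \<inter> (\<Union>R\<in>ch P'. cell R) = {}" using ch_sub by blast
  qed
  have "Um (Suc m) Q = (\<Union>P\<in>desc m Q. \<Union>R\<in>ch P. cell R)" by (auto simp: Um_def desc_Suc)
  hence "2 * vol (Um (Suc m) Q) = 2 * (\<Sum>\<^sup>+P\<in>desc m Q. vol (\<Union>R\<in>ch P. cell R))"
    using emeasure_UN_countable[of "desc m Q" "\<lambda>P. \<Union>R\<in>ch P. cell R" lebesgue] d by simp
  also have "... = (\<Sum>\<^sup>+P\<in>desc m Q. 2 * vol (\<Union>R\<in>ch P. cell R))" by (rule nn_integral_cmult[symmetric]) simp
  also have "... \<le> (\<Sum>\<^sup>+P\<in>desc m Q. vol (cell P))" by (intro nn_integral_mono ch_half)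
  also have "... = vol (Um m Q)" unfolding Um_def using desc_disj by (subst emeasure_UN_countable) auto
  finally have 1: "2 * vol (Um (Suc m) Q) \<le> vol (Um m Q)" .
  have "ennreal (2^Suc m) = ennreal (2^m) * 2" by (simp add: ennreal_mult mult.commute)
  hence "ennreal (2^Suc m) * vol (Um (Suc m) Q) = ennreal (2^m) * (2 * vol (Um (Suc m) Q))" by (simp only: mult.assoc)
  also have "... \<le> ennreal (2^m) * vol (Um m Q)" by (intro mult_left_mono 1) auto
  also note Suc
  finally show ?case .
qed

lemma desc_unique: "P \<in> desc m Q \<Longrightarrow> P' \<in> desc m Q \<Longrightarrow> x \<in> cell P \<Longrightarrow> x \<in> cell P' \<Longrightarrow> P = P'"
  using desc_disj[of m Q] unfolding disjoint_family_on_def by blast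

text \<open>Descendants of equal depth are disjoint, so the ancestor of P at the depth of R can only
  be R. If R is the deeper one, the same argument makes the two cells coincide.\<close>

lemma descs_nested:
  assumes P: "P \<in> descs Q" and R: "R \<in> descs Q" and PR: "cell P \<subseteq> cell R"
  shows "P \<in> descs R"
proof -
  obtain i j where ij: "P \<in> desc i Q" "R \<in> desc j Q" using P R by (auto simp: descs_def)
  show ?thesis
  proof (cases "j \<le> i")
    case True
    hence "P \<in> desc (j + (i - j)) Q" using ij by simp
    then obtain R' where R': "R' \<in> desc j Q" "P \<in> desc (i - j) R'" unfolding desc_add by blast
    have "R' = R" using desc_unique[OF R'(1) ij(2) _ _, of "ctr P"] desc_sub[OF R'(2)] PR ctr_in_cell[of P] by blast
    thus ?thesis using R'(2) by (auto simp: descs_def)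
  next
    case False
    hence "R \<in> desc (i + (j - i)) Q" using ij by simp
    then obtain P' where P': "P' \<in> desc i Q" "R \<in> desc (j - i) P'" unfolding desc_add by blast
    have "P' = P" using desc_unique[OF P'(1) ij(1) _ _, of "ctr P"] desc_sub[OF P'(2)] PR ctr_in_cell[of P] by blast
    hence "cell R \<subseteq> cell P" using desc_sub[OF P'(2)] by simp
    hence "P = R" using PR cell_subset_antisym by blast
    hence "P \<in> desc 0 R" by simp
    thus ?thesis unfolding descs_def by blast
  qed
qed

lemma ch_not_Q: assumes "P \<in> ch Q" shows "\<not> cell Q \<subseteq> cell P"
proof
  assume "cell Q \<subseteq> cell P"
  hence "vol (cell Q) \<le> vol (\<Union>P\<in>ch Q. cell P)" using assms by (intro emeasure_mono) auto
  hence "2 * vol (cell Q) \<le> vol (cell Q)" using ch_half[of Q] by (meson mult_left_mono order_trans zero_le)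
  hence "ennreal (2 * cv Q) \<le> ennreal (cv Q)" by (simp add: emeasure_cell ennreal_mult)
  hence "2 * cv Q \<le> cv Q" by (subst (asm) ennreal_le_iff) auto
  thus False using zero_less_power[of "2 * rad Q" "CARD('n)"] rad_pos[of Q] by linarith
qed

text \<open>Unrolling the recursive estimate along the branch of the tree that contains \<open>x\<close>.\<close>

lemma branch_sum:
  fixes \<tau> :: "'n cube \<Rightarrow> real^'n \<Rightarrow> ennreal"
  assumes off: "\<And>Q x. x \<in> cell Q \<Longrightarrow> x \<notin> (\<Union>P\<in>ch Q. cell P) \<Longrightarrow> \<tau> Q x \<le> \<alpha> Q"
    and on: "\<And>Q P x. P \<in> ch Q \<Longrightarrow> x \<in> cell P \<Longrightarrow> \<tau> Q x \<le> \<alpha> Q + \<tau> P x"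
  shows "x \<in> cell Q \<Longrightarrow> x \<notin> Um m Q \<Longrightarrow> \<exists>S. finite S \<and> S \<subseteq> {P\<in>descs Q. x \<in> cell P} \<and> \<tau> Q x \<le> (\<Sum>P\<in>S. \<alpha> P)"
proof (induction m arbitrary: Q)
  case 0 thus ?case by (simp add: Um_def)
next
  case (Suc m)
  have Q: "Q \<in> descs Q" using desc_0[of Q] unfolding descs_def by blast
  show ?case
  proof (cases "x \<in> (\<Union>P\<in>ch Q. cell P)")
    case False
    thus ?thesis using off[OF Suc.prems(1)] Q Suc.prems(1) by (intro exI[of _ "{Q}"]) auto
  next
    case True
    then obtain P where P: "P \<in> ch Q" "x \<in> cell P" by blast
    have "x \<notin> Um m P" using Suc.prems(2) P by (auto simp: Um_def desc_Suc2)
    then obtain S where S: "finite S" "S \<subseteq> {R\<in>descs P. x \<in> cell R}" "\<tau> P x \<le> (\<Sum>R\<in>S. \<alpha> R)" using Suc.IH[OF P(2)] by blast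
    have "Q \<notin> S" using S(2) descs_sub[of Q P] ch_not_Q[OF P(1)] by blast
    have dP: "descs P \<subseteq> descs Q"
    proof
      fix R assume "R \<in> descs P"
      then obtain k where "R \<in> desc k P" by (auto simp: descs_def)
      hence "R \<in> desc (Suc k) Q" using P(1) by (auto simp: desc_Suc2)
      thus "R \<in> descs Q" unfolding descs_def by blast
    qed
    have "\<tau> Q x \<le> \<alpha> Q + \<tau> P x" by (rule on[OF P])
    also have "... \<le> \<alpha> Q + (\<Sum>R\<in>S. \<alpha> R)" by (intro add_left_mono S)
    also have "... = (\<Sum>R\<in>insert Q S. \<alpha> R)" using S(1) \<open>Q \<notin> S\<close> by simp
    finally show ?thesis using S dP Q Suc.prems(1) by (intro exI[of _ "insert Q S"]) auto
  qed
qed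

lemma Um_null: "AE x in lebesgue. \<exists>m. x \<notin> Um m Q"
proof -
  have "vol (\<Inter>m. Um m Q) \<le> 0"
  proof (rule ennreal_le_epsilon)
    fix e :: real assume e: "0 < e"
    define v where "v = cv Q"
    have v: "0 < v" by (simp add: v_def)
    obtain m where m: "v / e < 2^m" using real_arch_pow[of 2] by auto
    have "ennreal (2^m) * vol (\<Inter>m. Um m Q) \<le> ennreal (2^m) * vol (Um m Q)" by (intro mult_left_mono emeasure_mono) auto
    also have "... \<le> ennreal v" using Um_measure[of m Q] by (simp add: emeasure_cell v_def)
    also have "... \<le> ennreal (2^m * e)" using m e by (intro ennreal_leI) (simp add: field_simps)
    finally have "ennreal (2^m) * vol (\<Inter>m. Um m Q) \<le> ennreal (2^m) * ennreal e" using e by (simp add: ennreal_mult)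
    thus "vol (\<Inter>m. Um m Q) \<le> 0 + ennreal e" by (simp add: ennreal_mult_le_mult_iff)
  qed
  hence "(\<Inter>m. Um m Q) \<in> null_sets lebesgue" by (auto simp: null_sets_def intro!: sets.countable_INT'')
  thus ?thesis by (rule AE_I') auto
qed

text \<open>A counting integral rather than a cardinality: it is measurable in x, and infinite when
  infinitely many cells contain x.\<close>

definition cnt :: "'n cube set \<Rightarrow> real^'n \<Rightarrow> ennreal" where
  "cnt A x = (\<Sum>\<^sup>+P\<in>A. indicator (cell P) x)"

lemma cnt_measurable [measurable]: "cnt A \<in> lmeas" unfolding cnt_def[abs_def] by measurable

lemma cnt_emeasure: "cnt A x = emeasure (count_space A) {P\<in>A. x \<in> cell P}"
proof -
  have "cnt A x = (\<Sum>\<^sup>+P\<in>A. indicator {P\<in>A. x \<in> cell P} P)" unfolding cnt_def by (intro nn_integral_cong) (auto simp: indicator_def)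
  thus ?thesis by simp
qed

lemma card_le_cnt: "finite S \<Longrightarrow> S \<subseteq> {P\<in>A. x \<in> cell P} \<Longrightarrow> ennreal (card S) \<le> cnt A x"
  unfolding cnt_emeasure using emeasure_mono[of S "{P\<in>A. x \<in> cell P}" "count_space A"]
  by (simp add: emeasure_count_space_finite subset_iff ennreal_of_nat_eq_real_of_nat)

text \<open>Cells through x have different depths below R, and all depths are less than m because
  the sets \<open>Um\<close> decrease.\<close>

lemma cnt_le:
  assumes sub: "\<And>P. P \<in> A \<Longrightarrow> x \<in> cell P \<Longrightarrow> P \<in> descs R" and x: "x \<notin> Um m R"
  shows "cnt A x \<le> ennreal (real m)"
proof -
  define A' where "A' = {P\<in>A. x \<in> cell P}"
  have "\<exists>j. P \<in> desc j R" if "P \<in> A'" for P using sub that by (auto simp: A'_def descs_def)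
  then obtain f where f: "\<And>P. P \<in> A' \<Longrightarrow> P \<in> desc (f P) R" by metis
  have lt: "f P < m" if "P \<in> A'" for P
  proof (rule ccontr)
    assume "\<not> f P < m"
    hence "Um (f P) R \<subseteq> Um m R" by (intro Um_antimono) auto
    moreover have "x \<in> Um (f P) R" using f[OF that] that by (auto simp: Um_def A'_def)
    ultimately show False using x by blast
  qed
  have inj: "inj_on f A'"
  proof (rule inj_onI)
    fix P P' assume "P \<in> A'" "P' \<in> A'" "f P = f P'"
    thus "P = P'" using f[of P] f[of P'] by (intro desc_unique[of P "f P" R P' x]) (auto simp: A'_def)
  qed
  have im: "f ` A' \<subseteq> {..<m}" using lt by auto
  have fin: "finite A'" by (rule inj_on_finite[OF inj im]) simp
  have "card A' \<le> m" using card_inj_on_le[OF inj im] by simp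
  thus ?thesis using fin unfolding cnt_emeasure A'_def[symmetric]
    by (subst emeasure_count_space_finite) (auto simp: A'_def ennreal_of_nat_eq_real_of_nat intro: ennreal_leI)
qed

end

section \<open>Levels of the selected cells\<close>

locale tree_weight = sawyer a s w \<sigma> W g p G + sparse_tree a s ch
  for a :: "real^'n" and s and w :: "real^'n \<Rightarrow> ennreal" and \<sigma> W and g :: "real^'n \<Rightarrow> ennreal" and p G ch
begin

text \<open>For cells inside the root the set is nonempty by \<open>five_root\<close> and finite
  because M g is bounded by G, so the maximum is attained.\<close>

definition lv :: "'n cube \<Rightarrow> nat" where "lv P = Max {k. five P \<subseteq> \<Omega> k}"

lemma lv:
  assumes "P \<in> subcells"
  shows "five P \<subseteq> \<Omega> (lv P)" "\<not> five P \<subseteq> \<Omega> (Suc (lv P))" "G \<le> lev K \<Longrightarrow> lv P < K"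
proof -
  have bd: "k < K" if "five P \<subseteq> \<Omega> k" "G \<le> lev K" for k K
  proof (rule ccontr)
    assume "\<not> k < K"
    hence "lev K \<le> lev k" by (intro lev_mono) auto
    moreover have "ennreal (lev k) < MM g (ctr P)" using that(1) ctr_in_five[of P] by (auto simp: \<Omega>_def)
    ultimately show False using MM_g_le[of "ctr P"] that(2) by (meson ennreal_leI leD order_trans)
  qed
  obtain K0 where "G / l0 < 2^K0" using real_arch_pow[of 2] by auto
  hence K0: "G \<le> lev K0" using l0_pos by (simp add: lev_def field_simps)
  have fin: "finite {k. five P \<subseteq> \<Omega> k}" by (rule finite_subset[of _ "{..<K0}"]) (use bd[OF _ K0] in auto)
  have "cell P \<subseteq> cell root" using assms by (simp add: subcells_def)
  hence "five P \<subseteq> five root" unfolding five_def by (rule qb_cell_mono) simp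
  hence ne: "0 \<in> {k. five P \<subseteq> \<Omega> k}" using five_root by blast
  have "lv P \<in> {k. five P \<subseteq> \<Omega> k}" unfolding lv_def using fin ne by (intro Max_in) auto
  thus 1: "five P \<subseteq> \<Omega> (lv P)" by simp
  show "\<not> five P \<subseteq> \<Omega> (Suc (lv P))" using Max_ge[OF fin, of "Suc (lv P)"] unfolding lv_def by auto
  show "G \<le> lev K \<Longrightarrow> lv P < K" by (rule bd[OF 1])
qed

definition Lv :: "nat \<Rightarrow> 'n cube set" where "Lv k = {P\<in>descs root. lv P = k}"

lemma Lv_sub: "P \<in> Lv k \<Longrightarrow> P \<in> subcells \<and> five P \<subseteq> \<Omega> k"
  using descs_sub[of P root] lv(1)[of P] by (auto simp: Lv_def subcells_def)

text \<open>Inside a Whitney cell, the cells of level k lie below the maximal ones among them and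
  are descendants of these by \<open>descs_nested\<close>. More than m of them through x therefore
  put x into an m-th generation, whose relative measure is at most 2^(-m).\<close>

lemma level_set_measure:
  assumes P: "P \<in> Wh k"
  shows "ennreal (2^m) * vol (cell P \<inter> {x. ennreal (real m) < cnt (Lv k) x}) \<le> vol (cell P)"
proof -
  define X where "X = maxc {R\<in>Lv k. cell R \<subseteq> cell P}"
  have X: "R \<in> Lv k" "cell R \<subseteq> cell P" if "R \<in> X" for R using that maxc_subset unfolding X_def by blast+
  have dX: "disjoint_family_on cell X" unfolding X_def by (rule maxc_disjoint)
  have dU: "disjoint_family_on (Um m) X" using dX Um_sub unfolding disjoint_family_on_def by blast
  have "cell P \<inter> {x. ennreal (real m) < cnt (Lv k) x} \<subseteq> (\<Union>R\<in>X. Um m R)"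
  proof (rule subsetI, rule ccontr)
    fix x assume x: "x \<in> cell P \<inter> {x. ennreal (real m) < cnt (Lv k) x}" "x \<notin> (\<Union>R\<in>X. Um m R)"
    have inX: "\<exists>R\<in>X. cell Q \<subseteq> cell R" if Q: "Q \<in> Lv k" "x \<in> cell Q" for Q
    proof -
      obtain P' where P': "P' \<in> Wh k" "cell Q \<subseteq> cell P'" using Wh_cover Lv_sub[OF Q(1)] by blast
      have "P' = P" using Wh_disjoint[of k] P' P Q(2) x(1) unfolding disjoint_family_on_def by blast
      hence "Q \<in> {R\<in>Lv k. cell R \<subseteq> cell P}" using P' Q by blast
      thus ?thesis unfolding X_def by (rule maxc_cover)
    qed
    have "cnt (Lv k) x \<le> ennreal (real m)"
    proof (cases "\<exists>Q\<in>Lv k. x \<in> cell Q")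
      case False
      hence "{P\<in>Lv k. x \<in> cell P} = {}" by blast
      hence "cnt (Lv k) x = 0" unfolding cnt_emeasure by (metis emeasure_empty)
      thus ?thesis by simp
    next
      case True
      then obtain Q R where R: "R \<in> X" "x \<in> cell R" using inX by blast
      show ?thesis
      proof (rule cnt_le[of _ _ R])
        fix Q assume Q: "Q \<in> Lv k" "x \<in> cell Q"
        then obtain R' where R': "R' \<in> X" "cell Q \<subseteq> cell R'" using inX by blast
        have "R' = R" using dX R R' Q(2) unfolding disjoint_family_on_def by blast
        thus "Q \<in> descs R" using R' Q(1) X(1)[OF R(1)] by (intro descs_nested[of Q root R]) (auto simp: Lv_def)
      next
        show "x \<notin> Um m R" using x(2) R(1) by blast
      qed
    qed
    thus False using x(1) not_less by blast
  qed
  hence "vol (cell P \<inter> {x. ennreal (real m) < cnt (Lv k) x}) \<le> vol (\<Union>R\<in>X. Um m R)" by (intro emeasure_mono) (auto intro!: sets.countable_UN'')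
  also have "... = (\<Sum>\<^sup>+R\<in>X. vol (Um m R))" using dU by (intro emeasure_UN_countable) auto
  finally have "ennreal (2^m) * vol (cell P \<inter> {x. ennreal (real m) < cnt (Lv k) x})
    \<le> ennreal (2^m) * (\<Sum>\<^sup>+R\<in>X. vol (Um m R))" by (rule mult_left_mono) simp
  also have "... = (\<Sum>\<^sup>+R\<in>X. ennreal (2^m) * vol (Um m R))" by (rule nn_integral_cmult[symmetric]) simp
  also have "... \<le> (\<Sum>\<^sup>+R\<in>X. vol (cell R))" by (intro nn_integral_mono Um_measure)
  also have "... = vol (\<Union>R\<in>X. cell R)" using dX by (intro emeasure_UN_countable[symmetric]) auto
  also have "... \<le> vol (cell P)" using X(2) by (intro emeasure_mono) auto
  finally show ?thesis .
qed

lemma level_set_sets [measurable, simp]: "{x. ennreal l < cnt A x} \<in> sets lebesgue"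
  using borel_measurable_less[OF borel_measurable_const[of "ennreal l" lebesgue] cnt_measurable[of A]] by simp

text \<open>Summing \<open>weight_small\<close> over the Whitney cells turns their tails into
  \<open>S k\<close>, the quantity that Sawyer's inequality controls.\<close>

lemma level_set_weight:
  "(\<integral>x. w x * indicator {x. ennreal (real m) < cnt (Lv k) x} x)
    \<le> ennreal (rA CARD('n) \<sigma> * W * exp (- rB CARD('n) \<sigma> * real m / W)) * S k"
proof -
  define E where "E = {x. ennreal (real m) < cnt (Lv k) x}"
  define c where "c = rA CARD('n) \<sigma> * W * exp (- rB CARD('n) \<sigma> * real m / W)"
  have Es [measurable]: "E \<in> sets lebesgue" unfolding E_def by simp
  have EP: "(\<integral>x\<in>cell P. w x * indicator E x) \<le> ennreal c * kq P" if P: "P \<in> Wh k" for P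
  proof -
    have "ennreal (2^m) * vol (cell P \<inter> E) \<le> ennreal (cv P)" using level_set_measure[OF P, of m] unfolding E_def by (simp add: emeasure_cell)
    also have "... = ennreal (2^m) * ennreal (1 * 2 powr - real m * cv P)" by (subst ennreal_mult[symmetric]) (auto simp: powr_minus powr_realpow)
    finally have "vol (cell P \<inter> E) \<le> ennreal (1 * 2 powr - real m * cv P)" by (simp add: ennreal_mult_le_mult_iff)
    hence "(\<integral>x\<in>cell P \<inter> E. w x) \<le> ennreal (rA CARD('n) \<sigma> * 1 * W * exp (- rB CARD('n) \<sigma> * real m / W)) * kq P"
      using cell_subset_qb[of P] by (intro weight_small) auto
    moreover have "(\<integral>x\<in>cell P. w x * indicator E x) = (\<integral>x\<in>cell P \<inter> E. w x)" by (intro nn_integral_cong) (auto simp: indicator_def)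
    ultimately show ?thesis by (simp add: c_def)
  qed
  have "E \<subseteq> (\<Union>P\<in>Wh k. cell P)"
  proof
    fix x assume x: "x \<in> E"
    have "\<exists>Q\<in>Lv k. x \<in> cell Q"
    proof (rule ccontr)
      assume "\<not> ?thesis"
      hence "{P\<in>Lv k. x \<in> cell P} = {}" by blast
      hence "cnt (Lv k) x = 0" unfolding cnt_emeasure by (metis emeasure_empty)
      thus False using x by (simp add: E_def)
    qed
    then obtain Q where Q: "Q \<in> Lv k" "x \<in> cell Q" by blast
    then obtain P where "P \<in> Wh k" "cell Q \<subseteq> cell P" using Wh_cover Lv_sub by blast
    thus "x \<in> (\<Union>P\<in>Wh k. cell P)" using Q by blast
  qed
  hence "(\<integral>x. w x * indicator E x) = (\<integral>x\<in>(\<Union>P\<in>Wh k. cell P). w x * indicator E x)"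
    by (intro nn_integral_cong) (auto simp: indicator_def)
  also have "... = (\<Sum>\<^sup>+P\<in>Wh k. (\<integral>x\<in>cell P. w x * indicator E x))" by (rule nn_integral_cells[OF Wh_disjoint]) measurable
  also have "... \<le> (\<Sum>\<^sup>+P\<in>Wh k. ennreal c * kq P)" by (rule nn_integral_mono) (simp add: EP)
  also have "... = ennreal c * S k" unfolding S_def by (rule nn_integral_cmult) simp
  finally show ?thesis unfolding E_def c_def .
qed

text \<open>\<open>Y\<close> dominates \<open>lev k powr p * (n_k - L) powr (2 * p)\<close>, where \<open>n_k\<close> counts the cubes of level
  \<open>k\<close> on the branch of \<open>x\<close>; the crude layer sum replaces the moment by measures of level sets.\<close>

definition Y :: "nat \<Rightarrow> nat \<Rightarrow> real^'n \<Rightarrow> ennreal" where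
  "Y K L x = (\<Sum>k<K. ennreal (lev k powr p) * (\<Sum>i. ennreal ((real i + 1) powr (2 * p)) * indicator {x. ennreal (real (L + i)) < cnt (Lv k) x} x))"

definition cY :: real where
  "cY = rA CARD('n) \<sigma> * (4 * p / rB CARD('n) \<sigma>) powr (2 * p) * exp 1 * (4 / rB CARD('n) \<sigma>)"

lemma rB_le1: "rB CARD('n) \<sigma> \<le> 1" using ln_2_less_1 by (simp add: rB_def min_def)

lemma rAB: "1 \<le> rA CARD('n) \<sigma>" "0 < rB CARD('n) \<sigma>" using \<sigma>_gt rA_ge1 rB_pos by auto

lemma cY_pos: "0 < cY" unfolding cY_def using rAB p_pos by (intro mult_pos_pos) auto

lemma Y_measurable [measurable]: "Y K L \<in> lmeas" unfolding Y_def[abs_def] by measurable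

text \<open>The moment of order 2 p of an exponential decay of rate 1/W costs W^(2p), the summation
  one more factor and \<open>weight_small\<close> another, which makes W^(2p+2).\<close>

lemma Y_integral:
  "(\<integral>x. Y K L x * w x) \<le> ennreal (cY * W powr (2 * p + 2) * exp (- rB CARD('n) \<sigma> * real L / W)) * (\<Sum>k<K. ennreal (lev k powr p) * S k)"
proof -
  define rb where "rb = rB CARD('n) \<sigma>"
  define c where "c = rA CARD('n) \<sigma> * W * exp (- rb * real L / W)"
  have W: "0 < W" using W_ge1 by linarith
  have c: "0 \<le> c" using rAB W by (simp add: c_def)
  have rb: "0 < rb" "rb \<le> 1" using rAB rB_le1 by (auto simp: rb_def)
  define D where "D = (2 * (2 * p) / (rb / W)) powr (2 * p) * exp 1 * (4 / (rb / W))"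
  let ?E = "\<lambda>k i. {x. ennreal (real (L + i)) < cnt (Lv k) x}"
  have inner: "(\<integral>x. (\<Sum>i. ennreal ((real i + 1) powr (2 * p)) * indicator (?E k i) x) * w x) \<le> ennreal (c * D) * S k" for k
  proof -
    have "(\<integral>x. (\<Sum>i. ennreal ((real i + 1) powr (2 * p)) * indicator (?E k i) x) * w x)
      = (\<integral>x. (\<Sum>i. ennreal ((real i + 1) powr (2 * p)) * (w x * indicator (?E k i) x)))"
      by (intro nn_integral_cong, subst ennreal_suminf_multc[symmetric]) (simp only: mult_ac)
    also have "... = (\<Sum>i. ennreal ((real i + 1) powr (2 * p)) * (\<integral>x. w x * indicator (?E k i) x))"
      by (subst nn_integral_suminf) (auto simp: nn_integral_cmult)
    also have "... \<le> (\<Sum>i. ennreal ((real i + 1) powr (2 * p) * exp (- (rb / W) * real i)) * (ennreal c * S k))"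
    proof (intro suminf_le)
      fix i
      have "rA CARD('n) \<sigma> * W * exp (- rb * real (L + i) / W) = c * exp (- (rb / W) * real i)"
      proof -
        have "- rb * real (L + i) / W = - rb * real L / W + (- (rb / W) * real i)" using W by (simp add: field_simps)
        thus ?thesis by (simp only: c_def exp_add mult.assoc)
      qed
      with level_set_weight[of "L + i" k] have "(\<integral>x. w x * indicator (?E k i) x) \<le> ennreal (c * exp (- (rb / W) * real i)) * S k" unfolding rb_def by simp
      hence "ennreal ((real i + 1) powr (2 * p)) * (\<integral>x. w x * indicator (?E k i) x)
        \<le> ennreal ((real i + 1) powr (2 * p)) * (ennreal (c * exp (- (rb / W) * real i)) * S k)" by (intro mult_left_mono) auto
      also have "... = ennreal ((real i + 1) powr (2 * p) * exp (- (rb / W) * real i)) * (ennreal c * S k)" using c by (simp add: ennreal_mult mult_ac)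
      finally show "ennreal ((real i + 1) powr (2 * p)) * (\<integral>x. w x * indicator (?E k i) x)
        \<le> ennreal ((real i + 1) powr (2 * p) * exp (- (rb / W) * real i)) * (ennreal c * S k)" .
    qed auto
    also have "... = (\<Sum>i. ennreal ((real i + 1) powr (2 * p) * exp (- (rb / W) * real i))) * (ennreal c * S k)" by (rule ennreal_suminf_multc)
    also have "... \<le> ennreal D * (ennreal c * S k)" unfolding D_def using p_pos rb W W_ge1 by (intro mult_right_mono suminf_powr_exp_le) auto
    also have "... = ennreal (c * D) * S k" using c ennreal_mult'[OF c, of D] by (simp add: mult_ac)
    finally show ?thesis .
  qed
  have "(\<integral>x. Y K L x * w x) = (\<integral>x. (\<Sum>k<K. ennreal (lev k powr p) * ((\<Sum>i. ennreal ((real i + 1) powr (2 * p)) * indicator (?E k i) x) * w x)))"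
    unfolding Y_def by (simp only: sum_distrib_right mult.assoc)
  also have "... = (\<Sum>k<K. ennreal (lev k powr p) * (\<integral>x. (\<Sum>i. ennreal ((real i + 1) powr (2 * p)) * indicator (?E k i) x) * w x))"
    by (subst nn_integral_sum) (auto simp: nn_integral_cmult)
  also have "... \<le> (\<Sum>k<K. ennreal (lev k powr p) * (ennreal (c * D) * S k))" by (intro sum_mono mult_left_mono inner) auto
  also have "... = ennreal (c * D) * (\<Sum>k<K. ennreal (lev k powr p) * S k)" by (simp add: sum_distrib_left mult_ac)
  also have "c * D = cY * W powr (2 * p + 2) * exp (- rb * real L / W)"
  using p_pos rb W by (auto simp: powr_mult[symmetric] powr_add power2_eq_square c_def D_def cY_def rb_def mult_ac)
  finally show ?thesis by (simp add: rb_def)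
qed

end

section \<open>The weighted estimate\<close>

text \<open>The support of F is confined to the concentric half of the root, so points outside the
  root see it from a distance; see \<open>trunc_outside\<close>.\<close>

locale tree_cz = tree_weight a s w \<sigma> W "\<lambda>y. enorm (F y)" p G ch + cz_grid a s K A \<eta> T B
  for a :: "real^'n" and s and w :: "real^'n \<Rightarrow> ennreal" and \<sigma> W and F :: "real^'n \<Rightarrow> complex" and p G ch
    and K :: "real^'n \<Rightarrow> real^'n \<Rightarrow> complex" and A \<eta>
    and T :: "(real^'n \<Rightarrow> complex) \<Rightarrow> (real^'n \<Rightarrow> complex) \<Rightarrow> complex" and B +
  assumes F_nice: "nice F"
    and F_supp: "\<And>y. F y \<noteq> 0 \<Longrightarrow> 2 * infnorm (y - ctr root) \<le> rad root"
    and ch_off: "\<And>Q x. x \<in> cell Q \<Longrightarrow> x \<notin> (\<Union>P\<in>ch Q. cell P) \<Longrightarrow> Tdil F Q x \<le> ennreal (cS * av F Q)"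
    and ch_on: "\<And>Q P x. P \<in> ch Q \<Longrightarrow> x \<in> cell P \<Longrightarrow>
      Tdil F Q x \<le> ennreal (cS * av F Q) + Tdil F P x"
begin

abbreviation M :: "real^'n \<Rightarrow> ennreal" where "M \<equiv> MM (\<lambda>y. enorm (F y))"

text \<open>The support lies at distance at least d/2 from x and inside a cube of half side 2 d
  about x, so the size of K and one average suffice; 8 is the quotient of 4 d and d/2.\<close>

lemma trunc_outside:
  assumes x: "x \<notin> cell root"
  shows "max_truncation K F x \<le> ennreal (A * 8^CARD('n)) * M x"
proof -
  define d where "d = infnorm (x - ctr root)"
  let ?I = "\<integral>y. enorm (F y)"
  have [measurable]: "F \<in> lmeas" by (rule nice_measurable[OF F_nice])
  have d: "rad root \<le> d"
  proof -
    obtain i where i: "\<not> (ctr root $ i - rad root \<le> x $ i \<and> x $ i < ctr root $ i + rad root)" using x by (auto simp: mem_cell_coord)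
    have "\<bar>(x - ctr root) $ i\<bar> \<le> d" unfolding d_def by (rule component_le_infnorm_cart)
    thus ?thesis using i by auto
  qed
  have d0: "0 < d" using d rad_pos[of root] by linarith
  have y1: "d / 2 \<le> norm (x - y)" if "F y \<noteq> 0" for y
    using F_supp[OF that] d infnorm_triangle_sub[of x "ctr root" y] infnorm_le_norm[of "x - y"] unfolding d_def by linarith
  have y2: "y \<in> qb x (2 * d)" if "F y \<noteq> 0" for y
    using F_supp[OF that] d d0 infnorm_triangle_sub[of y x "ctr root"] infnorm_sub[of "ctr root" x] unfolding d_def mem_qb by linarith
  have "?I = (\<integral>y\<in>qb x (2 * d). enorm (F y))" using y2 by (intro nn_integral_cong) (auto simp: indicator_def)
  also have "... \<le> M x * ennreal ((2 * (2 * d))^CARD('n))" using d0 by (intro MM_upper) (auto simp: mem_qb infnorm_0)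
  finally have I: "?I \<le> M x * ennreal ((2 * (2 * d))^CARD('n))" .
  show ?thesis unfolding max_truncation_le_iff
  proof (intro allI impI)
    fix t :: real assume "0 < t"
    have "enorm (tr t F x) \<le> (\<integral>y. far t x y * enorm (K x y * F y))" by (rule tr_le_nn)
    also have "... \<le> (\<integral>y. ennreal (A / (d / 2)^CARD('n)) * enorm (F y))"
    proof (rule nn_integral_mono, goal_cases)
      case (1 y)
      show ?case
      proof (cases "F y = 0")
        case False
        have "norm (K x y) \<le> A / norm (x - y)^CARD('n)" using y1[OF False] d0 by (intro size) auto
        also have "... \<le> A / (d / 2)^CARD('n)" using y1[OF False] d0 A_pos by (intro divide_left_mono power_mono mult_pos_pos zero_less_power) auto
        finally have "norm (K x y * F y) \<le> A / (d / 2)^CARD('n) * norm (F y)" unfolding norm_mult by (intro mult_right_mono) auto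
        thus ?thesis using A_pos d0 by (auto simp: ennreal_mult[symmetric] indicator_def intro: ennreal_leI)
      qed simp
    qed
    also have "... = ennreal (A / (d / 2)^CARD('n)) * ?I" by (rule nn_integral_cmult) measurable
    also have "... \<le> ennreal (A / (d / 2)^CARD('n)) * (M x * ennreal ((2 * (2 * d))^CARD('n)))" by (intro mult_left_mono I) auto
    also have "... = ennreal (A / (d / 2)^CARD('n) * (2 * (2 * d))^CARD('n)) * M x" using A_pos d0 by (subst ennreal_mult) (auto simp: mult_ac)
    also have "A / (d / 2)^CARD('n) * (2 * (2 * d))^CARD('n) = A * ((2 * (2 * d)) / (d / 2))^CARD('n)"
      by (simp only: power_divide[of "2 * (2 * d)"] times_divide_eq_left times_divide_eq_right)
    also have "(2 * (2 * d)) / (d / 2) = 8" using d0 by simp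
    finally show "enorm (tr t F x) \<le> ennreal (A * 8^CARD('n)) * M x" .
  qed
qed

text \<open>By the choice of the level, the five-fold dilate contains a point where M is at most
  twice \<open>lev (lv P)\<close>, and that point controls the average over the triple.\<close>

lemma av_le_lev:
  assumes P: "P \<in> subcells" shows "av F P \<le> 2 * 2^CARD('n) * lev (lv P)"
proof -
  obtain y where y: "y \<in> five P" "M y \<le> ennreal (lev (Suc (lv P)))" using lv(2)[OF P] unfolding \<Omega>_def subset_iff mem_Collect_eq not_less[symmetric] by blast
  have sub: "dil P \<subseteq> qb (ctr P) (5 * rad P)"
    using hc_subset_qb[of "ctr P" "3 * rad P"] qb_mono_radius[of "3 * rad P" "5 * rad P" "ctr P"] rad_pos[of P] unfolding dil_def by force
  have "ennreal (av F P * (6 * rad P)^CARD('n)) = (\<integral>y\<in>dil P. enorm (F y))" by (rule av_integral(2)[OF F_nice, symmetric])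
  also have "... \<le> (\<integral>y\<in>qb (ctr P) (5 * rad P). enorm (F y))" by (rule nn_integral_mono_set[OF sub])
  also have "... \<le> M y * ennreal ((2 * (5 * rad P))^CARD('n))" using y(1) by (intro MM_upper) (auto simp: five_def)
  also have "... \<le> ennreal (lev (Suc (lv P))) * ennreal ((2 * (5 * rad P))^CARD('n))" by (intro mult_right_mono y) auto
  also have "... = ennreal (lev (Suc (lv P)) * (2 * (5 * rad P))^CARD('n))" using less_imp_le[OF lev_pos[of "Suc (lv P)"]] by (intro ennreal_mult[symmetric]) auto
  finally have "av F P * (6 * rad P)^CARD('n) \<le> lev (Suc (lv P)) * (2 * (5 * rad P))^CARD('n)"
    using less_imp_le[OF lev_pos[of "Suc (lv P)"]] by (subst (asm) ennreal_le_iff) auto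
  also have "... \<le> lev (Suc (lv P)) * (2 * (6 * rad P))^CARD('n)"
    using less_imp_le[OF lev_pos[of "Suc (lv P)"]] rad_pos[of P] by (intro mult_left_mono power_mono) auto
  also have "(2 * (6 * rad P))^CARD('n) = 2^CARD('n) * (6 * rad P)^CARD('n)" by (rule power_mult_distrib)
  finally have "av F P * (6 * rad P)^CARD('n) \<le> (lev (Suc (lv P)) * 2^CARD('n)) * (6 * rad P)^CARD('n)" by (simp only: mult.assoc)
  hence "av F P \<le> lev (Suc (lv P)) * 2^CARD('n)" by (rule mult_right_le_imp_le) simp
  thus ?thesis by (simp add: lev_def mult_ac)
qed

definition cP :: real where "cP = A * 8^CARD('n) + cS * (2 * 2^CARD('n)) * 6"

lemma cP_pos: "0 < cP" unfolding cP_def using A_pos cS_pos by (intro add_pos_pos mult_pos_pos) auto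

text \<open>Cauchy--Schwarz on each level: \<open>lev k * b = sqrt (lev k) * sqrt (lev k * b^2)\<close>, and the first
  factors sum to a geometric series.\<close>

lemma level_sum_le:
  fixes m :: "nat \<Rightarrow> nat"
  assumes L: "1 \<le> L" and \<zeta>: "0 \<le> \<zeta>"
    and 1: "\<And>k. k < K' \<Longrightarrow> 0 < m k \<Longrightarrow> lev k \<le> \<zeta>"
    and 2: "\<And>k. k < K' \<Longrightarrow> L < m k \<Longrightarrow> lev k * (real (m k - L))\<^sup>2 \<le> \<zeta>"
  shows "(\<Sum>k<K'. lev k * real (m k)) \<le> 6 * real L * \<zeta>"
proof -
  define J where "J = {k\<in>{..<K'}. 0 < m k}"
  have J: "finite J" "\<And>k. k \<in> J \<Longrightarrow> lev k \<le> \<zeta>" using 1 by (auto simp: J_def)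
  have "(\<Sum>k<K'. lev k * real (m k)) = (\<Sum>k\<in>J. lev k * real (m k))" unfolding J_def by (intro sum.mono_neutral_right) auto
  also have "... \<le> (\<Sum>k\<in>J. real L * lev k + sqrt (lev k) * sqrt \<zeta>)"
  proof (rule sum_mono)
    fix k assume k: "k \<in> J"
    have l: "0 < lev k" by (rule lev_pos)
    show "lev k * real (m k) \<le> real L * lev k + sqrt (lev k) * sqrt \<zeta>"
    proof (cases "L < m k")
      case True
      have "sqrt (lev k * (real (m k - L))\<^sup>2) \<le> sqrt \<zeta>" using 2[of k] k True by (simp add: J_def)
      hence "sqrt (lev k) * real (m k - L) \<le> sqrt \<zeta>" by (simp add: real_sqrt_mult)
      hence "sqrt (lev k) * (sqrt (lev k) * real (m k - L)) \<le> sqrt (lev k) * sqrt \<zeta>" using l by (intro mult_left_mono) auto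
      moreover have "sqrt (lev k) * (sqrt (lev k) * real (m k - L)) = lev k * (real (m k) - real L)" using l True by (simp add: mult.assoc[symmetric] of_nat_diff)
      ultimately show ?thesis by (simp add: algebra_simps)
    next
      case False
      hence "lev k * real (m k) \<le> lev k * real L" using l by (intro mult_left_mono) auto
      moreover have "0 \<le> sqrt (lev k) * sqrt \<zeta>" using l \<zeta> by simp
      ultimately show ?thesis by (simp add: mult.commute)
    qed
  qed
  also have "... = real L * (\<Sum>k\<in>J. lev k) + (\<Sum>k\<in>J. sqrt (lev k)) * sqrt \<zeta>" by (simp add: sum.distrib sum_distrib_left sum_distrib_right)
  also have "... \<le> real L * (2 * \<zeta>) + (4 * sqrt \<zeta>) * sqrt \<zeta>"
  proof (intro add_mono mult_left_mono mult_right_mono)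
    show "(\<Sum>k\<in>J. lev k) \<le> 2 * \<zeta>" using geometric_le_top[of l0 2 J \<zeta>] l0_pos J \<zeta> by (simp add: lev_def)
    have sq: "sqrt (lev k) = sqrt l0 * sqrt 2 ^ k" for k by (simp add: lev_def real_sqrt_mult real_sqrt_power)
    have "(\<Sum>k\<in>J. sqrt l0 * sqrt 2 ^ k) \<le> sqrt 2 / (sqrt 2 - 1) * sqrt \<zeta>" using l0_pos J \<zeta> by (intro geometric_le_top) (auto simp: sq[symmetric])
    also have "sqrt 2 / (sqrt 2 - 1) \<le> (4::real)"
    proof -
      have "(4 / 3 :: real) \<le> sqrt 2" by (intro real_le_rsqrt) (simp add: power2_eq_square)
      thus ?thesis by (simp add: pos_divide_le_eq)
    qed
    finally show "(\<Sum>k\<in>J. sqrt (lev k)) \<le> 4 * sqrt \<zeta>" using \<zeta> by (simp add: sq mult_right_mono)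
  qed (use \<zeta> in auto)
  also have "... = 2 * real L * \<zeta> + 4 * \<zeta>" using \<zeta> by simp
  also have "... \<le> 2 * (real L * \<zeta>) + 4 * (real L * \<zeta>)" proof -
    have "1 * \<zeta> \<le> real L * \<zeta>" using L \<zeta> by (intro mult_right_mono) auto
    thus ?thesis unfolding mult.assoc by linarith
  qed
  also have "... = 6 * real L * \<zeta>" by simp
  finally show ?thesis .
qed

text \<open>Everything is measured by one number \<zeta> with \<zeta>^p = Y + M^p: it dominates
  \<open>lev k\<close> whenever a cell of level k on the branch contains x, and also
  \<open>lev k\<close> times the squared excess over L. These are the hypotheses of
  \<open>level_sum_le\<close>.\<close>

lemma trunc_pointwise:
  assumes x: "\<exists>m. x \<notin> Um m root" and L: "1 \<le> L" and K': "G \<le> lev K'"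
  shows "ennreal_powr (max_truncation K F x) p \<le> ennreal ((cP * real L) powr p) * (Y K' L x + ennreal_powr (M x) p)"
proof (cases "Y K' L x = \<infinity>")
  case True
  have "0 < (cP * real L) powr p" using cP_pos L by simp
  hence "ennreal ((cP * real L) powr p) * (Y K' L x + ennreal_powr (M x) p) = \<infinity>" using True by (simp add: ennreal_mult_top)
  thus ?thesis by simp
next
  case False
  have "M x \<noteq> \<infinity>" using MM_g_le[of x] by (auto simp: top_unique)
  then obtain \<mu> where \<mu>: "0 \<le> \<mu>" "M x = ennreal \<mu>" by (cases "M x") auto
  obtain z where z: "0 \<le> z" "Y K' L x = ennreal z" using False by (cases "Y K' L x") auto
  define \<zeta> where "\<zeta> = (z + \<mu> powr p) powr (1 / p)"
  have \<zeta>: "0 \<le> \<zeta>" by (simp add: \<zeta>_def)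
  have \<zeta>p: "\<zeta> powr p = z + \<mu> powr p" using z(1) p_pos by (simp add: \<zeta>_def powr_powr)
  have le\<zeta>: "u \<le> \<zeta>" if "0 \<le> u" "u powr p \<le> z + \<mu> powr p" for u
  proof -
    have "(u powr p) powr (1 / p) \<le> \<zeta>" unfolding \<zeta>_def using that(2) p_pos by (intro powr_mono2) auto
    thus ?thesis using that(1) p_pos by (simp add: powr_powr)
  qed
  have \<mu>\<zeta>: "\<mu> \<le> \<zeta>" using \<mu>(1) z(1) by (intro le\<zeta>) auto
  have main: "max_truncation K F x \<le> ennreal (cP * real L * \<zeta>)"
  proof (cases "x \<in> cell root")
    case False
    have "max_truncation K F x \<le> ennreal (A * 8^CARD('n)) * M x" by (rule trunc_outside[OF False])
    also have "... = ennreal (A * 8^CARD('n) * \<mu>)" using \<mu> A_pos by (simp add: ennreal_mult)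
    also have "... \<le> ennreal (cP * real L * \<zeta>)"
    proof (rule ennreal_leI)
      have "A * 8^CARD('n) \<le> cP" using cS_pos by (simp add: cP_def)
      hence "A * 8^CARD('n) * 1 \<le> cP * real L" using L A_pos cP_pos by (intro mult_mono) auto
      thus "A * 8^CARD('n) * \<mu> \<le> cP * real L * \<zeta>" using \<mu>\<zeta> \<mu>(1) cP_pos by (intro mult_mono[of "A * 8^CARD('n)"]) auto
    qed
    finally show ?thesis .
  next
    case True
    obtain m where "x \<notin> Um m root" using x by blast
    from branch_sum[of "\<lambda>Q. Tdil F Q" "\<lambda>Q. ennreal (cS * av F Q)", OF ch_off ch_on True this]
    obtain S where S: "finite S" "S \<subseteq> {P\<in>descs root. x \<in> cell P}"
      "max_truncation K (loc F (dil root)) x \<le> (\<Sum>P\<in>S. ennreal (cS * av F P))" by blast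
    have Ss: "P \<in> subcells" "P \<in> descs root" "x \<in> cell P" if "P \<in> S" for P using S(2) that descs_sub[of P root] unfolding subcells_def by blast+
    have lF: "loc F (dil root) = F"
    proof
      fix y
      have "y \<in> dil root" if "F y \<noteq> 0" unfolding dil_def hc_def
      proof (intro CollectI allI)
        fix i
        have "\<bar>(y - ctr root) $ i\<bar> \<le> infnorm (y - ctr root)" by (rule component_le_infnorm_cart)
        thus "ctr root $ i - 3 * rad root \<le> y $ i \<and> y $ i < ctr root $ i + 3 * rad root"
          using F_supp[OF that] rad_pos[of root] unfolding vector_minus_component abs_le_iff by linarith
      qed
      thus "loc F (dil root) y = F y" by (cases "F y = 0") (simp_all add: loc_def)
    qed
    define m where "m k = card {P\<in>S. lv P = k}" for k
    have cnt: "ennreal (real (m k)) \<le> cnt (Lv k) x" for k unfolding m_def using S(1) Ss by (intro card_le_cnt) (auto simp: Lv_def)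
    have sum: "(\<Sum>P\<in>S. cS * av F P) \<le> cS * (2 * 2^CARD('n)) * (\<Sum>k<K'. lev k * real (m k))"
    proof -
      have "(\<Sum>P\<in>S. cS * av F P) \<le> (\<Sum>P\<in>S. cS * (2 * 2^CARD('n) * lev (lv P)))" using cS_pos Ss by (intro sum_mono mult_left_mono av_le_lev) auto
      also have "... = cS * (2 * 2^CARD('n)) * (\<Sum>P\<in>S. lev (lv P))" by (simp add: sum_distrib_left mult.assoc)
      also have "(\<Sum>P\<in>S. lev (lv P)) = (\<Sum>k<K'. \<Sum>P\<in>{P\<in>S. lv P = k}. lev (lv P))"
        using S(1) lv(3)[OF Ss(1) K'] by (intro sum.group[symmetric]) auto
      also have "... = (\<Sum>k<K'. lev k * real (m k))" by (intro sum.cong refl) (simp add: m_def mult.commute)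
      finally show ?thesis .
    qed
    have "(\<Sum>k<K'. lev k * real (m k)) \<le> 6 * real L * \<zeta>"
    proof (rule level_sum_le[OF L \<zeta>])
      fix k assume k: "k < K'" "0 < m k"
      then obtain P where P: "P \<in> S" "lv P = k" unfolding m_def card_gt_0_iff by blast
      have "x \<in> \<Omega> k" using Ss[OF P(1)] cell_five[of P] lv(1)[of P] P(2) by blast
      hence "ennreal (lev k) < ennreal \<mu>" unfolding \<Omega>_def \<mu>(2)[symmetric] by simp
      hence "lev k < \<mu>" using less_imp_le[OF lev_pos[of k]] by (simp add: ennreal_less_iff)
      thus "lev k \<le> \<zeta>" using \<mu>\<zeta> by linarith
    next
      fix k assume k: "k < K'" "L < m k"
      \<comment> \<open>With this i the weight (i + 1)^(2p) of the layer sum is the p-th power of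
        the squared excess, and L + i < m k places x in the corresponding level set.\<close>
      define i where "i = m k - L - 1"
      have i: "real i + 1 = real (m k - L)" "L + i < m k" using k(2) by (auto simp: i_def)
      have "ennreal (real (L + i)) < ennreal (real (m k))" using i(2) by (simp add: ennreal_less_iff del: of_nat_add)
      hence ind: "x \<in> {x. ennreal (real (L + i)) < cnt (Lv k) x}" using cnt[of k] by (auto intro: less_le_trans)
      let ?t = "\<lambda>i. ennreal ((real i + 1) powr (2 * p)) * indicator {x. ennreal (real (L + i)) < cnt (Lv k) x} x"
      have "ennreal ((real i + 1) powr (2 * p)) = ?t i" using ind by simp
      also have "... = sum ?t {i}" by (simp only: sum.insert[OF finite.emptyI] sum.empty add_0_right empty_iff not_False_eq_True)
      also have "... \<le> (\<Sum>i. ?t i)" by (rule sum_le_suminf) auto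
      finally have "ennreal (lev k powr p) * ennreal ((real i + 1) powr (2 * p)) \<le> ennreal (lev k powr p) * (\<Sum>i. ?t i)" by (rule mult_left_mono) simp
      also have "... \<le> Y K' L x"
        unfolding Y_def using k(1) by (intro member_le_sum[where f="\<lambda>k. ennreal (lev k powr p) * (\<Sum>i. ennreal ((real i + 1) powr (2 * p)) * indicator {x. ennreal (real (L + i)) < cnt (Lv k) x} x)"]) auto
      finally have "lev k powr p * (real i + 1) powr (2 * p) \<le> z" unfolding z(2) using z(1) by (simp add: ennreal_mult[symmetric] ennreal_le_iff)
      moreover have "lev k powr p * (real i + 1) powr (2 * p) = (lev k * (real i + 1)\<^sup>2) powr p" by (simp add: powr_mult powr_powr[symmetric])
      ultimately have "(lev k * (real i + 1)\<^sup>2) powr p \<le> z + \<mu> powr p" using powr_ge_zero[of \<mu> p] by linarith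
      thus "lev k * (real (m k - L))\<^sup>2 \<le> \<zeta>" unfolding i(1) using less_imp_le[OF lev_pos[of k]] by (intro le\<zeta>) auto
    qed
    hence "cS * (2 * 2^CARD('n)) * (\<Sum>k<K'. lev k * real (m k)) \<le> cS * (2 * 2^CARD('n)) * (6 * real L * \<zeta>)" using cS_pos by (intro mult_left_mono) auto
    also have "... = cS * (2 * 2^CARD('n)) * 6 * (real L * \<zeta>)" by simp
    also have "... \<le> cP * (real L * \<zeta>)" using A_pos \<zeta> by (intro mult_right_mono) (auto simp: cP_def)
    finally have "(\<Sum>P\<in>S. cS * av F P) \<le> cP * real L * \<zeta>" using sum by (simp add: mult.assoc)
    moreover have "max_truncation K F x \<le> ennreal (\<Sum>P\<in>S. cS * av F P)"
      using S(3) cS_pos av_integral(1)[OF F_nice] unfolding lF by (subst sum_ennreal[symmetric]) auto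
    ultimately show ?thesis by (meson ennreal_leI order_trans)
  qed
  obtain u where u: "0 \<le> u" "max_truncation K F x = ennreal u" "u \<le> cP * real L * \<zeta>"
    using main cP_pos \<zeta> by (cases "max_truncation K F x") (auto simp: top_unique ennreal_le_iff)
  have "ennreal_powr (max_truncation K F x) p = ennreal (u powr p)" using u by (simp add: ennreal_powr_def)
  also have "... \<le> ennreal ((cP * real L * \<zeta>) powr p)" using u p_pos by (intro ennreal_leI powr_mono2) auto
  also have "(cP * real L * \<zeta>) powr p = (cP * real L) powr p * (z + \<mu> powr p)" unfolding \<zeta>p[symmetric] by (rule powr_mult)
  also have "ennreal ... = ennreal ((cP * real L) powr p) * (Y K' L x + ennreal_powr (M x) p)" using z \<mu> by (simp add: ennreal_mult ennreal_powr_def)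
  finally show ?thesis .
qed

text \<open>The absolute value gives a nonnegative constant without examining the sign of
  \<open>sC\<close>.\<close>

definition sK :: real where "sK = \<bar>sC CARD('n) p \<sigma>\<bar>"

lemma sK_nonneg: "0 \<le> sK" by (simp add: sK_def)

lemma Whitney_sum_le': "(\<Sum>k<k'. ennreal (lev k powr p) * S k) \<le> ennreal (sK * W\<^sup>2) * Nrm"
  by (rule order_trans[OF Whitney_sum_le]) (auto simp: sK_def intro!: mult_right_mono ennreal_leI)

definition cN :: real where "cN = 1 + cY * sK"
definition cW :: real where "cW = (2 * p + 4) / rB CARD('n) \<sigma> + 2"

lemma trunc_norm_le:
  "(\<integral>x. ennreal_powr (max_truncation K F x) p * w x)
    \<le> ennreal ((cP * (cW * (W * (1 + ln W)))) powr p * cN) * Nrm"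
proof -
  define rb where "rb = rB CARD('n) \<sigma>"
  \<comment> \<open>This size makes exp(-rb L / W) at most W^(-2p-4), which pays for W^(2p+2) from
    \<open>Y_integral\<close> and W^2 from Sawyer's inequality; the added 1 covers W = 1, where the
    logarithm vanishes.\<close>
  define L where "L = nat \<lceil>(2 * p + 4) / rb * (W * ln W)\<rceil> + 1"
  have W: "0 < W" "0 \<le> ln W" using W_ge1 by auto
  have rb: "0 < rb" using rAB by (simp add: rb_def)
  have b0: "0 \<le> (2 * p + 4) / rb * (W * ln W)" using W rb p_pos by simp
  have L1: "1 \<le> L" by (simp add: L_def)
  have Lge: "(2 * p + 4) / rb * (W * ln W) \<le> real L" unfolding L_def using b0 by linarith
  have Lle: "real L \<le> cW * (W * (1 + ln W))"
  proof -
    have "real L \<le> (2 * p + 4) / rb * (W * ln W) + 2" unfolding L_def using b0 by linarith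
    also have "... \<le> (2 * p + 4) / rb * (W * (1 + ln W)) + 2 * (W * (1 + ln W))"
    proof (intro add_mono mult_left_mono)
      have "1 * 1 \<le> W * (1 + ln W)" using W_ge1 W by (intro mult_mono) auto
      thus "2 \<le> 2 * (W * (1 + ln W))" by simp
    qed (use W rb p_pos in auto)
    finally show ?thesis by (simp add: cW_def rb_def distrib_right)
  qed
  obtain K' where "G / l0 < 2^K'" using real_arch_pow[of 2] by auto
  hence K': "G \<le> lev K'" using l0_pos by (simp add: lev_def field_simps)
  have Yb: "(\<integral>x. Y K' L x * w x) \<le> ennreal (cY * sK) * Nrm"
  proof -
    define e where "e = W powr (2 * p + 2) * exp (- rb * real L / W)"
    have e0: "0 \<le> e" by (simp add: e_def)
    have e1: "e * W\<^sup>2 \<le> 1"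
    proof -
      have "W\<^sup>2 = W powr 2" using W by (simp add: powr_numeral)
      hence "e * W\<^sup>2 = W powr (2 * p + 4) * exp (- rb * real L / W)" using W powr_add[of W "2 * p + 2" 2] by (simp add: e_def mult_ac add.assoc)
      also have "... = exp ((2 * p + 4) * ln W - rb * real L / W)" using W by (simp add: powr_def exp_add[symmetric])
      also have "... \<le> exp 0"
      proof (subst exp_le_cancel_iff)
        have "(2 * p + 4) * (W * ln W) \<le> rb * real L" using Lge rb by (simp add: field_simps)
        thus "(2 * p + 4) * ln W - rb * real L / W \<le> 0" using W by (simp add: field_simps)
      qed
      finally show ?thesis by simp
    qed
    have "(\<integral>x. Y K' L x * w x) \<le> ennreal (cY * e) * (\<Sum>k<K'. ennreal (lev k powr p) * S k)"
      using Y_integral[of K' L] by (simp add: e_def rb_def mult.assoc)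
    also have "... \<le> ennreal (cY * e) * (ennreal (sK * W\<^sup>2) * Nrm)" by (intro mult_left_mono Whitney_sum_le') simp
    also have "... = ennreal (cY * e * (sK * W\<^sup>2)) * Nrm" using cY_pos e0 sK_nonneg by (subst ennreal_mult) (auto simp: mult.assoc)
    also have "... \<le> ennreal (cY * sK) * Nrm"
    proof (intro mult_right_mono ennreal_leI)
      have "cY * e * (sK * W\<^sup>2) = cY * sK * (e * W\<^sup>2)" by (simp add: mult_ac)
      also have "... \<le> cY * sK * 1" using cY_pos sK_nonneg by (intro mult_left_mono e1) auto
      finally show "cY * e * (sK * W\<^sup>2) \<le> cY * sK" by simp
    qed simp
    finally show ?thesis .
  qed
  have [measurable]: "F \<in> lmeas" by (rule nice_measurable[OF F_nice])
  have "(\<integral>x. ennreal_powr (max_truncation K F x) p * w x)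
    \<le> (\<integral>x. ennreal ((cP * real L) powr p) * (Y K' L x * w x + ennreal_powr (M x) p * w x))"
  \<comment> \<open>Points on infinite branches of the tree form a null set and are
    discarded.\<close>
  proof (rule nn_integral_mono_AE)
    show "AE x in lebesgue. ennreal_powr (max_truncation K F x) p * w x \<le> ennreal ((cP * real L) powr p) * (Y K' L x * w x + ennreal_powr (M x) p * w x)"
      using Um_null[of root]
    proof eventually_elim
      case (elim x)
      have "ennreal_powr (max_truncation K F x) p * w x \<le> ennreal ((cP * real L) powr p) * (Y K' L x + ennreal_powr (M x) p) * w x"
        by (intro mult_right_mono trunc_pointwise elim L1 K') simp
      thus ?case by (simp add: mult.assoc distrib_right)
    qed
  qed
  also have "... = ennreal ((cP * real L) powr p) * ((\<integral>x. Y K' L x * w x) + Nrm)" unfolding Nrm_def by (subst nn_integral_cmult; (subst nn_integral_add)?; simp)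
  also have "... \<le> ennreal ((cP * real L) powr p) * (ennreal (cY * sK) * Nrm + Nrm)" by (intro mult_left_mono add_right_mono Yb) simp
  also have "ennreal (cY * sK) * Nrm + Nrm = ennreal cN * Nrm" using cY_pos sK_nonneg by (simp add: cN_def distrib_right add.commute)
  also have "ennreal ((cP * real L) powr p) * (ennreal cN * Nrm) \<le> ennreal ((cP * (cW * (W * (1 + ln W)))) powr p) * (ennreal cN * Nrm)"
    using Lle cP_pos p_pos by (intro mult_right_mono ennreal_leI powr_mono2 mult_left_mono) auto
  finally show ?thesis by (simp add: ennreal_mult' mult.assoc)
qed

end

section \<open>From the weight class to the abstract hypotheses\<close>

lemma ennreal_powr_mono: "x \<le> y \<Longrightarrow> 0 < p \<Longrightarrow> ennreal_powr x p \<le> ennreal_powr y p"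
  by (cases x; cases y) (auto simp: ennreal_powr_def ennreal_le_iff top_unique intro!: ennreal_leI powr_mono2)

lemma ennreal_powr_ennreal: "0 \<le> x \<Longrightarrow> ennreal_powr (ennreal x) p = ennreal (x powr p)" by (simp add: ennreal_powr_def)

lemma ennreal_powr_cmult:
  assumes "0 < a" shows "ennreal_powr (ennreal a * X) p = ennreal (a powr p) * ennreal_powr X p"
proof (cases X)
  case (real x)
  hence "ennreal a * X = ennreal (a * x)" using assms by (simp add: ennreal_mult)
  thus ?thesis using real assms unfolding real by (simp add: ennreal_powr_ennreal powr_mult ennreal_mult[symmetric])
next
  case top
  thus ?thesis using assms by (simp add: ennreal_powr_def ennreal_mult_top)
qed

text \<open>Local integrability gives measurability on each ball, and the weight is the limit of its
  restrictions.\<close>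

lemma weight_measurable:
  fixes w :: "real^'n \<Rightarrow> real"
  assumes "weight w" shows "w \<in> lmeas"
proof (rule borel_measurable_LIMSEQ_real)
  fix k :: nat
  have "set_integrable lebesgue (cball 0 (real k)) w" using assms by (simp add: weight_def)
  thus "(\<lambda>x. indicator (cball 0 (real k)) x *\<^sub>R w x) \<in> lmeas" unfolding set_integrable_def by (rule borel_measurable_integrable)
next
  fix x :: "real^'n"
  obtain N :: nat where N: "norm x \<le> real N" using real_arch_simple by blast
  have "\<forall>\<^sub>F k in sequentially. indicator (cball 0 (real k)) x *\<^sub>R w x = w x" using eventually_ge_at_top[of N] by eventually_elim (use N in auto)
  thus "(\<lambda>k. indicator (cball 0 (real k)) x *\<^sub>R w x) \<longlonglongrightarrow> w x" by (rule tendsto_eventually)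
qed

text \<open>If a cube of half side r' through y meets \<open>qb c r\<close>, then m \<le> 4 max(r,
  r'), while the intersection has at most the volume belonging to the half side min(r, r'); the
  product of minimum and maximum is r r'.\<close>

lemma MM_indicator_le:
  fixes c :: "real^'n"
  assumes r: "0 < r"
  shows "MM (indicator (qb c r)) y \<le> ennreal (4^CARD('n) * kap CARD('n) c r y)"
  unfolding MM_le_iff
proof (intro allI impI)
  fix c' :: "real^'n" and r' assume r': "0 < r'" and y: "y \<in> qb c' r'"
  define m where "m = max r (infnorm (y - c))"
  have m: "0 < m" "r \<le> m" using r by (auto simp: m_def)
  have kap: "kap CARD('n) c r y = (r / m)^CARD('n)" using r m by (simp add: kap_def m_def[symmetric] powr_realpow)
  have eq: "ennreal (4^CARD('n) * kap CARD('n) c r y) * ennreal ((2 * r')^CARD('n)) = ennreal ((4 * (r / m) * (2 * r'))^CARD('n))"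
    unfolding kap using r r' m by (subst ennreal_mult[symmetric]) (auto simp: power_mult_distrib[symmetric])
  show "(\<integral>z\<in>qb c' r'. indicator (qb c r) z) \<le> ennreal (4^CARD('n) * kap CARD('n) c r y) * ennreal ((2 * r')^CARD('n))"
  proof (cases "qb c r \<inter> qb c' r' = {}")
    case True
    hence "(\<integral>z\<in>qb c' r'. indicator (qb c r) z) = (\<integral>(z::real^'n). 0)" by (intro nn_integral_cong) (auto simp: indicator_def)
    thus ?thesis by simp
  next
    case False
    then obtain z where z: "z \<in> qb c r" "z \<in> qb c' r'" by blast
    have "infnorm (y - c) \<le> infnorm (y - c') + infnorm (c' - z) + infnorm (z - c)" using infnorm_triangle_sub[of y c z] infnorm_triangle_sub[of y z c'] by linarith
    hence "infnorm (y - c) \<le> 2 * r' + r" using y z infnorm_sub[of c' z] unfolding mem_qb by linarith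
    hence m4: "m \<le> 4 * max r r'" using r r' unfolding m_def by (simp add: max_def)
    have min: "min r r' \<le> 4 * (r / m) * r'"
    proof -
      have "min r r' * m \<le> min r r' * (4 * max r r')" using r r' by (intro mult_left_mono m4) auto
      also have "... = 4 * r * r'" by (simp add: min_def max_def)
      finally show ?thesis using m by (simp add: field_simps)
    qed
    have "(\<integral>z\<in>qb c' r'. indicator (qb c r) z) = (\<integral>z. indicator (qb c r \<inter> qb c' r') z)"
      by (intro nn_integral_cong) (auto simp: indicator_def)
    also have "... = vol (qb c r \<inter> qb c' r')" by (subst nn_integral_indicator) auto
    also have "... \<le> min (vol (qb c r)) (vol (qb c' r'))" by (intro min.boundedI emeasure_mono) auto
    also have "... \<le> ennreal ((2 * min r r')^CARD('n))" using r r' by (simp add: emeasure_qb min_def)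
    also have "... \<le> ennreal ((4 * (r / m) * (2 * r'))^CARD('n))" using min r r' m by (intro ennreal_leI power_mono) auto
    finally show ?thesis unfolding eq .
  qed
qed

lemma HL_max_indicator: "HL_max (indicator Q :: real^'n \<Rightarrow> real) y = MM (indicator Q) y"
  unfolding HL_max_eq_MM by (rule arg_cong[where f="\<lambda>h. MM h y"]) (auto simp: indicator_def)

lemma Cq_tail_le:
  fixes c :: "real^'n" and w :: "real^'n \<Rightarrow> real" and r q :: real
  assumes r: "0 < r" and q: "0 < q" and [measurable]: "w \<in> lmeas"
  shows "Cq_tail q w (qb c r) \<le> ennreal (4 powr (CARD('n) * q)) * kint (CARD('n) * q) (\<lambda>x. ennreal (w x)) c r"
proof -
  have "ennreal_powr (HL_max (indicator (qb c r) :: real^'n \<Rightarrow> real) y) q * ennreal (w y)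
    \<le> ennreal (4 powr (CARD('n) * q)) * (ennreal (w y) * ennreal (kap (CARD('n) * q) c r y))" for y
  proof -
    have "ennreal_powr (HL_max (indicator (qb c r) :: real^'n \<Rightarrow> real) y) q \<le> ennreal_powr (ennreal (4^CARD('n) * kap CARD('n) c r y)) q"
      unfolding HL_max_indicator by (intro ennreal_powr_mono MM_indicator_le r q)
    also have "... = ennreal ((4^CARD('n) * kap CARD('n) c r y) powr q)" by (simp add: ennreal_powr_ennreal)
    also have "(4^CARD('n) * kap CARD('n) c r y) powr q = 4 powr (CARD('n) * q) * kap (CARD('n) * q) c r y"
      by (simp add: powr_mult kap_def powr_powr powr_realpow[symmetric])
    finally have "ennreal_powr (HL_max (indicator (qb c r) :: real^'n \<Rightarrow> real) y) q * ennreal (w y)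
      \<le> ennreal (4 powr (CARD('n) * q) * kap (CARD('n) * q) c r y) * ennreal (w y)" by (rule mult_right_mono) simp
    thus ?thesis by (simp add: ennreal_mult mult_ac)
  qed
  hence "Cq_tail q w (qb c r) \<le> (\<integral>y. ennreal (4 powr (CARD('n) * q)) * (ennreal (w y) * ennreal (kap (CARD('n) * q) c r y)))"
    unfolding Cq_tail_def by (rule nn_integral_mono)
  also have "... = ennreal (4 powr (CARD('n) * q)) * kint (CARD('n) * q) (\<lambda>x. ennreal (w x)) c r" unfolding kint_def by (rule nn_integral_cmult) measurable
  finally show ?thesis .
qed

lemma MM_ge_kap:
  fixes c :: "real^'n"
  assumes \<rho>: "0 < \<rho>" and supp: "\<And>z. z \<notin> qb c \<rho> \<Longrightarrow> g z = 0"
  shows "(\<integral>z. g z) * ennreal (kap CARD('n) c \<rho> y) \<le> MM g y * ennreal ((2 * \<rho>)^CARD('n))"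
proof -
  define m where "m = max \<rho> (infnorm (y - c))"
  have m: "0 < m" "\<rho> \<le> m" using \<rho> by (auto simp: m_def)
  have "(\<integral>z. g z) = (\<integral>z\<in>qb c m. g z)" using supp qb_mono_radius[OF m(2), of c] by (intro nn_integral_cong) (auto simp: indicator_def)
  also have "... \<le> MM g y * ennreal ((2 * m)^CARD('n))" using m by (intro MM_upper) (auto simp: mem_qb m_def)
  finally have "(\<integral>z. g z) * ennreal (kap CARD('n) c \<rho> y) \<le> MM g y * ennreal ((2 * m)^CARD('n)) * ennreal (kap CARD('n) c \<rho> y)"
    by (rule mult_right_mono) simp
  also have "... = MM g y * ennreal ((2 * m)^CARD('n) * kap CARD('n) c \<rho> y)" using m by (simp add: ennreal_mult mult.assoc)
  also have "(2 * m)^CARD('n) * kap CARD('n) c \<rho> y = (2 * \<rho>)^CARD('n)"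
    using \<rho> m by (simp add: kap_def m_def[symmetric] powr_realpow power_divide power_mult_distrib)
  finally show ?thesis .
qed

text \<open>Finiteness of \<open>M f\<close> in \<open>L^p(w)\<close> forces the weighted tails of every cube to be finite, because
  \<open>M f\<close> decays no faster than \<open>M\<close> of an indicator.\<close>

lemma kint_finite_of_MM:
  fixes g :: "real^'n \<Rightarrow> ennreal" and p q :: real
  assumes r: "0 < r" and p: "0 < p" "p \<le> q" and R: "0 < R" "\<And>y. g y \<noteq> 0 \<Longrightarrow> infnorm y \<le> R"
    and g: "0 < (\<integral>y. g y)" and [measurable]: "w \<in> lmeas"
    and fin: "(\<integral>x. ennreal_powr (MM g x) p * w x) < \<infinity>"
  shows "kint (CARD('n) * q) w c r < \<infinity>"
proof -
  define \<rho> where "\<rho> = max r (R + infnorm c)"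
  have \<rho>: "0 < \<rho>" "r \<le> \<rho>" using r by (auto simp: \<rho>_def)
  have supp: "g z = 0" if "z \<notin> qb c \<rho>" for z
  proof (rule ccontr)
    assume "g z \<noteq> 0"
    hence "infnorm z \<le> R" by (rule R)
    moreover have "infnorm (z - c) \<le> infnorm z + infnorm c" using infnorm_triangle[of z "- c"] by (simp add: infnorm_neg)
    ultimately show False using that by (simp add: mem_qb \<rho>_def)
  qed
  obtain b where b: "0 < b" "ennreal b \<le> (\<integral>y. g y)"
  proof (cases "\<integral>y. g y")
    case (real u) thus ?thesis using g that[of u] by auto
  next
    case top thus ?thesis using that[of 1] by simp
  qed
  define e where "e = b / (2 * \<rho>)^CARD('n)"
  have e: "0 < e" using b \<rho> by (simp add: e_def)
  have n0: "0 < real CARD('n)" using zero_less_card_finite[where 'a='n] by simp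
  have pt: "ennreal (e powr p) * ennreal (kap (CARD('n) * q) c r y) \<le> ennreal_powr (MM g y) p" for y
  proof -
    have "ennreal b * ennreal (kap CARD('n) c \<rho> y) \<le> MM g y * ennreal ((2 * \<rho>)^CARD('n))"
      using MM_ge_kap[of \<rho> c g y] \<rho>(1) supp by (intro order_trans[OF mult_right_mono[OF b(2)]]) auto
    moreover have "ennreal b * ennreal (kap CARD('n) c \<rho> y) = ennreal (e * kap CARD('n) c \<rho> y) * ennreal ((2 * \<rho>)^CARD('n))"
      using b \<rho> by (simp add: ennreal_mult[symmetric] e_def)
    ultimately have "ennreal (e * kap CARD('n) c \<rho> y) \<le> MM g y" using \<rho> ennreal_mult_right_cancel[of "(2 * \<rho>)^CARD('n)"] by simp
    hence 1: "ennreal ((e * kap CARD('n) c \<rho> y) powr p) \<le> ennreal_powr (MM g y) p" using e p by (intro ennreal_powr_ge) auto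
    have "kap (CARD('n) * q) c r y \<le> kap (CARD('n) * q) c \<rho> y" using r \<rho> p by (intro kap_mono) (auto simp: infnorm_0)
    also have "... \<le> kap CARD('n) c \<rho> y powr p" unfolding kap_def powr_powr using \<rho> p n0 by (intro powr_mono') auto
    finally have "e powr p * kap (CARD('n) * q) c r y \<le> (e * kap CARD('n) c \<rho> y) powr p" using e by (simp add: powr_mult mult_left_mono)
    hence "ennreal (e powr p * kap (CARD('n) * q) c r y) \<le> ennreal ((e * kap CARD('n) c \<rho> y) powr p)" by (rule ennreal_leI)
    thus ?thesis using order_trans[OF _ 1] by (simp add: ennreal_mult)
  qed
  have "ennreal (e powr p) * kint (CARD('n) * q) w c r = (\<integral>y. ennreal (e powr p) * ennreal (kap (CARD('n) * q) c r y) * w y)"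
    unfolding kint_def by (subst nn_integral_cmult[symmetric]) (auto simp: mult_ac)
  also have "... \<le> (\<integral>x. ennreal_powr (MM g x) p * w x)" by (intro nn_integral_mono mult_right_mono pt) simp
  also note fin
  finally have "ennreal (e powr p) * kint (CARD('n) * q) w c r < \<infinity>" .
  thus ?thesis using e by (auto simp: ennreal_mult_less_top)
qed

text \<open>Passes from Bochner integrals to extended ones, the form in which the L2 bound is used
  above.\<close>

lemma CZ_operator_locale:
  fixes K :: "real^'n \<Rightarrow> real^'n \<Rightarrow> complex"
  assumes "CZ_operator K T"
  shows "\<exists>A \<eta> B. cz_operator K A \<eta> T B"
proof -
  obtain A \<eta> where K: "A > 0" "\<eta> > 0"
    "\<And>x y. x \<noteq> y \<Longrightarrow> norm (K x y) \<le> A / norm (x - y) ^ CARD('n)"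
    "\<And>x x' y. x \<noteq> y \<Longrightarrow> 2 * norm (x - x') \<le> norm (x - y) \<Longrightarrow>
        norm (K x y - K x' y) \<le> A * norm (x - x') powr \<eta> / norm (x - y) powr (real CARD('n) + \<eta>)"
    "\<And>x y y'. x \<noteq> y \<Longrightarrow> 2 * norm (y - y') \<le> norm (x - y) \<Longrightarrow>
        norm (K x y - K x y') \<le> A * norm (y - y') powr \<eta> / norm (x - y) powr (real CARD('n) + \<eta>)"
    using conjunct1[OF assms[unfolded CZ_operator_def]] unfolding CZ_kernel_def by metis
  obtain B where B: "\<And>f. f \<in> schwartz \<Longrightarrow> \<exists>g. g \<in> lmeas \<and>
     integrable lebesgue (\<lambda>x. (norm (g x))\<^sup>2) \<and> (\<forall>\<phi>\<in>schwartz. T f \<phi> = (LINT x|lebesgue. g x * \<phi> x)) \<and>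
     sqrt (LINT x|lebesgue. (norm (g x))\<^sup>2) \<le> B * sqrt (LINT x|lebesgue. (norm (f x))\<^sup>2)" using assms unfolding CZ_operator_def bounded_on_L2_def by blast
  have "cz_operator K A \<eta> T B"
  proof unfold_locales
    fix f :: "real^'n \<Rightarrow> complex" assume f: "f \<in> test_functions"
    obtain g where g: "g \<in> lmeas" "integrable lebesgue (\<lambda>x. (norm (g x))\<^sup>2)"
      "\<forall>\<phi>\<in>schwartz. T f \<phi> = (LINT x|lebesgue. g x * \<phi> x)"
      "sqrt (LINT x|lebesgue. (norm (g x))\<^sup>2) \<le> B * sqrt (LINT x|lebesgue. (norm (f x))\<^sup>2)" using B[OF test_functions_schwartz[OF f]] by blast
    let ?If = "LINT x|lebesgue. (norm (f x))\<^sup>2" and ?Ig = "LINT x|lebesgue. (norm (g x))\<^sup>2"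
    have nf: "nice f" by (rule test_function_nice[OF f])
    have "integrable lebesgue (\<lambda>x. f x * f x)" using nf nice_measurable[OF nf] nice_def nice_integrable nice_mult_bounded[OF nf] by metis
    hence fi: "integrable lebesgue (\<lambda>x. (norm (f x))\<^sup>2)"
      using integrable_norm[of lebesgue "\<lambda>x. f x * f x"] by (simp add: norm_mult power2_eq_square)
    have "0 \<le> ?Ig" "0 \<le> ?If" by (intro Bochner_Integration.integral_nonneg; simp)+
    hence "?Ig \<le> B\<^sup>2 * ?If" using power_mono[OF g(4), of 2] by (simp add: power_mult_distrib)
    hence "ennreal ?Ig \<le> ennreal (B\<^sup>2) * ennreal ?If" by (metis ennreal_leI ennreal_mult' zero_le_power2)
    hence "(\<integral>x. ennreal ((norm (g x))\<^sup>2)) \<le> ennreal (B\<^sup>2) * (\<integral>x. ennreal ((norm (f x))\<^sup>2))"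
      by (simp add: nn_integral_eq_integral[OF g(2)] nn_integral_eq_integral[OF fi])
    thus "\<exists>g. g \<in> lmeas \<and> (\<forall>\<phi>\<in>schwartz. T f \<phi> = (LINT x|lebesgue. g x * \<phi> x)) \<and>
      (\<integral>x. ennreal ((norm (g x))\<^sup>2)) \<le> ennreal (B\<^sup>2) * (\<integral>x. ennreal ((norm (f x))\<^sup>2))" using g by blast
  qed (use K assms in \<open>auto simp: CZ_operator_def\<close>)
  thus ?thesis by blast
qed

text \<open>The constants are written out because their names belong to contexts that mention w and
  F; in this form it is visible that only the operator, the dimension, the exponents and W
  enter.\<close>

lemma (in cz_operator) weighted_bound:
  fixes w :: "real^'n \<Rightarrow> ennreal" and p q :: real
  assumes p: "1 < p" "p < q" and wt: "Cq_weight w (CARD('n) * q) W"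
    and F: "F \<in> test_functions" and F0: "0 < (\<integral>y. enorm (F y))"
    and \<sigma>: "\<sigma> = CARD('n) * q"
  shows "(\<integral>x. ennreal_powr (max_truncation K F x) p * w x)
    \<le> ennreal (((A * 8^CARD('n) + cS * (2 * 2^CARD('n)) * 6) * (((2 * p + 4) / rB CARD('n) \<sigma> + 2) * (W * (1 + ln W)))) powr p
        * (1 + rA CARD('n) \<sigma> * (4 * p / rB CARD('n) \<sigma>) powr (2 * p) * exp 1 * (4 / rB CARD('n) \<sigma>) * \<bar>sC CARD('n) p \<sigma>\<bar>))
      * (\<integral>x. ennreal_powr (MM (\<lambda>y. enorm (F y)) x) p * w x)"
proof -
  interpret Cq_weight w "CARD('n) * q" W by (rule wt)
  have nF: "nice F" by (rule test_function_nice[OF F])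
  obtain M R where MR: "0 < M" "0 < R" "\<And>x. norm (F x) \<le> M" "\<And>x. R < norm x \<Longrightarrow> F x = 0" using nice_bounds[OF nF] by blast
  \<comment> \<open>The root is the cube of half side 2 R about the origin, twice the size of a cube
    containing the support, as \<open>F_supp\<close> demands.\<close>
  define a :: "real^'n" where "a = (\<chi> i. - (2 * R))"
  define s where "s = 4 * R"
  interpret cz_grid a s K A \<eta> T B by unfold_locales (use MR in \<open>simp add: s_def\<close>)
  have rt: "ctr root = 0" "rad root = 2 * R" unfolding ctr_def rad_def unfolding a_def s_def by (simp_all add: vec_eq_iff)
  have Fi: "infnorm y \<le> R" if "F y \<noteq> 0" for y using MR(4)[of y] that infnorm_le_norm[of y] by force
  \<comment> \<open>Children are chosen for every cell of the grid at once, which makes the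
    tree.\<close>
  obtain ch where ch: "\<And>Q. (\<forall>P\<in>ch Q. cell P \<subseteq> cell Q) \<and> disjoint_family_on cell (ch Q) \<and>
    2 * vol (\<Union>P\<in>ch Q. cell P) \<le> vol (cell Q) \<and>
    (\<forall>x\<in>cell Q. x \<notin> (\<Union>P\<in>ch Q. cell P) \<longrightarrow> Tdil F Q x \<le> ennreal (cS * av F Q)) \<and>
    (\<forall>P\<in>ch Q. \<forall>x\<in>cell P. Tdil F Q x \<le> ennreal (cS * av F Q) + Tdil F P x)" using sparse_step[OF F] by metis
  interpret tree_cz a s w "CARD('n) * q" W F p M ch K A \<eta> T B
  proof unfold_locales
    show "(\<lambda>y. enorm (F y)) \<in> lmeas" using nice_measurable[OF nF] by measurable
    fix y assume y: "y \<notin> cell root"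
    show "enorm (F y) = 0"
    proof (rule ccontr)
      assume "enorm (F y) \<noteq> 0"
      hence "infnorm y \<le> R" by (intro Fi) auto
      moreover have "\<bar>y $ i\<bar> \<le> infnorm y" for i by (rule component_le_infnorm_cart)
      ultimately have "- (2 * R) \<le> y $ i \<and> y $ i < 2 * R" for i using MR(2) by (smt (verit, best))
      thus False using y unfolding cell_hc rt by (simp add: hc_def)
    qed
  next
    show "real CARD('n) * p < real CARD('n) * q" using p zero_less_card_finite[where 'a='n] by simp
  qed (use p F0 nF Fi MR(3) ch rt in \<open>auto simp: ennreal_leI\<close>)
  show ?thesis using trunc_norm_le unfolding cP_def cW_def cN_def cY_def sK_def Nrm_def \<sigma> by (simp only: mult.assoc)
qed

theorem theorem1p2:
  fixes K :: "real^'n \<Rightarrow> real^'n \<Rightarrow> complex"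
    and T :: "(real^'n \<Rightarrow> complex) \<Rightarrow> (real^'n \<Rightarrow> complex) \<Rightarrow> complex"
    and p q :: real
  assumes "CZ_operator K T" and "1 < p" and "p < q"
  shows "\<exists>c::real. c > 0 \<and>
    (\<forall>w f. w \<in> Cq_class q \<longrightarrow> \<not> (AE x in lebesgue. w x = 0) \<longrightarrow> f \<in> test_functions \<longrightarrow>
      Lp_norm p w (max_truncation K f)
        \<le> ennreal c * (Cq_const q w + 1) * ennreal_ln (ennreal (exp 1) + Cq_const q w)
            * Lp_norm p w (HL_max f))"
proof -
  obtain A \<eta> B where "cz_operator K A \<eta> T B" using CZ_operator_locale[OF assms(1)] by blast
  then interpret cz_operator K A \<eta> T B .
  have p: "0 < p" "1 < p" "p < q" "1 < q" using assms by auto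
  define \<sigma> where "\<sigma> = real CARD('n) * q"
  have n1: "0 < real CARD('n)" using zero_less_card_finite[where 'a='n] by simp
  have \<sigma>: "real CARD('n) < \<sigma>" using p n1 by (simp add: \<sigma>_def)
  have \<sigma>0: "0 < \<sigma>" using \<sigma> n1 by linarith
  define kP where "kP = A * 8^CARD('n) + cS * (2 * 2^CARD('n)) * 6"
  define kW where "kW = (2 * p + 4) / rB CARD('n) \<sigma> + 2"
  define kN where "kN = 1 + rA CARD('n) \<sigma> * (4 * p / rB CARD('n) \<sigma>) powr (2 * p) * exp 1 * (4 / rB CARD('n) \<sigma>) * \<bar>sC CARD('n) p \<sigma>\<bar>"
  have rr: "1 \<le> rA CARD('n) \<sigma>" "0 < rB CARD('n) \<sigma>" using \<sigma> rA_ge1 rB_pos by auto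
  have kP: "0 < kP" unfolding kP_def using A_pos cS_pos by (intro add_pos_pos mult_pos_pos) auto
  have kW: "0 < kW" unfolding kW_def using rr p by (intro add_pos_pos divide_pos_pos) auto
  have kN: "1 \<le> kN" unfolding kN_def using rr p by (simp add: mult_nonneg_nonneg)
  define D where "D = 4 powr \<sigma>"
  have D: "1 \<le> D" unfolding D_def using \<sigma>0 by (intro ge_one_powr_ge_zero) auto
  \<comment> \<open>The factor D (2 + ln D) arises from W \<le> D (\<kappa> + 1) when W (1 + ln W)
    is bounded below, and \<open>kN powr (1 / p)\<close> from taking the p-th root.\<close>
  define c where "c = kP * kW * (D * (2 + ln D)) * kN powr (1 / p)"
  have c: "0 < c" unfolding c_def using kP kW D kN by (intro mult_pos_pos) (auto intro: add_pos_nonneg)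
  have "Lp_norm p w (max_truncation K f) \<le> ennreal c * (Cq_const q w + 1) * ennreal_ln (ennreal (exp 1) + Cq_const q w) * Lp_norm p w (HL_max f)"
    if w: "w \<in> Cq_class q" and w0: "\<not> (AE x in lebesgue. w x = 0)" and f: "f \<in> test_functions" for w f
  proof -
    have wt: "weight w" using w by (simp add: Cq_class_def)
    have w_nn: "0 \<le> w x" for x using wt by (simp add: weight_def)
    have wm [measurable]: "w \<in> lmeas" by (rule weight_measurable[OF wt])
    have nf: "nice f" by (rule test_function_nice[OF f])
    have [measurable]: "f \<in> lmeas" by (rule nice_measurable[OF nf])
    let ?g = "\<lambda>y. enorm (f y)"
    define NT where "NT = (\<integral>x. ennreal_powr (max_truncation K f x) p * ennreal (w x))"
    define NM where "NM = (\<integral>x. ennreal_powr (MM ?g x) p * ennreal (w x))"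
    have LT: "Lp_norm p w (max_truncation K f) = ennreal_powr NT (1 / p)" by (simp add: Lp_norm_def NT_def)
    have LM: "Lp_norm p w (HL_max f) = ennreal_powr NM (1 / p)" by (simp add: Lp_norm_def NM_def HL_max_eq_MM)
    have powr0: "ennreal_powr 0 u = 0" for u by (simp add: ennreal_powr_def)
    have ln1: "0 < ennreal_ln (ennreal (exp 1) + Cq_const q w)"
    proof (cases "Cq_const q w")
      case (real \<kappa>)
      have "1 \<le> ln (exp 1 + \<kappa>)" using real ln_mono[of "exp 1" "exp 1 + \<kappa>"] by (simp add: add_pos_nonneg)
      thus ?thesis using real by (simp add: ennreal_ln_def ennreal_plus[symmetric] del: ennreal_plus)
    qed (simp add: ennreal_ln_def)
    obtain M R where MR: "0 < M" "0 < R" "\<And>x. norm (f x) \<le> M" "\<And>x. R < norm x \<Longrightarrow> f x = 0" using nice_bounds[OF nf] by blast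
    have gi: "infnorm y \<le> R" if "?g y \<noteq> 0" for y using MR(4)[of y] that infnorm_le_norm[of y] by force
    show ?thesis
    \<comment> \<open>If f vanishes almost everywhere, all truncations are 0 and so is the left
      side. Otherwise M f is positive everywhere.\<close>
    proof (cases "(\<integral>y. ?g y) = 0")
      case True
      have "max_truncation K f x \<le> 0" for x unfolding max_truncation_le_iff using tr_le_integral[OF nf, of _ x] True by auto
      hence "NT = 0" by (simp add: NT_def powr0)
      thus ?thesis unfolding LT by (simp add: powr0)
    next
      case False
      hence g0: "0 < (\<integral>y. ?g y)" by (simp add: zero_less_iff_neq_zero)
      \<comment> \<open>M f is positive everywhere and w is not almost everywhere zero. A vanishing
        norm would annihilate an infinite constant, as 0 times infinity is 0.\<close>
      have NM0: "NM \<noteq> 0"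
      proof
        assume "NM = 0"
        hence "AE x in lebesgue. ennreal_powr (MM ?g x) p * ennreal (w x) = 0" unfolding NM_def by (subst (asm) nn_integral_0_iff_AE) auto
        hence "AE x in lebesgue. w x = 0"
        proof eventually_elim
          case (elim x)
          have "0 < (\<integral>y. ?g y) * ennreal (kap CARD('n) 0 R x)" using g0 MR(2) by (simp add: ennreal_zero_less_mult_iff kap_def)
          also have "... \<le> MM ?g x * ennreal ((2 * R)^CARD('n))" using MR(2) gi by (intro MM_ge_kap) (auto simp: mem_qb)
          finally have "MM ?g x \<noteq> 0" by (auto simp: ennreal_zero_less_mult_iff)
          hence "ennreal_powr (MM ?g x) p \<noteq> 0" using p(1) by (cases "MM ?g x") (auto simp: ennreal_powr_def ennreal_eq_0_iff)
          thus ?case using elim w_nn[of x] by simp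
        qed
        thus False using w0 by simp
      qed
      have NMp: "ennreal_powr NM (1 / p) \<noteq> 0" using NM0 by (cases NM) (auto simp: ennreal_powr_def)
      show ?thesis
      proof (cases "Cq_const q w = \<infinity> \<or> NM = \<infinity>")
        case True
        have "ennreal c * (Cq_const q w + 1) * ennreal_ln (ennreal (exp 1) + Cq_const q w) * ennreal_powr NM (1 / p) = \<infinity>"
          using True ln1 NMp c by (auto simp: ennreal_mult_eq_top_iff ennreal_ln_def ennreal_powr_def)
        thus ?thesis unfolding LM by simp
      next
        case fin: False
        then obtain \<kappa> where \<kappa>: "0 \<le> \<kappa>" "Cq_const q w = ennreal \<kappa>" by (cases "Cq_const q w") auto
        let ?w = "\<lambda>x. ennreal (w x)"
        \<comment> \<open>The finite norm of M f forces every tail to be finite. The constant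
          \<open>Cq_const\<close> does not tell, since its quotients are 0 where the tail is
          infinite.\<close>
        have kf: "kint \<sigma> ?w c r < \<infinity>" if "0 < r" for c r unfolding \<sigma>_def
        proof (rule kint_finite_of_MM[where g="?g" and p=p and R=R])
          show "(\<integral>x. ennreal_powr (MM ?g x) p * ?w x) < \<infinity>" using fin unfolding NM_def by (auto simp: less_top[symmetric])
        qed (use that p MR(2) gi g0 in auto)
        \<comment> \<open>\<open>Cq_const\<close> is relative to \<open>Cq_tail\<close>, which is at
          most D times \<open>kint\<close>; the added 1 ensures \<open>1 \<le> W\<close> even when
          the constant is 0.\<close>
        define W where "W = D * \<kappa> + 1"
        have Wk: "D * \<kappa> \<le> W" "1 \<le> W" using D \<kappa> by (auto simp: W_def)
        have "Cq_weight ?w \<sigma> W"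
        proof unfold_locales
          fix c :: "real^'n" and r :: real assume r: "0 < r"
          let ?Q = "qb c r"
          let ?I = "\<integral>x\<in>?Q. MM (\<lambda>y. ?w y * indicator ?Q y) x"
          have tail: "Cq_tail q w ?Q \<le> ennreal D * kint \<sigma> ?w c r" unfolding D_def \<sigma>_def using r p by (intro Cq_tail_le wm) auto
          hence "Cq_tail q w ?Q < \<infinity>" using kf[OF r, of c] by (auto simp: ennreal_mult_less_top intro: le_less_trans)
          then obtain t where t: "0 \<le> t" "Cq_tail q w ?Q = ennreal t" by (cases "Cq_tail q w ?Q") auto
          have HL: "HL_max (\<lambda>y. indicator ?Q y * w y) x = MM (\<lambda>y. ?w y * indicator ?Q y) x" for x
            unfolding HL_max_eq_MM using w_nn by (intro arg_cong[where f="\<lambda>h. MM h x"] ext) (auto simp: indicator_def)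
          have "(if Cq_tail q w ?Q = \<infinity> then 0 else (\<integral>x\<in>?Q. HL_max (\<lambda>y. indicator ?Q y * w y) x) / Cq_tail q w ?Q) \<le> Cq_const q w"
            unfolding Cq_const_def using r by (intro SUP_upper) (auto simp: cubes_qb)
          hence quot: "?I / ennreal t \<le> ennreal \<kappa>" using t \<kappa> by (simp add: HL)
          have "?I \<le> ennreal \<kappa> * ennreal t"
          \<comment> \<open>Dividing a positive extended number by zero gives infinity, so a finite
            quotient forces the numerator to vanish.\<close>
          proof (cases "t = 0")
            case True
            hence "?I = 0" using quot by (cases "?I = 0") (auto simp: ennreal_divide_zero top_unique)
            thus ?thesis by simp
          next
            case False
            thus ?thesis using quot t ennreal_div_le_iff[of t] by simp
          qed
          also have "... \<le> ennreal \<kappa> * (ennreal D * kint \<sigma> ?w c r)" using tail t by (intro mult_left_mono) auto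
          also have "... = ennreal (D * \<kappa>) * kint \<sigma> ?w c r" using D \<kappa> by (simp add: ennreal_mult mult_ac)
          also have "... \<le> ennreal W * kint \<sigma> ?w c r" using Wk by (intro mult_right_mono ennreal_leI) auto
          finally show "?I \<le> ennreal W * kint \<sigma> ?w c r" .
        qed (use \<sigma> Wk kf in auto)
        from weighted_bound[OF p(2,3) this[unfolded \<sigma>_def] f g0 \<sigma>_def]
        have NT: "NT \<le> ennreal ((kP * (kW * (W * (1 + ln W)))) powr p * kN) * NM" unfolding NT_def NM_def kP_def kW_def kN_def by simp
        have lnW: "0 \<le> ln W" using Wk by simp
        have kk: "0 < kP * (kW * (W * (1 + ln W)))" using kP kW Wk lnW by (intro mult_pos_pos) linarith+
        define l where "l = ln (exp 1 + \<kappa>)"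
        have l1: "1 \<le> l" using \<kappa> ln_mono[of "exp 1" "exp 1 + \<kappa>"] by (simp add: l_def add_pos_nonneg)
        have Wl: "W * (1 + ln W) \<le> D * (2 + ln D) * ((\<kappa> + 1) * l)"
        proof -
          have W1: "W \<le> D * (\<kappa> + 1)" using D by (simp add: W_def distrib_left)
          have "ln W \<le> ln (D * (\<kappa> + 1))" using W1 Wk D \<kappa> by (intro ln_mono) auto
          also have "... = ln D + ln (\<kappa> + 1)" using D \<kappa> by (simp add: ln_mult)
          also have "ln (\<kappa> + 1) \<le> l" unfolding l_def using \<kappa> exp_ge_add_one_self[of 1] by (intro ln_mono) auto
          finally have "1 + ln W \<le> l + ln D * l + l" using l1 D mult_left_mono[of 1 l "ln D"] by simp
          also have "... = (2 + ln D) * l" by (simp add: algebra_simps)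
          finally have "W * (1 + ln W) \<le> D * (\<kappa> + 1) * ((2 + ln D) * l)" using W1 Wk lnW D \<kappa> by (intro mult_mono) auto
          thus ?thesis by (simp add: mult_ac)
        qed
        have "ennreal_powr NT (1 / p) \<le> ennreal_powr (ennreal ((kP * (kW * (W * (1 + ln W)))) powr p * kN) * NM) (1 / p)" using NT p by (intro ennreal_powr_mono) auto
        also have "... = ennreal (((kP * (kW * (W * (1 + ln W)))) powr p * kN) powr (1 / p)) * ennreal_powr NM (1 / p)"
          using kk kN by (intro ennreal_powr_cmult mult_pos_pos) auto
        also have "((kP * (kW * (W * (1 + ln W)))) powr p * kN) powr (1 / p) = kP * (kW * (W * (1 + ln W))) * kN powr (1 / p)"
        proof -
          have "((kP * (kW * (W * (1 + ln W)))) powr p) powr (1 / p) = kP * (kW * (W * (1 + ln W)))" using kk p by (simp only: powr_powr) simp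
          thus ?thesis by (simp only: powr_mult)
        qed
        also have "ennreal (kP * (kW * (W * (1 + ln W))) * kN powr (1 / p)) * ennreal_powr NM (1 / p) \<le> ennreal (c * (\<kappa> + 1) * l) * ennreal_powr NM (1 / p)"
        proof (intro mult_right_mono ennreal_leI)
          have "kP * (kW * (W * (1 + ln W))) * kN powr (1 / p) \<le> kP * (kW * (D * (2 + ln D) * ((\<kappa> + 1) * l))) * kN powr (1 / p)"
            using kP kW by (intro mult_right_mono mult_left_mono Wl) auto
          thus "kP * (kW * (W * (1 + ln W))) * kN powr (1 / p) \<le> c * (\<kappa> + 1) * l" by (simp add: c_def mult_ac)
        qed simp
        also have "ennreal (c * (\<kappa> + 1) * l) = ennreal c * (Cq_const q w + 1) * ennreal_ln (ennreal (exp 1) + Cq_const q w)"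
        proof -
          have "ennreal (exp 1) + Cq_const q w = ennreal (exp 1 + \<kappa>)" using \<kappa> by simp
          hence "ennreal_ln (ennreal (exp 1) + Cq_const q w) = ennreal l" using \<kappa> by (simp add: ennreal_ln_def l_def add_nonneg_nonneg del: ennreal_plus)
          moreover have "Cq_const q w + 1 = ennreal (\<kappa> + 1)" using \<kappa> by simp
          ultimately show ?thesis using c \<kappa> l1 by (simp add: ennreal_mult del: ennreal_plus)
        qed
        finally show ?thesis unfolding LT LM .
      qed
    qed
  qed
  thus ?thesis using c by blast
qed

end
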